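(* Let $\mathbf{E}\in\mathbf{V}$ be a solution of the hemivariational inequality $$a(\mathbf{E},\mathbf{v})+\int_\Omega\psi^0(\mathbf{E};\mathbf{v})\,dx\ \ge\ \langle \mathbf{f},\mathbf{v}\rangle\qquad\forall\,\mathbf{v}\in\mathbf{V}.$$ Assume further that $\mu^{-1}\nabla\times\mathbf{E}\in\mathbf{H}(\mathrm{curl},\Omega)$ and that $(\mu^{-1}\nabla\times\mathbf{E})|_K\in\mathbf{H}^1(K)$ for all $K\in\mathcal{T}_h$. Then $$a_h(\mathbf{E},\mathbf{v}_h)+\int_\Omega\psi^0(\mathbf{E};\mathbf{v}_h)\,dx\ \ge\ \langle\mathbf{f},\mathbf{v}_h\rangle\qquad\forall\,\mathbf{v}_h\in\mathbf{V}_h .$$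
   Context: **Domain and spaces.** $\Omega\subset\mathbb{R}^3$ is a bounded domain with Lipschitz boundary and unit outward normal $\mathbf{n}$. Bold letters denote $\mathbb{R}^3$-valued fields and spaces of such fields. $\mathbf{H}(\mathrm{curl},\Omega)=\{\mathbf{v}\in\mathbf{L}^2(\Omega):\nabla\times\mathbf{v}\in\mathbf{L}^2(\Omega)\}$ and $\mathbf{V}=\mathbf{H}_0(\mathrm{curl},\Omega)=\{\mathbf{v}\in\mathbf{H}(\mathrm{curl},\Omega):\mathbf{n}\times\mathbf{v}=\mathbf{0}\text{ on }\partial\Omega\}$. **Data.** $\epsilon,\mu\in L^\infty(\Omega)$ are scalar with $0<\epsilon_0\le\epsilon(x)\le\epsilon_1<\infty$, $0<\mu_0\le\mu(x)\le\mu_1<\infty$ for a.e. $x\in\Omega$. The functional $\mathbf{f}$ is induced by a field $\tilde{\mathbf{l}}\in\mathbf{L}^2(\Omega)$: $\langle\mathbf{f},\mathbf{v}\rangle=\int_\Omega\tilde{\mathbf{l}}\cdot\mathbf{v}\,dx$ (for $\mathbf{v}\in\mathbf{V}$, and likewise for $\mathbf{v}\in\mathbf{V}_h$ below). For $\mathbf{E},\mathbf{v}\in\mathbf{V}$, $$a(\mathbf{E},\mathbf{v})=\int_\Omega\epsilon\,\mathbf{E}\cdot\mathbf{v}\,dx+\int_\Omega\mu^{-1}(\nabla\times\mathbf{E})\cdot(\nabla\times\mathbf{v})\,dx.$$ **The function $\psi$.** $\psi:\Omega\times\mathbb{R}^3\to\mathbb{R}$; $\partial\psi(x,\xi)$ and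 $\psi^0(x,\xi;\zeta)$ denote the Clarke subdifferential and the Clarke generalized directional derivative with respect to the second variable, $\psi^0(x,\xi;\zeta)=\limsup_{w\to\xi,\lambda\downarrow0}\lambda^{-1}(\psi(x,w+\lambda\zeta)-\psi(x,w))$, $\partial\psi(x,\xi)=\{\eta\in\mathbb{R}^3:\psi^0(x,\xi;\zeta)\ge\eta\cdot\zeta\ \forall\zeta\in\mathbb{R}^3\}$. The variable $x$ is suppressed: $\int_\Omega\psi^0(\mathbf{E};\mathbf{v})\,dx=\int_\Omega\psi^0(x,\mathbf{E}(x);\mathbf{v}(x))\,dx$. Assumptions on $\psi$: (a) $\psi(\cdot,\xi)$ is measurable in $\Omega$ for every $\xi\in\mathbb{R}^3$ and $\psi(\cdot,\mathbf{0})\in L^1(\Omega)$; (b) for a.e. $x\in\Omega$, $\psi(x,\cdot)$ is locally Lipschitz in $\mathbb{R}^3$; (c) there are $c_0,c_1\ge0$ such that for a.e. $x\in\Omega$ and all $\xi\in\mathbb{R}^3$, $|\eta|\le c_0+c_1|\xi|$ for all $\eta\in\partial\psi(x,\xi)$; (d) there is $m\ge0$ such that for a.e. $x\in\Omega$, $\psi^0(x,\xi_1;\xi_2-\xi_1)+\psi^0(x,\xi_2;\xi_1-\xi_2)\le m|\xi_1-\xi_2|^2$ for all $\xi_1,\xi_2\in\mathbb{R}^3$. **Mesh and DG notation.** $\mathcal{T}_h$ is a shape-regular partition of $\overline\Omega$ into tetrahedral or hexahedral elements $K$ with diameters $h_K$, $h=\max_K h_K$. $\mathcal{F}_h^{\mathcal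 I}$, $\mathcal{F}_h^{\mathcal B}$ are the sets of interior and boundary faces and $\mathcal{F}_h=\mathcal{F}_h^{\mathcal I}\cup\mathcal{F}_h^{\mathcal B}$. On an interior face $f$ shared by $K_1,K_2$ with outward unit normals $\mathbf{n}_1,\mathbf{n}_2$ and one-sided traces $\mathbf{v}_1,\mathbf{v}_2$: tangential jump $[\![\mathbf{v}]\!]=\mathbf{n}_1\times\mathbf{v}_1+\mathbf{n}_2\times\mathbf{v}_2$ and average $\{\mathbf{v}\}=(\mathbf{v}_1+\mathbf{v}_2)/2$; on a boundary face $[\![\mathbf{v}]\!]=\mathbf{n}\times\mathbf{v}$, $\{\mathbf{v}\}=\mathbf{v}$. For $\mathbf{v}\in\mathbf{H}_0(\mathrm{curl},\Omega)$ one has $[\![\mathbf{v}]\!]=\mathbf{0}$ on $\mathcal{F}_h$. For an integer $l\ge1$, $\mathbf{V}_h=\{\mathbf{v}\in\mathbf{L}^2(\Omega):\mathbf{v}|_K\in[P^l(K)]^3\ \forall K\in\mathcal{T}_h\}$, $P^l(K)$ being polynomials of degree at most $l$; $\nabla_h\times$ is the elementwise curl. $h_f=\min\{h_K,h_{K'}\}$ for $f=\partial K\cap\partial K'$ interior, $h_f=h_K$ for $f=\partial K\cap\partial\Omega$; $\alpha|_f=\eta h_f^{-1}$ with a constant $\eta>0$. The IPDG bilinear form is $$\begin{aligned}a_h(\mathbf{u},\mathbf{v})=&\int_\Omega\epsilon\,\mathbf{u}\cdot\mathbf{v}\,dx+\int_\Omega\mu^{-1}(\nabla_h\times\mathbf{u})\cdot(\nabla_h\times\mathbf{v})\,dx-\sum_{f\in\mathcal{F}_h}\int_f[\![\mathbf{u}]\!]\cdot\{\mu^{-1}\nabla_h\times\mathbf{v}\}\,dS\\&-\sum_{f\in\mathcal{F}_h}\int_f[\![\mathbf{v}]\!]\cdot\{\mu^{-1}\nabla_h\times\mathbf{u}\}\,dS+\sum_{f\in\mathcal{F}_h}\int_f\alpha[\![\mathbf{u}]\!]\cdot[\![\mathbf{v}]\!]\,dS.\end{aligned}$$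 In $a_h(\mathbf{E},\mathbf{v}_h)$ one puts $\mathbf{u}=\mathbf{E}$, $\mathbf{v}=\mathbf{v}_h$; since $[\![\mathbf{E}]\!]=\mathbf{0}$, the terms containing $[\![\mathbf{E}]\!]$ are zero, and $\{\mu^{-1}\nabla\times\mathbf{E}\}$ is formed from the elementwise traces of $\mu^{-1}\nabla\times\mathbf{E}$. *)

theory Defs
  imports "HOL-Analysis.Analysis"
begin

section \<open>Smooth functions and test functions on \<open>\<real>\<^sup>3\<close>\<close>

definition partial :: "3 \<Rightarrow> (real^3 \<Rightarrow> 'b::real_normed_vector) \<Rightarrow> real^3 \<Rightarrow> 'b" where
  "partial i \<phi> x = frechet_derivative \<phi> (at x) (axis i 1)"

primrec Ck :: "nat \<Rightarrow> (real^3 \<Rightarrow> 'b::real_normed_vector) \<Rightarrow> bool" where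
  "Ck 0 \<phi> \<longleftrightarrow> continuous_on UNIV \<phi>"
| "Ck (Suc k) \<phi> \<longleftrightarrow> (\<forall>x. \<phi> differentiable (at x)) \<and> (\<forall>i. Ck k (partial i \<phi>))"

definition smooth :: "(real^3 \<Rightarrow> 'b::real_normed_vector) \<Rightarrow> bool" where
  "smooth \<phi> \<longleftrightarrow> (\<forall>k. Ck k \<phi>)"

definition test_fun :: "(real^3) set \<Rightarrow> (real^3 \<Rightarrow> 'b::real_normed_vector) \<Rightarrow> bool" where
  "test_fun \<Omega> \<phi> \<longleftrightarrow> smooth \<phi> \<and> compact (closure {x. \<phi> x \<noteq> 0}) \<and> closure {x. \<phi> x \<noteq> 0} \<subseteq> \<Omega>"

definition curl :: "(real^3 \<Rightarrow> real^3) \<Rightarrow> real^3 \<Rightarrow> real^3" where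
  "curl \<phi> x = vector [partial 2 \<phi> x $ 3 - partial 3 \<phi> x $ 2,
                      partial 3 \<phi> x $ 1 - partial 1 \<phi> x $ 3,
                      partial 1 \<phi> x $ 2 - partial 2 \<phi> x $ 1]"


section \<open>Domains and function spaces\<close>

text \<open>Fields are total functions; only their values (up to null sets) on \<open>\<Omega>\<close> matter.\<close>

definition lipschitz_domain :: "(real^3) set \<Rightarrow> bool" where
  "lipschitz_domain \<Omega> \<longleftrightarrow> open \<Omega> \<and> connected \<Omega> \<and> bounded \<Omega> \<and> \<Omega> \<noteq> {} \<and>
     (\<forall>x\<in>frontier \<Omega>. \<exists>r>0. \<exists>L. \<exists>Q :: real^3 \<Rightarrow> real^3. \<exists>\<gamma> :: real \<times> real \<Rightarrow> real.
        orthogonal_transformation Q \<and> L-lipschitz_on UNIV \<gamma> \<and>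
        \<Omega> \<inter> ball x r = {y \<in> ball x r. Q y $ 3 > \<gamma> (Q y $ 1, Q y $ 2)})"

definition L2 :: "(real^3) set \<Rightarrow> (real^3 \<Rightarrow> 'b::euclidean_space) \<Rightarrow> bool" where
  "L2 \<Omega> v \<longleftrightarrow> v \<in> borel_measurable (lebesgue_on \<Omega>) \<and>
     integrable (lebesgue_on \<Omega>) (\<lambda>x. (norm (v x))\<^sup>2)"

definition has_weak_curl :: "(real^3) set \<Rightarrow> (real^3 \<Rightarrow> real^3) \<Rightarrow> (real^3 \<Rightarrow> real^3) \<Rightarrow> bool" where
  "has_weak_curl \<Omega> v w \<longleftrightarrow> L2 \<Omega> w \<and>
     (\<forall>\<phi>. test_fun \<Omega> \<phi> \<longrightarrow>
        (LINT x|lebesgue_on \<Omega>. v x \<bullet> curl \<phi> x) = (LINT x|lebesgue_on \<Omega>. w x \<bullet> \<phi> x))"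

definition Hcurl :: "(real^3) set \<Rightarrow> (real^3 \<Rightarrow> real^3) set" where
  "Hcurl \<Omega> = {v. L2 \<Omega> v \<and> (\<exists>w. has_weak_curl \<Omega> v w)}"

text \<open>The weak curl is unique up to null sets; this picks a representative.\<close>

definition weak_curl :: "(real^3) set \<Rightarrow> (real^3 \<Rightarrow> real^3) \<Rightarrow> real^3 \<Rightarrow> real^3" where
  "weak_curl \<Omega> v = (SOME w. has_weak_curl \<Omega> v w)"

text \<open>
  For \<open>v \<in> H(curl, \<Omega>)\<close> the tangential trace \<open>n \<times> v\<close> on \<open>\<partial>\<Omega>\<close> is a functional,
  given by Green's formula: \<open>\<langle>n \<times> v, \<phi>\<rangle> = \<integral> curl v \<bullet> \<phi> - v \<bullet> curl \<phi>\<close>.  Restrictions of smooth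
  fields on \<open>\<real>\<^sup>3\<close> are dense in \<open>H\<^sup>1(\<Omega>)\<close>, so they suffice as arguments.
\<close>

definition tangential_trace :: "(real^3) set \<Rightarrow> (real^3 \<Rightarrow> real^3) \<Rightarrow> (real^3 \<Rightarrow> real^3) \<Rightarrow> real" where
  "tangential_trace \<Omega> v \<phi> = (LINT x|lebesgue_on \<Omega>. weak_curl \<Omega> v x \<bullet> \<phi> x - v x \<bullet> curl \<phi> x)"

definition H0curl :: "(real^3) set \<Rightarrow> (real^3 \<Rightarrow> real^3) set" where
  "H0curl \<Omega> = {v \<in> Hcurl \<Omega>. \<forall>\<phi>. smooth \<phi> \<longrightarrow> tangential_trace \<Omega> v \<phi> = 0}"

definition has_weak_partial ::
  "(real^3) set \<Rightarrow> 3 \<Rightarrow> (real^3 \<Rightarrow> real^3) \<Rightarrow> (real^3 \<Rightarrow> real^3) \<Rightarrow> bool" where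
  "has_weak_partial \<Omega> i v w \<longleftrightarrow> L2 \<Omega> w \<and>
     (\<forall>\<phi> :: real^3 \<Rightarrow> real. test_fun \<Omega> \<phi> \<longrightarrow>
        (LINT x|lebesgue_on \<Omega>. partial i \<phi> x *\<^sub>R v x) = - (LINT x|lebesgue_on \<Omega>. \<phi> x *\<^sub>R w x))"

definition H1 :: "(real^3) set \<Rightarrow> (real^3 \<Rightarrow> real^3) set" where
  "H1 \<Omega> = {v. L2 \<Omega> v \<and> (\<forall>i. \<exists>w. has_weak_partial \<Omega> i v w)}"


section \<open>Clarke subdifferential\<close>

definition locally_lipschitz :: "(real^3 \<Rightarrow> real) \<Rightarrow> bool" where
  "locally_lipschitz g \<longleftrightarrow> (\<forall>\<xi>. \<exists>r>0. \<exists>L. L-lipschitz_on (ball \<xi> r) g)"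

text \<open>As \<open>w \<rightarrow> \<xi>\<close> the value \<open>w = \<xi>\<close> is allowed, hence \<open>nhds\<close> rather than \<open>at\<close>.  For locally
  Lipschitz \<open>g\<close> the upper limit is finite.\<close>

definition clarke_dd :: "(real^3 \<Rightarrow> real) \<Rightarrow> real^3 \<Rightarrow> real^3 \<Rightarrow> real" where
  "clarke_dd g \<xi> \<zeta> = real_of_ereal
     (Limsup (nhds \<xi> \<times>\<^sub>F at_right 0) (\<lambda>(w, t). ereal ((g (w + t *\<^sub>R \<zeta>) - g w) / t)))"

definition clarke_subdiff :: "(real^3 \<Rightarrow> real) \<Rightarrow> real^3 \<Rightarrow> (real^3) set" where
  "clarke_subdiff g \<xi> = {\<eta>. \<forall>\<zeta>. clarke_dd g \<xi> \<zeta> \<ge> \<eta> \<bullet> \<zeta>}"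


section \<open>Meshes\<close>

definition tetrahedron :: "(real^3) set \<Rightarrow> bool" where
  "tetrahedron K \<longleftrightarrow> 3 simplex K"

text \<open>A convex polyhedron with six quadrilateral faces is combinatorially a cube.\<close>

definition hexahedron :: "(real^3) set \<Rightarrow> bool" where
  "hexahedron K \<longleftrightarrow> polytope K \<and> aff_dim K = 3 \<and> card {F. F facet_of K} = 6 \<and>
     (\<forall>F. F facet_of K \<longrightarrow> card {x. x extreme_point_of F} = 4)"

text \<open>Hanging nodes are not excluded.\<close>

definition mesh :: "(real^3) set \<Rightarrow> (real^3) set set \<Rightarrow> bool" where
  "mesh \<Omega> T \<longleftrightarrow> finite T \<and> (\<forall>K\<in>T. tetrahedron K \<or> hexahedron K) \<and> \<Union>T = closure \<Omega> \<and>
     (\<forall>K\<in>T. \<forall>K'\<in>T. K \<noteq> K' \<longrightarrow> interior K \<inter> interior K' = {})"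

definition shape_regular :: "real \<Rightarrow> (real^3) set set \<Rightarrow> bool" where
  "shape_regular \<kappa> T \<longleftrightarrow> (\<forall>K\<in>T. \<exists>c r. r > 0 \<and> ball c r \<subseteq> K \<and> diameter K \<le> \<kappa> * (2 * r))"

text \<open>
  Surface measure on a planar set \<open>f\<close>: the image of two-dimensional Lebesgue measure under an
  isometric parametrisation of the plane spanned by \<open>f\<close>, which does not depend on
  the parametrisation chosen.
\<close>

definition plane_frame :: "(real^3) set \<Rightarrow> real^3 \<Rightarrow> real^3 \<Rightarrow> real^3 \<Rightarrow> bool" where
  "plane_frame A p a b \<longleftrightarrow> norm a = 1 \<and> norm b = 1 \<and> a \<bullet> b = 0 \<and>
     A = range (\<lambda>(s, t). p + s *\<^sub>R a + t *\<^sub>R b)"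

definition plane_measure :: "(real^3) set \<Rightarrow> (real^3) measure" where
  "plane_measure A = (case (SOME (p, a, b). plane_frame A p a b) of (p, a, b) \<Rightarrow>
     distr lborel borel (\<lambda>(s, t). p + s *\<^sub>R a + t *\<^sub>R b))"

definition surface_measure :: "(real^3) set \<Rightarrow> (real^3) measure" where
  "surface_measure f = restrict_space (plane_measure (affine hull f)) f"

definition interior_faces :: "(real^3) set set \<Rightarrow> (real^3) set set" where
  "interior_faces T = {K \<inter> K' | K K'. K \<in> T \<and> K' \<in> T \<and> K \<noteq> K' \<and> aff_dim (K \<inter> K') = 2}"

definition boundary_faces :: "(real^3) set \<Rightarrow> (real^3) set set \<Rightarrow> (real^3) set set" where
  "boundary_faces \<Omega> T = {F \<inter> frontier \<Omega> | F K. K \<in> T \<and> F facet_of K \<and>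
     emeasure (surface_measure F) (F \<inter> frontier \<Omega>) > 0}"

definition faces :: "(real^3) set \<Rightarrow> (real^3) set set \<Rightarrow> (real^3) set set" where
  "faces \<Omega> T = interior_faces T \<union> boundary_faces \<Omega> T"

text \<open>\<open>{K, K'}\<close> for the interior face \<open>K \<inter> K'\<close>, a singleton for a boundary face.\<close>

definition adjacent :: "(real^3) set set \<Rightarrow> (real^3) set \<Rightarrow> (real^3) set set" where
  "adjacent T f = {K \<in> T. f \<subseteq> K}"

definition face_size :: "(real^3) set set \<Rightarrow> (real^3) set \<Rightarrow> real" where
  "face_size T f = Min (diameter ` adjacent T f)"

definition outward_normal :: "(real^3) set \<Rightarrow> (real^3) set \<Rightarrow> real^3" where
  "outward_normal K f = (THE n. norm n = 1 \<and> (\<forall>x\<in>f. \<forall>y\<in>K. n \<bullet> (y - x) \<le> 0))"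


section \<open>Traces, jumps and averages\<close>

text \<open>The trace on a face \<open>f\<close> of \<open>v \<in> H\<^sup>1(K)\<close> is the \<open>L\<^sup>2(f)\<close> limit of the restrictions to \<open>f\<close> of
  smooth fields that converge to \<open>v\<close> in \<open>H\<^sup>1(K)\<close>.\<close>

definition has_trace ::
  "(real^3) set \<Rightarrow> (real^3) set \<Rightarrow> (real^3 \<Rightarrow> real^3) \<Rightarrow> (real^3 \<Rightarrow> real^3) \<Rightarrow> bool" where
  "has_trace K f v \<tau> \<longleftrightarrow> \<tau> \<in> borel_measurable (surface_measure f) \<and>
     (\<exists>\<phi> g. (\<forall>n. smooth (\<phi> n)) \<and>
        (\<lambda>n. \<integral>\<^sup>+ x. ennreal ((norm (\<phi> n x - v x))\<^sup>2) \<partial>lebesgue_on (interior K)) \<longlonglongrightarrow> 0 \<and>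
        (\<forall>i. has_weak_partial (interior K) i v (g i) \<and>
          (\<lambda>n. \<integral>\<^sup>+ x. ennreal ((norm (partial i (\<phi> n) x - g i x))\<^sup>2)
                  \<partial>lebesgue_on (interior K)) \<longlonglongrightarrow> 0) \<and>
        (\<lambda>n. \<integral>\<^sup>+ x. ennreal ((norm (\<phi> n x - \<tau> x))\<^sup>2) \<partial>surface_measure f) \<longlonglongrightarrow> 0)"

definition trace_on :: "(real^3) set \<Rightarrow> (real^3) set \<Rightarrow> (real^3 \<Rightarrow> real^3) \<Rightarrow> real^3 \<Rightarrow> real^3" where
  "trace_on K f v = (SOME \<tau>. has_trace K f v \<tau>)"

text \<open>Fields in \<open>H\<^sub>0(curl, \<Omega>)\<close> have no one-sided traces in \<open>L\<^sup>2(f)\<close> in general; their tangential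
  jump vanishes in the sense of functionals and is set to zero.  For piecewise smooth fields in
  \<open>H\<^sub>0(curl, \<Omega>)\<close> both branches agree almost everywhere.\<close>

definition tangential_jump ::
  "(real^3) set \<Rightarrow> (real^3) set set \<Rightarrow> (real^3) set \<Rightarrow> (real^3 \<Rightarrow> real^3) \<Rightarrow> real^3 \<Rightarrow> real^3" where
  "tangential_jump \<Omega> T f v x =
     (if v \<in> H0curl \<Omega> then 0
      else (\<Sum>K\<in>adjacent T f. cross3 (outward_normal K f) (trace_on K f v x)))"

definition average ::
  "(real^3) set set \<Rightarrow> (real^3) set \<Rightarrow> (real^3 \<Rightarrow> real^3) \<Rightarrow> real^3 \<Rightarrow> real^3" where
  "average T f v x = (\<Sum>K\<in>adjacent T f. trace_on K f v x) /\<^sub>R real (card (adjacent T f))"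


section \<open>Discrete spaces and bilinear forms\<close>

text \<open>\<open>\<real>\<^sup>3\<close>-valued polynomials of total degree at most \<open>l\<close>; \<open>\<alpha>\<close> ranges over multi-indices.\<close>

definition poly_fields :: "nat \<Rightarrow> (real^3 \<Rightarrow> real^3) set" where
  "poly_fields l = {p. \<exists>c :: (3 \<Rightarrow> nat) \<Rightarrow> real^3.
     \<forall>x. p x = (\<Sum>\<alpha> | (\<Sum>i\<in>UNIV. \<alpha> i) \<le> l. (\<Prod>i\<in>UNIV. (x $ i) ^ \<alpha> i) *\<^sub>R c \<alpha>)}"

definition dg_space :: "(real^3) set \<Rightarrow> (real^3) set set \<Rightarrow> nat \<Rightarrow> (real^3 \<Rightarrow> real^3) set" where
  "dg_space \<Omega> T l = {v. L2 \<Omega> v \<and> (\<forall>K\<in>T. \<exists>p\<in>poly_fields l. AE x in lebesgue_on K. v x = p x)}"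

text \<open>Element interiors are disjoint and cover \<open>\<Omega>\<close> up to a null set.\<close>

definition broken_curl :: "(real^3) set set \<Rightarrow> (real^3 \<Rightarrow> real^3) \<Rightarrow> real^3 \<Rightarrow> real^3" where
  "broken_curl T v x = (\<Sum>K\<in>T. indicator (interior K) x *\<^sub>R weak_curl (interior K) v x)"

definition maxwell_form ::
  "(real^3) set \<Rightarrow> (real^3 \<Rightarrow> real) \<Rightarrow> (real^3 \<Rightarrow> real) \<Rightarrow>
   (real^3 \<Rightarrow> real^3) \<Rightarrow> (real^3 \<Rightarrow> real^3) \<Rightarrow> real" where
  "maxwell_form \<Omega> \<epsilon> \<mu> u v =
     (LINT x|lebesgue_on \<Omega>. \<epsilon> x * (u x \<bullet> v x)) +
     (LINT x|lebesgue_on \<Omega>. inverse (\<mu> x) * (weak_curl \<Omega> u x \<bullet> weak_curl \<Omega> v x))"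

definition ipdg_form ::
  "(real^3) set \<Rightarrow> (real^3) set set \<Rightarrow> real \<Rightarrow> (real^3 \<Rightarrow> real) \<Rightarrow> (real^3 \<Rightarrow> real) \<Rightarrow>
   (real^3 \<Rightarrow> real^3) \<Rightarrow> (real^3 \<Rightarrow> real^3) \<Rightarrow> real" where
  "ipdg_form \<Omega> T \<eta> \<epsilon> \<mu> u v =
     (LINT x|lebesgue_on \<Omega>. \<epsilon> x * (u x \<bullet> v x)) +
     (LINT x|lebesgue_on \<Omega>. inverse (\<mu> x) * (broken_curl T u x \<bullet> broken_curl T v x)) -
     (\<Sum>f\<in>faces \<Omega> T. LINT x|surface_measure f.
        tangential_jump \<Omega> T f u x \<bullet> average T f (\<lambda>y. inverse (\<mu> y) *\<^sub>R broken_curl T v y) x) -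
     (\<Sum>f\<in>faces \<Omega> T. LINT x|surface_measure f.
        tangential_jump \<Omega> T f v x \<bullet> average T f (\<lambda>y. inverse (\<mu> y) *\<^sub>R broken_curl T u y) x) +
     (\<Sum>f\<in>faces \<Omega> T. LINT x|surface_measure f.
        (\<eta> / face_size T f) * (tangential_jump \<Omega> T f u x \<bullet> tangential_jump \<Omega> T f v x))"

end

theory Submission
 imports Defs
begin

text \<open>
 Let \<open>w = \<mu>\<inverse> curl E\<close> and \<open>c = curl w\<close>. Two facts combine to the claim.

 First, the variational inequality implies
 \<open>\<integral> \<epsilon> E \<bullet> v + \<integral> c \<bullet> v + \<integral> \<psi>\<^sup>0(E; v) \<ge> \<integral> load \<bullet> v\<close> for every piecewise polynomial \<open>v\<close>. For a test
 field \<open>v\<close> the curl can be moved to \<open>w\<close>, and what remains involves only the values of \<open>v\<close>. Cutting off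
 each polynomial piece inside its cell gives test fields that are dominated by \<open>v\<close> and converge to it
 almost everywhere (\<open>piecewise_smooth_approx\<close>), and dominated convergence applies (\<open>hvi_limit\<close>). The
 nonlinear term needs that \<open>\<psi>\<^sup>0(\<xi>; \<cdot>)\<close> is the support function of the subdifferential, hence Lipschitz
 with the constant of the growth condition (\<open>clarke_dd_lipschitz\<close>), and that the integrand is measurable
 (\<open>clarke_integrand_measurable\<close>).

 Second, \<open>a\<^sub>h(E, v) = \<integral> \<epsilon> E \<bullet> v + \<integral> c \<bullet> v\<close> for these \<open>v\<close> (\<open>ipdg_form_dg\<close>). On each cell Green's formula
 expresses \<open>\<integral> c \<bullet> v - \<integral> w \<bullet> curl v\<close> through the one-sided traces of \<open>n \<times> w\<close> and \<open>v\<close>. Since \<open>w\<close> has a weak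
 curl on the whole domain, its tangential traces from the two sides of an interior face agree
 (\<open>tangential_continuity\<close>); therefore the sum of the boundary terms is the sum over all faces of the
 integrals of the jump of \<open>v\<close> against the average of \<open>w\<close> (\<open>jump_average_integral\<close>), which the bilinear form
 subtracts. Discrete fields that belong to \<open>H\<^sub>0(curl)\<close> have no jumps by definition; for them the form is the
 original one and the variational inequality applies as it stands (\<open>ipdg_form_H0curl\<close>).

 Most of the text provides the analysis behind the second fact. Green's formula on a convex polyhedron
 (\<open>divergence_polyhedron\<close>) follows by integrating the derivative of a cut-off function and letting the
 cutoff tend to the indicator function. Smooth fields are dense in the Sobolev space of a convex cell
 (\<open>H1_density\<close>), and the trace inequality, the divergence theorem for \<open>\<bar>\<phi>\<bar>\<^sup>2 (x - x\<^sub>0)\<close>, carries traces and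
 Green's formula over to Sobolev fields (\<open>trace_exists\<close>, \<open>traces_close\<close>, \<open>green_curl_trace\<close>). The geometric part
 shows that the faces of the mesh, which may have hanging nodes, tile the facets of the cells up to null
 sets (\<open>face_partition\<close>), at most two cells meeting at a face.
\<close>

section \<open>Calculus of smooth functions\<close>

lemmas lint_cong = Bochner_Integration.integral_cong

lemma partial_eqI: "(f has_derivative f') (at x) ==> partial i f x = f' (axis i 1)"
 unfolding partial_def by (metis frechet_derivative_at)

lemma partial_cong_open:
 assumes "open U" "x \<in> U" "!!y. y \<in> U ==> f y = g y"
 shows "partial i f x = partial i g x"
proof -
 have "(f has_derivative f') (at x) \<longleftrightarrow> (g has_derivative f') (at x)" for f'
  using has_derivative_transform_within_open[of f f' x UNIV U g]
   has_derivative_transform_within_open[of g f' x UNIV U f] assms by auto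
 then show ?thesis unfolding partial_def frechet_derivative_def by simp
qed

lemma has_derivative_partials:
 fixes f :: "real^3 => 'b::real_normed_vector"
 assumes "f differentiable (at x)"
 shows "(f has_derivative (\<lambda>v. \<Sum>i\<in>UNIV. (v $ i) *\<^sub>R partial i f x)) (at x)"
proof -
 let ?D = "frechet_derivative f (at x)"
 have D: "(f has_derivative ?D) (at x)" using assms frechet_derivative_works by blast
 have "?D v = (\<Sum>i\<in>UNIV. (v $ i) *\<^sub>R partial i f x)" for v
 proof -
  have lin: "linear ?D" using D has_derivative_linear by blast
  have "v = (\<Sum>i\<in>UNIV. (v $ i) *\<^sub>R axis i 1)"
   using basis_expansion[of v] by (simp add: vec_eq_iff axis_def)
  then have "?D v = ?D (\<Sum>i\<in>UNIV. (v $ i) *\<^sub>R axis i 1)" by simp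
  also have "... = (\<Sum>i\<in>UNIV. (v $ i) *\<^sub>R partial i f x)"
   by (simp add: linear_sum[OF lin] linear_cmul[OF lin] partial_def)
  finally show ?thesis .
 qed
 then show ?thesis using D by presburger
qed

lemma Ck_imp_continuous: "Ck k f ==> continuous_on UNIV f"
 by (cases k) (auto intro!: continuous_at_imp_continuous_on differentiable_imp_continuous_within)

lemma Ck_Suc_imp: "Ck (Suc k) f ==> Ck k f"
proof (induction k arbitrary: f)
 case 0 then show ?case using Ck_imp_continuous Ck.simps(1) by blast
next
 case (Suc k)
 have "Ck k (partial i f)" for i
 proof -
  have "Ck (Suc k) (partial i f)" using Suc.prems by (subst (asm) Ck.simps(2)) blast
  then show ?thesis by (rule Suc.IH)
 qed
 moreover have "\<forall>x. f differentiable at x" using Suc.prems by simp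
 ultimately show ?case by simp
qed

lemma smooth_partial: "smooth f ==> smooth (partial i f)"
 unfolding smooth_def by (meson Ck.simps(2))

lemma smooth_differentiable: "smooth f ==> f differentiable (at x)"
 unfolding smooth_def by (meson Ck.simps(2))

lemma smooth_continuous: "smooth f ==> continuous_on S f"
 unfolding smooth_def by (meson Ck.simps(1) continuous_on_subset subset_UNIV)

lemma smooth_measurable: "smooth f ==> f \<in> borel_measurable borel"
 by (simp add: borel_measurable_continuous_onI smooth_continuous)

text \<open>Smoothness by coinduction: a set of differentiable functions that is closed under partial
 derivatives consists of smooth functions. It gives smoothness of a family whose members are closed
 under differentiation without computing higher derivatives.\<close>

lemma smooth_coinduct:
 assumes "f \<in> S" and d: "!!f x. f \<in> S ==> f differentiable (at x)"
  and p: "!!f i. f \<in> S ==> partial i f \<in> S"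
 shows "smooth f"
proof -
 have "\<forall>f\<in>S. Ck k f" for k
 proof (induction k)
  case 0 then show ?case
   using d by (auto intro!: continuous_at_imp_continuous_on differentiable_imp_continuous_within)
 next
  case (Suc k) then show ?case using d p by simp
 qed
 then show ?thesis using assms(1) unfolding smooth_def by blast
qed

lemma partial_bounded_linear:
 assumes "bounded_linear L" "f differentiable (at x)"
 shows "partial i (\<lambda>x. L (f x)) x = L (partial i f x)"
proof -
 have "(f has_derivative frechet_derivative f (at x)) (at x)"
  using assms frechet_derivative_works by blast
 then have "((\<lambda>x. L (f x)) has_derivative (\<lambda>v. L (frechet_derivative f (at x) v))) (at x)"
  by (rule bounded_linear.has_derivative[OF assms(1)])
 then show ?thesis unfolding partial_def[of i f] by (rule partial_eqI)
qed

lemma partial_add: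
 assumes "f differentiable (at x)" "g differentiable (at x)"
 shows "partial i (\<lambda>x. f x + g x) x = partial i f x + partial i g x"
 using partial_eqI[OF has_derivative_add[OF assms[unfolded frechet_derivative_works]]]
 by (simp add: partial_def)

lemma partial_bilinear:
 assumes "bounded_bilinear pr" "f differentiable (at x)" "g differentiable (at x)"
 shows "partial i (\<lambda>x. pr (f x) (g x)) x = pr (partial i f x) (g x) + pr (f x) (partial i g x)"
 using partial_eqI[OF bounded_bilinear.FDERIV[OF assms(1) assms(2,3)[unfolded frechet_derivative_works]]]
 by (simp add: partial_def)

lemma partial_const: "partial i (\<lambda>x. c) = (\<lambda>x. 0)"
 using partial_eqI[OF has_derivative_const] by fast

lemma partial_component: "partial i (\<lambda>x. x $ j) = (\<lambda>x. if i = j then 1 else 0)"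
proof
 fix x :: "real^3"
 have "((\<lambda>x::real^3. x $ j) has_derivative (\<lambda>x. x $ j)) (at x)"
  by (rule bounded_linear.has_derivative[OF bounded_linear_vec_nth has_derivative_ident])
 from partial_eqI[OF this, of i] show "partial i (\<lambda>x. x $ j) x = (if i = j then 1 else 0)"
  by (auto simp: axis_def)
qed

lemma smooth_const: "smooth (\<lambda>x. c)"
 by (rule smooth_coinduct[where S="{(\<lambda>x. c), (\<lambda>x. 0)}"]) (auto simp: partial_const)

lemma smooth_component: "smooth (\<lambda>x. x $ j)"
proof (rule smooth_coinduct[where S="insert (\<lambda>x. x $ j) {\<lambda>x. c | c::real. True}"], goal_cases)
 case (2 f x)
 then show ?case
  by (auto intro: bounded_linear_imp_differentiable bounded_linear_vec_nth)
next
 case (3 f i)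
 then show ?case by (auto simp: partial_const partial_component)
qed auto

lemma Ck_add: "Ck k f ==> Ck k g ==> Ck k (\<lambda>x. f x + g x)"
proof (induction k arbitrary: f g)
 case (Suc k)
 moreover have "partial i (\<lambda>x. f x + g x) = (\<lambda>x. partial i f x + partial i g x)" for i
  using Suc.prems by (auto simp: partial_add)
 ultimately show ?case by (auto intro: differentiable_add)
qed (auto intro: continuous_intros)

lemma smooth_add: "smooth f ==> smooth g ==> smooth (\<lambda>x. f x + g x)"
 by (simp add: smooth_def Ck_add)

lemma smooth_bilinear:
 assumes B: "bounded_bilinear pr" and "smooth f" "smooth g"
 shows "smooth (\<lambda>x. pr (f x) (g x))"
proof -
 have "Ck k f ==> Ck k g ==> Ck k (\<lambda>x. pr (f x) (g x))" for k
 proof (induction k arbitrary: f g)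
  case 0 then show ?case by (auto intro: bounded_bilinear.continuous_on[OF B])
 next
  case (Suc k)
  have *: "partial i (\<lambda>x. pr (f x) (g x)) = (\<lambda>x. pr (partial i f x) (g x) + pr (f x) (partial i g x))" for i
   using Suc.prems by (auto simp: partial_bilinear[OF B])
  have "Ck k f" "Ck k g" using Suc.prems Ck_Suc_imp by auto
  moreover have "Ck k (partial i f)" "Ck k (partial i g)" for i using Suc.prems by auto
  ultimately have "Ck k (partial i (\<lambda>x. pr (f x) (g x)))" for i
   unfolding * by (intro Ck_add Suc.IH)
  moreover have "(\<lambda>x. pr (f x) (g x)) differentiable at x" for x
  proof -
   have "f differentiable at x" "g differentiable at x" using Suc.prems by auto
   then show ?thesis unfolding differentiable_def
    using bounded_bilinear.FDERIV[OF B] by blast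
  qed
  ultimately show ?case by simp
 qed
 then show ?thesis using assms by (auto simp: smooth_def)
qed

lemma smooth_bounded_linear:
 assumes L: "bounded_linear L" and "smooth f"
 shows "smooth (\<lambda>x. L (f x))"
proof (rule smooth_coinduct[where S="{\<lambda>x. L (g x) | g. smooth g}"], goal_cases)
 case (2 h x)
 then obtain g where g: "h = (\<lambda>x. L (g x))" "smooth g" by blast
 then obtain D where "(g has_derivative D) (at x)"
  using smooth_differentiable differentiable_def by blast
 from bounded_linear.has_derivative[OF L this] show ?case
  unfolding g differentiable_def by blast
next
 case (3 h i)
 then obtain g where g: "h = (\<lambda>x. L (g x))" "smooth g" by blast
 then have "partial i h = (\<lambda>x. L (partial i g x))"
  by (auto simp: partial_bounded_linear[OF L] smooth_differentiable)
 then show ?case using g smooth_partial by blast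
qed (use assms in auto)

lemmas smooth_scaleR = smooth_bilinear[OF bounded_bilinear_scaleR]
lemmas smooth_mult = smooth_bilinear[OF bounded_bilinear_mult]
lemmas smooth_inner = smooth_bilinear[OF bounded_bilinear_inner]
lemmas smooth_vec_nth = smooth_bounded_linear[OF bounded_linear_vec_nth]

lemma smooth_uminus: "smooth f ==> smooth (\<lambda>x. - f x)"
 by (rule smooth_bounded_linear[OF bounded_linear_minus[OF bounded_linear_ident]])

lemma smooth_diff: "smooth f ==> smooth g ==> smooth (\<lambda>x. f x - g x)"
 using smooth_add[OF _ smooth_uminus, of f g] by simp

lemma smooth_sum: "(!!j. j \<in> J ==> smooth (f j)) ==> smooth (\<lambda>x. \<Sum>j\<in>J. f j x)"
 by (induction J rule: infinite_finite_induct) (auto intro: smooth_const smooth_add)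

lemma smooth_prod:
 fixes f :: "'j => real^3 => real"
 shows "(!!j. j \<in> J ==> smooth (f j)) ==> smooth (\<lambda>x. \<Prod>j\<in>J. f j x)"
 by (induction J rule: infinite_finite_induct) (auto intro: smooth_const smooth_mult)

lemma smooth_power:
 fixes f :: "real^3 => real"
 shows "smooth f ==> smooth (\<lambda>x. f x ^ n)"
 by (induction n) (auto intro: smooth_const smooth_mult)

lemma poly_fields_smooth: "p \<in> poly_fields l ==> smooth p"
proof -
 assume "p \<in> poly_fields l"
 then obtain c where "p = (\<lambda>x. \<Sum>\<alpha> | (\<Sum>i\<in>UNIV. \<alpha> i) \<le> l. (\<Prod>i\<in>UNIV. (x $ i) ^ \<alpha> i) *\<^sub>R c \<alpha>)"
  unfolding poly_fields_def by blast
 then show ?thesis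
  by (auto intro!: smooth_sum smooth_scaleR smooth_prod smooth_power smooth_component smooth_const)
qed

lemma partial_affine:
 assumes "g differentiable (at (c + r *\<^sub>R x))"
 shows "partial i (\<lambda>x. g (c + r *\<^sub>R x)) x = r *\<^sub>R partial i g (c + r *\<^sub>R x)"
proof -
 let ?D = "frechet_derivative g (at (c + r *\<^sub>R x))"
 have D: "(g has_derivative ?D) (at (c + r *\<^sub>R x))"
  using assms frechet_derivative_works by blast
 then have "((\<lambda>x. g (c + r *\<^sub>R x)) has_derivative (\<lambda>v. ?D (r *\<^sub>R v))) (at x)"
  by (auto intro!: derivative_eq_intros has_derivative_compose[where g=g])
 from partial_eqI[OF this, of i] show ?thesis
  using linear_cmul[OF has_derivative_linear[OF D]] by (simp add: partial_def)
qed

lemma smooth_affine: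
 assumes "smooth f" shows "smooth (\<lambda>x. f (c + r *\<^sub>R x))"
proof (rule smooth_coinduct[where S="{\<lambda>x. s *\<^sub>R g (c + r *\<^sub>R x) | s g. smooth g}"], goal_cases)
 case 1 show ?case using assms by simp (metis scaleR_one)
next
 case (2 h x)
 then obtain s g where g: "h = (\<lambda>x. s *\<^sub>R g (c + r *\<^sub>R x))" "smooth g" by blast
 have "(\<lambda>x. g (c + r *\<^sub>R x)) differentiable at x"
  by (rule differentiable_compose[where f=g]) (auto intro!: smooth_differentiable g derivative_intros)
 then show ?case unfolding g by (intro derivative_intros) auto
next
 case (3 h i)
 then obtain s g where g: "h = (\<lambda>x. s *\<^sub>R g (c + r *\<^sub>R x))" "smooth g" by blast
 have d: "(\<lambda>x. g (c + r *\<^sub>R x)) differentiable at x" for x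
  by (rule differentiable_compose[where f=g]) (auto intro!: smooth_differentiable g derivative_intros)
 have "partial i h x = (s * r) *\<^sub>R partial i g (c + r *\<^sub>R x)" for x
  unfolding g(1) partial_bounded_linear[OF bounded_linear_scaleR_right d]
  by (simp add: partial_affine[OF smooth_differentiable[OF g(2)]])
 then show ?case using g smooth_partial by blast
qed

section \<open>Compactly supported smooth functions\<close>

lemma zero_outside_closure:
 assumes "y \<notin> closure {x. f x \<noteq> 0}" shows "f y = 0"
proof (rule ccontr)
 assume "f y \<noteq> 0"
 then have "y \<in> {x. f x \<noteq> 0}" by simp
 then have "y \<in> closure {x. f x \<noteq> 0}" by (rule subsetD[OF closure_subset])
 with assms show False by (rule notE)
qed

lemma partial_outside_support:
 assumes "x \<notin> closure {x. f x \<noteq> 0}" shows "partial i f x = 0"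
proof -
 let ?U = "- closure {x. f x \<noteq> 0}"
 have "open ?U" by (intro open_Compl closed_closure)
 moreover have "x \<in> ?U" using assms by simp
 moreover have "f y = 0" if "y \<in> ?U" for y using zero_outside_closure[OF ComplD[OF that]] .
 ultimately have "partial i f x = partial i (\<lambda>x. 0) x" by (rule partial_cong_open)
 then show ?thesis unfolding partial_const .
qed

lemma partial_support: "{x. partial i f x \<noteq> 0} \<subseteq> closure {x. f x \<noteq> 0}"
proof (rule subsetI, rule ccontr)
 fix x assume "x \<in> {x. partial i f x \<noteq> 0}" "x \<notin> closure {x. f x \<noteq> 0}"
 then show False using partial_outside_support[of x f i] by simp
qed

lemma partial_bounded_support:
 assumes "bounded {x. f x \<noteq> 0}" shows "bounded {x. partial i f x \<noteq> 0}"
 using bounded_subset[OF bounded_closure[OF assms] partial_support[of i f]] .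

text \<open>Bounded support instead of compact closure is the form in which supports of products and
 derivatives are estimated.\<close>

lemma test_fun_alt: "test_fun U \<phi> \<longleftrightarrow> smooth \<phi> \<and> bounded {x. \<phi> x \<noteq> 0} \<and> closure {x. \<phi> x \<noteq> 0} \<subseteq> U"
 by (simp only: test_fun_def compact_closure)

lemma test_fun_partial:
 assumes "test_fun U \<phi>" shows "test_fun U (partial i \<phi>)"
proof -
 have a: "smooth \<phi>" "bounded {x. \<phi> x \<noteq> 0}" "closure {x. \<phi> x \<noteq> 0} \<subseteq> U"
  using assms unfolding test_fun_alt by simp_all
 show ?thesis unfolding test_fun_alt
  using smooth_partial[OF a(1)] partial_bounded_support[OF a(2)]
   order_trans[OF closure_minimal[OF partial_support closed_closure] a(3)] by blast
qed

lemma test_fun_mono: "test_fun U \<phi> ==> U \<subseteq> V ==> test_fun V \<phi>"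
 unfolding test_fun_def by (meson order_trans)

lemma test_fun_outside:
 assumes "test_fun U \<phi>" "x \<notin> U" shows "\<phi> x = 0"
proof (rule ccontr)
 assume "\<phi> x \<noteq> 0"
 then have "x \<in> closure {x. \<phi> x \<noteq> 0}" by (intro subsetD[OF closure_subset]) simp
 then show False using assms unfolding test_fun_def by (meson subsetD)
qed

lemma test_fun_scaleR:
 assumes "test_fun U f" "smooth g" shows "test_fun U (\<lambda>x. f x *\<^sub>R g x)"
proof -
 have a: "smooth f" "bounded {x. f x \<noteq> 0}" "closure {x. f x \<noteq> 0} \<subseteq> U"
  using assms unfolding test_fun_alt by simp_all
 have sub: "{x. f x *\<^sub>R g x \<noteq> 0} \<subseteq> {x. f x \<noteq> 0}" by auto
 show ?thesis unfolding test_fun_alt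
  using smooth_scaleR[OF a(1) assms(2)] bounded_subset[OF a(2) sub] order_trans[OF closure_mono[OF sub] a(3)]
  by blast
qed

lemma smooth_bounded_range:
 assumes "smooth f" "bounded {x. f x \<noteq> 0}"
 obtains B where "B > 0" "!!x. norm (f x) \<le> B"
proof -
 have "compact (f ` closure {x. f x \<noteq> 0})"
  by (rule compact_continuous_image) (auto simp: assms smooth_continuous compact_closure)
 then obtain B where B: "!!x. x \<in> closure {x. f x \<noteq> 0} ==> norm (f x) \<le> B"
  using compact_imp_bounded bounded_iff by (metis imageI)
 have "norm (f x) \<le> max B 1" for x
 proof (cases "f x = 0")
  case False
  then have "x \<in> closure {x. f x \<noteq> 0}" using zero_outside_closure[of x f] by argo
  then show ?thesis using B[of x] by simp
 qed auto
 then show ?thesis using that[of "max B 1"] by fastforce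
qed

lemma smooth_lipschitz:
 assumes "smooth f" "bounded {x. f x \<noteq> 0}"
 obtains B where "B > 0" "!!x y. norm (f x - f y) \<le> B * norm (x - y)"
proof -
 have "\<exists>b. \<forall>x. norm (partial i f x) \<le> b" for i
  using smooth_bounded_range[OF smooth_partial[OF assms(1)] partial_bounded_support[OF assms(2)]] by metis
 then obtain b where b: "!!i x. norm (partial i f x) \<le> b i" by metis
 define B where "B = (\<Sum>i\<in>UNIV. \<bar>b i\<bar>) + 1"
 have "norm (f x - f y) \<le> B * norm (x - y)" for x y
 proof (rule differentiable_bound[where S=UNIV and f'="\<lambda>x v. \<Sum>i\<in>UNIV. (v $ i) *\<^sub>R partial i f x"])
  fix x
  show "(f has_derivative (\<lambda>v. \<Sum>i\<in>UNIV. v $ i *\<^sub>R partial i f x)) (at x within UNIV)"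
   using has_derivative_partials smooth_differentiable assms by auto
  show "onorm (\<lambda>v. \<Sum>i\<in>UNIV. v $ i *\<^sub>R partial i f x) \<le> B"
  proof (rule onorm_le)
   fix v :: "real^3"
   have "norm (\<Sum>i\<in>UNIV. v $ i *\<^sub>R partial i f x) \<le> (\<Sum>i\<in>UNIV. norm (v $ i *\<^sub>R partial i f x))"
    by (rule norm_sum)
   also have "... \<le> (\<Sum>i\<in>UNIV. norm v * \<bar>b i\<bar>)"
    by (intro sum_mono) (auto intro!: mult_mono simp: component_le_norm_cart
       order_trans[OF b abs_ge_self])
   also have "... \<le> B * norm v" by (simp add: B_def sum_distrib_left[symmetric] algebra_simps)
   finally show "norm (\<Sum>i\<in>UNIV. v $ i *\<^sub>R partial i f x) \<le> B * norm v" .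
  qed
 qed auto
 moreover have "B > 0" by (simp add: B_def add_nonneg_pos sum_nonneg)
 ultimately show ?thesis using that by blast
qed

lemma smooth_integrable:
 fixes f :: "real^3 => 'b::euclidean_space"
 assumes "smooth f" "bounded {x. f x \<noteq> 0}"
 shows "integrable lborel f"
proof -
 obtain B where B: "!!x. norm (f x) \<le> B" using smooth_bounded_range[OF assms] by blast
 obtain r where r: "{x. f x \<noteq> 0} \<subseteq> cball 0 r" using bounded_subset_ballD[OF assms(2), of 0] ball_subset_cball by (meson order_trans)
 then have z: "!!x. x \<notin> cball 0 r ==> f x = 0" by auto
 show ?thesis
 proof (rule integrableI_bounded_set[where A="cball 0 r" and B=B])
  show "f \<in> borel_measurable lborel" using smooth_measurable assms by simp
  show "emeasure lborel (cball (0::real^3) r) < \<infinity>"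
   by (rule emeasure_bounded_finite) simp
  show "AE x in lborel. x \<in> cball 0 r --> norm (f x) \<le> B" using B by simp
  show "AE x in lborel. x \<notin> cball 0 r --> f x = 0" using z by simp
 qed simp
qed

text \<open>Compact support makes the first derivatives globally Lipschitz, so the quadratic remainder is
 uniform in the base point.\<close>

lemma smooth_taylor:
 assumes f: "smooth f" "bounded {x. f x \<noteq> 0}"
 obtains C where "C > 0"
  "!!z w. norm (f (z + w) - f z - (\<Sum>i\<in>UNIV. w $ i *\<^sub>R partial i f z)) \<le> C * (norm w)\<^sup>2"
proof -
 have "\<exists>B>0. \<forall>x y. norm (partial i f x - partial i f y) \<le> B * norm (x - y)" for i
  using smooth_lipschitz[OF smooth_partial[OF f(1)] partial_bounded_support[OF f(2)]] by metis
 then obtain B where B: "!!i. B i > 0" "!!i x y. norm (partial i f x - partial i f y) \<le> B i * norm (x - y)"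
  by metis
 define C where "C = (\<Sum>i\<in>UNIV. B i)"
 have C: "C > 0" unfolding C_def by (rule sum_pos) (auto simp: B)
 have "norm (f (z + w) - f z - (\<Sum>i\<in>UNIV. w $ i *\<^sub>R partial i f z)) \<le> C * (norm w)\<^sup>2" for z w
 proof -
  let ?f' = "\<lambda>x v. \<Sum>i\<in>UNIV. v $ i *\<^sub>R partial i f x"
  have "norm (f (z + w) - f z - ?f' z ((z + w) - z)) \<le> norm ((z + w) - z) * (C * norm w)"
  proof (rule differentiable_bound_linearization[where S="cball z (norm w)" and f'="?f'"])
   show "z + t *\<^sub>R (z + w - z) \<in> cball z (norm w)" if "t \<in> {0..1}" for t
    using that by (simp add: dist_norm mult_left_le_one_le)
   show "(f has_derivative ?f' x) (at x within cball z (norm w))" for x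
    using has_derivative_partials[OF smooth_differentiable[OF f(1)]] by (rule has_derivative_at_withinI)
   show "onorm (?f' x - ?f' z) \<le> C * norm w" if x: "x \<in> cball z (norm w)" for x
   proof (rule onorm_le)
    fix v :: "real^3"
    have "norm ((?f' x - ?f' z) v) = norm (\<Sum>i\<in>UNIV. v $ i *\<^sub>R (partial i f x - partial i f z))"
     by (simp add: sum_subtractf scaleR_diff_right)
    also have "... \<le> (\<Sum>i\<in>UNIV. norm (v $ i *\<^sub>R (partial i f x - partial i f z)))"
     by (rule norm_sum)
    also have "... \<le> (\<Sum>i\<in>UNIV. norm v * (B i * norm w))"
    proof (intro sum_mono)
     fix i :: 3
     have "norm (x - z) \<le> norm w" using x by (simp add: dist_norm norm_minus_commute)
     then have "norm (partial i f x - partial i f z) \<le> B i * norm w"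
      using order_trans[OF B(2) mult_left_mono] B(1)[of i] by simp
     then show "norm (v $ i *\<^sub>R (partial i f x - partial i f z)) \<le> norm v * (B i * norm w)"
      by (auto intro!: mult_mono component_le_norm_cart)
    qed
    also have "... = C * norm w * norm v"
     by (simp add: C_def sum_distrib_left[symmetric] sum_distrib_right[symmetric] mult.commute)
    finally show "norm ((?f' x - ?f' z) v) \<le> C * norm w * norm v" .
   qed
  qed auto
  then show ?thesis by (simp add: power2_eq_square mult_ac)
 qed
 then show ?thesis using that C by blast
qed

text \<open>Translation invariance: the integral of \<open>f(x + t e\<^sub>i) - f(x)\<close> vanishes, and by Taylor's formula
 it is \<open>t \<integral> \<partial>\<^sub>i f + O(t\<^sup>2)\<close>.\<close>

lemma integral_partial_eq_0:
 fixes f :: "real^3 => 'b::euclidean_space"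
 assumes f: "smooth f" "bounded {x. f x \<noteq> 0}"
 shows "(LINT x|lborel. partial i f x) = 0"
proof -
 obtain C where C: "C > 0" "!!z w. norm (f (z + w) - f z - (\<Sum>i\<in>UNIV. w $ i *\<^sub>R partial i f z)) \<le> C * (norm w)\<^sup>2"
  using smooth_taylor[OF f] by blast
 obtain r where "{x. f x \<noteq> 0} \<subseteq> cball 0 r" using bounded_subset_ballD[OF f(2), of 0] ball_subset_cball by (meson order_trans)
 then have cl: "closure {x. f x \<noteq> 0} \<subseteq> cball 0 r" by (rule closure_minimal) simp
 define V where "V = measure lborel (cball (0::real^3) (r + 1))"
 have fi: "integrable lborel f" "integrable lborel (partial i f)"
  by (intro smooth_integrable smooth_partial partial_bounded_support f)+
 have le: "norm (LINT x|lborel. partial i f x) \<le> C * V * t" if t: "0 < t" "t \<le> 1" for t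
 proof -
  define c where "c = t *\<^sub>R (axis i 1 :: real^3)"
  have nc: "norm c = t" using t by (simp add: c_def)
  have sc: "(\<Sum>j\<in>UNIV. c $ j *\<^sub>R partial j f z) = t *\<^sub>R partial i f z" for z
   using sum.delta[of UNIV i "\<lambda>j. t *\<^sub>R partial j f z"] by (simp add: c_def axis_def if_distrib if_distribR cong: if_cong)
  have meas: "f \<in> borel_measurable borel" by (rule smooth_measurable[OF f(1)])
  have d: "distr lborel borel (\<lambda>x. c + x) = lborel" by (rule lborel_distr_plus)
  have "integrable (distr lborel borel (\<lambda>x. c + x)) f" unfolding d by (rule fi(1))
  then have i1: "integrable lborel (\<lambda>x. f (x + c))"
   by (subst (asm) integrable_distr_eq) (use meas in \<open>auto simp: add.commute\<close>)
  have "(LINT x|lborel. f (x + c)) = (LINT x|distr lborel borel (\<lambda>x. c + x). f x)"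
   by (subst integral_distr) (use meas in \<open>auto simp: add.commute\<close>)
  then have eq: "(LINT x|lborel. f (x + c)) = (LINT x|lborel. f x)" unfolding d .
  let ?D = "\<lambda>x. f (x + c) - f x - t *\<^sub>R partial i f x"
  have i: "integrable lborel ?D" by (intro Bochner_Integration.integrable_diff integrable_scaleR_right i1 fi)
  have "(LINT x|lborel. ?D x) = - (t *\<^sub>R (LINT x|lborel. partial i f x))" using i1 fi eq by simp
  then have "t * norm (LINT x|lborel. partial i f x) = norm (LINT x|lborel. ?D x)" using t by simp
  also have "... \<le> (LINT x|lborel. C * t\<^sup>2 * indicator (cball (0::real^3) (r + 1)) x)"
  proof (rule order_trans[OF integral_norm_bound integral_mono])
   show "integrable lborel (\<lambda>x. norm (?D x))" using i by (rule integrable_norm)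
   have "emeasure lborel (cball (0::real^3) (r + 1)) < \<infinity>" by (rule emeasure_bounded_finite) simp
   then show "integrable lborel (\<lambda>x. C * t\<^sup>2 * indicator (cball (0::real^3) (r + 1)) x)" by simp
   fix x :: "real^3"
   show "norm (?D x) \<le> C * t\<^sup>2 * indicator (cball 0 (r + 1)) x"
   proof (cases "x \<in> cball 0 (r + 1)")
    case True then show ?thesis using C(2)[of x c] by (simp add: sc nc)
   next
    case False
    then have "norm x > r + 1" by simp
    then have n: "norm (x + c) > r" "norm x > r" using norm_diff_ineq[of x c] nc t by linarith+
    then have z: "x + c \<notin> closure {x. f x \<noteq> 0}" "x \<notin> closure {x. f x \<noteq> 0}" using cl by auto
    have "?D x = 0" by (simp add: z[THEN zero_outside_closure] partial_outside_support[OF z(2)])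
    then show ?thesis using C(1) by simp
   qed
  qed
  also have "... = t * (C * V * t)" by (simp add: V_def power2_eq_square)
  finally show ?thesis using t by simp
 qed
 have n: "norm (LINT x|lborel. partial i f x) \<le> C * V * (1 / real (Suc n))" for n by (intro le) simp_all
 have "(\<lambda>n. C * V * (1 / real (Suc n))) \<longlonglongrightarrow> C * V * 0" by (intro tendsto_mult tendsto_const LIMSEQ_Suc[OF lim_1_over_n])
 then have "norm (LINT x|lborel. partial i f x) \<le> C * V * 0" by (rule LIMSEQ_le_const) (use n in blast)
 then show ?thesis by simp
qed

section \<open>Integration by parts for the curl\<close>

lemma bounded_bilinear_cross3: "bounded_bilinear cross3"
 using bilinear_conv_bounded_bilinear bilinear_cross by blast

lemma bounded_bilinear_cross3_nth: "bounded_bilinear (\<lambda>x y. cross3 x y $ j)"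
 unfolding bilinear_conv_bounded_bilinear[symmetric] bilinear_def
 by (auto intro!: linearI simp: cross_add_left cross_add_right cross_mult_left cross_mult_right)

lemmas smooth_cross3_nth = smooth_bilinear[OF bounded_bilinear_cross3_nth]

lemma curl_smooth: "smooth \<phi> ==> smooth (curl \<phi>)"
proof -
 assume "smooth \<phi>"
 then have s: "smooth (\<lambda>x. partial i \<phi> x $ j)" for i j by (intro smooth_vec_nth smooth_partial)
 have "curl \<phi> = (\<lambda>x. (partial 2 \<phi> x $ 3 - partial 3 \<phi> x $ 2) *\<^sub>R axis 1 1 +
   (partial 3 \<phi> x $ 1 - partial 1 \<phi> x $ 3) *\<^sub>R axis 2 1 + (partial 1 \<phi> x $ 2 - partial 2 \<phi> x $ 1) *\<^sub>R axis 3 1)"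
  by (auto simp: curl_def vec_eq_iff forall_3 axis_def)
 then show ?thesis
  by (simp only:) (intro smooth_add smooth_scaleR smooth_diff smooth_const s)
qed

text \<open>Green's formula for the curl is the divergence theorem applied to the cross product of the two
 fields.\<close>

lemma div_cross3:
 assumes "v differentiable (at x)" "\<phi> differentiable (at x)"
 shows "(\<Sum>i\<in>UNIV. partial i (\<lambda>y. cross3 (v y) (\<phi> y) $ i) x) = curl v x \<bullet> \<phi> x - v x \<bullet> curl \<phi> x"
 using partial_bilinear[OF bounded_bilinear_cross3_nth assms]
 by (simp add: sum_3 inner_vec_def curl_def cross3_def algebra_simps)

lemma curl_support: "{x. curl \<phi> x \<noteq> 0} \<subseteq> closure {x. \<phi> x \<noteq> 0}"
proof (rule subsetI, rule ccontr)
 fix x assume x: "x \<in> {x. curl \<phi> x \<noteq> 0}" "x \<notin> closure {x. \<phi> x \<noteq> 0}"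
 have "partial i \<phi> x = 0" for i by (rule partial_outside_support[OF x(2)])
 then show False using x(1) by (simp add: curl_def vec_eq_iff forall_3)
qed

lemma test_fun_curl:
 assumes "test_fun U \<phi>" shows "test_fun U (curl \<phi>)"
proof -
 have a: "smooth \<phi>" "bounded {x. \<phi> x \<noteq> 0}" "closure {x. \<phi> x \<noteq> 0} \<subseteq> U"
  using assms unfolding test_fun_alt by simp_all
 show ?thesis unfolding test_fun_alt
  using curl_smooth[OF a(1)] bounded_subset[OF bounded_closure[OF a(2)] curl_support]
   order_trans[OF closure_minimal[OF curl_support closed_closure] a(3)] by blast
qed

text \<open>For fields on the whole space one of which has bounded support, the cross product has bounded
 support and its divergence integrates to zero.\<close>

lemma integral_curl_by_parts:
 assumes "smooth v" "smooth \<phi>" "bounded {x. v x \<noteq> 0} \<or> bounded {x. \<phi> x \<noteq> 0}"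
 shows "(LINT x|lborel. curl v x \<bullet> \<phi> x) = (LINT x|lborel. v x \<bullet> curl \<phi> x)"
proof -
 have s: "smooth (\<lambda>y. cross3 (v y) (\<phi> y) $ i)" for i
  using assms by (intro smooth_cross3_nth)
 have b: "bounded {x. cross3 (v x) (\<phi> x) $ i \<noteq> 0}" for i
 proof -
  have "{x. cross3 (v x) (\<phi> x) $ i \<noteq> 0} \<subseteq> {x. v x \<noteq> 0}" "{x. cross3 (v x) (\<phi> x) $ i \<noteq> 0} \<subseteq> {x. \<phi> x \<noteq> 0}"
   by auto
  then show ?thesis using assms(3) by (auto intro: bounded_subset)
 qed
 have bc: "bounded {x. v x \<noteq> 0} \<or> bounded {x. curl \<phi> x \<noteq> 0}" "bounded {x. curl v x \<noteq> 0} \<or> bounded {x. \<phi> x \<noteq> 0}"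
  using assms(3) bounded_subset[OF bounded_closure curl_support[of v]]
   bounded_subset[OF bounded_closure curl_support[of \<phi>]] by auto
 have bi: "bounded {x. f x \<bullet> g x \<noteq> 0}" if "bounded {x. f x \<noteq> 0} \<or> bounded {x. g x \<noteq> 0}" for f g :: "real^3 => real^3"
 proof -
  have "{x. f x \<bullet> g x \<noteq> 0} \<subseteq> {x. f x \<noteq> 0}" "{x. f x \<bullet> g x \<noteq> 0} \<subseteq> {x. g x \<noteq> 0}" by auto
  then show ?thesis using that by (auto intro: bounded_subset)
 qed
 have i1: "integrable lborel (\<lambda>x. curl v x \<bullet> \<phi> x)" and i2: "integrable lborel (\<lambda>x. v x \<bullet> curl \<phi> x)"
  by (rule smooth_integrable smooth_inner curl_smooth assms bi bc)+
 have "(LINT x|lborel. curl v x \<bullet> \<phi> x) - (LINT x|lborel. v x \<bullet> curl \<phi> x)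
   = (LINT x|lborel. (\<Sum>i\<in>UNIV. partial i (\<lambda>y. cross3 (v y) (\<phi> y) $ i) x))"
  using i1 i2 by (simp add: div_cross3 assms smooth_differentiable)
 also have "... = (\<Sum>i\<in>UNIV. LINT x|lborel. partial i (\<lambda>y. cross3 (v y) (\<phi> y) $ i) x)"
  by (intro Bochner_Integration.integral_sum smooth_integrable smooth_partial s partial_bounded_support b)
 also have "... = 0" using integral_partial_eq_0[OF s b] by simp
 finally show ?thesis by simp
qed

section \<open>The function \<open>exp (-1/t)\<close> and smooth bumps\<close>

text \<open>Multiplying by a polynomial in \<open>1/t\<close> makes the family closed under differentiation, so that
 smoothness of all its members follows at once.\<close>

definition expinv :: "real poly => real => real" where
 "expinv p t = (if t > 0 then poly p (1/t) * exp (- (1/t)) else 0)"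

definition expinv_deriv :: "real poly => real poly" where
 "expinv_deriv p = [:0,0,1:] * (p - pderiv p)"

lemma poly_div_exp_tendsto_0: "((\<lambda>s. poly p s * exp (- s)) \<longlongrightarrow> 0) (at_top :: real filter)"
proof -
 have "((\<lambda>s. \<Sum>i\<le>degree p. coeff p i * (s ^ i / exp s)) \<longlongrightarrow> (\<Sum>i\<le>degree p. coeff p i * 0)) (at_top :: real filter)"
  by (intro tendsto_sum tendsto_mult tendsto_const tendsto_power_div_exp_0)
 then show ?thesis by (simp add: poly_altdef sum_distrib_right exp_minus divide_inverse mult.assoc)
qed

lemma expinv_has_derivative:
 "(expinv p has_real_derivative expinv (expinv_deriv p) t) (at t)"
proof -
 consider "t > 0" | "t < 0" | "t = 0" by linarith
 then show ?thesis
 proof cases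
  case 1
  have "((\<lambda>t. poly p (1/t) * exp (- (1/t))) has_real_derivative
    poly (pderiv p) (1/t) * (- 1 / t^2) * exp (- (1/t)) + poly p (1/t) * (exp (- (1/t)) * (1 / t^2))) (at t)"
   using 1 by (auto intro!: derivative_eq_intros DERIV_chain2[OF poly_DERIV] simp: power2_eq_square)
  moreover have "poly (pderiv p) (1/t) * (- 1 / t^2) * exp (- (1/t)) + poly p (1/t) * (exp (- (1/t)) * (1 / t^2))
    = expinv (expinv_deriv p) t"
   using 1 by (simp add: expinv_def expinv_deriv_def field_simps power2_eq_square)
  ultimately have "((\<lambda>t. poly p (1/t) * exp (- (1/t))) has_real_derivative expinv (expinv_deriv p) t) (at t)"
   by simp
  then show ?thesis
   by (rule has_field_derivative_transform_within_open[where S="{0<..}"]) (use 1 in \<open>auto simp: expinv_def\<close>)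
 next
  case 2
  have "((\<lambda>t. 0) has_real_derivative 0) (at t)" by simp
  then have "(expinv p has_real_derivative 0) (at t)"
   by (rule has_field_derivative_transform_within_open[where S="{..<0}"]) (use 2 in \<open>auto simp: expinv_def\<close>)
  then show ?thesis using 2 by (simp add: expinv_def)
 next
  case 3
  have "((\<lambda>h. expinv p h / h) \<longlongrightarrow> 0) (at_right 0)"
  proof (rule Lim_transform_eventually)
   show "((\<lambda>h. poly (pCons 0 p) (inverse h) * exp (- inverse h)) \<longlongrightarrow> 0) (at_right (0::real))"
    by (rule filterlim_compose[OF poly_div_exp_tendsto_0 filterlim_inverse_at_top_right])
   show "\<forall>\<^sub>F h in at_right 0. poly (pCons 0 p) (inverse h) * exp (- inverse h) = expinv p h / h"
    by (auto simp: eventually_at_filter expinv_def divide_inverse)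
  qed
  moreover have "((\<lambda>h. expinv p h / h) \<longlongrightarrow> 0) (at_left 0)"
   by (rule Lim_transform_eventually[OF tendsto_const]) (auto simp: eventually_at_filter expinv_def)
  ultimately have "((\<lambda>h. expinv p h / h) \<longlongrightarrow> 0) (at 0)" by (simp add: filterlim_split_at)
  then show ?thesis using 3 by (simp add: DERIV_def expinv_def)
 qed
qed

lemma expinv_compose_affine:
 "((\<lambda>x. expinv p (\<alpha> - a \<bullet> x)) has_derivative (\<lambda>v. - (a \<bullet> v) * expinv (expinv_deriv p) (\<alpha> - a \<bullet> x))) (at (x::real^3))"
proof -
 have "((\<lambda>x. \<alpha> - a \<bullet> x) has_derivative (\<lambda>v. - (a \<bullet> v))) (at x)"
  by (auto intro!: derivative_eq_intros)
 from has_derivative_compose[OF this expinv_has_derivative[unfolded has_field_derivative_def]]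
 show ?thesis by (simp add: mult.commute)
qed

lemma partial_expinv_affine:
 "partial i (\<lambda>x. expinv p (\<alpha> - a \<bullet> x)) = (\<lambda>x. - (a $ i) * expinv (expinv_deriv p) (\<alpha> - a \<bullet> x))"
 by (rule ext) (simp add: partial_eqI[OF expinv_compose_affine] inner_axis)

lemma smooth_expinv_affine: "smooth (\<lambda>x. expinv p (\<alpha> - a \<bullet> x))"
proof (rule smooth_coinduct[where S="{\<lambda>x. c * expinv p (\<alpha> - a \<bullet> x) | c p. True}"], goal_cases)
 case 1 show ?case by (simp, rule exI[of _ 1]) auto
next
 case (2 f x)
 then obtain c p where f: "f = (\<lambda>x. c * expinv p (\<alpha> - a \<bullet> x))" by blast
 show ?case unfolding f differentiable_def
  using has_derivative_mult_right[OF expinv_compose_affine] by blast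
next
 case (3 f i)
 then obtain c p where f: "f = (\<lambda>x. c * expinv p (\<alpha> - a \<bullet> x))" by blast
 have "partial i f = (\<lambda>x. (c * - (a $ i)) * expinv (expinv_deriv p) (\<alpha> - a \<bullet> x))"
 proof
  fix x
  have "partial i (\<lambda>x. c * expinv p (\<alpha> - a \<bullet> x)) x = c * partial i (\<lambda>x. expinv p (\<alpha> - a \<bullet> x)) x"
   by (rule partial_bounded_linear[OF bounded_linear_mult_right])
     (rule differentiableI[OF expinv_compose_affine])
  then show "partial i f x = (c * - (a $ i)) * expinv (expinv_deriv p) (\<alpha> - a \<bullet> x)"
   by (simp add: f partial_expinv_affine)
 qed
 then show ?case by blast
qed

lemma expinv_1_bounds: "0 \<le> expinv 1 t" "expinv 1 t \<le> 1"
 by (auto simp: expinv_def)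

lemma expinv_nonpos: "t \<le> 0 ==> expinv p t = 0"
 by (auto simp: expinv_def)

lemma expinv_1_at_top: "(expinv 1 \<longlongrightarrow> 1) at_top"
proof (rule Lim_transform_eventually)
 have "((\<lambda>t::real. exp (- inverse t)) \<longlongrightarrow> exp (- 0)) at_top"
  by (intro tendsto_intros tendsto_inverse_0_at_top filterlim_ident)
 then show "((\<lambda>t::real. exp (- inverse t)) \<longlongrightarrow> 1) at_top" by simp
 show "\<forall>\<^sub>F t in at_top. exp (- inverse t) = expinv 1 t"
  using eventually_gt_at_top[of 0] by eventually_elim (auto simp: expinv_def divide_inverse)
qed


section \<open>Convolution with a smooth kernel\<close>

text \<open>Only one factor is smooth; all derivatives fall on it, which makes the convolution with an
 integrable field smooth.\<close>

definition convol :: "(real^3 => real) => (real^3 => real^3) => real^3 => real^3" where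
 "convol h u x = (LINT y|lborel. h (x - y) *\<^sub>R u y)"

lemma convol_integrable:
 assumes h: "smooth h" "bounded {x. h x \<noteq> 0}" and u: "integrable lborel u"
 shows "integrable lborel (\<lambda>y. h (x - y) *\<^sub>R u y :: real^3)"
proof -
 obtain B where B: "!!x. norm (h x) \<le> B" using smooth_bounded_range[OF h] by blast
 have [measurable]: "h \<in> borel_measurable borel" "u \<in> borel_measurable borel"
  using smooth_measurable[OF h(1)] borel_measurable_integrable[OF u] by simp_all
 show ?thesis
 proof (rule Bochner_Integration.integrable_bound)
  show "integrable lborel (\<lambda>y. B *\<^sub>R norm (u y))" using u by simp
  have "\<bar>h z\<bar> \<le> B" for z using B[of z] by simp
  then show "AE y in lborel. norm (h (x - y) *\<^sub>R u y) \<le> norm (B *\<^sub>R norm (u y))"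
   by (intro AE_I2) (auto intro!: mult_right_mono intro: order_trans[OF _ abs_ge_self])
 qed measurable
qed

lemma convol_has_derivative:
 assumes h: "smooth h" "bounded {x. h x \<noteq> 0}" and u: "integrable lborel u"
 shows "(convol h u has_derivative (\<lambda>v. \<Sum>i\<in>UNIV. v $ i *\<^sub>R convol (partial i h) u x)) (at x)"
proof -
 obtain C where C: "C > 0"
  "!!z w. norm (h (z + w) - h z - (\<Sum>i\<in>UNIV. w $ i *\<^sub>R partial i h z)) \<le> C * (norm w)\<^sup>2"
  using smooth_taylor[OF h] by blast
 define I where "I = (LINT y|lborel. norm (u y))"
 have I: "I \<ge> 0" by (simp add: I_def)
 have int: "integrable lborel (\<lambda>y. h (z - y) *\<^sub>R u y)" "integrable lborel (\<lambda>y. partial i h (z - y) *\<^sub>R u y)" for z i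
  by (intro convol_integrable h u smooth_partial partial_bounded_support)+
 have bound: "norm (convol h u (x + v) - convol h u x - (\<Sum>i\<in>UNIV. v $ i *\<^sub>R convol (partial i h) u x))
   \<le> C * I * (norm v)\<^sup>2" for v
 proof -
  have "convol h u (x + v) - convol h u x - (\<Sum>i\<in>UNIV. v $ i *\<^sub>R convol (partial i h) u x)
    = (LINT y|lborel. h (x + v - y) *\<^sub>R u y - h (x - y) *\<^sub>R u y - (\<Sum>i\<in>UNIV. v $ i *\<^sub>R (partial i h (x - y) *\<^sub>R u y)))"
   unfolding convol_def using int
   by (simp add: Bochner_Integration.integral_sum del: scaleR_scaleR)
  also have "... = (LINT y|lborel. (h ((x - y) + v) - h (x - y) - (\<Sum>i\<in>UNIV. v $ i *\<^sub>R partial i h (x - y))) *\<^sub>R u y)"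
   by (intro lint_cong refl)
    (simp add: scaleR_diff_left scaleR_sum_left algebra_simps)
  also have "norm ... \<le> (LINT y|lborel. (C * (norm v)\<^sup>2) * norm (u y))"
  proof (rule Bochner_Integration.integral_norm_bound_integral)
   show "integrable lborel (\<lambda>y. (h ((x - y) + v) - h (x - y) - (\<Sum>i\<in>UNIV. v $ i *\<^sub>R partial i h (x - y))) *\<^sub>R u y)"
   proof -
    have "integrable lborel (\<lambda>y. h (x + v - y) *\<^sub>R u y - h (x - y) *\<^sub>R u y - (\<Sum>i\<in>UNIV. v $ i *\<^sub>R (partial i h (x - y) *\<^sub>R u y)))"
     by (intro Bochner_Integration.integrable_diff Bochner_Integration.integrable_sum integrable_scaleR_right int)
    then show ?thesis
     by (rule Bochner_Integration.integrable_cong[THEN iffD1, rotated 2])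
      (simp_all add: scaleR_diff_left scaleR_sum_left algebra_simps)
   qed
   show "integrable lborel (\<lambda>y. (C * (norm v)\<^sup>2) * norm (u y))" using u by simp
   fix y
   show "norm ((h ((x - y) + v) - h (x - y) - (\<Sum>i\<in>UNIV. v $ i *\<^sub>R partial i h (x - y))) *\<^sub>R u y)
     \<le> (C * (norm v)\<^sup>2) * norm (u y)"
    unfolding norm_scaleR by (intro mult_right_mono) (use C(2)[of "x - y" v] in auto)
  qed
  also have "... = C * I * (norm v)\<^sup>2" by (simp add: I_def)
  finally show ?thesis .
 qed
 show ?thesis unfolding has_derivative_at
 proof
  show "bounded_linear (\<lambda>v. \<Sum>i\<in>UNIV. v $ i *\<^sub>R convol (partial i h) u x)"
   by (intro bounded_linear_sum bounded_linear_scaleR_const bounded_linear_vec_nth)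
  show "((\<lambda>v. norm (convol h u (x + v) - convol h u x - (\<Sum>i\<in>UNIV. v $ i *\<^sub>R convol (partial i h) u x)) / norm v)
    \<longlongrightarrow> 0) (at 0)"
  proof (rule tendsto_sandwich[where f="\<lambda>_. 0" and h="\<lambda>v. C * I * norm v"])
   show "\<forall>\<^sub>F v in at 0. norm (convol h u (x + v) - convol h u x - (\<Sum>i\<in>UNIV. v $ i *\<^sub>R convol (partial i h) u x)) / norm v
     \<le> C * I * norm v"
    using bound by (auto simp: eventually_at_filter divide_simps power2_eq_square mult_ac)
   show "((\<lambda>v. C * I * norm v) \<longlongrightarrow> 0) (at (0::real^3))"
    using tendsto_mult[OF tendsto_const[of "C * I"] tendsto_norm_zero[OF tendsto_ident_at[of "0::real^3" UNIV]]]
    by simp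
  qed auto
 qed
qed

lemma partial_convol:
 assumes "smooth h" "bounded {x. h x \<noteq> 0}" "integrable lborel u"
 shows "partial i (convol h u) = convol (partial i h) u"
proof
 fix x
 have "partial i (convol h u) x = (\<Sum>j\<in>UNIV. axis i 1 $ j *\<^sub>R convol (partial j h) u x)"
  by (rule partial_eqI[OF convol_has_derivative[OF assms]])
 also have "... = (\<Sum>j\<in>UNIV. if j = i then convol (partial j h) u x else 0)"
  by (intro sum.cong) (auto simp: axis_def)
 finally show "partial i (convol h u) x = convol (partial i h) u x" by simp
qed

lemma smooth_convol:
 assumes "smooth h" "bounded {x. h x \<noteq> 0}" and u: "integrable lborel u"
 shows "smooth (convol h u)"
proof (rule smooth_coinduct[where S="{convol g u | g. smooth g \<and> bounded {x. g x \<noteq> 0}}"], goal_cases)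
 case 1 then show ?case using assms by blast
next
 case (2 f x) then show ?case using convol_has_derivative[OF _ _ u] differentiable_def by blast
next
 case (3 f i)
 then obtain g where "f = convol g u" "smooth g" "bounded {x. g x \<noteq> 0}" by blast
 then have "partial i f = convol (partial i g) u" "smooth (partial i g)" "bounded {x. partial i g x \<noteq> 0}"
  using partial_convol[OF _ _ u] smooth_partial partial_bounded_support by simp_all
 then show ?case by blast
qed

section \<open>Square integrable fields\<close>

lemma borel_lebesgue_on: "f \<in> borel_measurable borel ==> f \<in> borel_measurable (lebesgue_on S)"
 by (intro measurable_restrict_space1 measurable_completion) simp

definition L2_on :: "'a measure => ('a => 'b::euclidean_space) => bool" where
 "L2_on M f \<longleftrightarrow> f \<in> borel_measurable M \<and> integrable M (\<lambda>x. (norm (f x))\<^sup>2)"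

abbreviation sq_nn :: "'a measure => ('a => 'b::real_normed_vector) => ennreal" where
 "sq_nn M f \<equiv> \<integral>\<^sup>+ x. ennreal ((norm (f x))\<^sup>2) \<partial>M"

text \<open>Convergence in mean square, measured by the extended nonnegative integral as in the definition of
 traces, so that no integrability is required to state it.\<close>

definition L2_tendsto :: "'a measure => (nat => 'a => 'b::euclidean_space) => ('a => 'b) => bool" where
 "L2_tendsto M f g \<longleftrightarrow> (\<lambda>n. sq_nn M (\<lambda>x. f n x - g x)) \<longlonglongrightarrow> 0"

lemma L2_iff: "L2 \<Omega> v \<longleftrightarrow> L2_on (lebesgue_on \<Omega>) v"
 by (simp add: L2_def L2_on_def)

lemma norm_add_sq_le: "(norm (a + b :: 'b::real_normed_vector))\<^sup>2 \<le> 2 * (norm a)\<^sup>2 + 2 * (norm b)\<^sup>2"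
proof -
 have "(norm (a + b))\<^sup>2 \<le> (norm a + norm b)\<^sup>2" by (intro power_mono norm_triangle_ineq) auto
 also have "... \<le> 2 * (norm a)\<^sup>2 + 2 * (norm b)\<^sup>2"
  using zero_le_power2[of "norm a - norm b"] by (simp add: power2_sum power2_diff)
 finally show ?thesis .
qed

lemma L2_on_add:
 assumes "L2_on M f" "L2_on M g"
 shows "L2_on M (\<lambda>x. f x + g x)"
proof -
 have [measurable]: "f \<in> borel_measurable M" "g \<in> borel_measurable M"
  using assms by (auto simp: L2_on_def)
 have "integrable M (\<lambda>x. (norm (f x + g x))\<^sup>2)"
 proof (rule Bochner_Integration.integrable_bound)
  show "integrable M (\<lambda>x. 2 * (norm (f x))\<^sup>2 + 2 * (norm (g x))\<^sup>2)"
   using assms by (auto simp: L2_on_def)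
  show "AE x in M. norm ((norm (f x + g x))\<^sup>2) \<le> norm (2 * (norm (f x))\<^sup>2 + 2 * (norm (g x))\<^sup>2)"
   using norm_add_sq_le by (auto intro!: AE_I2)
 qed measurable
 then show ?thesis by (simp add: L2_on_def)
qed

lemma L2_on_bounded_linear:
 assumes "L2_on M f" "bounded_linear L"
 shows "L2_on M (\<lambda>x. L (f x) :: 'c::euclidean_space)"
proof -
 have f[measurable]: "f \<in> borel_measurable M" and i: "integrable M (\<lambda>x. (norm (f x))\<^sup>2)"
  using assms by (auto simp: L2_on_def)
 obtain K where K: "!!x. norm (L x) \<le> norm x * K" using bounded_linear.bounded[OF assms(2)] by blast
 have m[measurable]: "(\<lambda>x. L (f x)) \<in> borel_measurable M"
  using assms(2) f by (intro measurable_compose[OF f] borel_measurable_continuous_onI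
    linear_continuous_on)
 have "integrable M (\<lambda>x. (norm (L (f x)))\<^sup>2)"
 proof (rule Bochner_Integration.integrable_bound)
  show "integrable M (\<lambda>x. K\<^sup>2 * (norm (f x))\<^sup>2)" using i by simp
  have "(norm (L v))\<^sup>2 \<le> K\<^sup>2 * (norm v)\<^sup>2" for v
   using power_mono[OF K[of v], of 2] by (simp add: power_mult_distrib mult.commute)
  then show "AE x in M. norm ((norm (L (f x)))\<^sup>2) \<le> norm (K\<^sup>2 * (norm (f x))\<^sup>2)"
   by (auto intro!: AE_I2)
 qed measurable
 with m show ?thesis by (simp add: L2_on_def)
qed

lemma L2_on_diff:
 "L2_on M f ==> L2_on M g ==> L2_on M (\<lambda>x. f x - g x)"
 using L2_on_add[OF _ L2_on_bounded_linear[OF _ bounded_linear_minus[OF bounded_linear_ident]]]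
 by fastforce

lemma L2_on_bounded_mult:
 assumes f: "L2_on M f" and g: "g \<in> borel_measurable M" "AE x in M. \<bar>g x\<bar> \<le> (B::real)"
 shows "L2_on M (\<lambda>x. g x *\<^sub>R f x)"
proof -
 have [measurable]: "f \<in> borel_measurable M" "g \<in> borel_measurable M" and i: "integrable M (\<lambda>x. (norm (f x))\<^sup>2)"
  using assms by (auto simp: L2_on_def)
 have "integrable M (\<lambda>x. (norm (g x *\<^sub>R f x))\<^sup>2)"
 proof (rule Bochner_Integration.integrable_bound)
  show "integrable M (\<lambda>x. B\<^sup>2 * (norm (f x))\<^sup>2)" using i by simp
  show "AE x in M. norm ((norm (g x *\<^sub>R f x))\<^sup>2) \<le> norm (B\<^sup>2 * (norm (f x))\<^sup>2)"
   using g(2)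
  proof eventually_elim
   case (elim x)
   then have "(\<bar>g x\<bar>)\<^sup>2 \<le> B\<^sup>2" by (intro power_mono) auto
   then show ?case by (simp add: power_mult_distrib mult_right_mono)
  qed
 qed measurable
 then show ?thesis by (simp add: L2_on_def)
qed

lemma L2_on_inner:
 assumes "L2_on M f" "L2_on M g"
 shows "integrable M (\<lambda>x. f x \<bullet> g x)"
proof (rule Bochner_Integration.integrable_bound)
 have [measurable]: "f \<in> borel_measurable M" "g \<in> borel_measurable M"
  using assms by (auto simp: L2_on_def)
 show "(\<lambda>x. f x \<bullet> g x) \<in> borel_measurable M" by measurable
 show "integrable M (\<lambda>x. (norm (f x))\<^sup>2 + (norm (g x))\<^sup>2)"
  using assms by (auto simp: L2_on_def)
 have "\<bar>u \<bullet> v\<bar> \<le> (norm u)\<^sup>2 + (norm v)\<^sup>2" for u v :: 'b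
 proof -
  have "\<bar>u \<bullet> v\<bar> \<le> norm u * norm v" by (rule Cauchy_Schwarz_ineq2)
  also have "... \<le> (norm u)\<^sup>2 + (norm v)\<^sup>2"
   using sum_squares_bound[of "norm u" "norm v"] mult_nonneg_nonneg[of "norm u" "norm v"] norm_ge_zero[of u] norm_ge_zero[of v]
   by linarith
  finally show ?thesis .
 qed
 then show "AE x in M. norm (f x \<bullet> g x) \<le> norm ((norm (f x))\<^sup>2 + (norm (g x))\<^sup>2)"
  by (auto intro!: AE_I2)
qed

lemma (in finite_measure) bounded_L2_on:
 assumes "f \<in> borel_measurable M" "AE x in M. norm (f x) \<le> B"
 shows "L2_on M (f :: _ => 'b::euclidean_space)"
proof -
 have "integrable M (\<lambda>x. (norm (f x))\<^sup>2)"
 proof (rule integrable_const_bound[where B="B\<^sup>2"])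
  show "AE x in M. norm ((norm (f x))\<^sup>2) \<le> B\<^sup>2"
   using assms(2) by eventually_elim (auto intro!: power_mono)
  have [measurable]: "f \<in> borel_measurable M" by fact
  show "(\<lambda>x. (norm (f x))\<^sup>2) \<in> borel_measurable M" by measurable
 qed
 then show ?thesis using assms by (simp add: L2_on_def)
qed

lemma (in finite_measure) L2_on_imp_integrable:
 assumes "L2_on M (f :: _ => 'b::euclidean_space)" shows "integrable M f"
proof (rule Bochner_Integration.integrable_bound)
 show "f \<in> borel_measurable M" using assms by (simp add: L2_on_def)
 show "integrable M (\<lambda>x. 1 + (norm (f x))\<^sup>2)" using assms by (simp add: L2_on_def)
 have "t \<le> 1 + t\<^sup>2" for t :: real
 proof -
  have "2 * t \<le> t\<^sup>2 + 1" using sum_squares_bound[of t 1] by simp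
  moreover have "t\<^sup>2 \<ge> 0" by simp
  ultimately show ?thesis by linarith
 qed
 then show "AE x in M. norm (f x) \<le> norm (1 + (norm (f x))\<^sup>2)" by (auto intro!: AE_I2)
qed

lemma sq_nn_add_le:
 fixes f g :: "'a => 'b::euclidean_space"
 assumes [measurable]: "f \<in> borel_measurable M" "g \<in> borel_measurable M"
 shows "sq_nn M (\<lambda>x. f x + g x) \<le> 2 * sq_nn M f + 2 * sq_nn M g"
proof -
 have "ennreal ((norm (f x + g x))\<^sup>2) \<le> 2 * ennreal ((norm (f x))\<^sup>2) + 2 * ennreal ((norm (g x))\<^sup>2)" for x
  using ennreal_leI[OF norm_add_sq_le[of "f x" "g x"]] by (simp add: ennreal_mult)
 then have "sq_nn M (\<lambda>x. f x + g x) \<le> (\<integral>\<^sup>+ x. 2 * ennreal ((norm (f x))\<^sup>2) + 2 * ennreal ((norm (g x))\<^sup>2) \<partial>M)"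
  by (intro nn_integral_mono)
 then show ?thesis by (simp add: nn_integral_add nn_integral_cmult)
qed

text \<open>The filter is arbitrary because the statement is used for sequences and, to express the Cauchy
 condition, for double sequences.\<close>

lemma sq_nn_tendsto_add:
 fixes f g :: "'i => 'a => 'b::euclidean_space"
 assumes m: "!!i. f i \<in> borel_measurable M" "!!i. g i \<in> borel_measurable M"
  and lim: "((\<lambda>i. sq_nn M (f i)) \<longlongrightarrow> 0) F" "((\<lambda>i. sq_nn M (g i)) \<longlongrightarrow> 0) F"
 shows "((\<lambda>i. sq_nn M (\<lambda>x. f i x + g i x)) \<longlongrightarrow> 0) F"
proof (rule tendsto_sandwich[OF _ _ tendsto_const])
 show "((\<lambda>i. 2 * sq_nn M (f i) + 2 * sq_nn M (g i)) \<longlongrightarrow> 0) F"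
  using tendsto_add[OF ennreal_tendsto_cmult[OF _ lim(1), of 2] ennreal_tendsto_cmult[OF _ lim(2), of 2]] by simp
qed (use sq_nn_add_le[OF m] in simp_all)

lemma sq_nn_tendsto_diff:
 fixes f g :: "'i => 'a => 'b::euclidean_space"
 assumes m: "!!i. f i \<in> borel_measurable M" "!!i. g i \<in> borel_measurable M"
  and lim: "((\<lambda>i. sq_nn M (f i)) \<longlongrightarrow> 0) F" "((\<lambda>i. sq_nn M (g i)) \<longlongrightarrow> 0) F"
 shows "((\<lambda>i. sq_nn M (\<lambda>x. f i x - g i x)) \<longlongrightarrow> 0) F"
 using sq_nn_tendsto_add[of f M "\<lambda>i x. - g i x" F] assms by simp

lemma L2_tendsto_diff:
 fixes f f' :: "nat => 'a => 'b::euclidean_space"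
 assumes m: "!!n. f n \<in> borel_measurable M" "!!n. f' n \<in> borel_measurable M" "g \<in> borel_measurable M" "g' \<in> borel_measurable M"
  and lim: "L2_tendsto M f g" "L2_tendsto M f' g'"
 shows "L2_tendsto M (\<lambda>n x. f n x - f' n x) (\<lambda>x. g x - g' x)"
proof -
 have eq: "f n x - f' n x - (g x - g' x) = (f n x - g x) - (f' n x - g' x)" for n x by simp
 show ?thesis unfolding L2_tendsto_def eq by (rule sq_nn_tendsto_diff) (use m lim in \<open>simp_all add: L2_tendsto_def\<close>)
qed

lemma L2_tendstoI:
 assumes le: "!!e. e > 0 ==> \<exists>N. \<forall>n\<ge>N. sq_nn M (\<lambda>x. f n x - g x) \<le> ennreal e"
 shows "L2_tendsto M f g"
 unfolding L2_tendsto_def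
proof (rule order_tendstoI)
 fix a :: ennreal assume a: "0 < a"
 obtain c where c: "0 < c" "c < a" using dense[OF a] by blast
 then have "c < top" using less_le_trans[OF c(2) top_greatest] by simp
 then obtain e where "e \<ge> 0" "c = ennreal e" using less_top_ennreal by metis
 then have e: "e > 0" "ennreal e < a" using c by auto
 show "\<forall>\<^sub>F n in sequentially. sq_nn M (\<lambda>x. f n x - g x) < a"
  unfolding eventually_sequentially using le[OF e(1)] le_less_trans[OF _ e(2)] by blast
qed simp

definition L2_cauchy :: "'a measure => (nat => 'a => 'b::euclidean_space) => bool" where
 "L2_cauchy M f \<longleftrightarrow> ((\<lambda>p. sq_nn M (\<lambda>x. f (fst p) x - f (snd p) x)) \<longlongrightarrow> 0) (sequentially \<times>\<^sub>F sequentially)"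

lemma L2_tendsto_imp_cauchy:
 fixes f :: "nat => 'a => 'b::euclidean_space"
 assumes m: "!!n. f n \<in> borel_measurable M" "g \<in> borel_measurable M" and lim: "L2_tendsto M f g"
 shows "L2_cauchy M f"
proof -
 have eq: "f i x - f j x = (f i x - g x) - (f j x - g x)" for i j x by simp
 note l = filterlim_compose[OF lim[unfolded L2_tendsto_def]]
 show ?thesis unfolding L2_cauchy_def by (subst eq, rule sq_nn_tendsto_diff)
  (use m l[OF filterlim_fst] l[OF filterlim_snd] in simp_all)
qed

lemma L2_tendsto_integral_inner:
 fixes f :: "nat => 'a => 'b::euclidean_space"
 assumes f: "!!n. L2_on M (f n)" and g: "L2_on M g" and h: "L2_on M h"
  and lim: "L2_tendsto M f g"
 shows "(\<lambda>n. LINT x|M. f n x \<bullet> h x) \<longlonglongrightarrow> (LINT x|M. g x \<bullet> h x)"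
proof -
 have [measurable]: "f n \<in> borel_measurable M" "g \<in> borel_measurable M" "h \<in> borel_measurable M" for n
  using f g h by (simp_all add: L2_on_def)
 define a where "a n = (LINT x|M. (f n x - g x) \<bullet> h x)" for n
 have a: "a n = (LINT x|M. f n x \<bullet> h x) - (LINT x|M. g x \<bullet> h x)" for n
  using L2_on_inner[OF f h] L2_on_inner[OF g h] by (simp add: a_def inner_diff_left)
 have le: "ennreal ((a n)\<^sup>2) \<le> sq_nn M h * sq_nn M (\<lambda>x. f n x - g x)" for n
 proof -
  have "ennreal (norm (a n)) \<le> (\<integral>\<^sup>+x. ennreal (norm ((f n x - g x) \<bullet> h x)) \<partial>M)"
   unfolding a_def by (rule integral_norm_bound_ennreal)
    (rule L2_on_inner[OF L2_on_diff[OF f g] h])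
  also have "... \<le> (\<integral>\<^sup>+x. ennreal (norm (h x)) * ennreal (norm (f n x - g x)) \<partial>M)"
  proof (rule nn_integral_mono)
   fix x
   have "norm ((f n x - g x) \<bullet> h x) \<le> norm (h x) * norm (f n x - g x)"
    using Cauchy_Schwarz_ineq2[of "f n x - g x" "h x"] by (simp add: mult.commute)
   then show "ennreal (norm ((f n x - g x) \<bullet> h x)) \<le> ennreal (norm (h x)) * ennreal (norm (f n x - g x))"
    unfolding ennreal_mult[OF norm_ge_zero norm_ge_zero, symmetric] by (rule ennreal_leI)
  qed
  finally have "(ennreal (norm (a n)))\<^sup>2 \<le> (\<integral>\<^sup>+x. ennreal (norm (h x)) * ennreal (norm (f n x - g x)) \<partial>M)\<^sup>2"
   by (rule power_mono) simp
  also have "... \<le> (\<integral>\<^sup>+x. (ennreal (norm (h x)))\<^sup>2 \<partial>M) * (\<integral>\<^sup>+x. (ennreal (norm (f n x - g x)))\<^sup>2 \<partial>M)"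
   by (rule Cauchy_Schwarz_nn_integral) measurable
  finally show ?thesis by (simp add: ennreal_power)
 qed
 have "sq_nn M h < top" using h by (simp add: nn_integral_eq_integral L2_on_def)
 then have "(\<lambda>n. sq_nn M h * sq_nn M (\<lambda>x. f n x - g x)) \<longlonglongrightarrow> sq_nn M h * 0"
  using lim unfolding L2_tendsto_def by (rule ennreal_tendsto_cmult)
 then have l0: "(\<lambda>n. sq_nn M h * sq_nn M (\<lambda>x. f n x - g x)) \<longlonglongrightarrow> 0" by simp
 have "(\<lambda>n. ennreal ((a n)\<^sup>2)) \<longlonglongrightarrow> 0"
  by (rule tendsto_sandwich[OF always_eventually always_eventually tendsto_const l0]) (intro allI zero_le le)+
 then have "(\<lambda>n. (a n)\<^sup>2) \<longlonglongrightarrow> 0" using tendsto_ennreal_iff[of "\<lambda>n. (a n)\<^sup>2" sequentially 0] by simp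
 from tendsto_real_sqrt[OF this] have "(\<lambda>n. \<bar>a n\<bar>) \<longlonglongrightarrow> 0" by simp
 then have "a \<longlonglongrightarrow> 0" by (rule tendsto_rabs_zero_cancel)
 then show ?thesis unfolding a by (rule LIM_zero_cancel)
qed

text \<open>Two sequences that approach each other have the same limit; for limits of restrictions to a face
 this is the uniqueness of traces.\<close>

lemma L2_tendsto_unique_AE:
 assumes [measurable]: "!!n. f n \<in> borel_measurable M" "!!n. f' n \<in> borel_measurable M"
  "g \<in> borel_measurable M" "g' \<in> borel_measurable M"
  and lim: "L2_tendsto M f g" "L2_tendsto M f' g'" "L2_tendsto M (\<lambda>n x. f n x - f' n x) (\<lambda>x. 0)"
 shows "AE x in M. g x = g' x"
proof -
 have d: "L2_tendsto M (\<lambda>n x. f n x - f' n x) (\<lambda>x. g x - g' x)" by (rule L2_tendsto_diff) (use lim in simp_all)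
 have "L2_tendsto M (\<lambda>n x. (f n x - f' n x) - (f n x - f' n x)) (\<lambda>x. (g x - g' x) - 0)"
  by (rule L2_tendsto_diff[OF _ _ _ _ d lim(3)]) simp_all
 then have "sq_nn M (\<lambda>x. g x - g' x) = 0" unfolding L2_tendsto_def by (simp add: LIMSEQ_const_iff norm_minus_commute)
 then have "AE x in M. ennreal ((norm (g x - g' x))\<^sup>2) = 0" by (subst (asm) nn_integral_0_iff_AE) auto
 then show ?thesis by eventually_elim simp
qed

lemma L2_tendsto_scaleR_seq:
 fixes f :: "nat => 'a => 'b::euclidean_space"
 assumes [measurable]: "!!n. f n \<in> borel_measurable M" and g: "L2_on M g"
  and lim: "L2_tendsto M f g" and c: "c \<longlonglongrightarrow> 1" "!!n. \<bar>c n\<bar> \<le> (1::real)"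
 shows "L2_tendsto M (\<lambda>n x. c n *\<^sub>R f n x) g"
proof -
 have [measurable]: "g \<in> borel_measurable M" and gi: "integrable M (\<lambda>x. (norm (g x))\<^sup>2)" using g by (auto simp: L2_on_def)
 have sc: "sq_nn M (\<lambda>x. a *\<^sub>R F x) = ennreal (a\<^sup>2) * sq_nn M F" if "F \<in> borel_measurable M" for a and F :: "'a => 'b"
  using that by (simp add: power_mult_distrib ennreal_mult nn_integral_cmult)
 have z1: "(\<lambda>n. sq_nn M (\<lambda>x. c n *\<^sub>R (f n x - g x))) \<longlonglongrightarrow> 0"
 proof (rule tendsto_sandwich[OF _ _ tendsto_const lim[unfolded L2_tendsto_def]])
  have "ennreal ((c n)\<^sup>2) \<le> 1" for n using c(2)[of n] by (simp add: abs_square_le_1)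
  then have "ennreal ((c n)\<^sup>2) * S \<le> 1 * S" for n S by (rule mult_right_mono) simp
  then show "\<forall>\<^sub>F n in sequentially. sq_nn M (\<lambda>x. c n *\<^sub>R (f n x - g x)) \<le> sq_nn M (\<lambda>x. f n x - g x)"
   by (intro always_eventually allI) (simp add: sc del: norm_scaleR)
 qed simp
 have "sq_nn M g < top" using gi by (simp add: nn_integral_eq_integral)
 moreover have "(\<lambda>n. ennreal ((c n - 1)\<^sup>2)) \<longlonglongrightarrow> ennreal ((1 - 1)\<^sup>2)" by (intro tendsto_intros tendsto_ennrealI c)
 ultimately have "(\<lambda>n. sq_nn M g * ennreal ((c n - 1)\<^sup>2)) \<longlonglongrightarrow> sq_nn M g * ennreal ((1 - 1)\<^sup>2)" by (rule ennreal_tendsto_cmult)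
 then have z2: "(\<lambda>n. sq_nn M (\<lambda>x. (c n - 1) *\<^sub>R g x)) \<longlonglongrightarrow> 0" by (simp add: sc mult.commute del: norm_scaleR)
 have eq: "c n *\<^sub>R f n x - g x = c n *\<^sub>R (f n x - g x) + (c n - 1) *\<^sub>R g x" for n x by (simp add: algebra_simps)
 show ?thesis unfolding L2_tendsto_def eq by (intro sq_nn_tendsto_add z1 z2) simp_all
qed

lemma L2_tendsto_cong_AE:
 assumes "AE x in M. g x = g' x" shows "L2_tendsto M f g \<longleftrightarrow> L2_tendsto M f g'"
proof -
 have "sq_nn M (\<lambda>x. f n x - g x) = sq_nn M (\<lambda>x. f n x - g' x)" for n
  by (rule nn_integral_cong_AE) (use assms in \<open>eventually_elim, simp\<close>)
 then show ?thesis by (simp add: L2_tendsto_def)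
qed

section \<open>Cutoff functions of convex polyhedra\<close>

definition halfspaces :: "(real^3) set => (real^3 => real) => (real^3) set" where
 "halfspaces A b = {x. \<forall>a\<in>A. a \<bullet> x \<le> b a}"

definition open_halfspaces :: "(real^3) set => (real^3 => real) => (real^3) set" where
 "open_halfspaces A b = {x. \<forall>a\<in>A. a \<bullet> x < b a}"

text \<open>A product of one smooth step for each half space. Every step vanishes within distance
 \<open>1/n\<close> of its plane, so the cutoff is a test function of the open polyhedron and
 converges to its indicator function.\<close>

definition cutoff :: "(real^3) set => (real^3 => real) => nat => real^3 => real" where
 "cutoff A b n x = (\<Prod>a\<in>A. expinv 1 (real n * (b a - a \<bullet> x) - 1))"

lemma cutoff_factor_affine:
 "expinv p (real n * (b a - a \<bullet> x) - 1) = expinv p ((real n * b a - 1) - (real n *\<^sub>R a) \<bullet> x)"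
 by (simp add: algebra_simps)

lemma cutoff_smooth: "smooth (cutoff A b n)"
 unfolding cutoff_def[abs_def] cutoff_factor_affine by (intro smooth_prod smooth_expinv_affine)

lemma cutoff_bounds: "0 \<le> cutoff A b n x" "cutoff A b n x \<le> 1"
 unfolding cutoff_def by (auto intro!: prod_nonneg prod_le_1 simp: expinv_1_bounds)

lemma cutoff_nonzero:
 assumes "finite A" "cutoff A b n x \<noteq> 0" "a \<in> A" shows "n > 0" "a \<bullet> x + 1 / real n \<le> b a"
proof -
 have "expinv 1 (real n * (b a - a \<bullet> x) - 1) \<noteq> 0"
  using assms unfolding cutoff_def by auto
 then have p: "real n * (b a - a \<bullet> x) - 1 > 0" by (metis expinv_nonpos not_le)
 then show n: "n > 0" by (cases n) auto
 then show "a \<bullet> x + 1 / real n \<le> b a" using p by (simp add: field_simps)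
qed

lemma cutoff_outside: "finite A ==> x \<notin> open_halfspaces A b ==> cutoff A b n x = 0"
proof (rule ccontr)
 assume A: "finite A" and x: "x \<notin> open_halfspaces A b" and nz: "cutoff A b n x \<noteq> 0"
 from x obtain a where a: "a \<in> A" "\<not> a \<bullet> x < b a" by (auto simp: open_halfspaces_def)
 have "1 / real n > 0" using cutoff_nonzero(1)[OF A nz a(1)] by simp
 then show False using cutoff_nonzero(2)[OF A nz a(1)] a(2) by linarith
qed

lemma cutoff_tendsto:
 assumes "finite A" shows "(\<lambda>n. cutoff A b n x) \<longlonglongrightarrow> indicator (open_halfspaces A b) x"
proof (cases "x \<in> open_halfspaces A b")
 case True
 have "(\<lambda>n. expinv 1 (real n * (b a - a \<bullet> x) - 1)) \<longlonglongrightarrow> 1" if "a \<in> A" for a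
 proof (rule filterlim_compose[OF expinv_1_at_top])
  have "b a - a \<bullet> x > 0" using True that by (simp add: open_halfspaces_def)
  then have "filterlim (\<lambda>n. real n * (b a - a \<bullet> x)) at_top sequentially"
   by (intro filterlim_at_top_mult_tendsto_pos[OF tendsto_const] filterlim_real_sequentially) auto
  then show "filterlim (\<lambda>n. real n * (b a - a \<bullet> x) - 1) at_top sequentially"
   using filterlim_tendsto_add_at_top[OF tendsto_const[of "-1"]] by fastforce
 qed
 then have "(\<lambda>n. cutoff A b n x) \<longlonglongrightarrow> (\<Prod>a\<in>A. 1)"
  unfolding cutoff_def by (intro tendsto_prod) auto
 then show ?thesis using True by simp
qed (simp add: cutoff_outside assms)

lemma cutoff_test_fun:
 assumes A: "finite A" and b: "bounded (halfspaces A b)" and U: "open_halfspaces A b \<subseteq> U"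
 shows "test_fun U (cutoff A b n)"
proof -
 have ne: "A \<noteq> {}"
 proof
  assume "A = {}"
  then have "bounded (UNIV :: (real^3) set)" using b by (simp add: halfspaces_def)
  then show False using not_bounded_UNIV by blast
 qed
 define C where "C = {x. \<forall>a\<in>A. a \<bullet> x \<le> b a - 1 / real n} \<inter> {x. n > 0}"
 have "closed C"
 proof -
  have "C = (\<Inter>a\<in>A. {x. a \<bullet> x \<le> b a - 1 / real n}) \<inter> {x. n > 0}" by (auto simp: C_def)
  then show ?thesis by (auto intro!: closed_INT closed_halfspace_le closed_Int)
 qed
 moreover have "{x. cutoff A b n x \<noteq> 0} \<subseteq> C"
 proof
  fix x assume "x \<in> {x. cutoff A b n x \<noteq> 0}"
  then have nz: "cutoff A b n x \<noteq> 0" by simp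
  show "x \<in> C" using cutoff_nonzero[OF A nz] ne by (force simp: C_def)
 qed
 ultimately have cl: "closure {x. cutoff A b n x \<noteq> 0} \<subseteq> C" by (rule closure_minimal[rotated])
 have "C \<subseteq> open_halfspaces A b"
 proof
  fix x assume x: "x \<in> C"
  then have n: "1 / real n > 0" by (auto simp: C_def split: if_splits)
  have "a \<bullet> x < b a" if "a \<in> A" for a
  proof -
   have "a \<bullet> x \<le> b a - 1 / real n" using x that by (auto simp: C_def)
   then show ?thesis using n by linarith
  qed
  then show "x \<in> open_halfspaces A b" by (simp add: open_halfspaces_def)
 qed
 moreover have "open_halfspaces A b \<subseteq> halfspaces A b"
  by (auto simp: open_halfspaces_def halfspaces_def less_imp_le)
 moreover have "{x. cutoff A b n x \<noteq> 0} \<subseteq> closure {x. cutoff A b n x \<noteq> 0}" by (rule closure_subset)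
 ultimately have "closure {x. cutoff A b n x \<noteq> 0} \<subseteq> U" "{x. cutoff A b n x \<noteq> 0} \<subseteq> halfspaces A b"
  using cl U by (meson order_trans)+
 then show ?thesis unfolding test_fun_alt
  using cutoff_smooth bounded_subset[OF b] by blast
qed

lemma open_open_halfspaces: "finite A ==> open (open_halfspaces A b)"
proof -
 assume "finite A"
 moreover have "open_halfspaces A b = (\<Inter>a\<in>A. {x. a \<bullet> x < b a})" by (auto simp: open_halfspaces_def)
 ultimately show ?thesis by (auto intro!: open_INT open_halfspace_lt)
qed

lemma closed_halfspaces: "closed (halfspaces A b)"
proof -
 have "halfspaces A b = (\<Inter>a\<in>A. {x. a \<bullet> x \<le> b a})" by (auto simp: halfspaces_def)
 then show ?thesis by (auto intro!: closed_INT closed_halfspace_le)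
qed

lemma box_as_halfspaces:
 fixes l u :: "real^3"
 obtains A b where "finite A" "box l u = open_halfspaces A b" "bounded (halfspaces A b)"
proof
 let ?A = "Basis \<union> uminus ` Basis :: (real^3) set"
 let ?b = "\<lambda>a. if a \<in> Basis then u \<bullet> a else l \<bullet> a"
 have nb: "- e \<notin> Basis" if "e \<in> Basis" for e :: "real^3"
 proof
  assume "- e \<in> Basis"
  then have "(- e) \<bullet> e = (if - e = e then 1 else 0)" using that by (rule inner_Basis)
  then show False using that by (auto split: if_splits)
 qed
 show "finite ?A" by simp
 have "open_halfspaces ?A ?b = {x. (\<forall>e\<in>Basis. e \<bullet> x < u \<bullet> e) \<and> (\<forall>e\<in>Basis. - (e \<bullet> x) < - (l \<bullet> e))}"
  by (simp add: open_halfspaces_def ball_Un nb)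
 then show "box l u = open_halfspaces ?A ?b"
  by (auto simp: box_def inner_commute)
 have "halfspaces ?A ?b = {x. (\<forall>e\<in>Basis. e \<bullet> x \<le> u \<bullet> e) \<and> (\<forall>e\<in>Basis. - (e \<bullet> x) \<le> - (l \<bullet> e))}"
  by (simp add: halfspaces_def ball_Un nb)
 then have "halfspaces ?A ?b \<subseteq> cbox l u"
  by (auto simp: cbox_def inner_commute)
 then show "bounded (halfspaces ?A ?b)" using bounded_subset bounded_cbox by blast
qed

section \<open>The fundamental lemma of the calculus of variations\<close>

text \<open>Cutoffs of boxes inside \<open>U\<close> increase to indicator functions; boxes form a generator of the
 Borel sets that is stable under intersections.\<close>

lemma fundamental_lemma:
 fixes g :: "real^3 => real"
 assumes M[measurable_cong]: "sets M = sets borel" and U: "open U"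
  and g: "integrable M g"
  and z: "!!\<phi>::real^3 => real. test_fun U \<phi> ==> (LINT x|M. \<phi> x * g x) = 0"
 shows "AE x in M. x \<in> U --> g x = 0"
proof -
 have spM: "space M = UNIV" using M sets_eq_imp_space_eq by force
 have gm[measurable]: "g \<in> borel_measurable M" using g by simp
 have gm'[measurable]: "g \<in> borel_measurable borel" using gm M measurable_cong_sets by blast
 have box0: "(LINT x|M. indicator (box l u) x * g x) = 0" if lu: "box l u \<subseteq> U" for l u
 proof -
  obtain A b where A: "finite A" "box l u = open_halfspaces A b" "bounded (halfspaces A b)"
   by (rule box_as_halfspaces)
  have "(\<lambda>n. LINT x|M. cutoff A b n x * g x) \<longlonglongrightarrow> (LINT x|M. indicator (box l u) x * g x)"
  proof (rule integral_dominated_convergence[where w="\<lambda>x. \<bar>g x\<bar>"])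
   show "(\<lambda>x. cutoff A b n x * g x) \<in> borel_measurable M" for n
    using smooth_measurable[OF cutoff_smooth] by measurable
   show "AE x in M. (\<lambda>n. cutoff A b n x * g x) \<longlonglongrightarrow> indicator (box l u) x * g x"
    unfolding A(2) by (intro AE_I2 tendsto_mult cutoff_tendsto A tendsto_const)
   show "AE x in M. norm (cutoff A b n x * g x) \<le> \<bar>g x\<bar>" for n
    using cutoff_bounds[of A b n] by (auto intro!: AE_I2 mult_left_le_one_le simp: abs_mult)
  qed (use g in auto)
  moreover have "(LINT x|M. cutoff A b n x * g x) = 0" for n
   using cutoff_test_fun[OF A(1,3)] lu unfolding A(2) by (intro z) blast
  ultimately have "(\<lambda>n. 0) \<longlonglongrightarrow> (LINT x|M. indicator (box l u) x * g x)" by simp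
  from LIMSEQ_unique[OF this tendsto_const] show ?thesis .
 qed
 have AE_box: "AE x in M. x \<in> box l u --> g x = 0" if lu: "box l u \<subseteq> U" for l u
 proof -
  let ?B = "box l u"
  have int: "integrable M (\<lambda>x. indicator B x * g x)" if "B \<in> sets borel" for B
   using integrable_mult_indicator[OF _ g, of B] that M by simp
  have all: "(LINT x|M. indicator (?B \<inter> B) x * g x) = 0" if "B \<in> sets borel" for B
  proof -
   have "Int_stable (range (\<lambda>(a, b). box a b :: (real^3) set))"
    by (auto simp: Int_stable_def Int_interval box_Int_box)
   moreover have "range (\<lambda>(a, b). box a b :: (real^3) set) \<subseteq> Pow UNIV" by simp
   moreover have "B \<in> sigma_sets UNIV (range (\<lambda>(a, b). box a b))"
    using that unfolding borel_eq_box by simp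
   ultimately show ?thesis
   proof (induction rule: sigma_sets_induct_disjoint)
    case (basic X)
    then obtain a b where "X = box a b" by auto
    then have "\<exists>c d. ?B \<inter> X = box c d" by (auto simp: box_Int_box)
    then obtain c d where "?B \<inter> X = box c d" by blast
    then show ?case using box0[of c d] lu by auto
   next
    case (compl X)
    have X: "X \<in> sets borel" using compl unfolding borel_eq_box by simp
    have "(LINT x|M. indicator (?B \<inter> (UNIV - X)) x * g x) = (LINT x|M. indicator ?B x * g x - indicator (?B \<inter> X) x * g x)"
     by (intro lint_cong) (auto simp: indicator_def)
    also have "... = (LINT x|M. indicator ?B x * g x) - (LINT x|M. indicator (?B \<inter> X) x * g x)"
     using X by (intro Bochner_Integration.integral_diff int) auto
    finally show ?case using compl box0[OF lu] by simp
   next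
    case (union X)
    have X: "X i \<in> sets borel" for i using union unfolding borel_eq_box by auto
    have "(LINT x:(\<Union>i. ?B \<inter> X i)|M. g x) = (\<Sum>i. (LINT x:?B \<inter> X i|M. g x))"
    proof (rule lebesgue_integral_countable_add)
     show "?B \<inter> X i \<in> sets M" for i using X M by auto
     show "(?B \<inter> X i) \<inter> (?B \<inter> X j) = {}" if "i \<noteq> j" for i j
      using union(1) that by (auto simp: disjoint_family_on_def)
     show "set_integrable M (\<Union>i. ?B \<inter> X i) g"
      unfolding set_integrable_def using X int[of "\<Union>i. ?B \<inter> X i"] by simp
    qed
    also have "... = (\<Sum>i. 0)"
     using union by (simp add: set_lebesgue_integral_def)
    finally have "(LINT x:(\<Union>i. ?B \<inter> X i)|M. g x) = 0" by simp
    moreover have "?B \<inter> \<Union>(range X) = (\<Union>i. ?B \<inter> X i)" by (rule Int_UN_distrib)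
    ultimately show ?case unfolding set_lebesgue_integral_def real_scaleR_def by (simp only:)
   qed simp
  qed
  have sign: "AE x in M. x \<in> ?B --> s * g x \<le> 0" for s :: real
  proof -
   let ?B' = "{x. s * g x > 0}"
   have B': "?B' \<in> sets borel" by measurable
   have "(LINT x|M. indicator (?B \<inter> ?B') x * (s * g x)) = s * (LINT x|M. indicator (?B \<inter> ?B') x * g x)"
    by (simp add: mult.left_commute)
   also have "... = 0" using all[OF B'] by simp
   finally have "(LINT x|M. indicator (?B \<inter> ?B') x * (s * g x)) = 0" .
   moreover have "integrable M (\<lambda>x. indicator (?B \<inter> ?B') x * (s * g x))"
    using integrable_mult_right[OF int[of "?B \<inter> ?B'"], of s] B' by (simp add: mult.left_commute)
   ultimately have "AE x in M. indicator (?B \<inter> ?B') x * (s * g x) = 0"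
    by (subst (asm) integral_nonneg_eq_0_iff_AE) (auto simp: indicator_def)
   then show ?thesis by eventually_elim (auto simp: indicator_def split: if_splits)
  qed
  show ?thesis using sign[of 1] sign[of "-1"] by eventually_elim auto
 qed
 obtain \<D> where D: "countable \<D>" "\<D> \<subseteq> Pow U" "!!X. X \<in> \<D> ==> \<exists>a b. X = box a b" "\<Union>\<D> = U"
  by (rule open_countable_Union_open_box[OF U]) blast
 have "AE x in M. \<forall>X\<in>\<D>. x \<in> X --> g x = 0"
 proof (subst AE_ball_countable[OF D(1)], intro ballI)
  fix X assume "X \<in> \<D>"
  then obtain a b where "X = box a b" "box a b \<subseteq> U" using D by blast
  then show "AE x in M. x \<in> X --> g x = 0" using AE_box by blast
 qed
 then show ?thesis by eventually_elim (use D(4) in blast)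
qed

lemma lebesgue_on_integral_eq:
 fixes f :: "real^3 => 'b::euclidean_space"
 assumes "S \<in> sets lebesgue"
 shows "(LINT x|lebesgue_on S. f x) = (LINT x|lebesgue. indicator S x *\<^sub>R f x)"
  and "integrable (lebesgue_on S) f \<longleftrightarrow> integrable lebesgue (\<lambda>x. indicator S x *\<^sub>R f x)"
 using assms by (simp_all add: integral_restrict_space integrable_restrict_space)

lemma integral_lebesgue_on_lborel:
 fixes f :: "real^3 => 'b::euclidean_space"
 assumes S: "S \<in> sets lebesgue" and f: "f \<in> borel_measurable borel" and z: "!!x. x \<notin> S ==> f x = 0"
 shows "(LINT x|lebesgue_on S. f x) = (LINT x|lborel. f x)"
proof -
 have "(\<lambda>x. indicator S x *\<^sub>R f x) = f" using z by (auto simp: indicator_def)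
 then show ?thesis using lebesgue_on_integral_eq(1)[OF S, of f] integral_completion[of f lborel] f by simp
qed

text \<open>The Borel version applies to a Borel representative of the extension by zero.\<close>

lemma fundamental_lemma_lebesgue_on:
 fixes g :: "real^3 => real"
 assumes U: "open U" and g: "integrable (lebesgue_on U) g"
  and z: "!!\<phi>::real^3 => real. test_fun U \<phi> ==> (LINT x|lebesgue_on U. \<phi> x * g x) = 0"
 shows "AE x in lebesgue_on U. g x = 0"
proof -
 have Um: "U \<in> sets lebesgue" using U by simp
 let ?f = "\<lambda>x. indicator U x * g x"
 have f: "integrable lebesgue ?f" using g lebesgue_on_integral_eq(2)[OF Um, of g] by simp
 obtain f' where f': "f' \<in> borel_measurable lborel" "AE x in lborel. ?f x = f' x"
  using completion_ex_borel_measurable_real[OF borel_measurable_integrable[OF f]] by blast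
 have eq: "AE x in lebesgue. ?f x = f' x" using f'(2) by (rule AE_completion)
 have f'm: "f' \<in> borel_measurable lebesgue" using f'(1) by (rule measurable_completion)
 have "integrable lebesgue f'"
  using integrable_cong_AE[OF borel_measurable_integrable[OF f] f'm eq] f by blast
 then have f'i: "integrable lborel f'" using f'(1) by (simp add: integrable_completion)
 have "AE x in lborel. x \<in> U --> f' x = 0"
 proof (rule fundamental_lemma[OF _ U f'i])
  fix \<phi> :: "real^3 => real" assume phi: "test_fun U \<phi>"
  have pm: "\<phi> \<in> borel_measurable borel" using phi smooth_measurable by (auto simp: test_fun_def)
  then have pm': "\<phi> \<in> borel_measurable lebesgue" by (intro measurable_completion) simp
  have "(LINT x|lborel. \<phi> x * f' x) = (LINT x|lebesgue. \<phi> x * f' x)"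
   using pm f'(1) by (subst integral_completion) auto
  also have "... = (LINT x|lebesgue. indicator U x *\<^sub>R (\<phi> x * g x))"
  proof (rule integral_cong_AE)
   show "(\<lambda>x. \<phi> x * f' x) \<in> borel_measurable lebesgue" using pm' f'm by simp
   have "(\<lambda>x. indicator U x *\<^sub>R (\<phi> x * g x)) = (\<lambda>x. \<phi> x * ?f x)" by (auto simp: indicator_def)
   then show "(\<lambda>x. indicator U x *\<^sub>R (\<phi> x * g x)) \<in> borel_measurable lebesgue"
    using pm' borel_measurable_integrable[OF f] by simp
   show "AE x in lebesgue. \<phi> x * f' x = indicator U x *\<^sub>R (\<phi> x * g x)"
    using eq by eventually_elim (simp add: indicator_def split: if_splits)
  qed
  also have "... = (LINT x|lebesgue_on U. \<phi> x * g x)" by (rule lebesgue_on_integral_eq(1)[OF Um, symmetric])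
  finally show "(LINT x|lborel. \<phi> x * f' x) = 0" using z[OF phi] by simp
 qed simp
 then have "AE x in lebesgue. x \<in> U --> f' x = 0" by (rule AE_completion)
 with eq have "AE x in lebesgue. x \<in> U --> g x = 0" by eventually_elim auto
 then show ?thesis using Um by (simp add: AE_restrict_space_iff)
qed

lemma finite_measure_lebesgue_on:
 assumes "bounded (U :: (real^3) set)" "U \<in> sets lebesgue" shows "finite_measure (lebesgue_on U)"
proof (rule finite_measureI)
 have "emeasure lebesgue U < \<infinity>"
  using fmeasurableD2[OF bounded_set_imp_lmeasurable[OF assms]] by (simp add: less_top del: emeasure_completion)
 then show "emeasure (lebesgue_on U) (space (lebesgue_on U)) \<noteq> \<infinity>"
  using assms(2) by (simp add: emeasure_restrict_space space_restrict_space del: emeasure_completion)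
qed

lemma smooth_L2:
 fixes f :: "real^3 => 'b::euclidean_space"
 assumes U: "bounded U" "U \<in> sets lebesgue" and f: "smooth f"
 shows "L2 U f"
proof -
 have "compact (f ` closure U)"
  using U by (intro compact_continuous_image smooth_continuous f) (simp add: compact_closure)
 then have "\<exists>B. \<forall>y\<in>f ` closure U. norm y \<le> B" using compact_imp_bounded bounded_iff by metis
 then obtain B where B0: "\<forall>y\<in>f ` closure U. norm y \<le> B" by (rule exE)
 have B: "norm (f x) \<le> B" if "x \<in> U" for x
  using B0 subsetD[OF closure_subset that] by simp
 have m: "f \<in> borel_measurable (lebesgue_on U)"
  using smooth_measurable[OF f] by (rule borel_lebesgue_on)
 have "AE x in lebesgue_on U. norm (f x) \<le> B" by (rule AE_I2) (simp add: B)
 then show ?thesis unfolding L2_iff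
  by (rule finite_measure.bounded_L2_on[OF finite_measure_lebesgue_on[OF U] m])
qed

lemma fundamental_lemma_L2:
 fixes u u' :: "real^3 => real^3"
 assumes U: "open U" "bounded U" and u: "L2 U u" "L2 U u'"
  and z: "!!\<phi>::real^3 => real^3. test_fun U \<phi> ==>
   (LINT x|lebesgue_on U. u x \<bullet> \<phi> x) = (LINT x|lebesgue_on U. u' x \<bullet> \<phi> x)"
 shows "AE x in lebesgue_on U. u x = u' x"
proof -
 have Um: "U \<in> sets lebesgue" using U by simp
 interpret finite_measure "lebesgue_on U" by (rule finite_measure_lebesgue_on[OF U(2) Um])
 let ?d = "\<lambda>x. u x - u' x"
 have d: "L2_on (lebesgue_on U) ?d" using u unfolding L2_iff by (rule L2_on_diff)
 have "AE x in lebesgue_on U. ?d x $ i = 0" for i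
 proof (rule fundamental_lemma_lebesgue_on[OF U(1)])
  show "integrable (lebesgue_on U) (\<lambda>x. ?d x $ i)"
   by (rule L2_on_imp_integrable)
    (rule L2_on_bounded_linear[OF d bounded_linear_vec_nth])
  fix \<phi> :: "real^3 => real" assume phi: "test_fun U \<phi>"
  have t: "test_fun U (\<lambda>x. \<phi> x *\<^sub>R (axis i 1 :: real^3))" by (rule test_fun_scaleR[OF phi smooth_const])
  then have p: "L2_on (lebesgue_on U) (\<lambda>x. \<phi> x *\<^sub>R (axis i 1 :: real^3))"
   unfolding test_fun_def by (intro smooth_L2[OF U(2) Um, unfolded L2_iff]) (rule conjunct1)
  have "(LINT x|lebesgue_on U. \<phi> x * ?d x $ i) = (LINT x|lebesgue_on U. u x \<bullet> (\<phi> x *\<^sub>R axis i 1) - u' x \<bullet> (\<phi> x *\<^sub>R axis i 1))"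
   by (intro lint_cong refl) (simp add: inner_axis algebra_simps)
  also have "... = 0"
   using z[OF t] L2_on_inner[OF u(1)[unfolded L2_iff] p] L2_on_inner[OF u(2)[unfolded L2_iff] p]
   by simp
  finally show "(LINT x|lebesgue_on U. \<phi> x * ?d x $ i) = 0" .
 qed
 then have "AE x in lebesgue_on U. \<forall>i\<in>UNIV. ?d x $ i = 0"
  by (subst AE_ball_countable) auto
 then show ?thesis by eventually_elim (simp add: vec_eq_iff)
qed

lemma weak_curl_unique:
 assumes "open U" "bounded U" "has_weak_curl U v w" "has_weak_curl U v w'"
 shows "AE x in lebesgue_on U. w x = w' x"
 using assms by (intro fundamental_lemma_L2) (auto simp: has_weak_curl_def)

section \<open>Planes and adapted coordinates\<close>

lemma vec3_expand: "(v::real^3) = v $ 1 *\<^sub>R axis 1 1 + v $ 2 *\<^sub>R axis 2 1 + v $ 3 *\<^sub>R axis 3 1"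
 by (simp add: vec_eq_iff forall_3 axis_def)

definition frame_map :: "real^3 => real^3 => real^3 => real^3 => real^3" where
 "frame_map \<alpha> \<beta> n v = v $ 1 *\<^sub>R \<alpha> + v $ 2 *\<^sub>R \<beta> - v $ 3 *\<^sub>R n"

definition orthonormal3 :: "real^3 => real^3 => real^3 => bool" where
 "orthonormal3 \<alpha> \<beta> n \<longleftrightarrow> \<alpha> \<bullet> \<alpha> = 1 \<and> \<beta> \<bullet> \<beta> = 1 \<and> n \<bullet> n = 1 \<and> \<alpha> \<bullet> \<beta> = 0 \<and> n \<bullet> \<alpha> = 0 \<and> n \<bullet> \<beta> = 0"

lemma frame_map_orthogonal:
 assumes "orthonormal3 \<alpha> \<beta> n"
 shows "orthogonal_transformation (frame_map \<alpha> \<beta> n)"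
 unfolding orthogonal_transformation_def
proof (intro conjI allI)
 show "linear (frame_map \<alpha> \<beta> n)" by (rule linearI) (auto simp: frame_map_def algebra_simps)
 fix v w
 have o: "\<alpha> \<bullet> \<alpha> = 1" "\<beta> \<bullet> \<beta> = 1" "n \<bullet> n = 1" "\<alpha> \<bullet> \<beta> = 0" "\<beta> \<bullet> \<alpha> = 0" "n \<bullet> \<alpha> = 0" "n \<bullet> \<beta> = 0" "\<alpha> \<bullet> n = 0" "\<beta> \<bullet> n = 0"
  using assms by (simp_all add: orthonormal3_def inner_commute)
 show "frame_map \<alpha> \<beta> n v \<bullet> frame_map \<alpha> \<beta> n w = v \<bullet> w"
  unfolding frame_map_def inner_add_left inner_add_right inner_diff_left inner_diff_right
   inner_scaleR_left inner_scaleR_right o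
  by (simp add: inner_vec_def sum_3)
qed

lemma orthonormal3_expand:
 assumes "orthonormal3 \<alpha> \<beta> n"
 shows "v = (v \<bullet> \<alpha>) *\<^sub>R \<alpha> + (v \<bullet> \<beta>) *\<^sub>R \<beta> + (v \<bullet> n) *\<^sub>R n"
proof -
 obtain w where w: "v = frame_map \<alpha> \<beta> n w"
  using orthogonal_transformation_surj[OF frame_map_orthogonal[OF assms]] by (metis surjD)
 have o: "\<alpha> \<bullet> \<alpha> = 1" "\<beta> \<bullet> \<beta> = 1" "n \<bullet> n = 1" "\<alpha> \<bullet> \<beta> = 0" "\<beta> \<bullet> \<alpha> = 0" "n \<bullet> \<alpha> = 0" "n \<bullet> \<beta> = 0" "\<alpha> \<bullet> n = 0" "\<beta> \<bullet> n = 0"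
  using assms by (simp_all add: orthonormal3_def inner_commute)
 have "v \<bullet> \<alpha> = w $ 1" "v \<bullet> \<beta> = w $ 2" "v \<bullet> n = - w $ 3"
  unfolding w frame_map_def inner_add_left inner_diff_left inner_scaleR_left o by simp_all
 then show ?thesis using w by (simp add: frame_map_def)
qed

lemma hyperplane_frame_exists:
 fixes n :: "real^3"
 assumes "norm n = 1" shows "\<exists>p \<alpha> \<beta>. plane_frame {x. n \<bullet> x = c} p \<alpha> \<beta>"
proof -
 obtain f :: "real^3 => real^3" where f: "orthogonal_transformation f" "f (axis 3 1) = n"
  using orthogonal_transformation_exists_1[of "axis 3 1 :: real^3" n] assms by auto
 have lin: "linear f" and inn: "!!x y. f x \<bullet> f y = x \<bullet> y"
  using f by (auto simp: orthogonal_transformation_def)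
 let ?\<alpha> = "f (axis 1 1)" and ?\<beta> = "f (axis 2 1)" and ?p = "c *\<^sub>R n"
 have o: "?\<alpha> \<bullet> ?\<alpha> = 1" "?\<beta> \<bullet> ?\<beta> = 1" "n \<bullet> n = 1" "?\<alpha> \<bullet> ?\<beta> = 0" "n \<bullet> ?\<alpha> = 0" "n \<bullet> ?\<beta> = 0"
  unfolding f(2)[symmetric] inn by (simp_all add: inner_axis_axis)
 have "{x. n \<bullet> x = c} = range (\<lambda>(s, t). ?p + s *\<^sub>R ?\<alpha> + t *\<^sub>R ?\<beta>)"
 proof (intro set_eqI iffI)
  fix x assume x: "x \<in> {x. n \<bullet> x = c}"
  obtain y where y: "x = f y" using orthogonal_transformation_surj[OF f(1)] by (metis surjD)
  have "n \<bullet> x = axis 3 1 \<bullet> y" unfolding y f(2)[symmetric] inn ..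
  then have y3: "y $ 3 = c" using x by (simp add: inner_axis')
  have "f y = f (y $ 1 *\<^sub>R axis 1 1 + y $ 2 *\<^sub>R axis 2 1 + y $ 3 *\<^sub>R axis 3 1)"
   using vec3_expand[of y] by simp
  also have "... = ?p + (y $ 1) *\<^sub>R ?\<alpha> + (y $ 2) *\<^sub>R ?\<beta>"
   by (simp add: linear_add[OF lin] linear_cmul[OF lin] f(2) y3)
  finally have "x = (\<lambda>(s, t). ?p + s *\<^sub>R ?\<alpha> + t *\<^sub>R ?\<beta>) (y $ 1, y $ 2)" by (simp add: y)
  then show "x \<in> range (\<lambda>(s, t). ?p + s *\<^sub>R ?\<alpha> + t *\<^sub>R ?\<beta>)" by (rule range_eqI)
 next
  fix x assume "x \<in> range (\<lambda>(s, t). ?p + s *\<^sub>R ?\<alpha> + t *\<^sub>R ?\<beta>)"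
  then show "x \<in> {x. n \<bullet> x = c}" using o by (auto simp: inner_add_right)
 qed
 then have "plane_frame {x. n \<bullet> x = c} ?p ?\<alpha> ?\<beta>"
  unfolding plane_frame_def using o by (simp add: norm_eq_1)
 then show ?thesis by blast
qed

lemma plane_measure_hyperplane:
 fixes n :: "real^3"
 assumes n: "norm n = 1"
 obtains p \<alpha> \<beta> where "orthonormal3 \<alpha> \<beta> n" "n \<bullet> p = c"
  "{x. n \<bullet> x = c} = range (\<lambda>(s, t). p + s *\<^sub>R \<alpha> + t *\<^sub>R \<beta>)"
  "plane_measure {x. n \<bullet> x = c} = distr lborel borel (\<lambda>(s, t). p + s *\<^sub>R \<alpha> + t *\<^sub>R \<beta>)"
proof -
 let ?P = "\<lambda>(p, \<alpha>, \<beta>). plane_frame {x. n \<bullet> x = c} p \<alpha> \<beta>"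
 obtain p \<alpha> \<beta> where e: "(SOME z. ?P z) = (p, \<alpha>, \<beta>)" by (metis prod_cases3)
 have "?P (SOME z. ?P z)"
  by (rule someI_ex) (use hyperplane_frame_exists[OF n, of c] in auto)
 then have fr: "plane_frame {x. n \<bullet> x = c} p \<alpha> \<beta>" unfolding e by simp
 then have H: "{x. n \<bullet> x = c} = range (\<lambda>(s, t). p + s *\<^sub>R \<alpha> + t *\<^sub>R \<beta>)" by (simp add: plane_frame_def)
 have mem: "n \<bullet> (p + s *\<^sub>R \<alpha> + t *\<^sub>R \<beta>) = c" for s t
 proof -
  have "p + s *\<^sub>R \<alpha> + t *\<^sub>R \<beta> \<in> range (\<lambda>(s, t). p + s *\<^sub>R \<alpha> + t *\<^sub>R \<beta>)"
   by (rule range_eqI[of _ _ "(s, t)"]) simp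
  then show ?thesis unfolding H[symmetric] by simp
 qed
 have np: "n \<bullet> p = c" using mem[of 0 0] by simp
 moreover have "n \<bullet> \<alpha> = 0" "n \<bullet> \<beta> = 0" using mem[of 1 0] mem[of 0 1] np by (simp_all add: inner_add_right)
 ultimately have "orthonormal3 \<alpha> \<beta> n"
  using fr n by (simp add: orthonormal3_def plane_frame_def norm_eq_1)
 moreover have "plane_measure {x. n \<bullet> x = c} = distr lborel borel (\<lambda>(s, t). p + s *\<^sub>R \<alpha> + t *\<^sub>R \<beta>)"
  unfolding plane_measure_def e by simp
 ultimately show ?thesis using that np H by blast
qed

lemma sets_plane_measure [measurable_cong, simp]: "sets (plane_measure A) = sets borel"
 unfolding plane_measure_def by (simp split: prod.split)

lemma space_plane_measure [simp]: "space (plane_measure A) = UNIV"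
 unfolding plane_measure_def by (simp split: prod.split)

lemma AE_plane_on:
 fixes n :: "real^3"
 assumes n: "norm n = 1" shows "AE x in plane_measure {x. n \<bullet> x = c}. n \<bullet> x = c"
proof -
 obtain p \<alpha> \<beta> where H: "{x. n \<bullet> x = c} = range (\<lambda>(s, t). p + s *\<^sub>R \<alpha> + t *\<^sub>R \<beta>)"
  and pm: "plane_measure {x. n \<bullet> x = c} = distr lborel borel (\<lambda>(s, t). p + s *\<^sub>R \<alpha> + t *\<^sub>R \<beta>)"
  by (rule plane_measure_hyperplane[OF n, of c]) blast
 have "n \<bullet> (case z of (s, t) => p + s *\<^sub>R \<alpha> + t *\<^sub>R \<beta>) = c" for z
 proof -
  have "(case z of (s, t) => p + s *\<^sub>R \<alpha> + t *\<^sub>R \<beta>) \<in> {x. n \<bullet> x = c}" unfolding H by (rule rangeI)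
  then show ?thesis by simp
 qed
 moreover have "(\<lambda>(s, t). p + s *\<^sub>R \<alpha> + t *\<^sub>R \<beta>) \<in> borel_measurable (lborel :: (real \<times> real) measure)"
  unfolding split_def by (simp, intro borel_measurable_continuous_onI continuous_intros)
 ultimately show ?thesis unfolding pm by (subst AE_distr_iff) auto
qed

lemma lborel_distr_orthogonal:
 fixes Q :: "real^3 => real^3"
 assumes Q: "orthogonal_transformation Q"
 shows "distr lborel borel Q = lborel"
proof (rule lborel_eqI[symmetric])
 have lin: "linear Q" using Q by (simp add: orthogonal_transformation_def)
 have m[measurable]: "Q \<in> borel_measurable borel"
  by (intro borel_measurable_continuous_onI linear_continuous_on)
   (simp add: lin linear_conv_bounded_linear[symmetric])
 have bij: "bij Q" by (rule orthogonal_transformation_bij[OF Q])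
 have Q': "orthogonal_transformation (inv Q)" by (rule orthogonal_transformation_inv[OF Q])
 fix l u :: "real^3" assume lu: "!!b. b \<in> Basis ==> l \<bullet> b \<le> u \<bullet> b"
 have box: "box l u \<in> lmeasurable" by simp
 have im: "inv Q ` box l u \<in> lmeasurable" by (rule measurable_orthogonal_image[OF Q' box])
 have ve: "Q -` box l u = inv Q ` box l u" by (rule bij_vimage_eq_inv_image[OF bij])
 have bm: "Q -` box l u \<in> sets borel" using measurable_sets[OF m, of "box l u"] by simp
 have "emeasure (distr lborel borel Q) (box l u) = emeasure lborel (Q -` box l u)"
  by (subst emeasure_distr) auto
 also have "... = emeasure lebesgue (inv Q ` box l u)" using bm unfolding ve by simp
 also have "... = ennreal (measure lebesgue (inv Q ` box l u))"
  using fmeasurableD2[OF im] by (rule emeasure_eq_ennreal_measure)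
 also have "... = ennreal (measure lebesgue (box l u))" by (simp only: measure_orthogonal_image[OF Q' box])
 also have "... = emeasure lebesgue (box l u)"
  using fmeasurableD2[OF box] by (rule emeasure_eq_ennreal_measure[symmetric])
 also have "... = emeasure lborel (box l u)" by simp
 also have "... = (\<Prod>b\<in>Basis. (u - l) \<bullet> b)" by (rule emeasure_lborel_box[OF lu])
 finally show "emeasure (distr lborel borel Q) (box l u) = (\<Prod>b\<in>Basis. (u - l) \<bullet> b)" .
qed simp

definition vec_of3 :: "(real \<times> real) \<times> real => real^3" where
 "vec_of3 z = fst (fst z) *\<^sub>R axis 1 1 + snd (fst z) *\<^sub>R axis 2 1 + snd z *\<^sub>R axis 3 1"

lemma prod_Basis_vec3: "(\<Prod>b\<in>Basis. (v :: real^3) \<bullet> b) = v $ 1 * v $ 2 * v $ 3"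
proof -
 have B: "(Basis :: (real^3) set) = range (\<lambda>i. axis i 1)" by (auto simp: Basis_vec_def)
 have "inj (\<lambda>i. axis i (1::real) :: real^3)" by (auto simp: inj_def axis_eq_axis)
 then have "(\<Prod>b\<in>Basis. v \<bullet> b) = (\<Prod>i\<in>UNIV. v \<bullet> axis i 1)"
  unfolding B by (subst prod.reindex) auto
 also have "... = v $ 1 * v $ 2 * v $ 3" unfolding UNIV_3 by (simp add: inner_axis mult.assoc)
 finally show ?thesis .
qed

text \<open>Lebesgue measure on \<open>real^3\<close> as a product measure, the bridge to Fubini's theorem.\<close>

lemma lborel_distr_vec_of3: "distr lborel borel vec_of3 = (lborel :: (real^3) measure)"
proof (rule lborel_eqI[symmetric])
 have m[measurable]: "vec_of3 \<in> borel_measurable borel"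
  unfolding vec_of3_def by (intro borel_measurable_continuous_onI continuous_intros)
 fix l u :: "real^3" assume "!!b. b \<in> Basis ==> l \<bullet> b \<le> u \<bullet> b"
 then have lu: "l $ i \<le> u $ i" for i by (metis axis_in_Basis_iff inner_axis mult.right_neutral inner_real_def Basis_real_def insertI1 real_inner_1_right)
 have "vec_of3 -` box l u = ({l $ 1 <..< u $ 1} \<times> {l $ 2 <..< u $ 2}) \<times> {l $ 3 <..< u $ 3}"
  by (auto simp: vec_of3_def mem_box_cart forall_3 axis_def)
 then have "emeasure (distr lborel borel vec_of3) (box l u)
   = emeasure lborel (({l $ 1 <..< u $ 1} \<times> {l $ 2 <..< u $ 2}) \<times> {l $ 3 <..< u $ 3})"
  by (subst emeasure_distr) auto
 also have "... = emeasure lborel {l $ 1 <..< u $ 1} * emeasure lborel {l $ 2 <..< u $ 2} * emeasure lborel {l $ 3 <..< u $ 3}"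
  by (simp add: lborel_prod[symmetric] lborel.emeasure_pair_measure_Times)
 also have "... = (\<Prod>b\<in>Basis. (u - l) \<bullet> b)"
  using lu by (simp add: prod_Basis_vec3 ennreal_mult)
 finally show "emeasure (distr lborel borel vec_of3) (box l u) = (\<Prod>b\<in>Basis. (u - l) \<bullet> b)" .
qed simp

text \<open>Coordinates with origin \<open>p\<close>, axes \<open>\<alpha>\<close>, \<open>\<beta>\<close> in the plane and the depth below the plane.\<close>

definition frame_coords :: "real^3 => real^3 => real^3 => real^3 => (real \<times> real) \<times> real => real^3" where
 "frame_coords p \<alpha> \<beta> n z = p + fst (fst z) *\<^sub>R \<alpha> + snd (fst z) *\<^sub>R \<beta> - snd z *\<^sub>R n"

lemma frame_coords_measurable [measurable]: "frame_coords p \<alpha> \<beta> n \<in> borel_measurable borel"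
 unfolding frame_coords_def by (intro borel_measurable_continuous_onI continuous_intros)

lemma lborel_distr_frame_coords:
 assumes "orthonormal3 \<alpha> \<beta> n"
 shows "distr lborel borel (frame_coords p \<alpha> \<beta> n) = lborel"
proof -
 have Q: "orthogonal_transformation (frame_map \<alpha> \<beta> n)" by (rule frame_map_orthogonal[OF assms])
 have [measurable]: "frame_map \<alpha> \<beta> n \<in> borel_measurable borel"
  unfolding frame_map_def by (intro borel_measurable_continuous_onI continuous_intros)
 have [measurable]: "vec_of3 \<in> borel_measurable borel"
  unfolding vec_of3_def by (intro borel_measurable_continuous_onI continuous_intros)
 have eq: "frame_coords p \<alpha> \<beta> n = (\<lambda>x. p + x) \<circ> frame_map \<alpha> \<beta> n \<circ> vec_of3"
  by (auto simp: frame_coords_def frame_map_def vec_of3_def axis_def)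
 have "distr lborel borel (frame_coords p \<alpha> \<beta> n) = distr (distr (distr lborel borel vec_of3) borel (frame_map \<alpha> \<beta> n)) borel (\<lambda>x. p + x)"
  unfolding eq by (simp add: distr_distr comp_assoc)
 then show ?thesis by (simp only: lborel_distr_vec_of3 lborel_distr_orthogonal[OF Q] lborel_distr_plus)
qed

text \<open>Fubini's theorem in coordinates adapted to a plane, with the depth below the plane rescaled by
 \<open>k\<close>; the shift by one matches the argument of the smooth step in the cutoff.\<close>

lemma integral_slab_coords:
 fixes F :: "real^3 => real"
 assumes o: "orthonormal3 \<alpha> \<beta> n" and k: "k > 0" and F: "integrable lborel F"
  and S: "integrable lborel (\<lambda>z. F (frame_coords p \<alpha> \<beta> n (fst z, (snd z + 1) / k)))"
 shows "(LINT x|lborel. F x) = (LINT z|lborel. F (frame_coords p \<alpha> \<beta> n (fst z, (snd z + 1) / k))) / k"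
proof -
 let ?G = "\<lambda>z. F (frame_coords p \<alpha> \<beta> n z)"
 have Fm[measurable]: "F \<in> borel_measurable borel" using F borel_measurable_integrable by fastforce
 have iG: "integrable lborel ?G"
  using F lborel_distr_frame_coords[OF o, of p] integrable_distr_eq[of "frame_coords p \<alpha> \<beta> n" lborel borel F] by simp
 have "(LINT x|lborel. F x) = (LINT x|distr lborel borel (frame_coords p \<alpha> \<beta> n). F x)"
  by (simp only: lborel_distr_frame_coords[OF o])
 also have "... = (LINT z|lborel. ?G z)" by (rule integral_distr) measurable
 also have "... = (LINT y|lborel. LINT r|lborel. ?G (y, r))"
  using lborel_pair.integral_fst'[of ?G] iG by (simp add: lborel_prod)
 also have "... = (LINT y|lborel. (LINT r|lborel. ?G (y, (r + 1) / k)) / k)"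
 proof (rule lint_cong[OF refl])
  fix y
  have "(LINT r|lborel. ?G (y, r)) = \<bar>1 / k\<bar> *\<^sub>R (LINT r|lborel. ?G (y, 1 / k + (1 / k) * r))"
   by (rule lborel_integral_real_affine) (use k in simp)
  then show "(LINT r|lborel. ?G (y, r)) = (LINT r|lborel. ?G (y, (r + 1) / k)) / k"
   using k by (simp add: add_divide_distrib add.commute)
 qed
 also have "... = (LINT y|lborel. LINT r|lborel. ?G (y, (r + 1) / k)) / k" by simp
 also have "... = (LINT z|lborel. ?G (fst z, (snd z + 1) / k)) / k"
  using lborel_pair.integral_fst'[of "\<lambda>z. ?G (fst z, (snd z + 1) / k)"] S by (simp add: lborel_prod)
 finally show ?thesis .
qed

section \<open>The divergence theorem on convex polyhedra\<close>

abbreviation expinv' :: "real => real" where "expinv' \<equiv> expinv (expinv_deriv 1)"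

lemma expinv'_eq: "expinv' t = (if t > 0 then (1/t)^2 * exp (- (1/t)) else 0)"
 by (simp add: expinv_def expinv_deriv_def power2_eq_square)

lemma expinv'_nonneg: "expinv' t \<ge> 0" by (simp add: expinv'_eq)

lemma expinv_continuous: "continuous_on S (expinv p)"
 by (meson DERIV_isCont continuous_at_imp_continuous_on expinv_has_derivative)

lemma expinv_measurable [measurable]: "expinv p \<in> borel_measurable borel"
 by (intro borel_measurable_continuous_onI expinv_continuous)

text \<open>The derivative of the smooth step is a probability density; this normalises the surface measure
 that appears in the limit.\<close>

lemma nn_integral_expinv': "(\<integral>\<^sup>+t. ennreal (expinv' t) \<partial>lborel) = 1"
proof -
 have "(\<integral>\<^sup>+t. ennreal (expinv' t) * indicator {0..} t \<partial>lborel) = ennreal (1 - expinv 1 0)"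
  by (rule nn_integral_FTC_atLeast[OF _ expinv_has_derivative _ expinv_1_at_top])
   (auto simp: expinv'_nonneg)
 moreover have "(\<integral>\<^sup>+t. ennreal (expinv' t) \<partial>lborel) = (\<integral>\<^sup>+t. ennreal (expinv' t) * indicator {0..} t \<partial>lborel)"
  by (intro nn_integral_cong) (auto simp: indicator_def expinv'_eq)
 ultimately show ?thesis by (simp add: expinv_def)
qed

lemma integral_expinv': "integrable lborel expinv'" "(LINT t|lborel. expinv' t) = 1"
proof -
 show "integrable lborel expinv'"
  by (rule integrableI_nonneg) (auto simp: expinv'_nonneg nn_integral_expinv')
 show "(LINT t|lborel. expinv' t) = 1"
  by (subst integral_eq_nn_integral) (auto simp: expinv'_nonneg nn_integral_expinv')
qed

text \<open>The contribution of the face with normal \<open>a\<close> to the gradient of the cutoff.\<close>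

definition slab_weight :: "(real^3) set => (real^3 => real) => real^3 => nat => real^3 => real" where
 "slab_weight A b a k x = real (Suc k) * expinv' (real (Suc k) * (b a - a \<bullet> x) - 1) *
   (\<Prod>a'\<in>A - {a}. expinv 1 (real (Suc k) * (b a' - a' \<bullet> x) - 1))"

lemma partial_cutoff:
 assumes "finite A"
 shows "partial i (cutoff A b (Suc k)) x = - (\<Sum>a\<in>A. a $ i * slab_weight A b a k x)"
proof -
 let ?c = "\<lambda>a x. expinv 1 (real (Suc k) * (b a - a \<bullet> x) - 1)"
 have d: "(?c a has_derivative (\<lambda>v. - ((real (Suc k) *\<^sub>R a) \<bullet> v) * expinv' (real (Suc k) * (b a - a \<bullet> x) - 1))) (at x)" for a
  unfolding cutoff_factor_affine by (rule expinv_compose_affine)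
 have "(cutoff A b (Suc k) has_derivative (\<lambda>v. \<Sum>a\<in>A. (- ((real (Suc k) *\<^sub>R a) \<bullet> v) * expinv' (real (Suc k) * (b a - a \<bullet> x) - 1)) *
   (\<Prod>a'\<in>A-{a}. ?c a' x))) (at x)"
  unfolding cutoff_def[abs_def] by (rule has_derivative_prod) (rule d)
 from partial_eqI[OF this, of i] show ?thesis
  by (simp add: inner_axis slab_weight_def sum_negf[symmetric] mult_ac del: of_nat_Suc)
qed

lemma slab_weight_nonzero:
 assumes A: "finite A" "a \<in> A" and nz: "slab_weight A b a k x \<noteq> 0"
 shows "x \<in> open_halfspaces A b"
proof -
 have "a' \<bullet> x < b a'" if "a' \<in> A" for a'
 proof -
  have "real (Suc k) * (b a' - a' \<bullet> x) - 1 > 0"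
  proof (cases "a' = a")
   case True
   then have "expinv' (real (Suc k) * (b a' - a' \<bullet> x) - 1) \<noteq> 0" using nz by (auto simp: slab_weight_def)
   then show ?thesis by (metis expinv_nonpos not_le)
  next
   case False
   then have "expinv 1 (real (Suc k) * (b a' - a' \<bullet> x) - 1) \<noteq> 0"
    using nz that A by (auto simp: slab_weight_def)
   then show ?thesis by (metis expinv_nonpos not_le)
  qed
  then have "real (Suc k) * (b a' - a' \<bullet> x) > 0" by linarith
  then show ?thesis by (simp add: zero_less_mult_iff del: of_nat_Suc)
 qed
 then show ?thesis by (simp add: open_halfspaces_def)
qed

lemma slab_weight_smooth: "smooth (slab_weight A b a k)"
 unfolding slab_weight_def[abs_def] cutoff_factor_affine
 by (intro smooth_mult smooth_const smooth_prod smooth_expinv_affine)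

lemma open_halfspaces_subset: "open_halfspaces A b \<subseteq> halfspaces A b"
 by (auto simp: open_halfspaces_def halfspaces_def less_imp_le)

lemma halfspaces_borel [measurable]: "halfspaces A b \<in> sets borel"
 using closed_halfspaces by (rule borel_closed)

lemma unit_parallel_cases:
 assumes "orthonormal3 \<alpha> \<beta> n" "norm v = 1" "v \<bullet> \<alpha> = 0" "v \<bullet> \<beta> = 0"
 shows "v = n \<or> v = - n"
proof -
 have v: "v = (v \<bullet> n) *\<^sub>R n" using orthonormal3_expand[OF assms(1), of v] assms(3,4) by simp
 have "norm n = 1" using assms(1) by (simp add: orthonormal3_def norm_eq_1)
 then have "\<bar>v \<bullet> n\<bar> = 1" using arg_cong[OF v, of norm] assms(2) by simp
 then have "v \<bullet> n = 1 \<or> v \<bullet> n = -1" by linarith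
 then show ?thesis using v by (metis scaleR_minus1_left scaleR_one)
qed

text \<open>The derivative of the cutoff in direction \<open>a\<close> concentrates on the face with normal \<open>a\<close>: after
 rescaling the depth below the plane of that face by \<open>k + 1\<close>, the profile \<open>expinv'\<close> of total
 mass one separates and the remaining factors converge to the indicator of the face.\<close>

lemma slab_weight_limit:
 assumes A: "finite A" "!!a. a \<in> A ==> norm a = 1" and bd: "bounded (halfspaces A b)"
  and ne: "open_halfspaces A b \<noteq> {}" and f: "smooth f" and a: "a \<in> A"
 shows "(\<lambda>k. LINT x|lborel. f x * slab_weight A b a k x)
  \<longlonglongrightarrow> (LINT x|plane_measure {x. a \<bullet> x = b a}. indicator (halfspaces A b) x * f x)"
proof -
 obtain p \<alpha> \<beta> where o: "orthonormal3 \<alpha> \<beta> a" and p: "a \<bullet> p = b a"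
  and pm: "plane_measure {x. a \<bullet> x = b a} = distr lborel borel (\<lambda>(s, t). p + s *\<^sub>R \<alpha> + t *\<^sub>R \<beta>)"
  by (rule plane_measure_hyperplane[OF A(2)[OF a], of "b a"]) blast
 have oo: "\<alpha> \<bullet> \<alpha> = 1" "\<beta> \<bullet> \<beta> = 1" "a \<bullet> a = 1" "\<alpha> \<bullet> \<beta> = 0" "\<beta> \<bullet> \<alpha> = 0" "a \<bullet> \<alpha> = 0" "a \<bullet> \<beta> = 0" "\<alpha> \<bullet> a = 0" "\<beta> \<bullet> a = 0"
  using o by (simp_all add: orthonormal3_def inner_commute)
 define X where "X k z = frame_coords p \<alpha> \<beta> a (fst z, (snd z + 1) / real (Suc k))" for k z
 define Y where "Y y = p + fst y *\<^sub>R \<alpha> + snd y *\<^sub>R \<beta>" for y :: "real \<times> real"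
 have XY: "X k z = Y (fst z) - ((snd z + 1) / real (Suc k)) *\<^sub>R a" for k z
  by (simp add: X_def Y_def frame_coords_def)
 have aY: "a \<bullet> Y y = b a" for y by (simp add: Y_def inner_add_right oo p)
 have aX: "real (Suc k) * (b a - a \<bullet> X k z) - 1 = snd z" for k z
  unfolding XY by (simp add: inner_diff_right aY oo del: of_nat_Suc)
 define Q where "Q k z = (\<Prod>a'\<in>A - {a}. expinv 1 (real (Suc k) * (b a' - a' \<bullet> X k z) - 1))" for k z
 define W where "W k z = f (X k z) * expinv' (snd z) * Q k z" for k z
 have W: "f (X k z) * slab_weight A b a k (X k z) = real (Suc k) * W k z" for k z
  by (simp add: slab_weight_def W_def Q_def aX del: of_nat_Suc)
 obtain M where M: "halfspaces A b \<subseteq> cball 0 M" using bounded_subset_ballD[OF bd, of 0] ball_subset_cball by (meson order_trans)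
 have "compact (f ` cball 0 M)" by (intro compact_continuous_image smooth_continuous f) simp
 then obtain C where C: "!!x. x \<in> cball 0 M ==> \<bar>f x\<bar> \<le> C"
  using compact_imp_bounded bounded_iff by (metis imageI real_norm_def)
 define R where "R = M + norm p"
 define w where "w z = \<bar>C\<bar> * indicator (cbox (-R, -R) (R, R)) (fst z) * expinv' (snd z)" for z :: "(real \<times> real) \<times> real"
 have Wbound: "\<bar>W k z\<bar> \<le> w z" for k z
 proof (cases "W k z = 0")
  case True then show ?thesis by (simp add: w_def expinv'_nonneg)
 next
  case False
  then have "slab_weight A b a k (X k z) \<noteq> 0" using W[of k z] by auto
  then have "X k z \<in> halfspaces A b" using slab_weight_nonzero[OF A(1) a] open_halfspaces_subset by blast
  then have XM: "X k z \<in> cball 0 M" using M by blast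
  have le: "\<bar>(X k z - p) \<bullet> v\<bar> \<le> R" if "v \<bullet> v = 1" for v
  proof -
   have "norm v = 1" using that by (simp add: norm_eq_1)
   then have "\<bar>(X k z - p) \<bullet> v\<bar> \<le> norm (X k z - p)" using Cauchy_Schwarz_ineq2[of "X k z - p" v] by simp
   also have "... \<le> norm (X k z) + norm p" by (rule norm_triangle_ineq4)
   also have "... \<le> R" using XM by (simp add: R_def)
   finally show ?thesis .
  qed
  have "(X k z - p) \<bullet> \<alpha> = fst (fst z)" "(X k z - p) \<bullet> \<beta> = snd (fst z)"
   unfolding XY Y_def by (simp_all add: inner_diff_left inner_add_left oo)
  then have "fst z \<in> cbox (-R, -R) (R, R)"
   using le[of \<alpha>] le[of \<beta>] oo by (cases "fst z") (auto simp: cbox_Pair_eq abs_le_iff)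
  then have wz: "w z = \<bar>C\<bar> * expinv' (snd z)" by (simp add: w_def)
  have pr: "0 \<le> Q k z" "Q k z \<le> 1"
   unfolding Q_def by (auto intro!: prod_nonneg prod_le_1 simp: expinv_1_bounds simp del: of_nat_Suc)
  have "\<bar>W k z\<bar> = (\<bar>f (X k z)\<bar> * expinv' (snd z)) * Q k z"
   using pr(1) expinv'_nonneg[of "snd z"] by (simp add: W_def abs_mult del: of_nat_Suc)
  also have "... \<le> (\<bar>f (X k z)\<bar> * expinv' (snd z)) * 1"
   using pr(2) expinv'_nonneg[of "snd z"] by (intro mult_left_mono) auto
  also have "... \<le> \<bar>C\<bar> * expinv' (snd z)"
   using C[OF XM] expinv'_nonneg[of "snd z"] by (auto intro!: mult_right_mono)
  finally show ?thesis by (simp add: wz)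
 qed
 have w_int: "integrable lborel w"
 proof (rule integrableI_nonneg)
  show "w \<in> borel_measurable lborel"
  proof -
   have "w \<in> borel_measurable (lborel \<Otimes>\<^sub>M lborel)" unfolding w_def by measurable
   then show ?thesis by (simp only: lborel_prod)
  qed
  show "AE z in lborel. 0 \<le> w z" by (simp add: w_def expinv'_nonneg)
  have "(\<integral>\<^sup>+z. ennreal (w z) \<partial>lborel) = (\<integral>\<^sup>+y. \<integral>\<^sup>+r. ennreal (w (y, r)) \<partial>lborel \<partial>lborel)"
  proof -
   have "w \<in> borel_measurable (lborel \<Otimes>\<^sub>M lborel)" unfolding w_def by measurable
   then show ?thesis by (subst lborel.nn_integral_fst) (auto simp: lborel_prod)
  qed
  also have "... = (\<integral>\<^sup>+y. ennreal \<bar>C\<bar> * indicator (cbox (-R, -R) (R, R)) (y :: real \<times> real) \<partial>lborel)"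
  proof (rule nn_integral_cong)
   fix y :: "real \<times> real"
   have "(\<integral>\<^sup>+r. ennreal (w (y, r)) \<partial>lborel) = (\<integral>\<^sup>+r. (ennreal \<bar>C\<bar> * indicator (cbox (-R, -R) (R, R)) y) * ennreal (expinv' r) \<partial>lborel)"
    by (intro nn_integral_cong) (auto simp: w_def indicator_def ennreal_mult expinv'_nonneg)
   also have "... = (ennreal \<bar>C\<bar> * indicator (cbox (-R, -R) (R, R)) y) * 1"
    by (subst nn_integral_cmult) (auto simp: nn_integral_expinv')
   finally show "(\<integral>\<^sup>+r. ennreal (w (y, r)) \<partial>lborel) = ennreal \<bar>C\<bar> * indicator (cbox (-R, -R) (R, R)) y" by simp
  qed
  also have "... = ennreal \<bar>C\<bar> * emeasure lborel (cbox (-R, -R) (R, R) :: (real \<times> real) set)"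
   by (subst nn_integral_cmult_indicator) auto
  also have "... < \<infinity>" using emeasure_bounded_finite[OF bounded_cbox[of "(-R,-R)" "(R,R)"]] by (simp add: ennreal_mult_less_top)
  finally show "(\<integral>\<^sup>+z. ennreal (w z) \<partial>lborel) < \<infinity>" .
 qed
 have fm[measurable]: "f \<in> borel_measurable borel" by (rule smooth_measurable[OF f])
 have Ym[measurable]: "Y \<in> borel_measurable borel"
  unfolding Y_def by (intro borel_measurable_continuous_onI continuous_intros)
 have Xm[measurable]: "X k \<in> borel_measurable borel" for k
  unfolding XY Y_def by (intro borel_measurable_continuous_onI continuous_intros) auto
 have sm[measurable]: "(snd :: (real \<times> real) \<times> real => real) \<in> borel_measurable borel"
  "(fst :: (real \<times> real) \<times> real => real \<times> real) \<in> borel_measurable borel"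
  by (intro borel_measurable_continuous_onI continuous_intros)+
 have Wm[measurable]: "W k \<in> borel_measurable borel" for k
  unfolding W_def Q_def by measurable
 have W_int: "integrable lborel (W k)" for k
  by (rule Bochner_Integration.integrable_bound[OF w_int]) (use Wbound[of k] in \<open>auto intro!: AE_I2 intro: order_trans[OF _ abs_ge_self]\<close>)
 have step1: "(LINT x|lborel. f x * slab_weight A b a k x) = (LINT z|lborel. W k z)" for k
 proof -
  have i: "integrable lborel (\<lambda>x. f x * slab_weight A b a k x)"
  proof (rule smooth_integrable)
   show "smooth (\<lambda>x. f x * slab_weight A b a k x)" by (intro smooth_mult f slab_weight_smooth)
   have "{x. f x * slab_weight A b a k x \<noteq> 0} \<subseteq> halfspaces A b"
    using slab_weight_nonzero[OF A(1) a, of b k] open_halfspaces_subset[of A b] by auto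
   then show "bounded {x. f x * slab_weight A b a k x \<noteq> 0}" by (rule bounded_subset[OF bd])
  qed
  have "(LINT x|lborel. f x * slab_weight A b a k x) = (LINT z|lborel. real (Suc k) * W k z) / real (Suc k)"
   using integral_slab_coords[OF o _ i, of "real (Suc k)" p] W_int[of k]
   by (simp add: X_def[symmetric] W del: of_nat_Suc)
  then show ?thesis by (simp del: of_nat_Suc)
 qed
 define L where "L z = indicator (halfspaces A b) (Y (fst z)) * f (Y (fst z)) * expinv' (snd z)" for z
 have Lm: "L \<in> borel_measurable borel" unfolding L_def by measurable
 have AEne: "AE z in (lborel :: ((real \<times> real) \<times> real) measure). \<forall>a'\<in>A - {a}. a' \<bullet> Y (fst z) \<noteq> b a'"
 proof (subst AE_ball_countable)
  show "countable (A - {a})" using A(1) by (simp add: countable_finite)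
  show "\<forall>a'\<in>A - {a}. AE z in (lborel :: ((real \<times> real) \<times> real) measure). a' \<bullet> Y (fst z) \<noteq> b a'"
  proof
   fix a' assume a': "a' \<in> A - {a}"
   show "AE z in (lborel :: ((real \<times> real) \<times> real) measure). a' \<bullet> Y (fst z) \<noteq> b a'"
   proof (cases "a' \<bullet> \<alpha> = 0 \<and> a' \<bullet> \<beta> = 0")
    case True
    then have "a' = - a" using unit_parallel_cases[OF o] A(2) a' by blast
    moreover obtain x0 where "x0 \<in> open_halfspaces A b" using ne by blast
    ultimately have "a \<bullet> x0 < b a" "- (a \<bullet> x0) < b a'" using a a' by (auto simp: open_halfspaces_def)
    then have "- b a < b a'" by linarith
    then show ?thesis using aY \<open>a' = - a\<close> by simp
   next
    case False
    let ?v = "((a' \<bullet> \<alpha>, a' \<bullet> \<beta>), 0) :: (real \<times> real) \<times> real"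
    have "?v \<noteq> 0" using False by (auto simp: zero_prod_def)
    then have "negligible {z. ?v \<bullet> z = b a' - a' \<bullet> p}" using negligible_hyperplane by blast
    moreover have "{z. ?v \<bullet> z = b a' - a' \<bullet> p} = {z :: (real \<times> real) \<times> real. a' \<bullet> Y (fst z) = b a'}"
     by (auto simp: Y_def inner_add_right algebra_simps)
    moreover have "{z. ?v \<bullet> z = b a' - a' \<bullet> p} \<in> sets borel" by (intro borel_closed closed_hyperplane)
    ultimately have "negligible {z :: (real \<times> real) \<times> real. a' \<bullet> Y (fst z) = b a'}" "{z :: (real \<times> real) \<times> real. a' \<bullet> Y (fst z) = b a'} \<in> sets borel"
     by (simp_all only:)
    then have "{z :: (real \<times> real) \<times> real. a' \<bullet> Y (fst z) = b a'} \<in> null_sets lborel"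
     by (simp add: negligible_iff_null_sets null_sets_def)
    then show ?thesis by (rule AE_I'[of _ lborel]) auto
   qed
  qed
 qed
 have lim: "AE z in lborel. (\<lambda>k. W k z) \<longlonglongrightarrow> L z"
  using AEne
 proof eventually_elim
  case (elim z)
  have X0: "(\<lambda>k. X k z) \<longlonglongrightarrow> Y (fst z)"
  proof -
   have "(\<lambda>k. (snd z + 1) * (1 / real (Suc k))) \<longlonglongrightarrow> (snd z + 1) * 0"
    by (intro tendsto_mult tendsto_const LIMSEQ_Suc[OF lim_1_over_n])
   then have "(\<lambda>k. Y (fst z) - ((snd z + 1) / real (Suc k)) *\<^sub>R a) \<longlonglongrightarrow> Y (fst z) - 0 *\<^sub>R a"
    by (intro tendsto_diff tendsto_const tendsto_scaleR) (simp del: of_nat_Suc)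
   then show ?thesis unfolding XY by simp
  qed
  have fac: "(\<lambda>k. expinv 1 (real (Suc k) * (b a' - a' \<bullet> X k z) - 1)) \<longlonglongrightarrow> (if a' \<bullet> Y (fst z) < b a' then 1 else 0)"
   if a': "a' \<in> A - {a}" for a'
  proof -
   have d: "(\<lambda>k. b a' - a' \<bullet> X k z) \<longlonglongrightarrow> b a' - a' \<bullet> Y (fst z)" by (intro tendsto_intros X0)
   show ?thesis
   proof (cases "a' \<bullet> Y (fst z) < b a'")
    case True
    have "filterlim (\<lambda>k. real (Suc k) * (b a' - a' \<bullet> X k z)) at_top sequentially"
     by (rule filterlim_at_top_mult_tendsto_pos[OF d])
      (use True in \<open>auto intro: filterlim_compose[OF filterlim_real_sequentially filterlim_Suc] simp del: of_nat_Suc\<close>)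
    then have "filterlim (\<lambda>k. - 1 + real (Suc k) * (b a' - a' \<bullet> X k z)) at_top sequentially"
     by (rule filterlim_tendsto_add_at_top[OF tendsto_const])
    from filterlim_compose[OF expinv_1_at_top this] show ?thesis using True by (simp del: of_nat_Suc)
   next
    case False
    then have "b a' - a' \<bullet> Y (fst z) < 0" using elim a' by force
    with d have "\<forall>\<^sub>F k in sequentially. b a' - a' \<bullet> X k z < 0" by (rule order_tendstoD)
    then have "\<forall>\<^sub>F k in sequentially. expinv 1 (real (Suc k) * (b a' - a' \<bullet> X k z) - 1) = 0"
    proof eventually_elim
     case (elim k)
     then have "real (Suc k) * (b a' - a' \<bullet> X k z) \<le> 0" by (intro mult_nonneg_nonpos) auto
     then show ?case by (intro expinv_nonpos) linarith
    qed
    then show ?thesis using False by (simp add: tendsto_eventually)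
   qed
  qed
  have pr: "(\<Prod>a'\<in>A - {a}. if a' \<bullet> Y (fst z) < b a' then 1 else 0) = (indicator (halfspaces A b) (Y (fst z)) :: real)"
  proof (cases "\<forall>a'\<in>A - {a}. a' \<bullet> Y (fst z) < b a'")
   case True
   then have "Y (fst z) \<in> halfspaces A b" using aY[of "fst z"] unfolding halfspaces_def by force
   then show ?thesis using True by simp
  next
   case False
   then obtain a' where a': "a' \<in> A - {a}" "\<not> a' \<bullet> Y (fst z) < b a'" by blast
   then have "a' \<bullet> Y (fst z) > b a'" using elim by force
   then have "Y (fst z) \<notin> halfspaces A b" using a' by (force simp: halfspaces_def)
   moreover have "(\<Prod>a'\<in>A - {a}. if a' \<bullet> Y (fst z) < b a' then 1 else 0) = (0::real)"
    using a' A(1) by (intro prod_zero) auto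
   ultimately show ?thesis by simp
  qed
  have "(\<lambda>k. f (X k z)) \<longlonglongrightarrow> f (Y (fst z))"
   using continuous_on_tendsto_compose[OF smooth_continuous[OF f, of UNIV] X0] by simp
  then have "(\<lambda>k. W k z) \<longlonglongrightarrow> f (Y (fst z)) * expinv' (snd z) * (\<Prod>a'\<in>A - {a}. if a' \<bullet> Y (fst z) < b a' then 1 else 0)"
   unfolding W_def Q_def by (intro tendsto_mult tendsto_const tendsto_prod fac)
  then show ?case unfolding pr L_def by (simp add: mult_ac)
 qed
 have dcl: "(\<lambda>k. LINT z|lborel. W k z) \<longlonglongrightarrow> (LINT z|lborel. L z)"
  by (rule integral_dominated_convergence[where w=w]) (use Lm Wm w_int lim Wbound in auto)
 have Li: "integrable lborel L"
  by (rule integrable_dominated_convergence[where w=w and s=W]) (use Lm Wm w_int lim Wbound in auto)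
 have "(LINT z|lborel. L z) = (LINT y|lborel. LINT r|lborel. L (y, r))"
  using lborel_pair.integral_fst'[of L] Li by (simp add: lborel_prod)
 also have "... = (LINT y|lborel. indicator (halfspaces A b) (Y y) * f (Y y))"
  by (simp add: L_def integral_expinv')
 also have "... = (LINT x|plane_measure {x. a \<bullet> x = b a}. indicator (halfspaces A b) x * f x)"
 proof -
  have "(\<lambda>(s, t). p + s *\<^sub>R \<alpha> + t *\<^sub>R \<beta>) = Y" by (auto simp: Y_def)
  then show ?thesis unfolding pm by (simp add: integral_distr)
 qed
 finally show ?thesis using dcl unfolding step1 by simp
qed

text \<open>The integral of a derivative of \<open>f\<close> times the cutoff vanishes. In the limit the term
 with \<open>\<partial>\<^sub>i f\<close> gives the volume integral, and the gradient of the cutoff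
 concentrates on the faces.\<close>

theorem divergence_polyhedron:
 assumes A: "finite A" "!!a. a \<in> A ==> norm a = 1" and bd: "bounded (halfspaces A b)"
  and ne: "open_halfspaces A b \<noteq> {}" and f: "smooth f"
 shows "(LINT x|lborel. indicator (open_halfspaces A b) x * partial i f x)
  = (\<Sum>a\<in>A. a $ i * (LINT x|plane_measure {x. a \<bullet> x = b a}. indicator (halfspaces A b) x * f x))"
proof -
 let ?c = "\<lambda>k. cutoff A b (Suc k)"
 have sub: "{x. g x * ?c k x \<noteq> 0} \<subseteq> halfspaces A b" for g :: "real^3 => real" and k
  using cutoff_outside[OF A(1), of _ b "Suc k"] open_halfspaces_subset[of A b] by fastforce
 have bc: "bounded {x. g x * ?c k x \<noteq> 0}" for g :: "real^3 => real" and k by (rule bounded_subset[OF bd sub])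
 have i1: "integrable lborel (\<lambda>x. partial i f x * ?c k x)" for k
  by (intro smooth_integrable smooth_mult smooth_partial f cutoff_smooth bc)
 have i2: "integrable lborel (\<lambda>x. f x * slab_weight A b a k x)" if "a \<in> A" for k a
 proof (rule smooth_integrable)
  show "smooth (\<lambda>x. f x * slab_weight A b a k x)" by (intro smooth_mult f slab_weight_smooth)
  have "{x. f x * slab_weight A b a k x \<noteq> 0} \<subseteq> halfspaces A b"
   using slab_weight_nonzero[OF A(1) that, of b k] open_halfspaces_subset[of A b] by auto
  then show "bounded {x. f x * slab_weight A b a k x \<noteq> 0}" by (rule bounded_subset[OF bd])
 qed
 have eq: "(LINT x|lborel. partial i f x * ?c k x) = (\<Sum>a\<in>A. a $ i * (LINT x|lborel. f x * slab_weight A b a k x))" for k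
 proof -
  have "0 = (LINT x|lborel. partial i (\<lambda>x. f x * ?c k x) x)"
   by (rule integral_partial_eq_0[symmetric]) (intro smooth_mult f cutoff_smooth bc)+
  also have "... = (LINT x|lborel. partial i f x * ?c k x - (\<Sum>a\<in>A. a $ i * (f x * slab_weight A b a k x)))"
   by (intro lint_cong refl)
    (simp add: partial_bilinear[OF bounded_bilinear_mult] smooth_differentiable f cutoff_smooth partial_cutoff A
     sum_distrib_left mult_ac)
  also have "... = (LINT x|lborel. partial i f x * ?c k x) - (\<Sum>a\<in>A. a $ i * (LINT x|lborel. f x * slab_weight A b a k x))"
   using i1 i2 by (subst Bochner_Integration.integral_diff) (auto simp: Bochner_Integration.integral_sum)
  finally show ?thesis by simp
 qed
 have "(\<lambda>k. LINT x|lborel. partial i f x * ?c k x) \<longlonglongrightarrow> (LINT x|lborel. partial i f x * indicator (open_halfspaces A b) x)"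
 proof -
  obtain M where M: "halfspaces A b \<subseteq> cball 0 M" using bounded_subset_ballD[OF bd, of 0] ball_subset_cball by (meson order_trans)
  have "compact (partial i f ` cball 0 M)" by (intro compact_continuous_image smooth_continuous smooth_partial f) simp
  then obtain C where C: "!!x. x \<in> cball 0 M ==> \<bar>partial i f x\<bar> \<le> C"
   using compact_imp_bounded bounded_iff by (metis imageI real_norm_def)
  show ?thesis
  proof (rule integral_dominated_convergence[where w="\<lambda>x. \<bar>C\<bar> * indicator (cball 0 M) x"])
   have [measurable]: "partial i f \<in> borel_measurable borel" "?c k \<in> borel_measurable borel" for k
    by (intro smooth_measurable smooth_partial f cutoff_smooth)+
   have [measurable]: "open_halfspaces A b \<in> sets borel" using open_open_halfspaces[OF A(1)] by simp
   show "(\<lambda>x. partial i f x * indicator (open_halfspaces A b) x) \<in> borel_measurable lborel" by measurable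
   show "(\<lambda>x. partial i f x * ?c k x) \<in> borel_measurable lborel" for k by measurable
   have "emeasure lborel (cball (0::real^3) M) < \<infinity>" by (rule emeasure_bounded_finite) simp
   then show "integrable lborel (\<lambda>x. \<bar>C\<bar> * indicator (cball (0::real^3) M) x)" by simp
   show "AE x in lborel. (\<lambda>k. partial i f x * ?c k x) \<longlonglongrightarrow> partial i f x * indicator (open_halfspaces A b) x"
    by (intro AE_I2 tendsto_mult tendsto_const LIMSEQ_Suc[OF cutoff_tendsto[OF A(1)]])
   show "AE x in lborel. norm (partial i f x * ?c k x) \<le> \<bar>C\<bar> * indicator (cball 0 M) x" for k
   proof (rule AE_I2)
    fix x
    show "norm (partial i f x * ?c k x) \<le> \<bar>C\<bar> * indicator (cball 0 M) x"
    proof (cases "partial i f x * ?c k x = 0")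
     case False
     then have x: "x \<in> cball 0 M" using sub[of "partial i f" k] M by auto
     have "\<bar>partial i f x\<bar> * \<bar>?c k x\<bar> \<le> \<bar>C\<bar> * 1"
      using cutoff_bounds[of A b "Suc k" x] C[OF x] by (intro mult_mono) auto
     then show ?thesis using x by (simp add: abs_mult)
    qed (auto simp: indicator_def)
   qed
  qed
 qed
 moreover have "(\<lambda>k. \<Sum>a\<in>A. a $ i * (LINT x|lborel. f x * slab_weight A b a k x)) \<longlonglongrightarrow>
   (\<Sum>a\<in>A. a $ i * (LINT x|plane_measure {x. a \<bullet> x = b a}. indicator (halfspaces A b) x * f x))"
  by (intro tendsto_sum tendsto_mult tendsto_const slab_weight_limit A bd ne f)
 ultimately show ?thesis unfolding eq using LIMSEQ_unique by (simp add: mult.commute)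
qed

section \<open>Convex cells: trace inequality and Green's formula\<close>

locale convex_cell =
 fixes A :: "(real^3) set" and b :: "real^3 => real"
 assumes fin: "finite A" and unit: "!!a. a \<in> A ==> norm a = 1"
  and bdd: "bounded (halfspaces A b)" and ne: "open_halfspaces A b \<noteq> {}"
begin

abbreviation "K \<equiv> halfspaces A b"
abbreviation "U \<equiv> open_halfspaces A b"
abbreviation "\<sigma> a \<equiv> plane_measure {x. a \<bullet> x = b a}"

abbreviation cell_int :: "(real^3 => real) => real" where
 "cell_int f \<equiv> LINT x|lborel. indicator U x * f x"
abbreviation face_int :: "real^3 => (real^3 => real) => real" where
 "face_int a f \<equiv> LINT x|\<sigma> a. indicator K x * f x"
abbreviation sq_nn_U :: "(real^3 => real^3) => ennreal" where
 "sq_nn_U f \<equiv> \<integral>\<^sup>+x. ennreal ((norm (f x))\<^sup>2) * indicator U x \<partial>lborel"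

lemma U_open: "open U" by (rule open_open_halfspaces[OF fin])
lemma U_bounded: "bounded U" by (rule bounded_subset[OF bdd open_halfspaces_subset])
lemma U_borel [measurable]: "U \<in> sets borel" using U_open by simp
lemma U_lebesgue: "U \<in> sets lebesgue" using U_open by simp

lemma K_compact: "compact K" using bdd closed_halfspaces compact_eq_bounded_closed by blast

lemma continuous_bounded_on_K:
 fixes g :: "real^3 => 'b::real_normed_vector"
 assumes "continuous_on UNIV g"
 obtains C where "C \<ge> 0" "!!x. x \<in> K ==> norm (g x) \<le> C"
proof -
 have "compact (g ` K)" using continuous_on_subset[OF assms subset_UNIV] K_compact by (rule compact_continuous_image)
 then obtain C where "\<forall>y\<in>g ` K. norm y \<le> C" using compact_imp_bounded bounded_iff by metis
 then have "norm (g x) \<le> max C 0" if "x \<in> K" for x using that by fastforce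
 then show ?thesis using that[of "max C 0"] by simp
qed

lemma cell_integrable:
 fixes g :: "real^3 => real"
 assumes g: "continuous_on UNIV g" shows "integrable lborel (\<lambda>x. indicator U x * g x)"
proof -
 obtain C where C: "C \<ge> 0" "!!x. x \<in> K ==> norm (g x) \<le> C" using continuous_bounded_on_K[OF g] by blast
 have [measurable]: "g \<in> borel_measurable borel" using g by (rule borel_measurable_continuous_onI)
 show ?thesis
 proof (rule integrableI_bounded_set[where A=K and B=C])
  show "(\<lambda>x. indicator U x * g x) \<in> borel_measurable lborel" by measurable
  show "emeasure lborel K < \<infinity>" using bdd by (rule emeasure_bounded_finite)
  show "AE x in lborel. x \<in> K --> norm (indicator U x * g x) \<le> C"
   using C by (auto intro!: AE_I2 simp: indicator_def)
  show "AE x in lborel. x \<notin> K --> indicator U x * g x = 0"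
   using open_halfspaces_subset[of A b] by (auto intro!: AE_I2 simp: indicator_def)
 qed simp
qed

lemma plane_emeasure_bounded:
 assumes a: "a \<in> A" and B: "bounded B" "B \<in> sets borel"
 shows "emeasure (\<sigma> a) B < \<infinity>"
proof -
 obtain p \<alpha> \<beta> where o: "orthonormal3 \<alpha> \<beta> a"
  and pm: "\<sigma> a = distr lborel borel (\<lambda>(s, t). p + s *\<^sub>R \<alpha> + t *\<^sub>R \<beta>)"
  by (rule plane_measure_hyperplane[OF unit[OF a], of "b a"]) blast
 let ?Y = "\<lambda>(s, t). p + s *\<^sub>R \<alpha> + t *\<^sub>R \<beta>"
 have m: "?Y \<in> borel_measurable (lborel :: (real \<times> real) measure)"
  unfolding split_def by (simp, intro borel_measurable_continuous_onI continuous_intros)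
 obtain M where M: "!!x. x \<in> B ==> norm x \<le> M" using B(1) bounded_iff by blast
 have oo: "\<alpha> \<bullet> \<alpha> = 1" "\<beta> \<bullet> \<beta> = 1" "\<alpha> \<bullet> \<beta> = 0" "\<beta> \<bullet> \<alpha> = 0"
  using o by (simp_all add: orthonormal3_def inner_commute)
 let ?R = "M + norm p"
 have "?Y -` B \<subseteq> cbox (- ?R, - ?R) (?R, ?R)"
 proof (rule subsetI)
  fix z assume z: "z \<in> ?Y -` B"
  obtain s t where st: "z = (s, t)" by (cases z)
  from z have "p + s *\<^sub>R \<alpha> + t *\<^sub>R \<beta> \<in> B" by (simp add: st)
  then have n: "norm (p + s *\<^sub>R \<alpha> + t *\<^sub>R \<beta>) \<le> M" by (rule M)
  have le: "\<bar>(s *\<^sub>R \<alpha> + t *\<^sub>R \<beta>) \<bullet> v\<bar> \<le> ?R" if "v \<bullet> v = 1" for v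
  proof -
   have "norm v = 1" using that by (simp add: norm_eq_1)
   then have "\<bar>(s *\<^sub>R \<alpha> + t *\<^sub>R \<beta>) \<bullet> v\<bar> \<le> norm ((p + s *\<^sub>R \<alpha> + t *\<^sub>R \<beta>) - p)"
    using Cauchy_Schwarz_ineq2[of "s *\<^sub>R \<alpha> + t *\<^sub>R \<beta>" v] by (simp add: add.assoc)
   also have "... \<le> norm (p + s *\<^sub>R \<alpha> + t *\<^sub>R \<beta>) + norm p" by (rule norm_triangle_ineq4)
   finally show ?thesis using n by linarith
  qed
  have "\<bar>s\<bar> \<le> ?R" "\<bar>t\<bar> \<le> ?R" using le[of \<alpha>] le[of \<beta>] by (simp_all add: oo inner_add_left)
  then show "z \<in> cbox (- ?R, - ?R) (?R, ?R)"
   by (auto simp: abs_le_iff cbox_Pair_eq st)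
 qed
 then have "bounded (?Y -` B)" by (rule bounded_subset[OF bounded_cbox])
 then have "emeasure lborel (?Y -` B) < \<infinity>" by (rule emeasure_bounded_finite)
 then show ?thesis unfolding pm using B(2) by (subst emeasure_distr[OF m]) auto
qed

lemma face_integrable:
 fixes g :: "real^3 => real"
 assumes a: "a \<in> A" and g: "continuous_on UNIV g" shows "integrable (\<sigma> a) (\<lambda>x. indicator K x * g x)"
proof -
 obtain C where C: "C \<ge> 0" "!!x. x \<in> K ==> norm (g x) \<le> C" using continuous_bounded_on_K[OF g] by blast
 have gm: "g \<in> borel_measurable borel" using g by (rule borel_measurable_continuous_onI)
 show ?thesis
 proof (rule integrableI_bounded_set[where A=K and B=C])
  show "(\<lambda>x. indicator K x * g x) \<in> borel_measurable (\<sigma> a)" using gm by measurable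
  show "emeasure (\<sigma> a) K < \<infinity>" by (rule plane_emeasure_bounded[OF a bdd halfspaces_borel])
  show "AE x in \<sigma> a. x \<in> K --> norm (indicator K x * g x) \<le> C"
   using C by (auto intro!: AE_I2 simp: indicator_def)
 qed auto
qed

text \<open>The divergence theorem in the form that is applied to the trace inequality and to Green's formula.\<close>

lemma divergence_field:
 assumes f: "!!i. smooth (f i)"
 shows "(\<Sum>i\<in>UNIV. cell_int (partial i (f i))) = (\<Sum>a\<in>A. face_int a (\<lambda>x. \<Sum>i\<in>UNIV. a $ i * f i x))"
proof -
 have "(\<Sum>i\<in>UNIV. cell_int (partial i (f i))) = (\<Sum>i\<in>UNIV. \<Sum>a\<in>A. a $ i * face_int a (f i))"
  by (intro sum.cong refl divergence_polyhedron fin unit bdd ne f)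
 also have "... = (\<Sum>a\<in>A. \<Sum>i\<in>UNIV. a $ i * face_int a (f i))" by (rule sum.swap)
 also have "... = (\<Sum>a\<in>A. face_int a (\<lambda>x. \<Sum>i\<in>UNIV. a $ i * f i x))"
 proof (rule sum.cong[OF refl])
  fix a assume a: "a \<in> A"
  have "integrable (\<sigma> a) (\<lambda>x. indicator K x * f i x)" for i by (intro face_integrable a smooth_continuous f)
  then have "(\<Sum>i\<in>UNIV. a $ i * face_int a (f i)) = (LINT x|\<sigma> a. (\<Sum>i\<in>UNIV. a $ i * (indicator K x * f i x)))"
   by (simp add: Bochner_Integration.integral_sum)
  then show "(\<Sum>i\<in>UNIV. a $ i * face_int a (f i)) = face_int a (\<lambda>x. \<Sum>i\<in>UNIV. a $ i * f i x)"
   by (simp only: sum_distrib_left mult.left_commute)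
 qed
 finally show ?thesis .
qed

text \<open>The field \<open>\<bar>\<phi>\<bar>\<^sup>2 (x - x\<^sub>0)\<close> with \<open>x\<^sub>0\<close> inside the cell has a positive flux density on every face.\<close>

lemma trace_inequality:
 obtains C where "C \<ge> 0" "!!\<phi> :: real^3 => real^3. !!a. smooth \<phi> ==> a \<in> A ==>
  (face_int a (\<lambda>x. (norm (\<phi> x))\<^sup>2)) \<le>
  C * ((cell_int (\<lambda>x. (norm (\<phi> x))\<^sup>2)) + (\<Sum>i\<in>UNIV. LINT x|lborel. indicator U x * (norm (partial i \<phi> x))\<^sup>2))"
proof -
 obtain x0 where x0: "x0 \<in> U" using ne by blast
 obtain R0 where R0: "!!x. x \<in> U ==> norm x \<le> R0" using U_bounded bounded_iff by blast
 define R where "R = R0 + norm x0"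
 have R: "\<bar>x $ i - x0 $ i\<bar> \<le> R" if "x \<in> U" for x i
  using component_le_norm_cart[of "x - x0" i] norm_triangle_ineq4[of x x0] R0[OF that] by (simp add: R_def)
 have R_nn: "R \<ge> 0" using R[OF x0, of 1] by simp
 have pos: "b a - a \<bullet> x0 > 0" if "a \<in> A" for a using x0 that by (simp add: open_halfspaces_def)
 define D where "D = 3 * (1 + R)"
 define C where "C = (\<Sum>a\<in>A. D / (b a - a \<bullet> x0))"
 have D: "D \<ge> 0" using R_nn by (simp add: D_def)
 have C: "C \<ge> 0" unfolding C_def using pos D by (intro sum_nonneg) (simp add: less_imp_le)
 have main: "(face_int a (\<lambda>x. (norm (\<phi> x))\<^sup>2)) \<le>
  C * ((cell_int (\<lambda>x. (norm (\<phi> x))\<^sup>2)) + (\<Sum>i\<in>UNIV. LINT x|lborel. indicator U x * (norm (partial i \<phi> x))\<^sup>2))"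
  if phi: "smooth \<phi>" and a: "a \<in> A" for \<phi> :: "real^3 => real^3" and a
 proof -
  let ?S = "(cell_int (\<lambda>x. (norm (\<phi> x))\<^sup>2)) + (\<Sum>i\<in>UNIV. LINT x|lborel. indicator U x * (norm (partial i \<phi> x))\<^sup>2)"
  let ?N = "\<lambda>a. LINT x|\<sigma> a. indicator K x * (norm (\<phi> x))\<^sup>2"
  have cphi: "continuous_on UNIV (\<lambda>x. (norm (\<phi> x))\<^sup>2)" "continuous_on UNIV (\<lambda>x. (norm (partial i \<phi> x))\<^sup>2)" for i
   by (intro continuous_intros smooth_continuous phi smooth_partial)+
  define f where "f i x = (x $ i - x0 $ i) * (\<phi> x \<bullet> \<phi> x)" for i x
  have f: "smooth (f i)" for i
   unfolding f_def by (intro smooth_mult smooth_diff smooth_component smooth_const smooth_inner phi)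
  have pf: "partial i (f i) x = \<phi> x \<bullet> \<phi> x + 2 * (x $ i - x0 $ i) * (\<phi> x \<bullet> partial i \<phi> x)" for i x
  proof -
   have d: "\<phi> differentiable at x" by (rule smooth_differentiable[OF phi])
   have d1: "(\<lambda>x. x $ i - x0 $ i) differentiable at x" "(\<lambda>x. \<phi> x \<bullet> \<phi> x) differentiable at x"
    by (intro smooth_differentiable smooth_diff smooth_component smooth_const smooth_inner phi)+
   have "partial i (\<lambda>x. x $ i + (- x0 $ i)) x = partial i (\<lambda>x. x $ i) x + partial i (\<lambda>x. - x0 $ i) x"
    by (intro partial_add smooth_differentiable smooth_component smooth_const)
   then have "partial i (\<lambda>x. x $ i - x0 $ i) x = 1" by (simp add: partial_component partial_const)
   then show ?thesis
    unfolding f_def[abs_def] using partial_bilinear[OF bounded_bilinear_mult d1, of i] partial_bilinear[OF bounded_bilinear_inner d d, of i]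
    by (simp add: inner_commute algebra_simps)
  qed
  have le: "indicator U x * partial i (f i) x \<le> indicator U x * ((1 + R) * (norm (\<phi> x))\<^sup>2 + R * (norm (partial i \<phi> x))\<^sup>2)" for i x
  proof (cases "x \<in> U")
   case True
   have "2 * (x $ i - x0 $ i) * (\<phi> x \<bullet> partial i \<phi> x) \<le> 2 * (\<bar>x $ i - x0 $ i\<bar> * \<bar>\<phi> x \<bullet> partial i \<phi> x\<bar>)"
    using abs_ge_self[of "(x $ i - x0 $ i) * (\<phi> x \<bullet> partial i \<phi> x)"] unfolding abs_mult mult.assoc by linarith
   also have "... \<le> 2 * (R * (norm (\<phi> x) * norm (partial i \<phi> x)))"
    using R[OF True, of i] R_nn Cauchy_Schwarz_ineq2[of "\<phi> x" "partial i \<phi> x"]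
    by (intro mult_left_mono mult_mono) auto
   also have "... = R * (2 * norm (\<phi> x) * norm (partial i \<phi> x))" by simp
   also have "... \<le> R * ((norm (\<phi> x))\<^sup>2 + (norm (partial i \<phi> x))\<^sup>2)"
    using R_nn by (intro mult_left_mono sum_squares_bound)
   finally show ?thesis using True by (simp add: pf power2_norm_eq_inner algebra_simps)
  qed simp
  have ci: "integrable lborel (\<lambda>x. indicator U x * partial i (f i) x)" for i
   by (intro cell_integrable smooth_continuous smooth_partial f)
  have ci2: "integrable lborel (\<lambda>x. indicator U x * (norm (\<phi> x))\<^sup>2)" "integrable lborel (\<lambda>x. indicator U x * (norm (partial i \<phi> x))\<^sup>2)" for i
   by (intro cell_integrable cphi)+
  have left: "(\<Sum>i\<in>UNIV. LINT x|lborel. indicator U x * partial i (f i) x) \<le> D * ?S"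
  proof -
   have "(cell_int (\<lambda>x. partial i (f i) x)) \<le>
     (1 + R) * (cell_int (\<lambda>x. (norm (\<phi> x))\<^sup>2)) + R * (cell_int (\<lambda>x. (norm (partial i \<phi> x))\<^sup>2))" for i
   proof -
    have "(cell_int (\<lambda>x. partial i (f i) x)) \<le>
      (LINT x|lborel. (1 + R) * (indicator U x * (norm (\<phi> x))\<^sup>2) + R * (indicator U x * (norm (partial i \<phi> x))\<^sup>2))"
     by (rule integral_mono[OF ci]) (use ci2(1) ci2(2)[of i] le[where i=i] in \<open>auto simp: algebra_simps\<close>)
    then show ?thesis using ci2(1) ci2(2)[of i] by simp
   qed
   then have "(\<Sum>i\<in>UNIV. LINT x|lborel. indicator U x * partial i (f i) x) \<le>
    (\<Sum>i\<in>(UNIV::3 set). (1 + R) * (cell_int (\<lambda>x. (norm (\<phi> x))\<^sup>2)) + R * (cell_int (\<lambda>x. (norm (partial i \<phi> x))\<^sup>2)))"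
    by (intro sum_mono)
   also have "... = D * (cell_int (\<lambda>x. (norm (\<phi> x))\<^sup>2)) + R * (\<Sum>i\<in>UNIV. LINT x|lborel. indicator U x * (norm (partial i \<phi> x))\<^sup>2)"
    by (simp add: sum.distrib sum_distrib_left D_def)
   also have "... \<le> D * (cell_int (\<lambda>x. (norm (\<phi> x))\<^sup>2)) + D * (\<Sum>i\<in>UNIV. LINT x|lborel. indicator U x * (norm (partial i \<phi> x))\<^sup>2)"
    using R_nn by (intro add_left_mono mult_right_mono sum_nonneg integral_nonneg_AE) (auto simp: D_def)
   finally show ?thesis by (simp add: distrib_left)
  qed
  have right: "(\<Sum>i\<in>UNIV. cell_int (partial i (f i))) = (\<Sum>a\<in>A. (b a - a \<bullet> x0) * ?N a)"
   unfolding divergence_field[OF f]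
  proof (rule sum.cong[OF refl])
   fix a assume a: "a \<in> A"
   have "face_int a (\<lambda>x. \<Sum>i\<in>UNIV. a $ i * f i x) = face_int a (\<lambda>x. (b a - a \<bullet> x0) * (norm (\<phi> x))\<^sup>2)"
   proof (rule integral_cong_AE)
    show "(\<lambda>x. indicator K x * (\<Sum>i\<in>UNIV. a $ i * f i x)) \<in> borel_measurable (\<sigma> a)"
     by (intro borel_measurable_integrable face_integrable a smooth_continuous smooth_sum smooth_mult smooth_const f)
    show "(\<lambda>x. indicator K x * ((b a - a \<bullet> x0) * (norm (\<phi> x))\<^sup>2)) \<in> borel_measurable (\<sigma> a)"
     by (intro borel_measurable_integrable face_integrable a continuous_intros cphi(1))
    show "AE x in \<sigma> a. indicator K x * (\<Sum>i\<in>UNIV. a $ i * f i x) = indicator K x * ((b a - a \<bullet> x0) * (norm (\<phi> x))\<^sup>2)"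
     using AE_plane_on[OF unit[OF a]]
    proof eventually_elim
     case (elim x)
     have "(\<Sum>i\<in>UNIV. a $ i * f i x) = (a \<bullet> (x - x0)) * (norm (\<phi> x))\<^sup>2"
      unfolding inner_vec_def[of a] f_def power2_norm_eq_inner sum_distrib_right by (simp add: mult_ac)
     then show ?case using elim by (simp add: inner_diff_right)
    qed
   qed
   also have "... = (b a - a \<bullet> x0) * ?N a" by (simp add: mult.left_commute[of "indicator K _"])
   finally show "face_int a (\<lambda>x. \<Sum>i\<in>UNIV. a $ i * f i x) = (b a - a \<bullet> x0) * ?N a" .
  qed
  have N: "?N a' \<ge> 0" for a' by (rule integral_nonneg_AE) simp
  have S: "?S \<ge> 0" by (intro add_nonneg_nonneg sum_nonneg integral_nonneg_AE) auto
  have "(b a - a \<bullet> x0) * ?N a \<le> (\<Sum>a\<in>A. (b a - a \<bullet> x0) * ?N a)"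
   by (rule member_le_sum[OF a _ fin]) (use pos N in \<open>auto simp: less_imp_le\<close>)
  also have "... \<le> D * ?S" using left right by simp
  finally have "?N a \<le> D * ?S / (b a - a \<bullet> x0)" using pos[OF a] by (simp add: pos_le_divide_eq mult.commute)
  also have "... = (D / (b a - a \<bullet> x0)) * ?S" by simp
  also have "... \<le> C * ?S"
   unfolding C_def by (intro mult_right_mono member_le_sum[OF a _ fin] S) (use pos D in \<open>auto simp: less_imp_le\<close>)
  finally show ?thesis .
 qed
 show ?thesis by (rule that[OF C main])
qed

lemma green_curl_smooth:
 assumes u: "smooth u" and p: "smooth p"
 shows "(cell_int (\<lambda>x. curl u x \<bullet> p x - u x \<bullet> curl p x))
  = (\<Sum>a\<in>A. LINT x|\<sigma> a. indicator K x * (cross3 a (u x) \<bullet> p x))"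
proof -
 let ?f = "\<lambda>i x. cross3 (u x) (p x) $ i"
 have f: "smooth (?f i)" for i by (intro smooth_cross3_nth u p)
 have i: "integrable lborel (\<lambda>x. indicator U x * partial i (?f i) x)" for i
  by (intro cell_integrable smooth_continuous smooth_partial f)
 have "(cell_int (\<lambda>x. curl u x \<bullet> p x - u x \<bullet> curl p x))
   = (LINT x|lborel. (\<Sum>i\<in>UNIV. indicator U x * partial i (?f i) x))"
  by (intro lint_cong refl)
   (simp add: div_cross3[symmetric] smooth_differentiable u p sum_distrib_left)
 also have "... = (\<Sum>i\<in>UNIV. LINT x|lborel. indicator U x * partial i (?f i) x)"
  by (intro Bochner_Integration.integral_sum i)
 also have "... = (\<Sum>a\<in>A. face_int a (\<lambda>x. \<Sum>i\<in>UNIV. a $ i * ?f i x))" by (rule divergence_field[OF f])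
 also have "... = (\<Sum>a\<in>A. face_int a (\<lambda>x. cross3 a (u x) \<bullet> p x))"
  by (intro sum.cong lint_cong refl) (simp add: inner_vec_def sum_3 cross3_def algebra_simps)
 finally show ?thesis .
qed

end

section \<open>Density of smooth fields in the first order Sobolev space of a cell\<close>

text \<open>A quickly converging subsequence converges almost everywhere because
 \<open>\<Sum>k. 2 ^ k * \<bar>f\<^sub>k\<^sub>+\<^sub>1 - f\<^sub>k\<bar>\<^sup>2\<close> is integrable; Fatou's lemma carries the Cauchy bounds over to the limit.\<close>

lemma L2_complete:
 fixes f :: "nat => 'a => 'b::euclidean_space"
 assumes m[measurable]: "!!n. f n \<in> borel_measurable M"
  and c: "L2_cauchy M f"
 obtains g where "g \<in> borel_measurable M" "L2_tendsto M f g"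
proof -
 have cauchy: "\<exists>N. \<forall>i\<ge>N. \<forall>j\<ge>N. sq_nn M (\<lambda>x. f i x - f j x) \<le> ennreal e" if "e > 0" for e
 proof -
  have "\<forall>\<^sub>F p in sequentially \<times>\<^sub>F sequentially. sq_nn M (\<lambda>x. f (fst p) x - f (snd p) x) < ennreal e"
   using c unfolding L2_cauchy_def by (rule order_tendstoD) (use that in simp)
  then obtain N where N: "\<forall>m\<ge>N. \<forall>n\<ge>N. sq_nn M (\<lambda>x. f n x - f m x) < ennreal e" unfolding eventually_prod_sequentially by auto
  show ?thesis by (rule exI[of _ N]) (use N in \<open>auto intro: less_imp_le\<close>)
 qed
 have "\<forall>k. \<exists>N. \<forall>i\<ge>N. \<forall>j\<ge>N. sq_nn M (\<lambda>x. f i x - f j x) \<le> ennreal ((1/4) ^ k)"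
  by (intro allI cauchy) simp
 then obtain N where N: "!!k i j. i \<ge> N k ==> j \<ge> N k ==> sq_nn M (\<lambda>x. f i x - f j x) \<le> ennreal ((1/4) ^ k)"
  by metis
 \<comment> \<open>increasing indices beyond both \<open>N k\<close> and \<open>k\<close>\<close>
 define r where "r k = (\<Sum>j\<le>k. N j) + k" for k
 have rN: "r k \<ge> N k" for k
  unfolding r_def using member_le_sum[of k "{..k}" N] by simp
 have r_mono: "r (Suc k) \<ge> r k" for k by (simp add: r_def)
 have r_ge: "r k \<ge> k" for k by (simp add: r_def)
 have rN': "r l \<ge> N k" if "l \<ge> k" for k l
  using rN[of k] lift_Suc_mono_le[of r k l, OF r_mono that] by linarith
 let ?d = "\<lambda>k x. 2 ^ k * (norm (f (r (Suc k)) x - f (r k) x))\<^sup>2"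
 have "(\<integral>\<^sup>+ x. (\<Sum>k. ennreal (?d k x)) \<partial>M) = (\<Sum>k. \<integral>\<^sup>+ x. ennreal (?d k x) \<partial>M)"
  by (rule nn_integral_suminf) measurable
 also have "... \<le> (\<Sum>k. ennreal ((1/2) ^ k))"
 proof (rule suminf_le)
  fix k
  have em: "ennreal (?d k x) = ennreal (2 ^ k) * ennreal ((norm (f (r (Suc k)) x - f (r k) x))\<^sup>2)" for x
   by (rule ennreal_mult) simp_all
  have "(\<integral>\<^sup>+ x. ennreal (?d k x) \<partial>M) = ennreal (2 ^ k) * (sq_nn M (\<lambda>x. f (r (Suc k)) x - f (r k) x))"
   unfolding em by (rule nn_integral_cmult) measurable
  also have "... \<le> ennreal (2 ^ k) * ennreal ((1/4) ^ k)"
   by (intro mult_left_mono N rN' rN) auto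
  also have "... = ennreal (2 ^ k * (1/4) ^ k)" by (rule ennreal_mult[symmetric]) simp_all
  also have "(2::real) ^ k * (1/4) ^ k = (1/2) ^ k" by (simp add: power_mult_distrib[symmetric])
  finally show "(\<integral>\<^sup>+ x. ennreal (?d k x) \<partial>M) \<le> ennreal ((1/2) ^ k)" .
 qed auto
 also have "... = ennreal (\<Sum>k. (1/2) ^ k)"
  by (rule suminf_ennreal2) (simp_all add: summable_geometric)
 also have "... < \<infinity>" by simp
 finally have "AE x in M. (\<Sum>k. ennreal (?d k x)) \<noteq> \<infinity>"
  by (intro nn_integral_PInf_AE) auto
 then have conv: "AE x in M. convergent (\<lambda>k. f (r k) x)"
 proof eventually_elim
  case (elim x)
  then have "summable (\<lambda>k. ?d k x)" by (intro summable_suminf_not_top) auto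
  then have "(\<lambda>k. ?d k x) \<longlonglongrightarrow> 0" by (rule summable_LIMSEQ_zero)
  then have "Bseq (\<lambda>k. ?d k x)" by (meson convergentI convergent_imp_Bseq)
  then obtain B where B: "B > 0" "!!k. norm (?d k x) \<le> B" by (auto simp: Bseq_def)
  have nb: "norm (f (r (Suc k)) x - f (r k) x) \<le> sqrt B * (sqrt (1/2)) ^ k" for k
  proof -
   have "2 ^ k * (norm (f (r (Suc k)) x - f (r k) x))\<^sup>2 \<le> B" using B(2)[of k] by simp
   then have "(norm (f (r (Suc k)) x - f (r k) x))\<^sup>2 \<le> B / 2 ^ k" by (simp add: pos_le_divide_eq mult.commute)
   also have "... = (sqrt B * (sqrt (1/2)) ^ k)\<^sup>2"
    using B(1) by (simp add: power_mult_distrib power_mult[symmetric] mult.commute[of k 2]) (simp add: power_mult real_sqrt_divide power_divide)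
   finally show ?thesis by (rule power2_le_imp_le) (use B(1) in simp)
  qed
  have sg: "summable (\<lambda>k. sqrt B * (sqrt (1/2)) ^ k)"
   by (intro summable_mult summable_geometric) (simp add: real_sqrt_divide)
  have "summable (\<lambda>k. f (r (Suc k)) x - f (r k) x)"
   by (rule summable_comparison_test'[OF sg nb])
  then have "convergent (\<lambda>n. \<Sum>k<n. f (r (Suc k)) x - f (r k) x)" by (simp add: summable_iff_convergent)
  then have "convergent (\<lambda>n. f (r n) x - f (r 0) x)" using sum_lessThan_telescope[of "\<lambda>n. f (r n) x"] by simp
  then have "convergent (\<lambda>n. (f (r n) x - f (r 0) x) + f (r 0) x)" by (intro convergent_add convergent_const)
  then show ?case by simp
 qed
 define g where "g x = lim (\<lambda>k. f (r k) x)" for x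
 have gm: "g \<in> borel_measurable M" unfolding g_def by (rule borel_measurable_lim_metric) measurable
 have lim: "AE x in M. (\<lambda>k. f (r k) x) \<longlonglongrightarrow> g x"
  using conv unfolding g_def by eventually_elim (simp add: convergent_LIMSEQ_iff)
 have le: "sq_nn M (\<lambda>x. f n x - g x) \<le> ennreal e"
  if "\<forall>i\<ge>N0. \<forall>j\<ge>N0. sq_nn M (\<lambda>x. f i x - f j x) \<le> ennreal e" "n \<ge> N0" for n N0 e
 proof -
  have "sq_nn M (\<lambda>x. f n x - g x) = (\<integral>\<^sup>+ x. liminf (\<lambda>k. ennreal ((norm (f n x - f (r k) x))\<^sup>2)) \<partial>M)"
  proof (rule nn_integral_cong_AE)
   show "AE x in M. ennreal ((norm (f n x - g x))\<^sup>2) = liminf (\<lambda>k. ennreal ((norm (f n x - f (r k) x))\<^sup>2))"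
    using lim
   proof eventually_elim
    case (elim x)
    have "(\<lambda>k. ennreal ((norm (f n x - f (r k) x))\<^sup>2)) \<longlonglongrightarrow> ennreal ((norm (f n x - g x))\<^sup>2)"
     by (intro tendsto_ennrealI tendsto_power tendsto_norm tendsto_diff tendsto_const elim)
    then show ?case by (rule lim_imp_Liminf[OF sequentially_bot, symmetric])
   qed
  qed
  also have "... \<le> liminf (\<lambda>k. sq_nn M (\<lambda>x. f n x - f (r k) x))"
   by (rule nn_integral_liminf) measurable
  also have "... \<le> limsup (\<lambda>k. sq_nn M (\<lambda>x. f n x - f (r k) x))"
   by (intro Liminf_le_Limsup sequentially_bot)
  also have "... \<le> ennreal e"
  proof (rule Limsup_bounded)
   show "\<forall>\<^sub>F k in sequentially. sq_nn M (\<lambda>x. f n x - f (r k) x) \<le> ennreal e"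
    using eventually_ge_at_top[of N0]
   proof eventually_elim
    case (elim k)
    then have "r k \<ge> N0" using r_ge[of k] by linarith
    then show ?case using that by blast
   qed
  qed
  finally show ?thesis .
 qed
 have "L2_tendsto M f g"
 proof (rule L2_tendstoI)
  fix e :: real assume "e > 0"
  then obtain N0 where "\<forall>i\<ge>N0. \<forall>j\<ge>N0. sq_nn M (\<lambda>x. f i x - f j x) \<le> ennreal e" using cauchy by blast
  then show "\<exists>N. \<forall>n\<ge>N. sq_nn M (\<lambda>x. f n x - g x) \<le> ennreal e" using le by blast
 qed
 then show ?thesis using that gm by blast
qed

text \<open>Support in the ball of radius one half leaves room for the closure of the support inside the unit
 ball.\<close>

lemma smooth_kernel_exists:
 obtains h :: "real^3 => real" where "smooth h" "!!z. h z \<ge> 0" "!!z. h z \<noteq> 0 ==> norm z \<le> 1 / 2" "(LINT z|lborel. h z) = 1"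
proof -
 obtain l u :: "real^3" where lu: "0 \<in> box l u" "box l u \<subseteq> ball 0 (1 / 2)" using rational_boxes[of "1 / 2" "0::real^3"] by auto
 obtain A b where A: "finite A" "box l u = open_halfspaces A b" "bounded (halfspaces A b)"
  by (rule box_as_halfspaces)
 have "(\<lambda>n. cutoff A b n 0) \<longlonglongrightarrow> 1" using cutoff_tendsto[OF A(1), of b 0] lu(1) unfolding A(2)[symmetric] by simp
 then have "\<forall>\<^sub>F n in sequentially. cutoff A b n 0 > 0" by (rule order_tendstoD) simp
 then obtain n where n: "cutoff A b n 0 > 0" by (auto simp: eventually_sequentially)
 let ?c = "cutoff A b n"
 have sm: "smooth ?c" by (rule cutoff_smooth)
 have supp: "?c z \<noteq> 0 ==> z \<in> ball 0 (1 / 2)" for z using cutoff_outside[OF A(1), of z b n] lu(2) A(2) by blast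
 have "bounded {z. ?c z \<noteq> 0}" by (rule bounded_subset[OF bounded_ball[of 0 "1 / 2"]]) (use supp in blast)
 then have int: "integrable lborel ?c" by (rule smooth_integrable[OF sm])
 have "(LINT z|lborel. ?c z) \<noteq> 0"
 proof
  assume "(LINT z|lborel. ?c z) = 0"
  then have ae: "AE z in lborel. ?c z = 0"
   using int by (subst (asm) integral_nonneg_eq_0_iff_AE) (auto simp: cutoff_bounds)
  have "open {z. ?c z > 0}"
   by (intro open_Collect_less continuous_on_const smooth_continuous[OF sm])
  then obtain e where e: "e > 0" "ball 0 e \<subseteq> {z. ?c z > 0}" using n by (auto simp: open_contains_ball)
  obtain l' u' :: "real^3" where lu': "0 \<in> box l' u'" "box l' u' \<subseteq> ball 0 e" using rational_boxes[of e "0::real^3"] e by auto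
  have "AE z in lborel. z \<notin> box l' u'" using ae
  proof eventually_elim
   case (elim z) then show ?case using lu'(2) e(2) by fastforce
  qed
  then have "box l' u' \<in> null_sets lborel" by (simp add: AE_iff_null_sets[symmetric])
  then have "negligible (box l' u')" by (simp add: negligible_iff_null_sets null_sets_def)
  then show False using lu'(1) by (simp add: negligible_interval)
 qed
 moreover have "(LINT z|lborel. ?c z) \<ge> 0" by (intro integral_nonneg_AE) (simp add: cutoff_bounds)
 ultimately have I: "(LINT z|lborel. ?c z) > 0" by simp
 let ?h = "\<lambda>z. (1 / (LINT z|lborel. ?c z)) * ?c z"
 have "smooth ?h" by (intro smooth_mult smooth_const sm)
 moreover have "?h z \<ge> 0" for z using I cutoff_bounds[of A b n z] by simp
 moreover have "norm z \<le> 1 / 2" if "?h z \<noteq> 0" for z using supp[of z] that by auto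
 moreover have "(LINT z|lborel. ?h z) = 1" using I by simp
 ultimately show ?thesis by (rule that)
qed

text \<open>Compositions with affine maps are needed below and preserve Borel measurability, hence the passage
 from Lebesgue to Borel measurable fields.\<close>

lemma borel_representative:
 fixes v :: "real^3 => real^3"
 assumes U: "U \<in> sets borel" and v: "v \<in> borel_measurable (lebesgue_on U)"
 obtains V where "V \<in> borel_measurable borel" "AE x in lebesgue_on U. V x = v x" "!!x. x \<notin> U ==> V x = 0"
proof -
 have Ul: "U \<in> sets lebesgue" using U by simp
 let ?f = "\<lambda>x. indicator U x *\<^sub>R v x"
 have "?f \<in> borel_measurable lebesgue"
  using v Ul by (subst (asm) borel_measurable_restrict_space_iff) auto
 moreover have "(\<lambda>y::real^3. y $ i) \<in> borel_measurable borel" for i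
  by (intro borel_measurable_continuous_onI continuous_intros)
 ultimately have "(\<lambda>x. ?f x $ i) \<in> borel_measurable (completion lborel)" for i
  by (rule measurable_compose)
 then have "\<exists>F\<in>borel_measurable lborel. AE x in lborel. ?f x $ i = F x" for i
  by (rule completion_ex_borel_measurable_real)
 then have "\<forall>i. \<exists>F. F \<in> borel_measurable lborel \<and> (AE x in lborel. ?f x $ i = F x)"
  unfolding Bex_def by (rule allI)
 from choice[OF this] obtain F where
  "\<forall>i. F i \<in> borel_measurable lborel \<and> (AE x in lborel. ?f x $ i = F i x)" by (rule exE)
 then have F: "!!i. F i \<in> borel_measurable lborel" "!!i. AE x in lborel. ?f x $ i = F i x" by simp_all
 define V where "V x = indicator U x *\<^sub>R (\<Sum>i\<in>UNIV. F i x *\<^sub>R axis i (1::real))" for x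
 have "V \<in> borel_measurable borel"
  unfolding V_def using F(1) U by (intro borel_measurable_scaleR borel_measurable_indicator borel_measurable_sum borel_measurable_const) auto
 moreover have "AE x in lebesgue_on U. V x = v x"
 proof -
  have "AE x in lborel. \<forall>i\<in>UNIV. ?f x $ i = F i x" using F(2) by (subst AE_ball_countable) auto
  then have "AE x in lebesgue. \<forall>i\<in>UNIV. ?f x $ i = F i x" by (rule AE_completion)
  then have "AE x in lebesgue. x \<in> U --> V x = v x"
  proof eventually_elim
   case (elim x)
   show ?case
   proof
    assume x: "x \<in> U"
    then have "V x = (\<Sum>i\<in>UNIV. v x $ i *\<^sub>R axis i 1)" using elim by (simp add: V_def)
    also have "... = v x" by (simp add: vec_eq_iff axis_def if_distrib cong: if_cong)
    finally show "V x = v x" .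
   qed
  qed
  then show ?thesis using Ul by (simp add: AE_restrict_space_iff)
 qed
 ultimately show ?thesis using that[of V] by (simp add: V_def)
qed

lemma nn_integral_lebesgue_on:
 assumes U: "U \<in> sets borel" and f: "f \<in> borel_measurable borel"
 shows "(\<integral>\<^sup>+ x. f x \<partial>lebesgue_on U) = (\<integral>\<^sup>+ x. f x * indicator U x \<partial>(lborel :: (real^3) measure))"
 using U f by (subst nn_integral_restrict_space) (auto simp: nn_integral_completion)

lemma clamp_continuous:
 assumes "N > (0::real)" shows "continuous_on S (\<lambda>y::'b::real_normed_vector. (N / max N (norm y)) *\<^sub>R y)"
 by (intro continuous_intros) (use assms in auto)

lemma clamp_norm:
 assumes N: "N > (0::real)" shows "norm ((N / max N (norm y)) *\<^sub>R y) \<le> N"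
  "norm (y - (N / max N (norm y)) *\<^sub>R y) \<le> norm y" "norm y \<le> N ==> (N / max N (norm y)) *\<^sub>R y = y"
proof -
 have m: "max N (norm y) > 0" using N by simp
 have "N * norm y \<le> N * max N (norm y)" using N by (intro mult_left_mono) auto
 then show "norm ((N / max N (norm y)) *\<^sub>R y) \<le> N" using N m by (simp add: pos_divide_le_eq)
 have c: "0 \<le> N / max N (norm y)" "N / max N (norm y) \<le> 1" using N m by (auto simp: pos_divide_le_eq)
 have "norm (y - (N / max N (norm y)) *\<^sub>R y) = norm ((1 - N / max N (norm y)) *\<^sub>R y)" by (simp add: scaleR_diff_left)
 also have "... \<le> 1 * norm y" unfolding norm_scaleR using c by (intro mult_right_mono) auto
 finally show "norm (y - (N / max N (norm y)) *\<^sub>R y) \<le> norm y" by simp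
 assume "norm y \<le> N" then show "(N / max N (norm y)) *\<^sub>R y = y" using N by (simp add: max_absorb1)
qed

text \<open>Truncation makes the field bounded; a bounded measurable field is an almost everywhere limit of
 continuous fields, which can be truncated as well, and dominated convergence turns this into
 convergence in mean square.\<close>

lemma L2_continuous_approx:
 fixes v :: "real^3 => real^3"
 assumes U: "bounded U" "U \<in> sets lebesgue" and v: "L2 U v" and e: "e > 0"
 obtains W where "continuous_on UNIV W" "(LINT x|lebesgue_on U. (norm (v x - W x))\<^sup>2) < e"
proof -
 let ?M = "lebesgue_on U"
 interpret finite_measure ?M by (rule finite_measure_lebesgue_on[OF U])
 have vm[measurable]: "v \<in> borel_measurable ?M" and vi: "integrable ?M (\<lambda>x. (norm (v x))\<^sup>2)" using v by (auto simp: L2_def)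
 define cl where "cl n y = (real (Suc n) / max (real (Suc n)) (norm y)) *\<^sub>R y" for n and y :: "real^3"
 have clc: "continuous_on UNIV (cl n)" for n unfolding cl_def[abs_def] by (rule clamp_continuous) simp
 have clm[measurable]: "cl n \<in> borel_measurable borel" for n using clc by (rule borel_measurable_continuous_onI)
 have "(\<lambda>n. LINT x|?M. (norm (v x - cl n (v x)))\<^sup>2) \<longlonglongrightarrow> (LINT x|?M. 0)"
 proof (rule integral_dominated_convergence[where w="\<lambda>x. (norm (v x))\<^sup>2"])
  show "(\<lambda>x. (norm (v x - cl n (v x)))\<^sup>2) \<in> borel_measurable ?M" for n by measurable
  show "AE x in ?M. norm ((norm (v x - cl n (v x)))\<^sup>2) \<le> (norm (v x))\<^sup>2" for n
   unfolding cl_def using clamp_norm(2)[of "real (Suc n)"] by (intro AE_I2) (simp del: of_nat_Suc)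
  show "AE x in ?M. (\<lambda>n. (norm (v x - cl n (v x)))\<^sup>2) \<longlonglongrightarrow> 0"
  proof (rule AE_I2)
   fix x
   obtain n0 where "norm (v x) \<le> real n0" using real_arch_simple by blast
   then have "(norm (v x - cl n (v x)))\<^sup>2 = 0" if "n \<ge> n0" for n
    using clamp_norm(3)[of "real (Suc n)" "v x"] that by (simp add: cl_def)
   then show "(\<lambda>n. (norm (v x - cl n (v x)))\<^sup>2) \<longlonglongrightarrow> 0"
    by (intro tendsto_eventually) (auto simp: eventually_sequentially)
  qed
 qed (use vi in auto)
 then have "\<forall>\<^sub>F n in sequentially. (LINT x|?M. (norm (v x - cl n (v x)))\<^sup>2) < e / 4"
  by (rule order_tendstoD) (use e in simp)
 then obtain n where n: "(LINT x|?M. (norm (v x - cl n (v x)))\<^sup>2) < e / 4" by (auto simp: eventually_sequentially)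
 have "v measurable_on U" using vm U(2) by (simp add: measurable_on_iff_borel_measurable)
 then obtain Z g where Z: "negligible Z" "!!k. continuous_on UNIV (g k)" "!!x. x \<notin> Z ==> (\<lambda>k. g k x) \<longlonglongrightarrow> (if x \<in> U then v x else 0)"
  unfolding measurable_on_def by blast
 have gc: "continuous_on UNIV (\<lambda>x. cl n (g k x))" for k
  by (rule continuous_on_compose2[OF clc Z(2)]) simp
 have gcm: "(\<lambda>x. cl n (g k x)) \<in> borel_measurable ?M" for k
  using borel_measurable_continuous_onI[OF gc] by (rule borel_lebesgue_on)
 note gcm[measurable]
 have "(\<lambda>k. LINT x|?M. (norm (cl n (v x) - cl n (g k x)))\<^sup>2) \<longlonglongrightarrow> (LINT x|?M. 0)"
 proof (rule integral_dominated_convergence[where w="\<lambda>x. (2 * real (Suc n))\<^sup>2"])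
  show "(\<lambda>x. (norm (cl n (v x) - cl n (g k x)))\<^sup>2) \<in> borel_measurable ?M" for k by measurable
  have b: "norm (cl n y) \<le> real (Suc n)" for y unfolding cl_def by (rule clamp_norm) simp
  have "norm (cl n y - cl n y') \<le> 2 * real (Suc n)" for y y'
   unfolding mult_2 by (rule order_trans[OF norm_triangle_ineq4 add_mono[OF b b]])
  then have "(norm (cl n y - cl n y'))\<^sup>2 \<le> (2 * real (Suc n))\<^sup>2" for y y'
   by (intro power_mono norm_ge_zero)
  then show "AE x in ?M. norm ((norm (cl n (v x) - cl n (g k x)))\<^sup>2) \<le> (2 * real (Suc n))\<^sup>2" for k
   by (intro AE_I2) (simp only: real_norm_def abs_power2)
  have "AE x in lebesgue. x \<notin> Z" using Z(1) by (simp add: negligible_iff_null_sets AE_not_in)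
  then have "AE x in lebesgue. x \<in> U --> (\<lambda>k. (norm (cl n (v x) - cl n (g k x)))\<^sup>2) \<longlonglongrightarrow> 0"
  proof eventually_elim
   case (elim x)
   show ?case
   proof
    assume x: "x \<in> U"
    have "(\<lambda>k. cl n (g k x)) \<longlonglongrightarrow> cl n (v x)"
     using continuous_on_tendsto_compose[OF clc Z(3)[OF elim]] x by simp
    then have "(\<lambda>k. (norm (cl n (v x) - cl n (g k x)))\<^sup>2) \<longlonglongrightarrow> (norm (cl n (v x) - cl n (v x)))\<^sup>2" by (intro tendsto_intros)
    then show "(\<lambda>k. (norm (cl n (v x) - cl n (g k x)))\<^sup>2) \<longlonglongrightarrow> 0" by simp
   qed
  qed
  then show "AE x in ?M. (\<lambda>k. (norm (cl n (v x) - cl n (g k x)))\<^sup>2) \<longlonglongrightarrow> 0"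
   using U(2) by (simp add: AE_restrict_space_iff)
 qed auto
 then have "\<forall>\<^sub>F k in sequentially. (LINT x|?M. (norm (cl n (v x) - cl n (g k x)))\<^sup>2) < e / 4"
  by (rule order_tendstoD) (use e in simp)
 then obtain k where k: "(LINT x|?M. (norm (cl n (v x) - cl n (g k x)))\<^sup>2) < e / 4" by (auto simp: eventually_sequentially)
 have s1: "L2_on ?M (\<lambda>x. v x - cl n (v x))"
 proof -
  have "integrable ?M (\<lambda>x. (norm (v x - cl n (v x)))\<^sup>2)"
   by (rule Bochner_Integration.integrable_bound[OF vi])
    (use clamp_norm(2)[of "real (Suc n)"] in \<open>auto intro!: AE_I2 power_mono simp: cl_def simp del: of_nat_Suc\<close>)
  then show ?thesis by (simp add: L2_on_def)
 qed
 have s2: "L2_on ?M (\<lambda>x. cl n (v x) - cl n (g k x))"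
 proof (rule L2_on_diff)
  have b: "norm (cl n y) \<le> real (Suc n)" for y unfolding cl_def by (rule clamp_norm) simp
  show "L2_on ?M (\<lambda>x. cl n (v x))" "L2_on ?M (\<lambda>x. cl n (g k x))"
   by (rule bounded_L2_on[where B="real (Suc n)"], measurable, rule AE_I2, rule b)+
 qed
 have i: "integrable ?M (\<lambda>x. (norm (v x - cl n (v x)))\<^sup>2)" "integrable ?M (\<lambda>x. (norm (cl n (v x) - cl n (g k x)))\<^sup>2)"
  "integrable ?M (\<lambda>x. (norm (v x - cl n (g k x)))\<^sup>2)"
  using s1 s2 L2_on_add[OF s1 s2] by (auto simp: L2_on_def)
 have "(LINT x|?M. (norm (v x - cl n (g k x)))\<^sup>2) \<le> (LINT x|?M. 2 * (norm (v x - cl n (v x)))\<^sup>2 + 2 * (norm (cl n (v x) - cl n (g k x)))\<^sup>2)"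
 proof (rule integral_mono[OF i(3)])
  show "(norm (v x - cl n (g k x)))\<^sup>2 \<le> 2 * (norm (v x - cl n (v x)))\<^sup>2 + 2 * (norm (cl n (v x) - cl n (g k x)))\<^sup>2" for x
   using norm_add_sq_le[of "v x - cl n (v x)" "cl n (v x) - cl n (g k x)"] by simp
 qed (use i in simp)
 also have "... < e" using i n k by simp
 finally show ?thesis using that[OF gc] by blast
qed

lemma lborel_affine_vec3:
 "c > 0 ==> lborel = density (distr lborel borel (\<lambda>x :: real^3. t + c *\<^sub>R x)) (\<lambda>_. ennreal (c ^ 3))"
 using lborel_affine[of c t] by simp

lemma integral_affine_vec3:
 fixes F :: "real^3 => real^3"
 assumes F: "F \<in> borel_measurable borel" and c: "c > 0"
 shows "(LINT y|lborel. F y) = (LINT z|lborel. c ^ 3 *\<^sub>R F (t + c *\<^sub>R z))"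
proof -
 have "(LINT y|lborel. F y) = (LINT y|density (distr lborel borel (\<lambda>x. t + c *\<^sub>R x)) (\<lambda>_. ennreal (c ^ 3)). F y)"
  by (simp only: lborel_affine_vec3[OF c, of t, symmetric])
 also have "... = (LINT y|distr lborel borel (\<lambda>x. t + c *\<^sub>R x). c ^ 3 *\<^sub>R F y)"
  by (rule integral_density) (use F c in auto)
 also have "... = (LINT z|lborel. c ^ 3 *\<^sub>R F (t + c *\<^sub>R z))"
  by (rule integral_distr) (use F in auto)
 finally show ?thesis .
qed

lemma nn_integral_affine_vec3:
 fixes F :: "real^3 => ennreal"
 assumes F: "F \<in> borel_measurable borel" and c: "c > 0"
 shows "(\<integral>\<^sup>+y. F y \<partial>lborel) = ennreal (c ^ 3) * (\<integral>\<^sup>+z. F (t + c *\<^sub>R z) \<partial>lborel)"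
proof -
 have "(\<integral>\<^sup>+y. F y \<partial>lborel) = (\<integral>\<^sup>+y. F y \<partial>density (distr lborel borel (\<lambda>x. t + c *\<^sub>R x)) (\<lambda>_. ennreal (c ^ 3)))"
  by (simp only: lborel_affine_vec3[OF c, of t, symmetric])
 also have "... = (\<integral>\<^sup>+y. ennreal (c ^ 3) * F y \<partial>distr lborel borel (\<lambda>x. t + c *\<^sub>R x))"
  by (rule nn_integral_density) (use F in auto)
 also have "... = (\<integral>\<^sup>+z. ennreal (c ^ 3) * F (t + c *\<^sub>R z) \<partial>lborel)"
  by (rule nn_integral_distr) (use F in auto)
 also have "... = ennreal (c ^ 3) * (\<integral>\<^sup>+z. F (t + c *\<^sub>R z) \<partial>lborel)"
  by (rule nn_integral_cmult) (use F in measurable)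
 finally show ?thesis .
qed

context convex_cell
begin

lemma U_convex: "convex U"
proof -
 have "U = (\<Inter>a\<in>A. {x. a \<bullet> x < b a})" by (auto simp: open_halfspaces_def)
 then show ?thesis by (simp add: convex_INT convex_halfspace_lt)
qed

text \<open>Averages of the values at points pulled towards an inner ball: \<open>x\<close> is first contracted
 towards \<open>x0\<close>, so that the averaging ball of radius \<open>\<delta> \<rho>\<close> stays inside the cell.\<close>

definition pulled :: "real^3 => real => real => real^3 => real^3 => real^3" where
 "pulled x0 \<rho> \<delta> z x = (1 - \<delta>) *\<^sub>R x + \<delta> *\<^sub>R (x0 + \<rho> *\<^sub>R z)"

definition smoothing :: "(real^3 => real) => real^3 => real => real => (real^3 => real^3) => real^3 => real^3" where
 "smoothing h x0 \<rho> \<delta> V x = (LINT z|lborel. h z *\<^sub>R V (pulled x0 \<rho> \<delta> z x))"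

lemma pulled_in_cell:
 assumes "ball x0 \<rho> \<subseteq> U" "\<rho> > 0" "0 < \<delta>" "\<delta> < 1" "x \<in> U" "z \<in> ball 0 1"
 shows "pulled x0 \<rho> \<delta> z x \<in> U"
proof -
 have "x0 + \<rho> *\<^sub>R z \<in> ball x0 \<rho>" using assms(2,6) by (simp add: dist_norm)
 then have "x0 + \<rho> *\<^sub>R z \<in> U" using assms(1) by blast
 then show ?thesis unfolding pulled_def using assms by (intro convexD[OF U_convex]) auto
qed

lemma pulled_measurable:
 "(\<lambda>z. pulled x0 \<rho> \<delta> z x) \<in> borel_measurable borel" "pulled x0 \<rho> \<delta> z \<in> borel_measurable borel"
 unfolding pulled_def by (intro borel_measurable_continuous_onI continuous_intros)+

context
 fixes h :: "real^3 => real" and x0 :: "real^3" and \<rho> :: real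
 assumes h: "smooth h" "!!z. h z \<ge> 0" "\<forall>z. h z \<noteq> 0 --> norm z \<le> 1 / 2" "(LINT z|lborel. h z) = 1"
  and x0: "ball x0 \<rho> \<subseteq> U" "\<rho> > 0"
begin

abbreviation "T \<equiv> smoothing h x0 \<rho>"
abbreviation "P \<equiv> pulled x0 \<rho>"

lemma h_ball: "h z \<noteq> 0 ==> z \<in> ball 0 1"
 using h(3)[rule_format, of z] by simp

definition kern :: "real => real^3 => real" where
 "kern \<delta> w = h (0 + (- (1 / (\<delta> * \<rho>))) *\<^sub>R w) * (1 / (\<delta> * \<rho>) ^ 3)"

lemma h_bounded_support: "bounded {z. h z \<noteq> 0}"
 by (rule bounded_subset[OF bounded_ball[of 0 1]]) (use h_ball in blast)

lemma kern_smooth: "smooth (kern \<delta>)"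
 unfolding kern_def[abs_def] by (intro smooth_mult smooth_const smooth_affine h)

lemma kern_support: "\<delta> > 0 ==> kern \<delta> w \<noteq> 0 ==> norm w \<le> \<delta> * \<rho> / 2"
proof -
 assume d: "\<delta> > 0" and k: "kern \<delta> w \<noteq> 0"
 then have "h ((- (1 / (\<delta> * \<rho>))) *\<^sub>R w) \<noteq> 0" by (simp add: kern_def)
 from h(3)[rule_format, OF this] have "norm w / (\<delta> * \<rho>) \<le> 1 / 2" using d x0(2) by simp
 then show "norm w \<le> \<delta> * \<rho> / 2" using d x0(2) by (simp add: pos_divide_le_eq)
qed

lemma kern_bounded_support: "\<delta> > 0 ==> bounded {w. kern \<delta> w \<noteq> 0}"
 using kern_support by (intro bounded_subset[OF bounded_cball[of 0 "\<delta> * \<rho> / 2"]]) auto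

text \<open>The weights of the average at an inner point form a test function of the cell. Therefore the
 definition of weak derivatives applies to them, and the average of a field commutes with
 differentiation.\<close>

lemma kern_test_fun:
 assumes d: "0 < \<delta>" "\<delta> < 1" and x: "x \<in> U"
 shows "test_fun U (\<lambda>y. kern \<delta> (\<delta> *\<^sub>R x0 + (1 - \<delta>) *\<^sub>R x + (-1) *\<^sub>R y))" (is "test_fun U ?f")
proof -
 let ?X = "\<delta> *\<^sub>R x0 + (1 - \<delta>) *\<^sub>R x"
 have supp: "{y. ?f y \<noteq> 0} \<subseteq> cball ?X (\<delta> * \<rho> / 2)" using kern_support[OF d(1)] by (force simp: dist_norm)
 have "cball ?X (\<delta> * \<rho> / 2) \<subseteq> U"
 proof
  fix y assume y: "y \<in> cball ?X (\<delta> * \<rho> / 2)"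
  define z where "z = (1 / (\<delta> * \<rho>)) *\<^sub>R (y - ?X)"
  have dr: "\<delta> * \<rho> > 0" using d x0(2) by simp
  have "norm (y - ?X) < \<delta> * \<rho>" using y dr by (simp add: dist_norm norm_minus_commute)
  then have "z \<in> ball 0 1" using dr by (simp add: z_def)
  then have "pulled x0 \<rho> \<delta> z x \<in> U" by (rule pulled_in_cell[OF x0 d x])
  moreover have "\<delta> *\<^sub>R (\<rho> *\<^sub>R z) = y - ?X" using d(1) x0(2) by (simp add: z_def)
  then have "pulled x0 \<rho> \<delta> z x = y" unfolding pulled_def scaleR_add_right by simp
  ultimately show "y \<in> U" by simp
 qed
 then show ?thesis unfolding test_fun_alt
  using smooth_affine[OF kern_smooth] bounded_subset[OF bounded_cball supp] order_trans[OF closure_minimal[OF supp closed_cball]] by blast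
qed

lemma smoothing_convol:
 assumes d: "\<delta> > 0" and V: "V \<in> borel_measurable borel"
 shows "T \<delta> V x = convol (kern \<delta>) V (\<delta> *\<^sub>R x0 + (1 - \<delta>) *\<^sub>R x)"
proof -
 let ?X = "\<delta> *\<^sub>R x0 + (1 - \<delta>) *\<^sub>R x"
 have dr: "\<delta> * \<rho> > 0" using d x0(2) by simp
 have [measurable]: "V \<in> borel_measurable borel" "kern \<delta> \<in> borel_measurable borel"
  by (rule V, rule smooth_measurable[OF kern_smooth])
 have "convol (kern \<delta>) V ?X = (LINT z|lborel. (\<delta> * \<rho>) ^ 3 *\<^sub>R (kern \<delta> (?X - (?X + (\<delta> * \<rho>) *\<^sub>R z)) *\<^sub>R V (?X + (\<delta> * \<rho>) *\<^sub>R z)))"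
  unfolding convol_def by (rule integral_affine_vec3[OF _ dr]) measurable
 also have "... = (LINT z|lborel. h z *\<^sub>R V (P \<delta> z x))"
  by (intro lint_cong refl) (use d x0(2) in \<open>simp add: kern_def pulled_def algebra_simps\<close>)
 finally show ?thesis by (simp add: smoothing_def)
qed

lemma smoothing_smooth:
 assumes d: "\<delta> > 0" and V: "integrable lborel V"
 shows "smooth (T \<delta> V)"
proof -
 have m: "V \<in> borel_measurable borel" using borel_measurable_integrable[OF V] by simp
 have "T \<delta> V = (\<lambda>x. convol (kern \<delta>) V (\<delta> *\<^sub>R x0 + (1 - \<delta>) *\<^sub>R x))" using smoothing_convol[OF d m] by blast
 then show ?thesis using smooth_affine[OF smooth_convol[OF kern_smooth kern_bounded_support[OF d] V]] by simp
qed

lemma smoothing_diff: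
 assumes d: "\<delta> > 0" and V: "integrable lborel V" "integrable lborel W"
 shows "T \<delta> (\<lambda>x. V x - W x) x = T \<delta> V x - T \<delta> W x"
proof -
 have m: "V \<in> borel_measurable borel" "W \<in> borel_measurable borel" "(\<lambda>x. V x - W x) \<in> borel_measurable borel"
  using borel_measurable_integrable[OF V(1)] borel_measurable_integrable[OF V(2)] by simp_all
 note i = convol_integrable[OF kern_smooth kern_bounded_support[OF d] V(1)] convol_integrable[OF kern_smooth kern_bounded_support[OF d] V(2)]
 show ?thesis unfolding smoothing_convol[OF d m(1)] smoothing_convol[OF d m(2)] smoothing_convol[OF d m(3)] convol_def
  by (simp add: scaleR_diff_right i)
qed

lemma nn_integral_h: "(\<integral>\<^sup>+z. ennreal (h z) \<partial>lborel) = 1"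
 using nn_integral_eq_integral[OF smooth_integrable[OF h(1) h_bounded_support]] h(2,4) by simp

text \<open>Jensen's inequality for the probability density \<open>h\<close> and Fubini's theorem; the
 contraction by \<open>1 - \<delta> \<ge> 1/2\<close> changes volumes by a factor of at most eight.\<close>

lemma smoothing_bound:
 assumes d: "0 < \<delta>" "\<delta> \<le> 1 / 2" and D[measurable]: "D \<in> borel_measurable borel"
 shows "sq_nn_U (T \<delta> D) \<le> 8 * (sq_nn_U D)"
proof -
 let ?I = "sq_nn_U D"
 have [measurable]: "h \<in> borel_measurable borel" by (rule smooth_measurable[OF h(1)])
 have Pm[measurable]: "(\<lambda>z. P \<delta> z x) \<in> borel_measurable borel" "P \<delta> z \<in> borel_measurable borel" for x z
  by (rule pulled_measurable)+
 have Pm2[measurable]: "(\<lambda>(x, z). P \<delta> z x) \<in> borel_measurable (lborel \<Otimes>\<^sub>M lborel)"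
  unfolding pulled_def by measurable
 have jensen: "ennreal ((norm (T \<delta> D x))\<^sup>2) \<le> (\<integral>\<^sup>+z. ennreal (h z * (norm (D (P \<delta> z x)))\<^sup>2) \<partial>lborel)" for x
 proof -
  have "ennreal (norm (T \<delta> D x)) \<le> (\<integral>\<^sup>+z. ennreal (norm (h z *\<^sub>R D (P \<delta> z x))) \<partial>lborel)"
  proof (cases "integrable lborel (\<lambda>z. h z *\<^sub>R D (P \<delta> z x))")
   case True then show ?thesis unfolding smoothing_def by (rule integral_norm_bound_ennreal)
  next
   case False then show ?thesis by (simp add: smoothing_def not_integrable_integral_eq)
  qed
  also have "... = (\<integral>\<^sup>+z. ennreal (sqrt (h z)) * ennreal (sqrt (h z) * norm (D (P \<delta> z x))) \<partial>lborel)"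
   by (intro nn_integral_cong) (simp add: ennreal_mult[symmetric] h(2) mult.assoc[symmetric])
  finally have "(ennreal (norm (T \<delta> D x)))\<^sup>2 \<le> (\<integral>\<^sup>+z. ennreal (sqrt (h z)) * ennreal (sqrt (h z) * norm (D (P \<delta> z x))) \<partial>lborel)\<^sup>2"
   by (rule power_mono) simp
  also have "... \<le> (\<integral>\<^sup>+z. (ennreal (sqrt (h z)))\<^sup>2 \<partial>lborel) * (\<integral>\<^sup>+z. (ennreal (sqrt (h z) * norm (D (P \<delta> z x))))\<^sup>2 \<partial>lborel)"
   by (rule Cauchy_Schwarz_nn_integral) measurable
  also have "(\<integral>\<^sup>+z. (ennreal (sqrt (h z)))\<^sup>2 \<partial>lborel) = 1"
   using nn_integral_h by (simp add: ennreal_power h(2))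
  also have "(\<integral>\<^sup>+z. (ennreal (sqrt (h z) * norm (D (P \<delta> z x))))\<^sup>2 \<partial>lborel) = (\<integral>\<^sup>+z. ennreal (h z * (norm (D (P \<delta> z x)))\<^sup>2) \<partial>lborel)"
   by (intro nn_integral_cong) (simp add: ennreal_power h(2) power_mult_distrib)
  finally show ?thesis by (simp add: ennreal_power)
 qed
 have inner: "sq_nn_U (\<lambda>x. D (P \<delta> z x)) \<le> 8 * ?I" if z: "z \<in> ball 0 1" for z
 proof -
  have sub: "indicator U x \<le> (indicator U (P \<delta> z x) :: ennreal)" for x
   using pulled_in_cell[OF x0, of \<delta> x z] d z by (auto simp: indicator_def)
  let ?F = "\<lambda>y. ennreal ((norm (D y))\<^sup>2) * indicator U y"
  have "sq_nn_U (\<lambda>x. D (P \<delta> z x)) \<le> (\<integral>\<^sup>+x. ?F (\<delta> *\<^sub>R (x0 + \<rho> *\<^sub>R z) + (1 - \<delta>) *\<^sub>R x) \<partial>lborel)"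
   by (intro nn_integral_mono) (use sub in \<open>simp add: pulled_def mult_left_mono add.commute\<close>)
  also have "... = 8 * (ennreal (1/8) * (\<integral>\<^sup>+x. ?F (\<delta> *\<^sub>R (x0 + \<rho> *\<^sub>R z) + (1 - \<delta>) *\<^sub>R x) \<partial>lborel))"
  proof -
   have "(8::ennreal) * ennreal (1/8) = ennreal (8 * (1/8))" by (subst ennreal_mult) simp_all
   then show ?thesis by (simp add: mult.assoc[symmetric])
  qed
  also have "... \<le> 8 * (ennreal ((1 - \<delta>) ^ 3) * (\<integral>\<^sup>+x. ?F (\<delta> *\<^sub>R (x0 + \<rho> *\<^sub>R z) + (1 - \<delta>) *\<^sub>R x) \<partial>lborel))"
  proof (intro mult_left_mono mult_right_mono ennreal_leI)
   have "(1/2) ^ 3 \<le> (1 - \<delta>) ^ 3" using d by (intro power_mono) auto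
   then show "1 / 8 \<le> (1 - \<delta>) ^ 3" by (simp add: power_divide)
  qed auto
  also have "ennreal ((1 - \<delta>) ^ 3) * (\<integral>\<^sup>+x. ?F (\<delta> *\<^sub>R (x0 + \<rho> *\<^sub>R z) + (1 - \<delta>) *\<^sub>R x) \<partial>lborel) = ?I"
   by (rule nn_integral_affine_vec3[symmetric]) (use d in auto)
  finally show ?thesis .
 qed
 have "(sq_nn_U (T \<delta> D))
   \<le> (\<integral>\<^sup>+x. (\<integral>\<^sup>+z. ennreal (h z * (norm (D (P \<delta> z x)))\<^sup>2) * indicator U x \<partial>lborel) \<partial>lborel)"
 proof (rule nn_integral_mono)
  fix x
  have "ennreal ((norm (T \<delta> D x))\<^sup>2) * indicator U x \<le> (\<integral>\<^sup>+z. ennreal (h z * (norm (D (P \<delta> z x)))\<^sup>2) \<partial>lborel) * indicator U x"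
   by (intro mult_right_mono jensen) simp
  also have "... = (\<integral>\<^sup>+z. ennreal (h z * (norm (D (P \<delta> z x)))\<^sup>2) * indicator U x \<partial>lborel)"
   by (rule nn_integral_multc[symmetric]) measurable
  finally show "ennreal ((norm (T \<delta> D x))\<^sup>2) * indicator U x \<le> (\<integral>\<^sup>+z. ennreal (h z * (norm (D (P \<delta> z x)))\<^sup>2) * indicator U x \<partial>lborel)" .
 qed
 also have "... = (\<integral>\<^sup>+z. (\<integral>\<^sup>+x. ennreal (h z * (norm (D (P \<delta> z x)))\<^sup>2) * indicator U x \<partial>lborel) \<partial>lborel)"
  by (rule lborel_pair.Fubini'[symmetric]) (use Pm2 in \<open>simp add: split_def, measurable\<close>)
 also have "... = (\<integral>\<^sup>+z. ennreal (h z) * (sq_nn_U (\<lambda>x. D (P \<delta> z x))) \<partial>lborel)"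
 proof (rule nn_integral_cong)
  fix z
  have "(\<integral>\<^sup>+x. ennreal (h z * (norm (D (P \<delta> z x)))\<^sup>2) * indicator U x \<partial>lborel) = (\<integral>\<^sup>+x. ennreal (h z) * (ennreal ((norm (D (P \<delta> z x)))\<^sup>2) * indicator U x) \<partial>lborel)"
   by (intro nn_integral_cong) (simp add: ennreal_mult h(2) mult.assoc)
  also have "... = ennreal (h z) * (sq_nn_U (\<lambda>x. D (P \<delta> z x)))"
   by (rule nn_integral_cmult) measurable
  finally show "(\<integral>\<^sup>+x. ennreal (h z * (norm (D (P \<delta> z x)))\<^sup>2) * indicator U x \<partial>lborel) = ennreal (h z) * (sq_nn_U (\<lambda>x. D (P \<delta> z x)))" .
 qed
 also have "... \<le> (\<integral>\<^sup>+z. ennreal (h z) * (8 * ?I) \<partial>lborel)"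
 proof (rule nn_integral_mono)
  fix z
  show "ennreal (h z) * sq_nn_U (\<lambda>x. D (P \<delta> z x)) \<le> ennreal (h z) * (8 * ?I)"
  proof (cases "h z = 0")
   case False then show ?thesis using inner[OF h_ball] by (intro mult_left_mono) auto
  qed simp
 qed
 also have "... = (\<integral>\<^sup>+z. ennreal (h z) \<partial>lborel) * (8 * ?I)" by (rule nn_integral_multc) measurable
 also have "... = 8 * ?I" by (simp add: nn_integral_h)
 finally show ?thesis .
qed

text \<open>The averages are uniformly bounded operators, so it suffices to know convergence for the dense set
 of continuous fields, where it holds pointwise and boundedly.\<close>

lemma smoothing_tendsto:
 assumes Vm: "V \<in> borel_measurable borel" and V0: "\<forall>x. x \<notin> U --> V x = 0" and VL: "L2 U V"
 shows "integrable lborel V" "L2_tendsto (lebesgue_on U) (\<lambda>n. T (1 / real (n + 2)) V) V"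
proof -
 interpret fm: finite_measure "lebesgue_on U" by (rule finite_measure_lebesgue_on[OF U_bounded U_lebesgue])
 have ext: "integrable lborel F" if "integrable (lebesgue_on U) F" "F \<in> borel_measurable borel" "!!x. x \<notin> U ==> F x = 0" for F :: "real^3 => real^3"
 proof -
  have "(\<lambda>x. indicator U x *\<^sub>R F x) = F" using that(3) by (auto simp: indicator_def)
  then have "integrable lebesgue F" using lebesgue_on_integral_eq(2)[OF U_lebesgue, of F] that(1) by simp
  then show ?thesis using that(2) by (simp add: integrable_completion)
 qed
 show Vi: "integrable lborel V"
  by (rule ext[OF _ Vm V0[rule_format]]) (rule fm.L2_on_imp_integrable[OF VL[unfolded L2_iff]])
 define \<delta> where "\<delta> n = 1 / real (n + 2)" for n
 have d: "0 < \<delta> n" "\<delta> n \<le> 1 / 2" for n by (simp_all add: \<delta>_def field_simps)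
 have dlim: "\<delta> \<longlonglongrightarrow> 0" unfolding \<delta>_def using LIMSEQ_ignore_initial_segment[OF lim_1_over_n, of 2] by simp
 let ?M = "lebesgue_on U"
 note bm = borel_lebesgue_on
 have conv: "sq_nn ?M F = sq_nn_U F" if "F \<in> borel_measurable borel" for F
  by (rule nn_integral_lebesgue_on[OF U_borel]) (use that in measurable)
 have hi: "integrable lborel h" by (rule smooth_integrable[OF h(1) h_bounded_support])
 show "L2_tendsto ?M (\<lambda>n. T (1 / real (n + 2)) V) V"
  unfolding \<delta>_def[symmetric]
 proof (rule L2_tendstoI)
  fix e :: real assume e: "e > 0"
  \<comment> \<open>24 = 16 + 4 + 4: the error of the average of \<open>V - W'\<close> (twice 8), that of \<open>W'\<close> and \<open>V - W'\<close> itself\<close>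
  define e' where "e' = e / 24"
  have e': "e' > 0" using e by (simp add: e'_def)
  obtain W where W: "continuous_on UNIV W" "(LINT x|?M. (norm (V x - W x))\<^sup>2) < e'"
   by (rule L2_continuous_approx[OF U_bounded U_lebesgue VL e'])
  have Wm[measurable]: "W \<in> borel_measurable borel" using W(1) by (rule borel_measurable_continuous_onI)
  define W' where "W' x = indicator U x *\<^sub>R W x" for x
  have W'm[measurable]: "W' \<in> borel_measurable borel" unfolding W'_def by measurable
  obtain C where C: "C \<ge> 0" "!!x. x \<in> K ==> norm (W x) \<le> C" using continuous_bounded_on_K[OF W(1)] by blast
  have W'b: "norm (W' x) \<le> C" for x
   using C(1) C(2)[of x] open_halfspaces_subset[of A b] by (auto simp: W'_def indicator_def)
  have W'L: "L2_on ?M W'" by (rule fm.bounded_L2_on[OF bm[OF W'm] AE_I2[OF W'b]])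
  have W'i: "integrable lborel W'"
   by (rule ext[OF fm.L2_on_imp_integrable[OF W'L] W'm]) (simp add: W'_def)
  have E: "sq_nn ?M (\<lambda>x. V x - W' x) \<le> ennreal e'"
  proof -
   have "sq_nn ?M (\<lambda>x. V x - W' x) = ennreal (LINT x|?M. (norm (V x - W' x))\<^sup>2)"
    by (rule nn_integral_eq_integral)
     (use L2_on_diff[OF VL[unfolded L2_iff] W'L] in \<open>auto simp: L2_on_def\<close>)
   also have "(LINT x|?M. (norm (V x - W' x))\<^sup>2) = (LINT x|?M. (norm (V x - W x))\<^sup>2)"
    by (intro lint_cong refl) (simp add: W'_def space_restrict_space)
   finally show ?thesis using W(2) by (simp add: ennreal_leI)
  qed
  have hC: "integrable lborel (\<lambda>z. h z * C)" using hi by simp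
  have hb: "norm (h z *\<^sub>R W' y) \<le> h z * C" for z y using W'b h(2) by (simp add: mult_left_mono)
  have Tm: "T (\<delta> n) F \<in> borel_measurable borel" if "integrable lborel F" for n F
   by (rule smooth_measurable[OF smoothing_smooth[OF d(1) that]])
  have pt: "(\<lambda>n. T (\<delta> n) W' x) \<longlonglongrightarrow> W' x" if x: "x \<in> U" for x
  proof -
   have "(\<lambda>n. T (\<delta> n) W' x) \<longlonglongrightarrow> (LINT z|lborel. h z *\<^sub>R W' x)" unfolding smoothing_def
   proof (rule integral_dominated_convergence[OF _ _ hC])
    have hm: "h \<in> borel_measurable borel" by (rule smooth_measurable[OF h(1)])
    show "(\<lambda>z. h z *\<^sub>R W' x) \<in> borel_measurable lborel" using hm by simp
    show "(\<lambda>z. h z *\<^sub>R W' (P (\<delta> n) z x)) \<in> borel_measurable lborel" for n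
     using hm measurable_compose[OF pulled_measurable(1) W'm] by simp
    show "AE z in lborel. norm (h z *\<^sub>R W' (P (\<delta> n) z x)) \<le> h z * C" for n by (rule AE_I2) (rule hb)
    show "AE z in lborel. (\<lambda>n. h z *\<^sub>R W' (P (\<delta> n) z x)) \<longlonglongrightarrow> h z *\<^sub>R W' x"
    proof (rule AE_I2)
     fix z
     show "(\<lambda>n. h z *\<^sub>R W' (P (\<delta> n) z x)) \<longlonglongrightarrow> h z *\<^sub>R W' x"
     proof (cases "h z = 0")
      case False
      have "P (\<delta> n) z x \<in> U" for n using pulled_in_cell[OF x0 d(1)[of n] _ x h_ball[OF False]] d(2)[of n] by simp
      then have eq: "W' (P (\<delta> n) z x) = W (P (\<delta> n) z x)" for n by (simp add: W'_def)
      have "(\<lambda>n. P (\<delta> n) z x) \<longlonglongrightarrow> (1 - 0) *\<^sub>R x + 0 *\<^sub>R (x0 + \<rho> *\<^sub>R z)"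
       unfolding pulled_def by (intro tendsto_intros dlim)
      then have "(\<lambda>n. P (\<delta> n) z x) \<longlonglongrightarrow> x" by simp
      then have "(\<lambda>n. W (P (\<delta> n) z x)) \<longlonglongrightarrow> W x" by (intro continuous_on_tendsto_compose[OF W(1)]) simp_all
      moreover have "W x = W' x" using x by (simp add: W'_def)
      ultimately show ?thesis unfolding eq by (intro tendsto_scaleR tendsto_const) simp
     qed simp
    qed
   qed
   then show ?thesis using h(4) hi by simp
  qed
  have nb: "norm (T (\<delta> n) W' x) \<le> C" for n x
  proof -
   have "norm (T (\<delta> n) W' x) \<le> (LINT z|lborel. norm (h z *\<^sub>R W' (P (\<delta> n) z x)))"
    unfolding smoothing_def by (rule integral_norm_bound)
   also have "... \<le> (LINT z|lborel. h z * C)" by (rule integral_mono'[OF hC hb]) (use h(2) C(1) in simp)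
   finally show ?thesis using h(4) by simp
  qed
  have "(\<lambda>n. sq_nn ?M (\<lambda>x. T (\<delta> n) W' x - W' x)) \<longlonglongrightarrow> (\<integral>\<^sup>+ x. 0 \<partial>?M)"
  proof (rule nn_integral_dominated_convergence[where w = "\<lambda>_. ennreal ((C + C)\<^sup>2)"])
   show "(\<lambda>x. ennreal ((norm (T (\<delta> n) W' x - W' x))\<^sup>2)) \<in> borel_measurable ?M" for n
    using bm[OF Tm[OF W'i, of n]] bm[OF W'm] by measurable
   show "AE x in ?M. ennreal ((norm (T (\<delta> n) W' x - W' x))\<^sup>2) \<le> ennreal ((C + C)\<^sup>2)" for n
    by (intro AE_I2 ennreal_leI power_mono order_trans[OF norm_triangle_ineq4 add_mono[OF nb W'b]] norm_ge_zero)
   show "(\<integral>\<^sup>+ x. ennreal ((C + C)\<^sup>2) \<partial>?M) < \<infinity>" by (simp add: fm.emeasure_eq_measure ennreal_mult_less_top)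
   show "AE x in ?M. (\<lambda>n. ennreal ((norm (T (\<delta> n) W' x - W' x))\<^sup>2)) \<longlonglongrightarrow> 0"
   proof (rule AE_I2)
    fix x assume "x \<in> space ?M"
    then have "x \<in> U" by (simp add: space_restrict_space)
    then have "(\<lambda>n. ennreal ((norm (T (\<delta> n) W' x - W' x))\<^sup>2)) \<longlonglongrightarrow> ennreal ((norm (W' x - W' x))\<^sup>2)"
     by (intro tendsto_ennrealI tendsto_intros pt)
    then show "(\<lambda>n. ennreal ((norm (T (\<delta> n) W' x - W' x))\<^sup>2)) \<longlonglongrightarrow> 0" by simp
   qed
  qed simp_all
  then have "(\<lambda>n. sq_nn ?M (\<lambda>x. T (\<delta> n) W' x - W' x)) \<longlonglongrightarrow> 0" by simp
  then have "\<forall>\<^sub>F n in sequentially. sq_nn ?M (\<lambda>x. T (\<delta> n) W' x - W' x) < ennreal e'" by (rule order_tendstoD) (use e' in simp)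
  then obtain N where N: "!!n. n \<ge> N ==> sq_nn ?M (\<lambda>x. T (\<delta> n) W' x - W' x) \<le> ennreal e'"
   unfolding eventually_sequentially using less_imp_le by blast
  show "\<exists>N. \<forall>n\<ge>N. sq_nn ?M (\<lambda>x. T (\<delta> n) V x - V x) \<le> ennreal e"
  proof (intro exI allI impI)
   fix n assume n: "N \<le> n"
   let ?D = "\<lambda>x. V x - W' x"
   have Dm: "?D \<in> borel_measurable borel" using Vm W'm by simp
   have TD: "T (\<delta> n) ?D \<in> borel_measurable borel" by (rule Tm[OF Bochner_Integration.integrable_diff[OF Vi W'i]])
   have dec: "T (\<delta> n) V x - V x = T (\<delta> n) ?D x + ((T (\<delta> n) W' x - W' x) + - ?D x)" for x
    by (simp add: smoothing_diff[OF d(1) Vi W'i])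
   have m: "(\<lambda>x. T (\<delta> n) W' x - W' x) \<in> borel_measurable ?M" "(\<lambda>x. - ?D x) \<in> borel_measurable ?M"
    "(\<lambda>x. (T (\<delta> n) W' x - W' x) + - ?D x) \<in> borel_measurable ?M"
    using bm[OF Tm[OF W'i, of n]] bm[OF W'm] bm[OF Vm] by simp_all
   have "sq_nn ?M (\<lambda>x. T (\<delta> n) V x - V x) \<le> 2 * sq_nn ?M (T (\<delta> n) ?D) + 2 * sq_nn ?M (\<lambda>x. (T (\<delta> n) W' x - W' x) + - ?D x)"
    unfolding dec by (rule sq_nn_add_le[OF bm[OF TD] m(3)])
   also have "... \<le> 2 * (8 * sq_nn ?M ?D) + 2 * (2 * sq_nn ?M (\<lambda>x. T (\<delta> n) W' x - W' x) + 2 * sq_nn ?M (\<lambda>x. - ?D x))"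
   proof (intro add_mono mult_left_mono sq_nn_add_le m)
    show "sq_nn ?M (T (\<delta> n) ?D) \<le> 8 * sq_nn ?M ?D"
     unfolding conv[OF TD] conv[OF Dm] by (rule smoothing_bound[OF d Dm])
   qed simp_all
   also have "... \<le> 2 * (8 * ennreal e') + 2 * (2 * ennreal e' + 2 * ennreal e')"
    unfolding norm_minus_cancel by (intro add_mono mult_left_mono N[OF n] E) simp_all
   also have "... = ennreal e"
   proof -
    have "2 * (8 * ennreal e') + 2 * (2 * ennreal e' + 2 * ennreal e') = (16 + 8) * ennreal e'"
     unfolding distrib_right by (simp add: mult.assoc[symmetric] distrib_right[symmetric])
    also have "... = ennreal (24 * e')" using e' by (simp add: ennreal_mult)
    finally have "2 * (8 * ennreal e') + 2 * (2 * ennreal e' + 2 * ennreal e') = ennreal (24 * e')" .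
    then show ?thesis by (simp add: e'_def)
   qed
   finally show "sq_nn ?M (\<lambda>x. T (\<delta> n) V x - V x) \<le> ennreal e" .
  qed
 qed
qed

end

end

section \<open>Traces and Green's formula for Sobolev fields\<close>

lemma curl_inner: "curl u x \<bullet> p = (\<Sum>i\<in>UNIV. partial i u x \<bullet> cross3 p (axis i 1))"
 by (simp add: sum_3 inner_vec_def curl_def cross3_def axis_def algebra_simps)

context convex_cell
begin

lemma smooth_L2_on_U:
 fixes f :: "real^3 => 'b::euclidean_space"
 assumes "smooth f" shows "L2_on (lebesgue_on U) f"
 using smooth_L2[OF U_bounded U_lebesgue assms] by (simp add: L2_iff)

text \<open>The averages of the field are smooth on the whole space, and up to the contraction factor their
 derivatives are the averages of the weak derivatives.\<close>

lemma H1_density: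
 assumes v: "L2 U v" and g: "!!i. has_weak_partial U i v (g i)"
 obtains \<phi> where "!!n. smooth (\<phi> n)" "L2_tendsto (lebesgue_on U) \<phi> v" "!!i. L2_tendsto (lebesgue_on U) (\<lambda>n. partial i (\<phi> n)) (g i)"
proof -
 have gL: "L2 U (g i)" for i using g by (auto simp: has_weak_partial_def)
 obtain h :: "real^3 => real" where h: "smooth h" "!!z. h z \<ge> 0" "\<forall>z. h z \<noteq> 0 --> norm z \<le> 1 / 2" "(LINT z|lborel. h z) = 1"
  by (rule smooth_kernel_exists) (rule that; (assumption | blast))
 obtain x0 where "x0 \<in> U" using ne by blast
 then obtain \<rho> where x0: "\<rho> > 0" "ball x0 \<rho> \<subseteq> U" using U_open open_contains_ball by blast
 obtain V where V: "V \<in> borel_measurable borel" "AE x in lebesgue_on U. V x = v x" "\<forall>x. x \<notin> U --> V x = 0"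
  by (rule borel_representative[OF U_borel, of v]) (use v in \<open>auto simp: L2_def\<close>)
 have "\<exists>G. G \<in> borel_measurable borel \<and> (AE x in lebesgue_on U. G x = g i x) \<and> (\<forall>x. x \<notin> U --> G x = 0)" for i
  by (rule borel_representative[OF U_borel, of "g i"]) (use gL[of i] in \<open>auto simp: L2_def\<close>)
 then have "\<forall>i. \<exists>G. G \<in> borel_measurable borel \<and> (AE x in lebesgue_on U. G x = g i x) \<and> (\<forall>x. x \<notin> U --> G x = 0)" by (rule allI)
 from choice[OF this] obtain G where
  "\<forall>i. G i \<in> borel_measurable borel \<and> (AE x in lebesgue_on U. G i x = g i x) \<and> (\<forall>x. x \<notin> U --> G i x = 0)" by (rule exE)
 then have G: "!!i. G i \<in> borel_measurable borel" "!!i. AE x in lebesgue_on U. G i x = g i x" "!!i. \<forall>x. x \<notin> U --> G i x = 0" by simp_all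
 have L2_rep: "L2 U F" if "F \<in> borel_measurable borel" "AE x in lebesgue_on U. F x = f x" "L2 U f" for F f :: "real^3 => real^3"
 proof -
  have m: "F \<in> borel_measurable (lebesgue_on U)" using that(1) by (rule borel_lebesgue_on)
  have fm: "f \<in> borel_measurable (lebesgue_on U)" "integrable (lebesgue_on U) (\<lambda>x. (norm (f x))\<^sup>2)" using that(3) by (auto simp: L2_def)
  have "integrable (lebesgue_on U) (\<lambda>x. (norm (F x))\<^sup>2)"
  proof (rule integrable_cong_AE_imp[OF fm(2)])
   show "(\<lambda>x. (norm (F x))\<^sup>2) \<in> borel_measurable (lebesgue_on U)" using m by measurable
   show "AE x in lebesgue_on U. (norm (f x))\<^sup>2 = (norm (F x))\<^sup>2" using that(2) by eventually_elim simp
  qed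
  then show ?thesis using m by (simp add: L2_def)
 qed
 have VL: "L2 U V" by (rule L2_rep[OF V(1,2) v])
 have GL: "L2 U (G i)" for i by (rule L2_rep[OF G(1,2) gL])
 let ?T = "smoothing h x0 \<rho>"
 let ?d = "\<lambda>n::nat. 1 / real (n + 2)"
 have d: "?d n > 0" "?d n < 1" for n by simp_all
 note ts = smoothing_tendsto[OF h x0(2,1)]
 have Vi: "integrable lborel V" by (rule ts(1)[OF V(1,3) VL])
 have Gi: "integrable lborel (G i)" for i by (rule ts(1)[OF G(1,3) GL])
 define \<phi> where "\<phi> n = ?T (?d n) V" for n
 have s: "smooth (\<phi> n)" for n unfolding \<phi>_def by (rule smoothing_smooth[OF h x0(2,1) d(1) Vi])
 have sG: "smooth (?T (?d n) (G i))" for n i by (rule smoothing_smooth[OF h x0(2,1) d(1) Gi])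
 have t1: "L2_tendsto (lebesgue_on U) \<phi> v"
  using ts(2)[OF V(1,3) VL] L2_tendsto_cong_AE[OF V(2)] unfolding \<phi>_def by blast
 have par: "partial i (\<phi> n) x = (1 - ?d n) *\<^sub>R ?T (?d n) (G i) x" if x: "x \<in> U" for i n x
 proof -
  let ?k = "kern h \<rho> (?d n)"
  let ?X = "?d n *\<^sub>R x0 + (1 - ?d n) *\<^sub>R x"
  have ks: "smooth ?k" "bounded {w. ?k w \<noteq> 0}"
   using kern_smooth[OF h x0(2,1)] kern_bounded_support[OF h x0(2,1) d(1)] by blast+
  have eq: "\<phi> n = (\<lambda>x. convol ?k V (?d n *\<^sub>R x0 + (1 - ?d n) *\<^sub>R x))"
   unfolding \<phi>_def by (rule ext) (rule smoothing_convol[OF h x0(2,1) d(1) V(1)])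
  have "partial i (\<phi> n) x = (1 - ?d n) *\<^sub>R partial i (convol ?k V) ?X"
   unfolding eq by (rule partial_affine) (rule smooth_differentiable[OF smooth_convol[OF ks Vi]])
  also have "partial i (convol ?k V) ?X = convol (partial i ?k) V ?X" unfolding partial_convol[OF ks Vi] ..
  also have "... = convol ?k (G i) ?X"
  proof -
   define \<theta> where "\<theta> y = ?k (?X + (-1) *\<^sub>R y)" for y
   have tf: "test_fun U \<theta>" unfolding \<theta>_def[abs_def] by (rule kern_test_fun[OF h x0(2,1) d x])
   then have cs: "smooth \<theta>" by (simp add: test_fun_def)
   have pc: "partial i \<theta> y = - partial i ?k (?X - y)" for y
    unfolding \<theta>_def[abs_def] using partial_affine[OF smooth_differentiable[OF ks(1)], of i ?X "-1" y] by simp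
   have wp: "(LINT y|lebesgue_on U. partial i \<theta> y *\<^sub>R v y) = - (LINT y|lebesgue_on U. \<theta> y *\<^sub>R g i y)"
    using g[of i] tf by (auto simp: has_weak_partial_def)
   have toU: "(LINT y|lborel. q y *\<^sub>R F y) = (LINT y|lebesgue_on U. q y *\<^sub>R f y)"
    if q: "q \<in> borel_measurable borel" and F: "F \<in> borel_measurable borel" "AE x in lebesgue_on U. F x = f x" "\<forall>x. x \<notin> U --> F x = 0" "L2 U f"
    for q and F f :: "real^3 => real^3"
   proof -
    have qf: "(\<lambda>y. q y *\<^sub>R F y) \<in> borel_measurable borel" using q F(1) by simp
    have "(LINT y|lebesgue_on U. q y *\<^sub>R F y) = (LINT y|lborel. q y *\<^sub>R F y)"
     by (rule integral_lebesgue_on_lborel[OF U_lebesgue qf]) (simp add: F(3))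
    moreover have "(LINT y|lebesgue_on U. q y *\<^sub>R F y) = (LINT y|lebesgue_on U. q y *\<^sub>R f y)"
    proof (rule integral_cong_AE)
     note q' = borel_lebesgue_on[OF q, of U] and F' = borel_lebesgue_on[OF F(1), of U]
     show "(\<lambda>y. q y *\<^sub>R F y) \<in> borel_measurable (lebesgue_on U)" using q' F' by simp
     show "(\<lambda>y. q y *\<^sub>R f y) \<in> borel_measurable (lebesgue_on U)" using q' F(4) by (auto simp: L2_def)
     show "AE y in lebesgue_on U. q y *\<^sub>R F y = q y *\<^sub>R f y" using F(2) by eventually_elim simp
    qed
    ultimately show ?thesis by simp
   qed
   have m1: "(\<lambda>y. partial i \<theta> y) \<in> borel_measurable borel" "\<theta> \<in> borel_measurable borel"
    using smooth_measurable[OF smooth_partial[OF cs]] smooth_measurable[OF cs] by simp_all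
   have "convol (partial i ?k) V ?X = - (LINT y|lborel. partial i \<theta> y *\<^sub>R V y)"
    unfolding convol_def by (simp add: pc)
   also have "... = (LINT y|lebesgue_on U. \<theta> y *\<^sub>R g i y)" using toU[OF m1(1) V v] wp by simp
   also have "... = (LINT y|lborel. \<theta> y *\<^sub>R G i y)" by (rule toU[OF m1(2) G gL, symmetric])
   also have "... = convol ?k (G i) ?X" by (simp add: convol_def \<theta>_def)
   finally show ?thesis .
  qed
  also have "... = ?T (?d n) (G i) x" by (rule smoothing_convol[OF h x0(2,1) d(1) G(1), symmetric])
  finally show ?thesis .
 qed
 have t2: "L2_tendsto (lebesgue_on U) (\<lambda>n. partial i (\<phi> n)) (g i)" for i
 proof -
  have "L2_tendsto (lebesgue_on U) (\<lambda>n x. (1 - ?d n) *\<^sub>R ?T (?d n) (G i) x) (G i)"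
  proof (rule L2_tendsto_scaleR_seq)
   show "?T (?d n) (G i) \<in> borel_measurable (lebesgue_on U)" for n
    using smooth_L2_on_U[OF sG] by (simp add: L2_on_def)
   show "L2_on (lebesgue_on U) (G i)" using GL by (simp add: L2_iff)
   show "L2_tendsto (lebesgue_on U) (\<lambda>n. ?T (?d n) (G i)) (G i)" by (rule ts(2)[OF G(1,3) GL])
   have "?d \<longlonglongrightarrow> 0" using LIMSEQ_ignore_initial_segment[OF lim_1_over_n, of 2] by simp
   then show "(\<lambda>n. 1 - ?d n) \<longlonglongrightarrow> 1" using tendsto_diff[OF tendsto_const[of 1]] by fastforce
   show "\<bar>1 - ?d n\<bar> \<le> 1" for n using d[of n] by simp
  qed
  moreover have "sq_nn (lebesgue_on U) (\<lambda>x. partial i (\<phi> n) x - G i x) = (sq_nn (lebesgue_on U) (\<lambda>x. (1 - ?d n) *\<^sub>R ?T (?d n) (G i) x - G i x))" for n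
   by (rule nn_integral_cong) (simp add: par space_restrict_space)
  ultimately have "L2_tendsto (lebesgue_on U) (\<lambda>n. partial i (\<phi> n)) (G i)" by (simp add: L2_tendsto_def)
  then show ?thesis using L2_tendsto_cong_AE[OF G(2)] by blast
 qed
 show ?thesis by (rule that[OF s t1 t2])
qed

abbreviation "face a \<equiv> restrict_space (\<sigma> a) K"

lemma face_integral: "(LINT x|face a. f x) = (face_int a (\<lambda>x. f x))" for f :: "real^3 => real"
 by (subst integral_restrict_space) auto

lemma face_finite: "a \<in> A ==> finite_measure (face a)"
 using plane_emeasure_bounded[OF _ bdd halfspaces_borel, of a]
 by (intro finite_measureI) (simp add: emeasure_restrict_space space_restrict_space)

lemma borel_imp_face_measurable: "f \<in> borel_measurable borel ==> f \<in> borel_measurable (face a)"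
 by (intro measurable_restrict_space1) (simp add: measurable_cong_sets[OF sets_plane_measure refl])

lemma smooth_L2_on_face:
 fixes f :: "real^3 => 'b::euclidean_space"
 assumes f: "smooth f" and a: "a \<in> A" shows "L2_on (face a) f"
proof -
 obtain C where C: "!!x. x \<in> K ==> norm (f x) \<le> C" using continuous_bounded_on_K[OF smooth_continuous[OF f]] by blast
 show ?thesis
  by (rule finite_measure.bounded_L2_on[OF face_finite[OF a] borel_imp_face_measurable[OF smooth_measurable[OF f]], of C])
   (rule AE_I2, simp add: space_restrict_space C)
qed

lemma trace_inequality_nn:
 obtains C where "C \<ge> 0" "!!\<phi> :: real^3 => real^3. !!a. smooth \<phi> ==> a \<in> A ==>
  sq_nn (face a) \<phi> \<le>
  ennreal C * ((sq_nn (lebesgue_on U) \<phi>) + (\<Sum>i\<in>UNIV. sq_nn (lebesgue_on U) (partial i \<phi>)))"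
proof -
 obtain C where C: "C \<ge> 0" "!!\<phi> :: real^3 => real^3. !!a. smooth \<phi> ==> a \<in> A ==>
  (face_int a (\<lambda>x. (norm (\<phi> x))\<^sup>2)) \<le>
  C * ((cell_int (\<lambda>x. (norm (\<phi> x))\<^sup>2)) + (\<Sum>i\<in>UNIV. LINT x|lborel. indicator U x * (norm (partial i \<phi> x))\<^sup>2))"
  by (rule trace_inequality) blast
 have conv: "sq_nn (lebesgue_on U) \<phi> = ennreal (cell_int (\<lambda>x. (norm (\<phi> x))\<^sup>2))"
  if "smooth \<phi>" for \<phi> :: "real^3 => real^3"
 proof -
  have m: "(\<lambda>x. indicator U x * (norm (\<phi> x))\<^sup>2) \<in> borel_measurable borel" using smooth_measurable[OF that] by measurable
  have "sq_nn (lebesgue_on U) \<phi> = ennreal (LINT x|lebesgue_on U. (norm (\<phi> x))\<^sup>2)"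
   by (rule nn_integral_eq_integral) (use smooth_L2_on_U[OF that] in \<open>auto simp: L2_on_def\<close>)
  also have "(LINT x|lebesgue_on U. (norm (\<phi> x))\<^sup>2) = (LINT x|lebesgue_on U. indicator U x * (norm (\<phi> x))\<^sup>2)"
   by (intro lint_cong refl) (simp add: space_restrict_space)
  also have "... = (cell_int (\<lambda>x. (norm (\<phi> x))\<^sup>2))"
   by (rule integral_lebesgue_on_lborel[OF U_lebesgue m]) simp
  finally show ?thesis .
 qed
 have convf: "sq_nn (face a) \<phi> = ennreal (face_int a (\<lambda>x. (norm (\<phi> x))\<^sup>2))"
  if "smooth \<phi>" "a \<in> A" for \<phi> :: "real^3 => real^3" and a
  unfolding face_integral[symmetric]
  by (rule nn_integral_eq_integral) (use smooth_L2_on_face[OF that] in \<open>auto simp: L2_on_def\<close>)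
 have nn: "(cell_int (\<lambda>x. (norm (\<phi> x))\<^sup>2)) \<ge> 0" for \<phi> :: "real^3 => real^3"
  by (rule integral_nonneg_AE) simp
 show ?thesis
 proof (rule that[OF C(1)])
  fix \<phi> :: "real^3 => real^3" and a assume phi: "smooth \<phi>" and a: "a \<in> A"
  have s: "(\<Sum>i\<in>UNIV. sq_nn (lebesgue_on U) (partial i \<phi>)) = ennreal (\<Sum>i\<in>UNIV. LINT x|lborel. indicator U x * (norm (partial i \<phi> x))\<^sup>2)"
   by (simp add: conv smooth_partial phi sum_ennreal nn)
  show "sq_nn (face a) \<phi> \<le>
   ennreal C * ((sq_nn (lebesgue_on U) \<phi>) + (\<Sum>i\<in>UNIV. sq_nn (lebesgue_on U) (partial i \<phi>)))"
   unfolding convf[OF phi a] conv[OF phi] s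
   using C(2)[OF phi a] C(1) nn
   by (simp add: ennreal_plus[symmetric] ennreal_mult[symmetric] sum_nonneg ennreal_leI del: ennreal_plus)
 qed
qed

lemma partial_diff_smooth:
 assumes "smooth f" "smooth g" shows "partial i (\<lambda>x. f x - g x) x = partial i f x - partial i g x"
proof -
 have "partial i (\<lambda>x. f x + - g x) x = partial i f x + partial i (\<lambda>x. - g x) x"
  by (intro partial_add smooth_differentiable smooth_uminus assms)
 moreover have "partial i (\<lambda>x. - g x) x = - partial i g x"
  by (rule partial_bounded_linear[OF bounded_linear_minus[OF bounded_linear_ident] smooth_differentiable[OF assms(2)]])
 ultimately show ?thesis by simp
qed

text \<open>By the trace inequality smooth fields that tend to zero in the Sobolev norm of the cell tend to
 zero in the mean square norm of each face. Applied to the differences of a convergent sequence this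
 yields the existence of traces, applied to the difference of two sequences their uniqueness.\<close>

lemma face_tendsto_zero:
 fixes \<phi> :: "'i => real^3 => real^3"
 assumes phi: "!!j. smooth (\<phi> j)" and a: "a \<in> A"
  and t: "((\<lambda>j. sq_nn (lebesgue_on U) (\<phi> j)) \<longlongrightarrow> 0) F" "!!i. ((\<lambda>j. sq_nn (lebesgue_on U) (partial i (\<phi> j))) \<longlongrightarrow> 0) F"
 shows "((\<lambda>j. sq_nn (face a) (\<phi> j)) \<longlongrightarrow> 0) F"
proof -
 obtain C where C: "C \<ge> 0" "!!\<phi> :: real^3 => real^3. !!a. smooth \<phi> ==> a \<in> A ==>
  sq_nn (face a) \<phi> \<le> ennreal C * (sq_nn (lebesgue_on U) \<phi> + (\<Sum>i\<in>UNIV. sq_nn (lebesgue_on U) (partial i \<phi>)))"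
  by (rule trace_inequality_nn) blast
 have "((\<lambda>j. ennreal C * (sq_nn (lebesgue_on U) (\<phi> j) + (\<Sum>i\<in>UNIV. sq_nn (lebesgue_on U) (partial i (\<phi> j)))))
   \<longlongrightarrow> ennreal C * (0 + (\<Sum>i\<in>(UNIV::3 set). 0))) F"
  by (intro ennreal_tendsto_cmult tendsto_add tendsto_sum t) simp
 then have lim: "((\<lambda>j. ennreal C * (sq_nn (lebesgue_on U) (\<phi> j) + (\<Sum>i\<in>UNIV. sq_nn (lebesgue_on U) (partial i (\<phi> j))))) \<longlongrightarrow> 0) F" by simp
 show ?thesis by (rule tendsto_sandwich[OF _ _ tendsto_const lim]) (use C(2)[OF phi a] in simp_all)
qed

lemma trace_exists:
 assumes phi: "!!n. smooth (\<phi> n)" and v: "L2_on (lebesgue_on U) v" and g: "!!i. L2_on (lebesgue_on U) (g i)"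
  and t: "L2_tendsto (lebesgue_on U) \<phi> v" "!!i. L2_tendsto (lebesgue_on U) (\<lambda>n. partial i (\<phi> n)) (g i)" and a: "a \<in> A"
 obtains \<tau> where "\<tau> \<in> borel_measurable borel" "L2_on (face a) \<tau>" "L2_tendsto (face a) \<phi> (\<tau> :: real^3 => real^3)"
proof -
 have pm: "\<phi> n \<in> borel_measurable (lebesgue_on U)" "partial i (\<phi> n) \<in> borel_measurable (lebesgue_on U)" for n i
  using smooth_L2_on_U[OF phi] smooth_L2_on_U[OF smooth_partial[OF phi]] by (simp_all add: L2_on_def)
 have gm: "v \<in> borel_measurable (lebesgue_on U)" "g i \<in> borel_measurable (lebesgue_on U)" for i
  using v g by (simp_all add: L2_on_def)
 have fm: "\<phi> n \<in> borel_measurable (face a)" for n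
  using smooth_L2_on_face[OF phi a] by (simp add: L2_on_def)
 have cauchy: "L2_cauchy (face a) \<phi>" unfolding L2_cauchy_def
 proof (rule face_tendsto_zero[OF smooth_diff[OF phi phi] a])
  show "((\<lambda>p. sq_nn (lebesgue_on U) (\<lambda>x. \<phi> (fst p) x - \<phi> (snd p) x)) \<longlongrightarrow> 0) (sequentially \<times>\<^sub>F sequentially)"
   using L2_tendsto_imp_cauchy[OF pm(1) gm(1) t(1)] by (simp add: L2_cauchy_def)
  show "((\<lambda>p. sq_nn (lebesgue_on U) (partial i (\<lambda>x. \<phi> (fst p) x - \<phi> (snd p) x))) \<longlongrightarrow> 0) (sequentially \<times>\<^sub>F sequentially)" for i
   using L2_tendsto_imp_cauchy[OF pm(2) gm(2) t(2), of i] by (simp add: L2_cauchy_def partial_diff_smooth[OF phi phi])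
 qed
 obtain \<tau> where tau: "\<tau> \<in> borel_measurable (face a)" "L2_tendsto (face a) \<phi> \<tau>"
  by (rule L2_complete[OF fm cauchy])
 define \<tau>' where "\<tau>' x = indicator K x *\<^sub>R \<tau> x" for x
 have b: "\<tau>' \<in> borel_measurable borel"
  using tau(1) unfolding \<tau>'_def by (subst (asm) borel_measurable_restrict_space_iff) (auto simp: measurable_cong_sets[OF sets_plane_measure refl])
 have ae: "AE x in face a. \<tau> x = \<tau>' x" by (rule AE_I2) (simp add: \<tau>'_def space_restrict_space)
 have lim: "L2_tendsto (face a) \<phi> \<tau>'" using tau(2) L2_tendsto_cong_AE[OF ae] by blast
 have "L2_on (face a) \<tau>'"
 proof -
  have "\<forall>\<^sub>F n in sequentially. sq_nn (face a) (\<lambda>x. \<phi> n x - \<tau>' x) < 1"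
   using lim unfolding L2_tendsto_def by (rule order_tendstoD) simp
  then obtain n where n: "sq_nn (face a) (\<lambda>x. \<phi> n x - \<tau>' x) < 1" by (auto simp: eventually_sequentially)
  have m: "\<tau>' \<in> borel_measurable (face a)" by (rule borel_imp_face_measurable[OF b])
  have "integrable (face a) (\<lambda>x. (norm (\<phi> n x - \<tau>' x))\<^sup>2)"
   by (rule integrableI_nonneg) (use m fm[of n] less_trans[OF n ennreal_one_less_top] in auto)
  then have "L2_on (face a) (\<lambda>x. \<phi> n x - \<tau>' x)" using m fm[of n] by (simp add: L2_on_def)
  from L2_on_diff[OF smooth_L2_on_face[OF phi[of n] a] this] show ?thesis by simp
 qed
 then show ?thesis using that b lim by blast
qed

lemma traces_close:
 assumes phi: "!!n. smooth (\<phi> n)" "!!n. smooth (\<phi>' n)" and v: "v \<in> borel_measurable (lebesgue_on U)" and g: "!!i. g i \<in> borel_measurable (lebesgue_on U)"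
  and t: "L2_tendsto (lebesgue_on U) \<phi> v" "!!i. L2_tendsto (lebesgue_on U) (\<lambda>n. partial i (\<phi> n)) (g i)"
  and t': "L2_tendsto (lebesgue_on U) \<phi>' v" "!!i. L2_tendsto (lebesgue_on U) (\<lambda>n. partial i (\<phi>' n)) (g i)" and a: "a \<in> A"
 shows "L2_tendsto (face a) (\<lambda>n x. \<phi> n x - \<phi>' n x) (\<lambda>x. 0 :: real^3)"
proof -
 have pm: "f \<in> borel_measurable (lebesgue_on U)" if "smooth f" for f :: "real^3 => real^3"
  using smooth_L2_on_U[OF that] by (simp add: L2_on_def)
 have "(\<lambda>n. sq_nn (face a) (\<lambda>x. \<phi> n x - \<phi>' n x)) \<longlonglongrightarrow> 0"
 proof (rule face_tendsto_zero[OF smooth_diff[OF phi] a])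
  show "(\<lambda>n. sq_nn (lebesgue_on U) (\<lambda>x. \<phi> n x - \<phi>' n x)) \<longlonglongrightarrow> 0"
   using L2_tendsto_diff[OF pm[OF phi(1)] pm[OF phi(2)] v v t(1) t'(1)] by (simp add: L2_tendsto_def)
  show "(\<lambda>n. sq_nn (lebesgue_on U) (partial i (\<lambda>x. \<phi> n x - \<phi>' n x))) \<longlonglongrightarrow> 0" for i
   using L2_tendsto_diff[OF pm[OF smooth_partial[OF phi(1)]] pm[OF smooth_partial[OF phi(2)]] g g t(2)[of i] t'(2)[of i]]
   by (simp add: L2_tendsto_def partial_diff_smooth[OF phi])
 qed
 then show ?thesis by (simp add: L2_tendsto_def)
qed

text \<open>Green's formula for smooth fields passes to the limit in all three terms. The curls of the
 approximating fields converge to the field formed from the weak partial derivatives, which is the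
 weak curl by the fundamental lemma.\<close>

lemma green_curl_trace:
 assumes phi: "!!n. smooth (\<phi> n)" and v: "L2_on (lebesgue_on U) v" and g: "!!i. L2_on (lebesgue_on U) (g i)"
  and t: "L2_tendsto (lebesgue_on U) \<phi> v" "!!i. L2_tendsto (lebesgue_on U) (\<lambda>n. partial i (\<phi> n)) (g i)"
  and tau: "!!a. a \<in> A ==> L2_on (face a) (\<tau> a)" "!!a. a \<in> A ==> L2_tendsto (face a) \<phi> (\<tau> a)"
  and c: "has_weak_curl U v c" and p: "smooth p"
 shows "(LINT x|lebesgue_on U. c x \<bullet> p x) - (LINT x|lebesgue_on U. v x \<bullet> curl p x) = (\<Sum>a\<in>A. LINT x|face a. cross3 a (\<tau> a x) \<bullet> p x)"
proof -
 let ?M = "lebesgue_on U"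
 define cg where "cg x = (\<Sum>i\<in>UNIV. cross3 (axis i 1) (g i x))" for x
 have tri: "cross3 a u \<bullet> q = u \<bullet> cross3 q a" for a u q
  by (simp add: cross3_def inner_vec_def sum_3 algebra_simps)
 have cgL: "L2_on ?M cg"
 proof -
  have "L2_on ?M (\<lambda>x. cross3 (axis i 1) (g i x))" for i
   by (rule L2_on_bounded_linear[OF g bounded_bilinear.bounded_linear_right[OF bounded_bilinear_cross3]])
  then have "L2_on ?M (\<lambda>x. cross3 (axis 1 1) (g 1 x) + cross3 (axis 2 1) (g 2 x) + cross3 (axis 3 1) (g 3 x))"
   by (intro L2_on_add)
  then show ?thesis unfolding cg_def[abs_def] sum_3 .
 qed
 have sq: "L2_on ?M (\<lambda>x. cross3 (q x) (axis i 1))" if "smooth q" for q i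
  by (rule L2_on_bounded_linear[OF smooth_L2_on_U[OF that] bounded_bilinear.bounded_linear_left[OF bounded_bilinear_cross3]])
 have cg_int: "(LINT x|?M. cg x \<bullet> q x) = (\<Sum>i\<in>UNIV. LINT x|?M. g i x \<bullet> cross3 (q x) (axis i 1))" if q: "smooth q" for q
 proof -
  have "(LINT x|?M. cg x \<bullet> q x) = (LINT x|?M. (\<Sum>i\<in>UNIV. g i x \<bullet> cross3 (q x) (axis i 1)))"
   by (simp add: cg_def inner_sum_left tri)
  also have "... = (\<Sum>i\<in>UNIV. LINT x|?M. g i x \<bullet> cross3 (q x) (axis i 1))"
   by (intro Bochner_Integration.integral_sum L2_on_inner g sq q)
  finally show ?thesis .
 qed
 have lim1: "(\<lambda>n. LINT x|?M. curl (\<phi> n) x \<bullet> q x) \<longlonglongrightarrow> (LINT x|?M. cg x \<bullet> q x)" if q: "smooth q" for q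
 proof -
  have "(LINT x|?M. curl (\<phi> n) x \<bullet> q x) = (\<Sum>i\<in>UNIV. LINT x|?M. partial i (\<phi> n) x \<bullet> cross3 (q x) (axis i 1))" for n
   unfolding curl_inner
   by (intro Bochner_Integration.integral_sum L2_on_inner smooth_L2_on_U smooth_partial phi sq q)
  then show ?thesis unfolding cg_int[OF q]
   by (simp only:) (intro tendsto_sum L2_tendsto_integral_inner smooth_L2_on_U smooth_partial phi g sq q t)
 qed
 have lim2: "(\<lambda>n. LINT x|?M. \<phi> n x \<bullet> curl q x) \<longlonglongrightarrow> (LINT x|?M. v x \<bullet> curl q x)" if q: "smooth q" for q
  by (intro L2_tendsto_integral_inner smooth_L2_on_U phi v curl_smooth q t)
 have ae: "AE x in ?M. cg x = c x"
 proof (rule fundamental_lemma_L2[OF U_open U_bounded])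
  show "L2 U cg" using cgL by (simp add: L2_iff)
  show "L2 U c" using c by (simp add: has_weak_curl_def)
  fix q :: "real^3 => real^3" assume q: "test_fun U q"
  have qs: "smooth q" "bounded {x. q x \<noteq> 0}" using q by (simp_all add: test_fun_alt)
  have conv: "(LINT x|?M. f x \<bullet> r x) = (LINT x|lborel. f x \<bullet> r x)" if "smooth f" "test_fun U r" for f r :: "real^3 => real^3"
   by (rule integral_lebesgue_on_lborel[OF U_lebesgue])
    (use that test_fun_outside[OF that(2)] in \<open>auto simp: test_fun_def intro!: smooth_measurable smooth_inner\<close>)
  have "(LINT x|?M. curl (\<phi> n) x \<bullet> q x) = (LINT x|?M. \<phi> n x \<bullet> curl q x)" for n
   unfolding conv[OF curl_smooth[OF phi] q] conv[OF phi test_fun_curl[OF q]]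
   by (rule integral_curl_by_parts[OF phi qs(1)]) (use qs in simp)
  then have "(LINT x|?M. cg x \<bullet> q x) = (LINT x|?M. v x \<bullet> curl q x)"
   using LIMSEQ_unique[OF lim1[OF qs(1)]] lim2[OF qs(1)] by simp
  also have "... = (LINT x|?M. c x \<bullet> q x)" using c q by (simp add: has_weak_curl_def)
  finally show "(LINT x|?M. cg x \<bullet> q x) = (LINT x|?M. c x \<bullet> q x)" .
 qed
 have ps: "L2_on ?M p" by (rule smooth_L2_on_U[OF p])
 have cp: "(LINT x|?M. cg x \<bullet> p x) = (LINT x|?M. c x \<bullet> p x)"
 proof (rule integral_cong_AE)
  show "(\<lambda>x. cg x \<bullet> p x) \<in> borel_measurable ?M" using L2_on_inner[OF cgL ps] by (rule borel_measurable_integrable)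
  have "L2_on ?M c" using c by (simp add: has_weak_curl_def L2_iff)
  from L2_on_inner[OF this ps] show "(\<lambda>x. c x \<bullet> p x) \<in> borel_measurable ?M" by (rule borel_measurable_integrable)
  show "AE x in ?M. cg x \<bullet> p x = c x \<bullet> p x" using ae by eventually_elim simp
 qed
 have lhs: "(\<lambda>n. (LINT x|?M. curl (\<phi> n) x \<bullet> p x) - (LINT x|?M. \<phi> n x \<bullet> curl p x)) \<longlonglongrightarrow> (LINT x|?M. c x \<bullet> p x) - (LINT x|?M. v x \<bullet> curl p x)"
  unfolding cp[symmetric] by (intro tendsto_diff lim1 lim2 p)
 have pf: "L2_on (face a) (\<lambda>x. cross3 (p x) a)" if "a \<in> A" for a
  by (rule L2_on_bounded_linear[OF smooth_L2_on_face[OF p that] bounded_bilinear.bounded_linear_left[OF bounded_bilinear_cross3]])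
 have rhs: "(\<lambda>n. \<Sum>a\<in>A. LINT x|face a. cross3 a (\<phi> n x) \<bullet> p x) \<longlonglongrightarrow> (\<Sum>a\<in>A. LINT x|face a. cross3 a (\<tau> a x) \<bullet> p x)"
  unfolding tri by (intro tendsto_sum L2_tendsto_integral_inner smooth_L2_on_face phi tau pf)
 have eq: "(LINT x|?M. curl (\<phi> n) x \<bullet> p x) - (LINT x|?M. \<phi> n x \<bullet> curl p x) = (\<Sum>a\<in>A. LINT x|face a. cross3 a (\<phi> n x) \<bullet> p x)" for n
 proof -
  have i: "integrable ?M (\<lambda>x. curl (\<phi> n) x \<bullet> p x)" "integrable ?M (\<lambda>x. \<phi> n x \<bullet> curl p x)"
   by (intro L2_on_inner smooth_L2_on_U curl_smooth phi p)+
  have m: "(\<lambda>x. indicator U x * (curl (\<phi> n) x \<bullet> p x - \<phi> n x \<bullet> curl p x)) \<in> borel_measurable borel"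
   using smooth_measurable[OF smooth_diff[OF smooth_inner[OF curl_smooth[OF phi] p] smooth_inner[OF phi curl_smooth[OF p]]]] by measurable
  have "(LINT x|?M. curl (\<phi> n) x \<bullet> p x) - (LINT x|?M. \<phi> n x \<bullet> curl p x) = (LINT x|?M. curl (\<phi> n) x \<bullet> p x - \<phi> n x \<bullet> curl p x)"
   using i by simp
  also have "... = (LINT x|?M. indicator U x * (curl (\<phi> n) x \<bullet> p x - \<phi> n x \<bullet> curl p x))"
   by (intro lint_cong refl) (simp add: space_restrict_space)
  also have "... = (cell_int (\<lambda>x. curl (\<phi> n) x \<bullet> p x - \<phi> n x \<bullet> curl p x))"
   by (rule integral_lebesgue_on_lborel[OF U_lebesgue m]) simp
  also have "... = (\<Sum>a\<in>A. LINT x|\<sigma> a. indicator K x * (cross3 a (\<phi> n x) \<bullet> p x))" by (rule green_curl_smooth[OF phi p])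
  finally show ?thesis by (simp only: face_integral)
 qed
 show ?thesis using LIMSEQ_unique[OF lhs] rhs unfolding eq by blast
qed

end

section \<open>The Clarke directional derivative\<close>

definition diff_quot :: "(real^3 => real) => real^3 => (real^3) \<times> real => real" where
 "diff_quot g \<zeta> z = (g (fst z + snd z *\<^sub>R \<zeta>) - g (fst z)) / snd z"

abbreviation clarke_filter :: "real^3 => ((real^3) \<times> real) filter" where
 "clarke_filter \<xi> \<equiv> nhds \<xi> \<times>\<^sub>F at_right 0"

lemma clarke_filter_nontrivial: "clarke_filter \<xi> \<noteq> bot"
 by (simp add: prod_filter_eq_bot trivial_limit_at_right_real)

lemma eventually_clarke_filter:
 "eventually P (clarke_filter \<xi>) \<longleftrightarrow> (\<exists>r>0. \<forall>w t. dist w \<xi> < r --> 0 < t --> t < r --> P (w, t))"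
proof
 assume "eventually P (clarke_filter \<xi>)"
 then obtain Pf Pg where P: "eventually Pf (nhds \<xi>)" "eventually Pg (at_right (0::real))" "!!x y. Pf x ==> Pg y ==> P (x, y)"
  unfolding eventually_prod_filter by blast
 obtain r1 where r1: "r1 > 0" "!!w. dist w \<xi> < r1 ==> Pf w" using P(1) unfolding eventually_nhds_metric by blast
 obtain r2 where r2: "r2 > 0" "!!t. 0 < t ==> t < r2 ==> Pg t" using P(2) unfolding eventually_at_right_field by blast
 show "\<exists>r>0. \<forall>w t. dist w \<xi> < r --> 0 < t --> t < r --> P (w, t)"
  by (rule exI[of _ "min r1 r2"]) (use r1 r2 P(3) in auto)
next
 assume "\<exists>r>0. \<forall>w t. dist w \<xi> < r --> 0 < t --> t < r --> P (w, t)"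
 then obtain r where r: "r > 0" "!!w t. dist w \<xi> < r ==> 0 < t ==> t < r ==> P (w, t)" by blast
 have "eventually (\<lambda>w. dist w \<xi> < r) (nhds \<xi>)" unfolding eventually_nhds_metric using r(1) by blast
 moreover have "eventually (\<lambda>t. 0 < t \<and> t < r) (at_right (0::real))"
  unfolding eventually_at_right_field using r(1) by blast
 ultimately show "eventually P (clarke_filter \<xi>)" unfolding eventually_prod_filter using r(2) by blast
qed

lemma diff_quot_bounded:
 assumes "locally_lipschitz g"
 obtains L where "L \<ge> 0" "\<forall>\<^sub>F z in clarke_filter \<xi>. \<bar>diff_quot g \<zeta> z\<bar> \<le> L"
proof -
 obtain r L where r: "r > 0" and L: "L-lipschitz_on (ball \<xi> r) g"
  using assms unfolding locally_lipschitz_def by blast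
 have L0: "L \<ge> 0" using L by (rule lipschitz_on_nonneg)
 define \<rho> where "\<rho> = r / (2 * (norm \<zeta> + 1))"
 have np: "norm \<zeta> + 1 > 0" by (simp add: add_nonneg_pos)
 have rho: "\<rho> > 0" using r np by (simp add: \<rho>_def)
 have rho2: "\<rho> * norm \<zeta> \<le> r / 2" "\<rho> \<le> r / 2"
 proof -
  have e: "\<rho> * (norm \<zeta> + 1) = r / 2" using np by (simp add: \<rho>_def field_simps)
  have "\<rho> * norm \<zeta> \<ge> 0" using rho by simp
  then show "\<rho> * norm \<zeta> \<le> r / 2" "\<rho> \<le> r / 2" using e rho unfolding distrib_left mult_1_right by linarith+
 qed
 have "\<bar>diff_quot g \<zeta> (w, t)\<bar> \<le> L * norm \<zeta>" if w: "dist w \<xi> < \<rho>" and t: "0 < t" "t < \<rho>" for w t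
 proof -
  have "t * norm \<zeta> \<le> \<rho> * norm \<zeta>" using t by (intro mult_right_mono) auto
  then have tz: "t * norm \<zeta> \<le> r / 2" using rho2 by linarith
  have "w \<in> ball \<xi> r" using w rho2 r by (simp add: dist_commute)
  moreover have "dist \<xi> (w + t *\<^sub>R \<zeta>) \<le> dist \<xi> w + dist w (w + t *\<^sub>R \<zeta>)" by (rule dist_triangle)
  then have "w + t *\<^sub>R \<zeta> \<in> ball \<xi> r" using w rho2 tz t by (simp add: dist_commute dist_norm)
  ultimately have "dist (g (w + t *\<^sub>R \<zeta>)) (g w) \<le> L * dist (w + t *\<^sub>R \<zeta>) w" using lipschitz_onD[OF L] by blast
  then have "\<bar>g (w + t *\<^sub>R \<zeta>) - g w\<bar> \<le> (L * norm \<zeta>) * t" using t by (simp add: dist_norm mult_ac)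
  then show ?thesis using t by (simp add: diff_quot_def pos_divide_le_eq)
 qed
 then have "\<forall>\<^sub>F z in clarke_filter \<xi>. \<bar>diff_quot g \<zeta> z\<bar> \<le> L * norm \<zeta>"
  unfolding eventually_clarke_filter using rho by blast
 then show ?thesis using that[of "L * norm \<zeta>"] L0 by simp
qed

text \<open>The difference quotients of a locally Lipschitz function are bounded near the point, hence the
 upper limit is finite and the conversion to a real number loses nothing.\<close>

lemma clarke_dd_ereal:
 assumes "locally_lipschitz g"
 shows "ereal (clarke_dd g \<xi> \<zeta>) = Limsup (clarke_filter \<xi>) (\<lambda>z. ereal (diff_quot g \<zeta> z))"
proof -
 let ?S = "Limsup (clarke_filter \<xi>) (\<lambda>z. ereal (diff_quot g \<zeta> z))"
 obtain L where L: "\<forall>\<^sub>F z in clarke_filter \<xi>. \<bar>diff_quot g \<zeta> z\<bar> \<le> L" using diff_quot_bounded[OF assms] by blast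
 have "?S \<le> ereal L" by (rule Limsup_bounded) (use L in \<open>auto elim: eventually_mono\<close>)
 moreover have "ereal (- L) \<le> Liminf (clarke_filter \<xi>) (\<lambda>z. ereal (diff_quot g \<zeta> z))"
  by (rule Liminf_bounded) (use L in \<open>auto elim: eventually_mono\<close>)
 moreover have "... \<le> ?S" by (rule Liminf_le_Limsup[OF clarke_filter_nontrivial])
 ultimately have "\<bar>?S\<bar> \<noteq> \<infinity>" by (cases ?S) auto
 moreover have "clarke_dd g \<xi> \<zeta> = real_of_ereal ?S"
  by (simp add: clarke_dd_def diff_quot_def split_def)
 ultimately show ?thesis by (simp add: ereal_real')
qed

lemma clarke_dd_lessD:
 assumes "locally_lipschitz g" "clarke_dd g \<xi> \<zeta> < c"
 shows "\<forall>\<^sub>F z in clarke_filter \<xi>. diff_quot g \<zeta> z < c"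
proof -
 have "Limsup (clarke_filter \<xi>) (\<lambda>z. ereal (diff_quot g \<zeta> z)) < ereal c"
  using assms clarke_dd_ereal[OF assms(1), of \<xi> \<zeta>] by (metis ereal_less_eq(3) not_le)
 from Limsup_lessD[OF this] show ?thesis by simp
qed

lemma clarke_dd_leI:
 assumes "locally_lipschitz g" "\<forall>\<^sub>F z in clarke_filter \<xi>. diff_quot g \<zeta> z \<le> c"
 shows "clarke_dd g \<xi> \<zeta> \<le> c"
proof -
 have "Limsup (clarke_filter \<xi>) (\<lambda>z. ereal (diff_quot g \<zeta> z)) \<le> ereal c"
  by (rule Limsup_bounded) (use assms(2) in simp)
 then show ?thesis unfolding clarke_dd_ereal[OF assms(1), symmetric] by simp
qed

text \<open>The quotient in direction \<open>\<zeta>1 + \<zeta>2\<close> splits into one in direction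
 \<open>\<zeta>1\<close> at \<open>w\<close> and one in direction \<open>\<zeta>2\<close> at the
 shifted point \<open>w + t \<zeta>1\<close>, which is again close to \<open>\<xi>\<close>.\<close>

lemma clarke_dd_subadditive:
 assumes g: "locally_lipschitz g"
 shows "clarke_dd g \<xi> (\<zeta>1 + \<zeta>2) \<le> clarke_dd g \<xi> \<zeta>1 + clarke_dd g \<xi> \<zeta>2"
proof (rule field_le_epsilon)
 fix e :: real assume e: "e > 0"
 let ?c1 = "clarke_dd g \<xi> \<zeta>1 + e / 2" and ?c2 = "clarke_dd g \<xi> \<zeta>2 + e / 2"
 have "\<forall>\<^sub>F z in clarke_filter \<xi>. diff_quot g \<zeta>1 z < ?c1" "\<forall>\<^sub>F z in clarke_filter \<xi>. diff_quot g \<zeta>2 z < ?c2"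
  using e by (intro clarke_dd_lessD[OF g]; simp)+
 then obtain r1 r2 where r1: "r1 > 0" "!!w t. dist w \<xi> < r1 ==> 0 < t ==> t < r1 ==> diff_quot g \<zeta>1 (w, t) < ?c1"
  and r2: "r2 > 0" "!!w t. dist w \<xi> < r2 ==> 0 < t ==> t < r2 ==> diff_quot g \<zeta>2 (w, t) < ?c2"
  unfolding eventually_clarke_filter by blast
 define r where "r = min r1 (r2 / (norm \<zeta>1 + 1))"
 have np: "norm \<zeta>1 + 1 > 0" by (simp add: add_nonneg_pos)
 have r: "r > 0" using r1 r2 np by (simp add: r_def)
 have rle: "r * (norm \<zeta>1 + 1) \<le> r2"
 proof -
  have "r \<le> r2 / (norm \<zeta>1 + 1)" by (simp add: r_def)
  then show ?thesis using np by (simp add: pos_le_divide_eq)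
 qed
 have "diff_quot g (\<zeta>1 + \<zeta>2) (w, t) \<le> ?c1 + ?c2" if w: "dist w \<xi> < r" and t: "0 < t" "t < r" for w t
 proof -
  have "t * norm \<zeta>1 \<le> r * norm \<zeta>1" using t by (intro mult_right_mono) auto
  moreover have "dist (w + t *\<^sub>R \<zeta>1) \<xi> \<le> dist w \<xi> + t * norm \<zeta>1"
   using dist_triangle[of "w + t *\<^sub>R \<zeta>1" \<xi> w] t by (simp add: dist_norm)
  ultimately have "dist (w + t *\<^sub>R \<zeta>1) \<xi> < r2" using w rle by (simp add: distrib_left)
  moreover have "r \<le> r2"
  proof -
   have "r * 1 \<le> r * (norm \<zeta>1 + 1)" using r by (intro mult_left_mono) auto
   then show ?thesis using rle by simp
  qed
  ultimately have "diff_quot g \<zeta>2 (w + t *\<^sub>R \<zeta>1, t) < ?c2" using r2(2) t by auto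
  moreover have "diff_quot g \<zeta>1 (w, t) < ?c1" using r1(2)[of w t] w t by (simp add: r_def)
  moreover have "diff_quot g (\<zeta>1 + \<zeta>2) (w, t) = diff_quot g \<zeta>2 (w + t *\<^sub>R \<zeta>1, t) + diff_quot g \<zeta>1 (w, t)"
   by (simp add: diff_quot_def add_divide_distrib[symmetric] scaleR_add_right add.assoc)
  ultimately show ?thesis by linarith
 qed
 then have "\<forall>\<^sub>F z in clarke_filter \<xi>. diff_quot g (\<zeta>1 + \<zeta>2) z \<le> ?c1 + ?c2"
  unfolding eventually_clarke_filter using r by blast
 from clarke_dd_leI[OF g this] show "clarke_dd g \<xi> (\<zeta>1 + \<zeta>2) \<le> clarke_dd g \<xi> \<zeta>1 + clarke_dd g \<xi> \<zeta>2 + e" by simp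
qed

lemma clarke_dd_zero:
 assumes g: "locally_lipschitz g" shows "clarke_dd g \<xi> 0 = 0"
 using clarke_dd_ereal[OF g, of \<xi> 0] clarke_filter_nontrivial[of \<xi>]
 by (simp add: diff_quot_def Limsup_const zero_ereal_def)

lemma clarke_dd_scale:
 assumes g: "locally_lipschitz g" and s: "s > 0"
 shows "clarke_dd g \<xi> (s *\<^sub>R \<zeta>) = s * clarke_dd g \<xi> \<zeta>"
proof -
 have le: "clarke_dd g \<xi> (s *\<^sub>R \<zeta>) \<le> s * clarke_dd g \<xi> \<zeta>" if s: "s > 0" for s \<zeta>
 proof (rule field_le_epsilon)
  fix e :: real assume e: "e > 0"
  have "\<forall>\<^sub>F z in clarke_filter \<xi>. diff_quot g \<zeta> z < clarke_dd g \<xi> \<zeta> + e / s"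
   using e s by (intro clarke_dd_lessD[OF g]) simp
  then obtain r where r: "r > 0" "!!w t. dist w \<xi> < r ==> 0 < t ==> t < r ==> diff_quot g \<zeta> (w, t) < clarke_dd g \<xi> \<zeta> + e / s"
   unfolding eventually_clarke_filter by blast
  have "diff_quot g (s *\<^sub>R \<zeta>) (w, t) \<le> s * clarke_dd g \<xi> \<zeta> + e"
   if w: "dist w \<xi> < min r (r / s)" and t: "0 < t" "t < min r (r / s)" for w t
  proof -
   have "t < r / s" using t by simp
   then have "t * s < r" using s by (simp add: pos_less_divide_eq)
   then have "diff_quot g \<zeta> (w, t * s) < clarke_dd g \<xi> \<zeta> + e / s" using r(2)[of w "t * s"] w t s by simp
   moreover have "diff_quot g (s *\<^sub>R \<zeta>) (w, t) = s * diff_quot g \<zeta> (w, t * s)"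
    using s t by (simp add: diff_quot_def)
   ultimately have "diff_quot g (s *\<^sub>R \<zeta>) (w, t) < s * (clarke_dd g \<xi> \<zeta> + e / s)" using s by simp
   also have "... = s * clarke_dd g \<xi> \<zeta> + e" using s by (simp add: distrib_left)
   finally show ?thesis by simp
  qed
  then have "\<forall>\<^sub>F z in clarke_filter \<xi>. diff_quot g (s *\<^sub>R \<zeta>) z \<le> s * clarke_dd g \<xi> \<zeta> + e"
   unfolding eventually_clarke_filter using r(1) s by (intro exI[of _ "min r (r / s)"]) auto
  from clarke_dd_leI[OF g this] show "clarke_dd g \<xi> (s *\<^sub>R \<zeta>) \<le> s * clarke_dd g \<xi> \<zeta> + e" .
 qed
 have "clarke_dd g \<xi> ((1 / s) *\<^sub>R (s *\<^sub>R \<zeta>)) \<le> (1 / s) * clarke_dd g \<xi> (s *\<^sub>R \<zeta>)"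
  by (rule le) (use s in simp)
 then have "s * clarke_dd g \<xi> \<zeta> \<le> clarke_dd g \<xi> (s *\<^sub>R \<zeta>)" using s by (simp add: field_simps)
 then show ?thesis using le[OF s, of \<zeta>] by linarith
qed

text \<open>A finite dimensional Hahn--Banach argument: the open epigraph of a sublinear function and a
 point of its graph are separated by a hyperplane, which is not vertical; homogeneity makes the
 affine minorant linear.\<close>

lemma sublinear_supported:
 fixes q :: "real^3 => real"
 assumes sub: "!!x y. q (x + y) \<le> q x + q y" and hom: "!!s x. s > 0 ==> q (s *\<^sub>R x) = s * q x" and q0: "q 0 = 0"
 shows "\<exists>\<eta>. (\<forall>x. \<eta> \<bullet> x \<le> q x) \<and> \<eta> \<bullet> \<zeta> = q \<zeta>"
proof -
 define S where "S = {z :: (real^3) \<times> real. q (fst z) < snd z}"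
 have "convex S"
 proof (rule convexI)
  fix x y :: "(real^3) \<times> real" and u v :: real
  assume x: "x \<in> S" and y: "y \<in> S" and uv: "0 \<le> u" "0 \<le> v" "u + v = 1"
  have h: "q (s *\<^sub>R a) = s * q a" if "s \<ge> 0" for s a using hom[of s a] q0 that by (cases "s = 0") auto
  have "q (u *\<^sub>R fst x + v *\<^sub>R fst y) \<le> u * q (fst x) + v * q (fst y)"
   using sub[of "u *\<^sub>R fst x" "v *\<^sub>R fst y"] h[of u "fst x"] h[of v "fst y"] uv by linarith
  also have "... < u * snd x + v * snd y"
  proof (cases "u = 0")
   case True then show ?thesis using uv y by (simp add: S_def)
  next
   case False
   then have "u * q (fst x) < u * snd x" using uv x by (simp add: S_def)
   moreover have "v * q (fst y) \<le> v * snd y" using uv y by (intro mult_left_mono) (auto simp: S_def)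
   ultimately show ?thesis by linarith
  qed
  finally show "u *\<^sub>R x + v *\<^sub>R y \<in> S" by (simp add: S_def)
 qed
 moreover have "S \<noteq> {}"
 proof -
  have "(0, 1) \<in> S" by (simp add: S_def q0)
  then show ?thesis by blast
 qed
 moreover have "{(\<zeta>, q \<zeta>)} \<inter> S = {}" by (simp add: S_def)
 ultimately have "\<exists>ab c. ab \<noteq> 0 \<and> (\<forall>x\<in>{(\<zeta>, q \<zeta>)}. ab \<bullet> x \<le> c) \<and> (\<forall>x\<in>S. ab \<bullet> x \<ge> c)"
  by (intro separating_hyperplane_sets convex_singleton) simp_all
 then obtain ab c where ab: "ab \<noteq> 0" "ab \<bullet> (\<zeta>, q \<zeta>) \<le> c" "!!x. x \<in> S ==> ab \<bullet> x \<ge> c"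
  by blast
 obtain a \<beta> where ab': "ab = (a, \<beta>)" by (cases ab)
 have ge: "a \<bullet> x + \<beta> * r \<ge> a \<bullet> \<zeta> + \<beta> * q \<zeta>" if "q x < r" for x r
  using ab(2) ab(3)[of "(x, r)"] that by (simp add: ab' S_def)
 have "\<beta> \<ge> 0"
 proof (rule ccontr)
  assume "\<not> \<beta> \<ge> 0"
  then have "\<beta> < 0" by simp
  then show False using ge[of \<zeta> "q \<zeta> + 1"] by (simp add: distrib_left)
 qed
 moreover have "\<beta> \<noteq> 0"
 proof
  assume b: "\<beta> = 0"
  then have "a \<bullet> (\<zeta> - a) \<ge> a \<bullet> \<zeta>" using ge[of "\<zeta> - a" "q (\<zeta> - a) + 1"] by simp
  then have "a \<bullet> a \<le> 0" by (simp add: inner_diff_right)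
  then have "a = 0" by (metis inner_eq_zero_iff inner_ge_zero order_antisym)
  then show False using ab(1) b by (simp add: ab' zero_prod_def)
 qed
 ultimately have b: "\<beta> > 0" by simp
 have ge': "a \<bullet> x + \<beta> * q x \<ge> a \<bullet> \<zeta> + \<beta> * q \<zeta>" for x
 proof (rule field_le_epsilon)
  fix e :: real assume e: "e > 0"
  have "a \<bullet> \<zeta> + \<beta> * q \<zeta> \<le> a \<bullet> x + \<beta> * (q x + e / \<beta>)" using e b by (intro ge) simp
  then show "a \<bullet> \<zeta> + \<beta> * q \<zeta> \<le> a \<bullet> x + \<beta> * q x + e" using b by (simp add: distrib_left)
 qed
 have "a \<bullet> (2 *\<^sub>R \<zeta>) + \<beta> * q (2 *\<^sub>R \<zeta>) \<ge> a \<bullet> \<zeta> + \<beta> * q \<zeta>" by (rule ge')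
 moreover have "q (2 *\<^sub>R \<zeta>) = 2 * q \<zeta>" by (rule hom) simp
 ultimately have u: "a \<bullet> \<zeta> + \<beta> * q \<zeta> \<ge> 0" by simp
 have "a \<bullet> 0 + \<beta> * q 0 \<ge> a \<bullet> \<zeta> + \<beta> * q \<zeta>" by (rule ge')
 then have z: "a \<bullet> \<zeta> + \<beta> * q \<zeta> = 0" using u q0 by simp
 let ?\<eta> = "(- (1 / \<beta>)) *\<^sub>R a"
 have "?\<eta> \<bullet> x \<le> q x" for x using ge'[of x] z b by (simp add: field_simps)
 moreover have "?\<eta> \<bullet> \<zeta> = q \<zeta>" using z b by (simp add: field_simps)
 ultimately show ?thesis by blast
qed

text \<open>The directional derivative is the maximum of \<open>\<eta> \<bullet> \<zeta>\<close> over the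
 subdifferential, which turns the growth bound for subgradients into one for the directional
 derivative.\<close>

lemma clarke_dd_bound:
 assumes g: "locally_lipschitz g" and c: "!!\<eta>. \<eta> \<in> clarke_subdiff g \<xi> ==> norm \<eta> \<le> c"
 shows "\<bar>clarke_dd g \<xi> \<zeta>\<bar> \<le> c * norm \<zeta>"
proof -
 obtain \<eta> where \<eta>: "\<forall>x. \<eta> \<bullet> x \<le> clarke_dd g \<xi> x" "\<eta> \<bullet> \<zeta> = clarke_dd g \<xi> \<zeta>"
  using sublinear_supported[of "clarke_dd g \<xi>" \<zeta>] clarke_dd_subadditive[OF g] clarke_dd_scale[OF g] clarke_dd_zero[OF g]
  by blast
 then have "\<eta> \<in> clarke_subdiff g \<xi>" by (simp add: clarke_subdiff_def)
 then have "norm \<eta> * norm \<zeta> \<le> c * norm \<zeta>" by (intro mult_right_mono c) auto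
 then show ?thesis using Cauchy_Schwarz_ineq2[of \<eta> \<zeta>] \<eta>(2) by simp
qed

lemma clarke_dd_lipschitz:
 assumes g: "locally_lipschitz g" and c: "!!\<eta>. \<eta> \<in> clarke_subdiff g \<xi> ==> norm \<eta> \<le> c"
 shows "\<bar>clarke_dd g \<xi> \<zeta>1 - clarke_dd g \<xi> \<zeta>2\<bar> \<le> c * norm (\<zeta>1 - \<zeta>2)"
proof -
 have "clarke_dd g \<xi> a - clarke_dd g \<xi> b \<le> c * norm (a - b)" for a b
  using clarke_dd_subadditive[OF g, of \<xi> "a - b" b] clarke_dd_bound[OF g c, of \<xi> "a - b"] by simp
 from this[of \<zeta>1 \<zeta>2] this[of \<zeta>2 \<zeta>1] show ?thesis by (simp add: norm_minus_commute abs_le_iff)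
qed

section \<open>Measurability of the Clarke integrand\<close>

lemma locally_lipschitz_continuous:
 assumes "locally_lipschitz g" shows "continuous_on UNIV g"
proof (rule continuous_at_imp_continuous_on, rule ballI)
 fix \<xi>
 obtain r L where r: "r > 0" and L: "L-lipschitz_on (ball \<xi> r) g"
  using assms unfolding locally_lipschitz_def by blast
 have "continuous_on (ball \<xi> r) g" using L by (rule lipschitz_on_continuous_on)
 then show "isCont g \<xi>" using r by (simp add: continuous_on_eq_continuous_at)
qed

text \<open>Approximation of \<open>u\<close> by simple functions.\<close>

lemma caratheodory_measurable:
 fixes \<psi> :: "'a => real^3 => real"
 assumes m: "!!\<xi>. (\<lambda>x. \<psi> x \<xi>) \<in> borel_measurable M" and c: "!!x. x \<in> space M ==> continuous_on UNIV (\<psi> x)"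
  and u: "u \<in> borel_measurable M"
 shows "(\<lambda>x. \<psi> x (u x)) \<in> borel_measurable M"
proof -
 obtain F where F: "!!i. simple_function M (F i)" "!!x. x \<in> space M ==> (\<lambda>i. F i x) \<longlonglongrightarrow> u x"
  using borel_measurable_implies_sequence_metric[OF u, of 0] by blast
 have "(\<lambda>x. \<psi> x (F i x)) \<in> borel_measurable M" for i
 proof (rule measurable_compose_countable'[where f="\<lambda>\<xi> x. \<psi> x \<xi>" and g="F i" and I="F i ` space M"])
  have fin: "finite (F i ` space M)" using F(1)[of i] by (simp add: simple_function_def)
  then show "countable (F i ` space M)" by (rule countable_finite)
  show "F i \<in> measurable M (count_space (F i ` space M))"
   unfolding measurable_count_space_eq2[OF fin] using F(1)[of i] by (auto simp: simple_function_def)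
 qed (rule m)
 then show ?thesis
 proof (rule borel_measurable_LIMSEQ_real[rotated])
  fix x assume x: "x \<in> space M"
  show "(\<lambda>i. \<psi> x (F i x)) \<longlonglongrightarrow> \<psi> x (u x)"
   by (rule continuous_on_tendsto_compose[OF c[OF x] F(2)[OF x]]) auto
 qed
qed

text \<open>By continuity of the difference quotients the upper limit can be tested on a dense set; with a
 countable dense set and rational bounds this exhibits sublevel sets as countable combinations of
 measurable sets.\<close>

lemma clarke_dd_less_iff:
 fixes D :: "((real^3) \<times> real) set"
 assumes g: "locally_lipschitz g" and D: "!!X. open X ==> X \<noteq> {} ==> \<exists>d\<in>D. d \<in> X"
 shows "clarke_dd g \<xi> \<zeta> < c \<longleftrightarrow> (\<exists>c'\<in>\<rat>. c' < c \<and> (\<exists>n::nat. \<forall>d\<in>D \<inter> (ball 0 (1 / real (Suc n)) \<times> {0<..<1 / real (Suc n)}).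
   diff_quot g \<zeta> (\<xi> + fst d, snd d) \<le> c'))"
proof
 assume "clarke_dd g \<xi> \<zeta> < c"
 then obtain c' where c': "c' \<in> \<rat>" "clarke_dd g \<xi> \<zeta> < c'" "c' < c" using Rats_dense_in_real by blast
 obtain r where r: "r > 0" "!!w t. dist w \<xi> < r ==> 0 < t ==> t < r ==> diff_quot g \<zeta> (w, t) < c'"
  using clarke_dd_lessD[OF g c'(2)] unfolding eventually_clarke_filter by blast
 obtain n where n: "1 / real (Suc n) < r" using nat_approx_posE[OF r(1)] by blast
 have "diff_quot g \<zeta> (\<xi> + fst d, snd d) \<le> c'" if d: "d \<in> ball 0 (1 / real (Suc n)) \<times> {0<..<1 / real (Suc n)}" for d
 proof -
  have "norm (fst d) < 1 / real (Suc n)" "0 < snd d" "snd d < 1 / real (Suc n)" using d by auto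
  then show ?thesis using r(2)[of "\<xi> + fst d" "snd d"] n by (simp add: dist_norm less_imp_le)
 qed
 then show "\<exists>c'\<in>\<rat>. c' < c \<and> (\<exists>n::nat. \<forall>d\<in>D \<inter> (ball 0 (1 / real (Suc n)) \<times> {0<..<1 / real (Suc n)}).
   diff_quot g \<zeta> (\<xi> + fst d, snd d) \<le> c')" using c' by blast
next
 assume "\<exists>c'\<in>\<rat>. c' < c \<and> (\<exists>n::nat. \<forall>d\<in>D \<inter> (ball 0 (1 / real (Suc n)) \<times> {0<..<1 / real (Suc n)}).
   diff_quot g \<zeta> (\<xi> + fst d, snd d) \<le> c')"
 then obtain c' n where c': "c' < c" and n: "!!d. d \<in> D ==> d \<in> ball 0 (1 / real (Suc n)) \<times> {0<..<1 / real (Suc n)} ==>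
   diff_quot g \<zeta> (\<xi> + fst d, snd d) \<le> c'" by blast
 define r where "r = 1 / real (Suc n)"
 have r: "r > 0" by (simp add: r_def)
 define U where "U = ball (0::real^3) r \<times> {0<..<r}"
 have U: "open U" by (simp add: U_def open_Times)
 have gc: "continuous_on S g" for S using locally_lipschitz_continuous[OF g] continuous_on_subset by blast
 have qc: "continuous_on U (\<lambda>d. diff_quot g \<zeta> (\<xi> + fst d, snd d))"
  unfolding diff_quot_def fst_conv snd_conv
  by (intro continuous_intros continuous_on_compose2[OF gc[of UNIV]]) (auto simp: U_def)
 have all: "diff_quot g \<zeta> (\<xi> + fst d, snd d) \<le> c'" if d: "d \<in> U" for d
 proof (rule ccontr)
  assume "\<not> diff_quot g \<zeta> (\<xi> + fst d, snd d) \<le> c'"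
  let ?X = "U \<inter> (\<lambda>d. diff_quot g \<zeta> (\<xi> + fst d, snd d)) -` {c'<..}"
  have "open ((\<lambda>d. diff_quot g \<zeta> (\<xi> + fst d, snd d)) -` {c'<..} \<inter> U)"
   using iffD1[OF continuous_on_open_vimage[OF U] qc] open_greaterThan by blast
  then have "open ?X" by (simp only: Int_commute)
  moreover have "d \<in> ?X" using d \<open>\<not> _\<close> by simp
  ultimately obtain d' where "d' \<in> D" "d' \<in> ?X" using D by blast
  then show False using n[of d'] by (simp add: U_def r_def)
 qed
 have "diff_quot g \<zeta> (w, t) \<le> c'" if "dist w \<xi> < r" "0 < t" "t < r" for w t
  using all[of "(w - \<xi>, t)"] that by (simp add: U_def dist_norm norm_minus_commute)
 then have "\<forall>\<^sub>F z in clarke_filter \<xi>. diff_quot g \<zeta> z \<le> c'" unfolding eventually_clarke_filter using r by blast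
 from clarke_dd_leI[OF g this] show "clarke_dd g \<xi> \<zeta> < c" using c' by simp
qed

lemma clarke_dd_measurable:
 fixes \<psi> :: "'a => real^3 => real"
 assumes m: "!!\<xi>. (\<lambda>x. \<psi> x \<xi>) \<in> borel_measurable M" and l: "!!x. x \<in> space M ==> locally_lipschitz (\<psi> x)"
  and E: "E \<in> borel_measurable M" and v: "v \<in> borel_measurable M"
 shows "(\<lambda>x. clarke_dd (\<psi> x) (E x) (v x)) \<in> borel_measurable M"
proof -
 obtain D :: "((real^3) \<times> real) set" where D0: "countable D" "\<forall>X. open X --> X \<noteq> {} --> (\<exists>d\<in>D. d \<in> X)"
  using countable_dense_exists by (elim exE conjE)
 then have D: "countable D" "!!X. open X ==> X \<noteq> {} ==> \<exists>d\<in>D. d \<in> X" by simp_all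
 have c: "(\<lambda>x. \<psi> x (u x)) \<in> borel_measurable M" if "u \<in> borel_measurable M" for u
  by (rule caratheodory_measurable[OF m locally_lipschitz_continuous[OF l] that])
 have q: "(\<lambda>x. diff_quot (\<psi> x) (v x) (E x + fst d, snd d)) \<in> borel_measurable M" for d
 proof -
  have "(\<lambda>x. \<psi> x (E x + fst d + snd d *\<^sub>R v x)) \<in> borel_measurable M" by (rule c) (use E v in measurable)
  moreover have "(\<lambda>x. \<psi> x (E x + fst d)) \<in> borel_measurable M" by (rule c) (use E v in measurable)
  ultimately show ?thesis unfolding diff_quot_def fst_conv snd_conv by simp
 qed
 show ?thesis
 proof (subst borel_measurable_iff_less, rule allI)
  fix c
  let ?P = "\<lambda>x. \<exists>c'\<in>\<rat> \<inter> {..<c}. \<exists>n::nat. \<forall>d\<in>D \<inter> (ball 0 (1 / real (Suc n)) \<times> {0<..<1 / real (Suc n)}).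
   diff_quot (\<psi> x) (v x) (E x + fst d, snd d) \<le> c'"
  have "{x \<in> space M. ?P x} \<in> sets M"
  proof (intro sets.sets_Collect_countable_Ex' sets.sets_Collect_countable_All' sets.sets_Collect_countable_Ex)
   show "countable (\<rat> \<inter> {..<c})" using countable_rat by (rule countable_Int1)
   show "countable (D \<inter> X)" for X using D(1) by (rule countable_Int1)
   show "{x \<in> space M. diff_quot (\<psi> x) (v x) (E x + fst d, snd d) \<le> c'} \<in> sets M" for c' d
    using q[of d] by measurable
  qed
  moreover have "{x \<in> space M. clarke_dd (\<psi> x) (E x) (v x) < c} = {x \<in> space M. ?P x}"
  proof -
   have bex: "(\<exists>c'\<in>\<rat>. c' < c \<and> Q c') \<longleftrightarrow> (\<exists>c'\<in>\<rat> \<inter> {..<c}. Q c')" for Q :: "real => bool" by auto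
   have "clarke_dd (\<psi> x) (E x) (v x) < c \<longleftrightarrow> ?P x" if "x \<in> space M" for x
    by (rule trans[OF clarke_dd_less_iff[OF l[OF that] D(2)] bex])
   then show ?thesis by (intro Collect_cong conj_cong refl)
  qed
  ultimately show "{x \<in> space M. clarke_dd (\<psi> x) (E x) (v x) < c} \<in> sets M" by simp
 qed
qed

lemma lebesgue_on_measurable_AE:
 fixes f g :: "real^3 => real"
 assumes S: "S \<in> sets lebesgue" and g: "g \<in> borel_measurable (lebesgue_on S)" and eq: "AE x in lebesgue_on S. f x = g x"
 shows "f \<in> borel_measurable (lebesgue_on S)"
proof (rule measurableI)
 fix B :: "real set" assume B: "B \<in> sets borel"
 have "AE x in lebesgue. x \<in> S --> f x = g x" using eq S by (simp add: AE_restrict_space_iff)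
 then obtain N where N: "{x. \<not> (x \<in> S --> f x = g x)} \<subseteq> N" "N \<in> null_sets lebesgue"
  by (auto elim!: AE_E simp: null_sets_def)
 have neg: "X \<in> sets lebesgue" if "X \<subseteq> N" for X
  using negligible_subset[of N X] N(2) that negligible_imp_sets by (simp add: negligible_iff_null_sets)
 have Gs: "g -` B \<inter> S \<in> sets lebesgue"
  using measurable_sets[OF g B] S by (simp add: sets_restrict_space_iff space_restrict_space)
 have Xl: "f -` B \<inter> S \<inter> N \<in> sets lebesgue" by (rule neg) auto
 have "f -` B \<inter> S = (g -` B \<inter> S - N) \<union> (f -` B \<inter> S \<inter> N)" using N(1) by auto
 moreover have "(g -` B \<inter> S - N) \<union> (f -` B \<inter> S \<inter> N) \<in> sets lebesgue" using Gs Xl N(2) by (intro sets.Un sets.Diff) auto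
 ultimately have "f -` B \<inter> S \<in> sets lebesgue" by (simp only:)
 then show "f -` B \<inter> space (lebesgue_on S) \<in> sets (lebesgue_on S)"
  using S by (simp add: sets_restrict_space_iff space_restrict_space)
qed simp

text \<open>The exceptional null set, where \<open>\<psi>\<close> need not be locally Lipschitz, is removed by
 replacing \<open>\<psi>\<close> by zero there.\<close>

lemma clarke_integrand_measurable:
 fixes \<psi> :: "real^3 => real^3 => real"
 assumes S: "S \<in> sets lebesgue" and m: "!!\<xi>. (\<lambda>x. \<psi> x \<xi>) \<in> borel_measurable (lebesgue_on S)"
  and l: "AE x in lebesgue_on S. locally_lipschitz (\<psi> x)"
  and E: "E \<in> borel_measurable (lebesgue_on S)" and v: "v \<in> borel_measurable (lebesgue_on S)"
 shows "(\<lambda>x. clarke_dd (\<psi> x) (E x) (v x)) \<in> borel_measurable (lebesgue_on S)"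
proof -
 obtain N where N: "N \<in> null_sets (lebesgue_on S)" "!!x. x \<in> space (lebesgue_on S) - N ==> locally_lipschitz (\<psi> x)"
  using AE_E3[OF l] by blast
 define \<psi>' where "\<psi>' x = (if x \<in> N then (\<lambda>_. 0) else \<psi> x)" for x
 have "(\<lambda>x. \<psi>' x \<xi>) \<in> borel_measurable (lebesgue_on S)" for \<xi>
 proof -
  have "(\<lambda>x. if x \<in> N then 0 else \<psi> x \<xi>) \<in> borel_measurable (lebesgue_on S)"
   by (rule measurable_If_set) (use N(1) m in \<open>auto simp: null_sets_def\<close>)
  then show ?thesis by (simp add: \<psi>'_def if_distribR cong: if_cong)
 qed
 moreover have "locally_lipschitz (\<psi>' x)" if "x \<in> space (lebesgue_on S)" for x
 proof (cases "x \<in> N")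
  case True
  have l0: "0-lipschitz_on X (\<lambda>_::real^3. 0::real)" for X by (simp add: lipschitz_on_def)
  have "\<psi>' x = (\<lambda>_. 0)" using True by (simp add: \<psi>'_def)
  then show ?thesis unfolding locally_lipschitz_def using l0 zero_less_one by metis
 next
  case False then show ?thesis using N(2) that by (simp add: \<psi>'_def)
 qed
 ultimately have "(\<lambda>x. clarke_dd (\<psi>' x) (E x) (v x)) \<in> borel_measurable (lebesgue_on S)"
  using E v by (rule clarke_dd_measurable)
 moreover have "AE x in lebesgue_on S. clarke_dd (\<psi> x) (E x) (v x) = clarke_dd (\<psi>' x) (E x) (v x)"
  using AE_not_in[OF N(1)] by eventually_elim (simp add: \<psi>'_def)
 ultimately show ?thesis by (rule lebesgue_on_measurable_AE[OF S])
qed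

section \<open>Facets of full-dimensional polytopes\<close>

definition polyhedral_cell :: "(real^3) set => bool" where
 "polyhedral_cell K \<longleftrightarrow> polytope K \<and> interior K \<noteq> {}"

definition support :: "(real^3) set => real^3 => real" where
 "support K a = Sup ((\<lambda>x. a \<bullet> x) ` K)"

definition normals :: "(real^3) set => (real^3) set" where
 "normals K = {a. norm a = 1 \<and> K \<inter> {x. a \<bullet> x = support K a} facet_of K}"

lemma tetra_hexa_polyhedral_cell:
 assumes "tetrahedron K \<or> hexahedron K" shows "polyhedral_cell K"
proof -
 have p: "polytope K" and d: "aff_dim K = 3"
  using assms by (auto simp: tetrahedron_def hexahedron_def simplex_imp_polytope aff_dim_simplex)
 have c: "convex K" using p by (rule polytope_imp_convex)
 have "rel_interior K \<noteq> {}" using rel_interior_eq_empty[OF c] d by auto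
 moreover have "rel_interior K = interior K" by (rule interior_rel_interior) (simp add: d)
 ultimately show ?thesis using p by (simp add: polyhedral_cell_def)
qed

lemma affine_hyperplane_eq:
 fixes f :: "(real^3) set"
 assumes f: "aff_dim f = 2" and a: "a \<noteq> 0" and sub: "f \<subseteq> {x. a \<bullet> x = s}"
 shows "affine hull f = {x. a \<bullet> x = s}"
proof (rule affine_dim_equal)
 show "affine (affine hull f)" by (rule affine_affine_hull)
 show "affine {x. a \<bullet> x = s}" by (rule affine_hyperplane)
 show "affine hull f \<noteq> {}" using f by auto
 show "affine hull f \<subseteq> {x. a \<bullet> x = s}" by (intro hull_minimal sub affine_hyperplane)
 show "aff_dim (affine hull f) = aff_dim {x. a \<bullet> x = s}"
  using f aff_dim_hyperplane[OF a, of s] by simp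
qed

text \<open>A two-dimensional set spans its plane, which determines the unit normal up to sign.\<close>

lemma unit_normal_unique:
 fixes f :: "(real^3) set"
 assumes f: "aff_dim f = 2" and a: "norm a = 1" "f \<subseteq> {x. a \<bullet> x = s}" and a': "norm a' = 1" "f \<subseteq> {x. a' \<bullet> x = s'}"
 shows "(a' = a \<and> s' = s) \<or> (a' = - a \<and> s' = - s)"
proof -
 have nz: "a \<noteq> 0" "a' \<noteq> 0" using a a' by auto
 have H: "{x. a \<bullet> x = s} = {x. a' \<bullet> x = s'}"
  using affine_hyperplane_eq[OF f nz(1) a(2)] affine_hyperplane_eq[OF f nz(2) a'(2)] by simp
 have aa: "a \<bullet> a = 1" "a' \<bullet> a' = 1" using a a' by (simp_all add: norm_eq_1)
 define c where "c = a \<bullet> a'"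
 define v where "v = a' - c *\<^sub>R a"
 have av: "a \<bullet> v = 0" by (simp add: v_def inner_diff_right aa c_def)
 have "s *\<^sub>R a \<in> {x. a \<bullet> x = s}" "s *\<^sub>R a + v \<in> {x. a \<bullet> x = s}" using av by (simp_all add: aa inner_add_right)
 then have "a' \<bullet> (s *\<^sub>R a) = s'" "a' \<bullet> (s *\<^sub>R a + v) = s'" unfolding H by simp_all
 then have "a' \<bullet> v = 0" and s': "s' = s * c" by (simp_all add: inner_add_right c_def inner_commute)
 then have "v \<bullet> v = 0" using av by (simp add: v_def inner_diff_left)
 then have eq: "a' = c *\<^sub>R a" by (simp add: v_def)
 then have "\<bar>c\<bar> = 1" using a a' by (metis norm_scaleR mult.right_neutral)
 then have "c = 1 \<or> c = -1" by linarith
 then show ?thesis using eq s' by auto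
qed

lemma
 assumes K: "polyhedral_cell K"
 shows cell_compact: "compact K" and cell_convex: "convex K" and cell_closed: "closed K" and cell_bounded: "bounded K"
  and cell_nonempty: "K \<noteq> {}" and cell_aff_dim: "aff_dim K = 3" and cell_closure_interior: "closure (interior K) = K"
proof -
 have p: "polytope K" and i: "interior K \<noteq> {}" using K by (auto simp: polyhedral_cell_def)
 show c: "compact K" by (rule polytope_imp_compact[OF p])
 show cv: "convex K" by (rule polytope_imp_convex[OF p])
 show cl: "closed K" using c by (rule compact_imp_closed)
 show "bounded K" using c by (rule compact_imp_bounded)
 show "K \<noteq> {}" using i interior_subset by blast
 show "aff_dim K = 3" using aff_dim_nonempty_interior[OF i] by simp
 show "closure (interior K) = K" using convex_closure_interior[OF cv i] cl by simp
qed

lemma support_ge: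
 assumes "polyhedral_cell K" "x \<in> K" shows "a \<bullet> x \<le> support K a"
proof -
 have "compact ((\<lambda>x. a \<bullet> x) ` K)" by (intro compact_continuous_image continuous_intros cell_compact assms)
 then have "bdd_above ((\<lambda>x. a \<bullet> x) ` K)" by (intro bounded_imp_bdd_above compact_imp_bounded)
 then show ?thesis unfolding support_def using assms(2) by (intro cSup_upper) auto
qed

lemma support_eqI:
 assumes "polyhedral_cell K" "!!y. y \<in> K ==> a \<bullet> y \<le> s" "x \<in> K" "a \<bullet> x = s"
 shows "support K a = s"
 unfolding support_def by (rule cSup_eq_maximum) (use assms in auto)

lemma supporting_facet:
 assumes K: "polyhedral_cell K" and n: "norm n = 1" "!!y. y \<in> K ==> n \<bullet> y \<le> d"
  and f: "f \<subseteq> K" "f \<subseteq> {x. n \<bullet> x = d}" "aff_dim f = 2"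
 shows "n \<in> normals K" "support K n = d"
proof -
 have "f \<noteq> {}" using f(3) by auto
 then obtain x where x: "x \<in> f" by blast
 show s: "support K n = d" by (rule support_eqI[OF K n(2)]) (use x f in auto)
 let ?F = "K \<inter> {x. n \<bullet> x = d}"
 have "?F face_of K" using face_of_Int_supporting_hyperplane_le[OF cell_convex[OF K]] n(2) by blast
 moreover have "?F \<noteq> {}" using x f by blast
 moreover have "aff_dim ?F = aff_dim K - 1"
 proof -
  have "n \<noteq> 0" using n(1) by auto
  have "aff_dim f \<le> aff_dim ?F" using f by (intro aff_dim_subset) blast
  moreover have "aff_dim ?F \<le> aff_dim {x. n \<bullet> x = d}" by (intro aff_dim_subset) blast
  ultimately show ?thesis using f(3) aff_dim_hyperplane[OF \<open>n \<noteq> 0\<close>, of d] cell_aff_dim[OF K] by simp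
 qed
 ultimately have "?F facet_of K" by (simp add: facet_of_def)
 then show "n \<in> normals K" using n s by (simp add: normals_def)
qed

lemma normals_facet:
 assumes K: "polyhedral_cell K" and a: "a \<in> normals K"
 shows "norm a = 1" "aff_dim (K \<inter> {x. a \<bullet> x = support K a}) = 2" "affine hull (K \<inter> {x. a \<bullet> x = support K a}) = {x. a \<bullet> x = support K a}"
proof -
 show n: "norm a = 1" using a by (simp add: normals_def)
 show d: "aff_dim (K \<inter> {x. a \<bullet> x = support K a}) = 2" using a cell_aff_dim[OF K] by (simp add: normals_def facet_of_def)
 show "affine hull (K \<inter> {x. a \<bullet> x = support K a}) = {x. a \<bullet> x = support K a}"
  by (rule affine_hyperplane_eq[OF d]) (use n in auto)
qed

lemma cell_not_flat:
 assumes K: "polyhedral_cell K" and a: "norm a = 1" and neg: "a' = - a" "support K a' = - support K a"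
 shows False
proof -
 have "support K (- a) = - support K a" using neg by simp
 then have "a \<bullet> y = support K a" if "y \<in> K" for y
  using support_ge[OF K that, of a] support_ge[OF K that, of "- a"] by simp
 then have "K \<subseteq> {x. a \<bullet> x = support K a}" by blast
 then have "aff_dim K \<le> aff_dim {x. a \<bullet> x = support K a}" by (rule aff_dim_subset)
 moreover have "a \<noteq> 0" using a by auto
 ultimately show False using cell_aff_dim[OF K] aff_dim_hyperplane[of a] by simp
qed

text \<open>A minimal representation as an intersection of half spaces has one half space for each facet;
 after normalisation these are given by the outer unit normals and the support function.\<close>

lemma facet_rep:
 assumes K: "polyhedral_cell K"
 shows "finite (normals K)" "K = halfspaces (normals K) (support K)" "F facet_of K ==> \<exists>a\<in>normals K. F = K \<inter> {x. a \<bullet> x = support K a}"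
proof -
 have "polyhedron K" using K by (simp add: polyhedral_cell_def polytope_imp_polyhedron)
 moreover have hullK: "affine hull K = UNIV"
  using cell_aff_dim[OF K] aff_dim_eq_full[of K] by simp
 ultimately obtain \<F> where F: "finite \<F>" "K = affine hull K \<inter> \<Inter>\<F>" "\<forall>h \<in> \<F>. \<exists>a b. a \<noteq> 0 \<and> h = {x. a \<bullet> x \<le> b}"
  and min: "\<forall>\<F>'. \<F>' \<subset> \<F> --> K \<subset> affine hull K \<inter> \<Inter>\<F>'"
  unfolding polyhedron_Int_affine_minimal by blast
 from F(3) obtain \<alpha> \<beta> where ab: "!!h. h \<in> \<F> ==> \<alpha> h \<noteq> 0 \<and> h = {x. \<alpha> h \<bullet> x \<le> \<beta> h}" by metis
 have facet: "C facet_of K \<longleftrightarrow> (\<exists>h. h \<in> \<F> \<and> C = K \<inter> {x. \<alpha> h \<bullet> x = \<beta> h})" for C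
  by (rule facet_of_polyhedron_explicit[OF F(1,2) ab]) (use min in auto)
 define u where "u h = (1 / norm (\<alpha> h)) *\<^sub>R \<alpha> h" for h
 have u: "norm (u h) = 1" "u h \<bullet> x = (\<alpha> h \<bullet> x) / norm (\<alpha> h)" if "h \<in> \<F>" for h x
  using ab[OF that] by (simp_all add: u_def)
 have KF: "K = \<Inter>\<F>" using F(2) hullK by simp
 have hsub: "\<alpha> h \<bullet> y \<le> \<beta> h" if "h \<in> \<F>" "y \<in> K" for h y
 proof -
  have "y \<in> h" using that KF by blast
  then show ?thesis using ab[OF that(1)] by blast
 qed
 have un: "u h \<in> normals K \<and> support K (u h) = \<beta> h / norm (\<alpha> h)" if h: "h \<in> \<F>" for h
 proof -
  have nz: "norm (\<alpha> h) > 0" using ab[OF h] by simp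
  let ?C = "K \<inter> {x. \<alpha> h \<bullet> x = \<beta> h}"
  have "?C facet_of K" using facet h by blast
  then have "aff_dim ?C = 2" using cell_aff_dim[OF K] by (simp add: facet_of_def)
  moreover have "?C \<subseteq> {x. u h \<bullet> x = \<beta> h / norm (\<alpha> h)}" using u(2)[OF h] by auto
  moreover have "u h \<bullet> y \<le> \<beta> h / norm (\<alpha> h)" if "y \<in> K" for y
   using hsub[OF h that] u(2)[OF h, of y] nz by (simp add: divide_right_mono)
  ultimately show ?thesis using supporting_facet[OF K u(1)[OF h], of "\<beta> h / norm (\<alpha> h)" ?C] by blast
 qed
 have plane: "{x. u h \<bullet> x = support K (u h)} = {x. \<alpha> h \<bullet> x = \<beta> h}" if h: "h \<in> \<F>" for h
  using un[OF h] u(2)[OF h] ab[OF h] by auto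
 have "normals K \<subseteq> u ` \<F>"
 proof
  fix a assume a: "a \<in> normals K"
  then have "K \<inter> {x. a \<bullet> x = support K a} facet_of K" by (simp add: normals_def)
  then obtain h where h: "h \<in> \<F>" "K \<inter> {x. a \<bullet> x = support K a} = K \<inter> {x. \<alpha> h \<bullet> x = \<beta> h}" using facet by blast
  have eq: "K \<inter> {x. a \<bullet> x = support K a} = K \<inter> {x. u h \<bullet> x = support K (u h)}" using h(2) plane[OF h(1)] by simp
  have "(u h = a \<and> support K (u h) = support K a) \<or> (u h = - a \<and> support K (u h) = - support K a)"
   by (rule unit_normal_unique[OF normals_facet(2)[OF K a] normals_facet(1)[OF K a] _ u(1)[OF h(1)]]) (use eq in auto)
  moreover have "\<not> (u h = - a \<and> support K (u h) = - support K a)"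
   using cell_not_flat[OF K normals_facet(1)[OF K a]] by blast
  ultimately show "a \<in> u ` \<F>" using h(1) by blast
 qed
 then have eqN: "normals K = u ` \<F>" using un by blast
 show "finite (normals K)" unfolding eqN using F(1) by (rule finite_imageI)
 show "K = halfspaces (normals K) (support K)"
 proof (intro equalityI subsetI)
  fix x assume "x \<in> K" then show "x \<in> halfspaces (normals K) (support K)"
   using support_ge[OF K] by (simp add: halfspaces_def)
 next
  fix x assume x: "x \<in> halfspaces (normals K) (support K)"
  have "x \<in> h" if h: "h \<in> \<F>" for h
  proof -
   have "u h \<bullet> x \<le> \<beta> h / norm (\<alpha> h)" using x un[OF h] by (auto simp: halfspaces_def)
   then have "\<alpha> h \<bullet> x \<le> \<beta> h" using u(2)[OF h, of x] ab[OF h] by (simp add: divide_le_cancel)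
   then show ?thesis using ab[OF h] by blast
  qed
  then show "x \<in> K" using KF by blast
 qed
 show "\<exists>a\<in>normals K. F = K \<inter> {x. a \<bullet> x = support K a}" if "F facet_of K"
 proof -
  obtain h where h: "h \<in> \<F>" "F = K \<inter> {x. \<alpha> h \<bullet> x = \<beta> h}" using facet \<open>F facet_of K\<close> by blast
  then show ?thesis using un[OF h(1)] plane[OF h(1)] by blast
 qed
qed

lemma interior_halfspaces:
 assumes A: "finite A" "!!a. a \<in> A ==> norm a = 1"
 shows "interior (halfspaces A b) = open_halfspaces A b"
proof (intro equalityI subsetI)
 fix x assume "x \<in> interior (halfspaces A b)"
 then obtain e where e: "e > 0" "ball x e \<subseteq> halfspaces A b" by (auto simp: mem_interior)
 have "a \<bullet> x < b a" if a: "a \<in> A" for a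
 proof -
  have "x + (e / 2) *\<^sub>R a \<in> ball x e" using e A(2)[OF a] by (simp add: dist_norm)
  then have "a \<bullet> (x + (e / 2) *\<^sub>R a) \<le> b a" using e(2) a by (auto simp: halfspaces_def)
  moreover have "a \<bullet> a = 1" using A(2)[OF a] by (simp add: norm_eq_1)
  ultimately show ?thesis using e(1) by (simp add: inner_add_right)
 qed
 then show "x \<in> open_halfspaces A b" by (simp add: open_halfspaces_def)
next
 fix x assume "x \<in> open_halfspaces A b"
 then show "x \<in> interior (halfspaces A b)"
  using interior_maximal[OF open_halfspaces_subset open_open_halfspaces[OF A(1)]] by blast
qed

lemma cell_interior:
 assumes K: "polyhedral_cell K" shows "interior K = open_halfspaces (normals K) (support K)"
proof -
 have "interior (halfspaces (normals K) (support K)) = open_halfspaces (normals K) (support K)"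
  by (rule interior_halfspaces[OF facet_rep(1)[OF K] normals_facet(1)[OF K]])
 then show ?thesis using facet_rep(2)[OF K] by simp
qed

lemma cell_convex_cell:
 assumes K: "polyhedral_cell K" shows "convex_cell (normals K) (support K)"
proof
 show "finite (normals K)" by (rule facet_rep(1)[OF K])
 show "norm a = 1" if "a \<in> normals K" for a by (rule normals_facet(1)[OF K that])
 show "bounded (halfspaces (normals K) (support K))" using cell_bounded[OF K] facet_rep(2)[OF K] by simp
 show "open_halfspaces (normals K) (support K) \<noteq> {}" using cell_interior[OF K] K by (simp add: polyhedral_cell_def)
qed

lemma cells_separated:
 assumes K: "polyhedral_cell K" "polyhedral_cell K'" and d: "interior K \<inter> interior K' = {}"
 obtains n s where "norm n = 1" "!!x. x \<in> K ==> n \<bullet> x \<le> s" "!!x. x \<in> K' ==> n \<bullet> x \<ge> s"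
proof -
 have "\<exists>a s. a \<noteq> 0 \<and> (\<forall>x\<in>interior K. a \<bullet> x \<le> s) \<and> (\<forall>x\<in>interior K'. a \<bullet> x \<ge> s)"
  by (rule separating_hyperplane_sets)
   (use K d cell_convex in \<open>auto simp: polyhedral_cell_def convex_interior polytope_imp_convex\<close>)
 then obtain a s where a: "a \<noteq> 0" "\<forall>x\<in>interior K. a \<bullet> x \<le> s" "\<forall>x\<in>interior K'. a \<bullet> x \<ge> s" by blast
 have "closure (interior K) \<subseteq> {x. a \<bullet> x \<le> s}" using a(2) by (intro closure_minimal closed_halfspace_le) auto
 moreover have "closure (interior K') \<subseteq> {x. a \<bullet> x \<ge> s}" using a(3) by (intro closure_minimal closed_halfspace_ge) auto
 ultimately have sub: "!!x. x \<in> K ==> a \<bullet> x \<le> s" "!!x. x \<in> K' ==> a \<bullet> x \<ge> s"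
  unfolding cell_closure_interior[OF K(1)] cell_closure_interior[OF K(2)] by auto
 let ?n = "(1 / norm a) *\<^sub>R a"
 show ?thesis
 proof (rule that[of ?n "s / norm a"])
  show "norm ?n = 1" using a(1) by simp
  show "?n \<bullet> x \<le> s / norm a" if "x \<in> K" for x using sub(1)[OF that] by (simp add: divide_right_mono)
  show "?n \<bullet> x \<ge> s / norm a" if "x \<in> K'" for x using sub(2)[OF that] by (simp add: divide_right_mono)
 qed
qed

text \<open>The plane that separates the interiors contains the common two-dimensional set, hence supports
 both cells along facets, with opposite outer normals.\<close>

lemma cells_opposite:
 assumes K: "polyhedral_cell K" "polyhedral_cell K'" and d: "interior K \<inter> interior K' = {}"
  and f: "f \<subseteq> K" "f \<subseteq> K'" "aff_dim f = 2"
 obtains n s where "n \<in> normals K" "support K n = s" "- n \<in> normals K'" "support K' (- n) = - s" "K \<inter> K' \<subseteq> {x. n \<bullet> x = s}"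
proof -
 obtain n s where n: "norm n = 1" "!!x. x \<in> K ==> n \<bullet> x \<le> s" "!!x. x \<in> K' ==> n \<bullet> x \<ge> s"
  by (rule cells_separated[OF K d]) blast
 have sub: "K \<inter> K' \<subseteq> {x. n \<bullet> x = s}" using n(2,3) by (auto intro: order_antisym)
 have fs: "f \<subseteq> {x. n \<bullet> x = s}" using f sub by blast
 have fs': "f \<subseteq> {x. (- n) \<bullet> x = - s}" using fs by auto
 have n': "norm (- n) = 1" "!!x. x \<in> K' ==> (- n) \<bullet> x \<le> - s" using n by auto
 show ?thesis
  by (rule that[OF supporting_facet[OF K(1) n(1,2) f(1) fs f(3)] supporting_facet[OF K(2) n' f(2) fs' f(3)] sub])
qed

lemma normal_on_face_unique:
 assumes K: "polyhedral_cell K" and f: "f \<subseteq> K" "aff_dim f = 2"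
  and a: "a \<in> normals K" "f \<subseteq> {x. a \<bullet> x = support K a}" and a': "norm a' = 1" "!!x y. x \<in> f ==> y \<in> K ==> a' \<bullet> y \<le> a' \<bullet> x"
 shows "a' = a"
proof -
 obtain x0 where x0: "x0 \<in> f" using f(2) by fastforce
 have "f \<subseteq> {x. a' \<bullet> x = a' \<bullet> x0}"
  using a'(2) x0 f(1) by (auto intro!: order_antisym)
 from unit_normal_unique[OF f(2) normals_facet(1)[OF K a(1)] a(2) a'(1) this]
 consider "a' = a" | "a' = - a" by blast
 then show ?thesis
 proof cases
  case 2
  have "K \<subseteq> {x. a \<bullet> x = support K a}"
  proof
   fix y assume y: "y \<in> K"
   have "a' \<bullet> y \<le> a' \<bullet> x0" by (rule a'(2)[OF x0 y])
   moreover have "a \<bullet> x0 = support K a" using a(2) x0 by blast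
   ultimately show "y \<in> {x. a \<bullet> x = support K a}" using support_ge[OF K y, of a] 2 by simp
  qed
  then have "aff_dim K \<le> 2" using normals_facet(2)[OF K a(1)] by (metis inf.absorb1 order_refl)
  then show ?thesis using cell_aff_dim[OF K] by simp
 qed
qed

text \<open>The three cells would pairwise lie on opposite sides of the same plane.\<close>

lemma no_three_cells:
 assumes K: "polyhedral_cell K1" "polyhedral_cell K2" "polyhedral_cell K3"
  and d: "interior K1 \<inter> interior K2 = {}" "interior K1 \<inter> interior K3 = {}" "interior K2 \<inter> interior K3 = {}"
  and f: "f \<subseteq> K1" "f \<subseteq> K2" "f \<subseteq> K3" "aff_dim f = 2"
 shows False
proof -
 obtain n s where n: "n \<in> normals K1" "support K1 n = s" "- n \<in> normals K2" "support K2 (- n) = - s" "K1 \<inter> K2 \<subseteq> {x. n \<bullet> x = s}"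
  by (rule cells_opposite[OF K(1,2) d(1) f(1,2,4)])
 obtain m t where m: "m \<in> normals K1" "support K1 m = t" "- m \<in> normals K3" "support K3 (- m) = - t" "K1 \<inter> K3 \<subseteq> {x. m \<bullet> x = t}"
  by (rule cells_opposite[OF K(1,3) d(2) f(1,3,4)])
 obtain k r where k: "k \<in> normals K2" "support K2 k = r" "- k \<in> normals K3" "support K3 (- k) = - r" "K2 \<inter> K3 \<subseteq> {x. k \<bullet> x = r}"
  by (rule cells_opposite[OF K(2,3) d(3) f(2,3,4)])
 have u: "a' = a" if "polyhedral_cell K" "f \<subseteq> K" "a \<in> normals K" "a' \<in> normals K" "f \<subseteq> {x. a \<bullet> x = support K a}" "f \<subseteq> {x. a' \<bullet> x = support K a'}" for K a a'
 proof (rule normal_on_face_unique[OF that(1,2) f(4) that(3,5) normals_facet(1)[OF that(1,4)]])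
  fix x y assume "x \<in> f" "y \<in> K"
  then show "a' \<bullet> y \<le> a' \<bullet> x" using support_ge[OF that(1), of y a'] that(6) by auto
 qed
 have "m = n" by (rule u[OF K(1) f(1) n(1) m(1)]) (use f n m in auto)
 moreover have "k = - n" by (rule u[OF K(2) f(2) n(3) k(1)]) (use f n k in auto)
 moreover have "- k = - m" by (rule u[OF K(3) f(3) m(3) k(3)]) (use f m k in auto)
 ultimately have "n = - n" by simp
 then have "n = 0" by (simp add: eq_neg_iff_add_eq_0 scaleR_2[symmetric])
 then show False using normals_facet(1)[OF K(1) n(1)] by simp
qed

section \<open>Null sets in planes\<close>

text \<open>In coordinates of the plane the set lies on a line.\<close>

lemma AE_plane_lowdim:
 fixes n :: "real^3"
 assumes n: "norm n = 1" and S: "S \<in> sets borel" "S \<subseteq> {x. n \<bullet> x = c}" "aff_dim S < 2"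
 shows "AE x in plane_measure {x. n \<bullet> x = c}. x \<notin> S"
proof -
 obtain p \<alpha> \<beta> where o: "orthonormal3 \<alpha> \<beta> n"
  and pm: "plane_measure {x. n \<bullet> x = c} = distr lborel borel (\<lambda>(s, t). p + s *\<^sub>R \<alpha> + t *\<^sub>R \<beta>)"
  by (rule plane_measure_hyperplane[OF n, of c]) blast
 let ?Y = "\<lambda>(s, t). p + s *\<^sub>R \<alpha> + t *\<^sub>R \<beta>"
 have m: "?Y \<in> borel_measurable (lborel :: (real \<times> real) measure)"
  unfolding split_def by (simp, intro borel_measurable_continuous_onI continuous_intros)
 have oo: "\<alpha> \<bullet> \<alpha> = 1" "\<beta> \<bullet> \<beta> = 1" "\<alpha> \<bullet> \<beta> = 0" "\<beta> \<bullet> \<alpha> = 0"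
  using o by (simp_all add: orthonormal3_def inner_commute)
 define L where "L x = (x \<bullet> \<alpha>, x \<bullet> \<beta>)" for x
 have linL: "linear L" by (rule linearI) (auto simp: L_def inner_add_left)
 have "?Y -` S \<subseteq> (\<lambda>z. (- L p) + z) ` (L ` S)"
 proof
  fix z assume z: "z \<in> ?Y -` S"
  obtain s t where st: "z = (s, t)" by (cases z)
  have "z = (- L p) + L (?Y z)" by (simp add: st L_def inner_add_left oo)
  then show "z \<in> (\<lambda>z. (- L p) + z) ` (L ` S)" using z by blast
 qed
 then have "aff_dim (?Y -` S) \<le> aff_dim ((\<lambda>z. (- L p) + z) ` (L ` S))" by (rule aff_dim_subset)
 also have "... = aff_dim (L ` S)" by (rule aff_dim_translation_eq)
 also have "... \<le> aff_dim S" by (rule aff_dim_linear_image_le[OF linL])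
 also have "... < int (DIM(real \<times> real))" using S(3) by simp
 finally obtain a b where ab: "a \<noteq> 0" "?Y -` S \<subseteq> {x. a \<bullet> x = b}" by (rule aff_lowdim_subset_hyperplane)
 have "negligible {x. a \<bullet> x = b}" by (rule negligible_hyperplane) (use ab in simp)
 then have "negligible (?Y -` S)" by (rule negligible_subset[OF _ ab(2)])
 moreover have "?Y -` S \<in> sets borel" using measurable_sets[OF m S(1)] by simp
 ultimately have "?Y -` S \<in> null_sets lborel" by (simp add: negligible_iff_null_sets null_sets_def)
 then have "AE z in lborel. ?Y z \<notin> S" using AE_not_in by fastforce
 then show ?thesis unfolding pm by (subst AE_distr_iff[OF m]) (use S(1) in auto)
qed

lemma AE_plane_other:
 fixes n :: "real^3"
 assumes n: "norm n = 1" and a: "norm a = 1" and ne: "\<not> (a = n \<and> s = c)" "\<not> (a = - n \<and> s = - c)"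
 shows "AE x in plane_measure {x. n \<bullet> x = c}. a \<bullet> x \<noteq> s"
proof -
 let ?S = "{x. n \<bullet> x = c} \<inter> {x. a \<bullet> x = s}"
 have "closed ?S" by (intro closed_Int closed_hyperplane)
 then have b: "?S \<in> sets borel" by simp
 have "aff_dim ?S < 2"
 proof (rule ccontr)
  assume "\<not> aff_dim ?S < 2"
  moreover have "aff_dim ?S \<le> aff_dim {x. n \<bullet> x = c}" by (intro aff_dim_subset) blast
  moreover have "n \<noteq> 0" using n by auto
  ultimately have "aff_dim ?S = 2" using aff_dim_hyperplane[of n c] by simp
  from unit_normal_unique[OF this n _ a] have "(a = n \<and> s = c) \<or> (a = - n \<and> s = - c)" by blast
  then show False using ne by blast
 qed
 then have "AE x in plane_measure {x. n \<bullet> x = c}. x \<notin> ?S" by (intro AE_plane_lowdim[OF n b]) blast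
 then show ?thesis using AE_plane_on[OF n, of c] by eventually_elim blast
qed

text \<open>On exactly one facet.\<close>

definition generic :: "(real^3) set => real^3 => real^3 => bool" where
 "generic K a x \<longleftrightarrow> a \<bullet> x = support K a \<and> (\<forall>a'\<in>normals K - {a}. a' \<bullet> x \<noteq> support K a')"

lemma AE_generic:
 assumes K: "polyhedral_cell K" and a: "a \<in> normals K"
 shows "AE x in plane_measure {x. a \<bullet> x = support K a}. generic K a x"
proof -
 have na: "norm a = 1" by (rule normals_facet(1)[OF K a])
 have "AE x in plane_measure {x. a \<bullet> x = support K a}. a' \<bullet> x \<noteq> support K a'" if a': "a' \<in> normals K - {a}" for a'
 proof (rule AE_plane_other[OF na])
  show "norm a' = 1" using a' normals_facet(1)[OF K] by blast
  show "\<not> (a' = a \<and> support K a' = support K a)" using a' by blast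
  show "\<not> (a' = - a \<and> support K a' = - support K a)" using cell_not_flat[OF K na] by blast
 qed
 then have "AE x in plane_measure {x. a \<bullet> x = support K a}. \<forall>a'\<in>normals K - {a}. a' \<bullet> x \<noteq> support K a'"
  using facet_rep(1)[OF K] by (subst AE_ball_countable) (auto simp: countable_finite)
 then show ?thesis using AE_plane_on[OF na, of "support K a"] by eventually_elim (simp add: generic_def)
qed

text \<open>All other constraints are strict at \<open>x\<close>, hence inactive nearby.\<close>

lemma generic_half_ball:
 assumes K: "polyhedral_cell K" and x: "x \<in> K" "generic K a x"
 obtains e where "e > 0" "!!y. dist x y < e ==> a \<bullet> y \<le> support K a ==> y \<in> K"
  "!!y. dist x y < e ==> a \<bullet> y < support K a ==> y \<in> interior K"
proof -
 let ?V = "open_halfspaces (normals K - {a}) (support K)"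
 have "open ?V" by (rule open_open_halfspaces) (simp add: facet_rep(1)[OF K])
 moreover have "x \<in> ?V"
  using x support_ge[OF K x(1)] by (auto simp: open_halfspaces_def generic_def less_le)
 ultimately obtain e where e: "e > 0" "ball x e \<subseteq> ?V" using open_contains_ball by blast
 show ?thesis
 proof (rule that[OF e(1)])
  fix y assume y: "dist x y < e"
  then have yV: "y \<in> ?V" using e(2) by auto
  show "y \<in> K" if "a \<bullet> y \<le> support K a"
  proof -
   have "y \<in> halfspaces (normals K) (support K)"
    using yV that unfolding halfspaces_def open_halfspaces_def by (force simp: less_imp_le)
   then show ?thesis using facet_rep(2)[OF K] by simp
  qed
  show "y \<in> interior K" if "a \<bullet> y < support K a"
   unfolding cell_interior[OF K] using yV that unfolding open_halfspaces_def by auto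
 qed
qed

section \<open>Faces of a mesh\<close>

text \<open>A Lipschitz domain lies locally on one side of its boundary. This is what excludes slits, across
 which two cells would touch without the common face being interior to the domain.\<close>

lemma lipschitz_domain_interior_closure:
 assumes "lipschitz_domain \<Omega>" shows "interior (closure \<Omega>) = \<Omega>"
proof
 have op: "open \<Omega>" using assms by (simp add: lipschitz_domain_def)
 show "\<Omega> \<subseteq> interior (closure \<Omega>)" by (rule interior_maximal[OF closure_subset op])
 show "interior (closure \<Omega>) \<subseteq> \<Omega>"
 proof (rule subsetI, rule ccontr)
  fix x assume x: "x \<in> interior (closure \<Omega>)" "x \<notin> \<Omega>"
  then have "x \<in> frontier \<Omega>" using interior_subset op by (auto simp: frontier_def interior_open)
  then obtain r L and Q :: "real^3 => real^3" and \<gamma> where r: "r > 0" and Q: "orthogonal_transformation Q" and \<gamma>: "L-lipschitz_on UNIV \<gamma>"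
   and eq: "\<Omega> \<inter> ball x r = {y \<in> ball x r. Q y $ 3 > \<gamma> (Q y $ 1, Q y $ 2)}"
   using assms unfolding lipschitz_domain_def by blast
  have linQ: "linear Q" using Q by (simp add: orthogonal_transformation_def)
  obtain e where e: "e > 0" "ball x e \<subseteq> closure \<Omega>" using x(1) by (auto simp: mem_interior)
  obtain d where d: "Q d = axis 3 1" using surjD[OF orthogonal_transformation_surj[OF Q], of "axis 3 1"] by (auto dest: sym)
  have nd: "norm d = 1" using orthogonal_transformation_norm[OF Q, of d] d by simp
  define t where "t = min e r / 2"
  have t: "t > 0" "t < e" "t < r" using e r by (auto simp: t_def min_def)
  let ?y = "x - t *\<^sub>R d"
  have Qy: "Q ?y = Q x - t *\<^sub>R axis 3 1" by (simp add: linear_diff[OF linQ] linear_cmul[OF linQ] d)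
  have "\<not> Q x $ 3 > \<gamma> (Q x $ 1, Q x $ 2)"
  proof
   assume "Q x $ 3 > \<gamma> (Q x $ 1, Q x $ 2)"
   then have "x \<in> \<Omega> \<inter> ball x r" unfolding eq using r by simp
   then show False using x(2) by blast
  qed
  then have lt: "Q ?y $ 3 < \<gamma> (Q ?y $ 1, Q ?y $ 2)" using t unfolding Qy by (simp add: axis_def)
  have Qc: "continuous_on UNIV Q" using linear_continuous_on linQ by (simp add: linear_conv_bounded_linear linear_continuous_on)
  have "continuous_on UNIV \<gamma>" using \<gamma> by (rule lipschitz_on_continuous_on)
  then have c1: "continuous_on UNIV (\<lambda>y. \<gamma> (Q y $ 1, Q y $ 2))"
   by (rule continuous_on_compose2) (intro continuous_intros Qc, simp)
  have c2: "continuous_on UNIV (\<lambda>y. Q y $ 3)" by (intro continuous_intros Qc)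
  let ?N = "{y. Q y $ 3 < \<gamma> (Q y $ 1, Q y $ 2)} \<inter> ball x r"
  have "open ?N" by (intro open_Int open_Collect_less c1 c2 open_ball)
  moreover have "?y \<in> ?N" using lt t nd by (simp add: dist_norm)
  moreover have "?y \<in> closure \<Omega>"
  proof -
   have "?y \<in> ball x e" using t nd by (simp add: dist_norm)
   then show ?thesis using e(2) by blast
  qed
  ultimately obtain z where "z \<in> \<Omega>" "z \<in> ?N" using open_Int_closure_eq_empty[of ?N \<Omega>] by blast
  then have "z \<in> {y \<in> ball x r. Q y $ 3 > \<gamma> (Q y $ 1, Q y $ 2)}" unfolding eq[symmetric] by blast
  then show False using \<open>z \<in> ?N\<close> by simp
 qed
qed

locale meshed_domain =
 fixes \<Omega> :: "(real^3) set" and T :: "(real^3) set set"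
 assumes dom: "lipschitz_domain \<Omega>" and mesh: "mesh \<Omega> T"
begin

lemma \<Omega>_open: "open \<Omega>" and \<Omega>_bounded: "bounded \<Omega>" using dom by (simp_all add: lipschitz_domain_def)
lemma \<Omega>_lebesgue: "\<Omega> \<in> sets lebesgue" using \<Omega>_open by simp
lemma T_finite: "finite T" using mesh by (simp add: mesh_def)
lemma cell: "K \<in> T ==> polyhedral_cell K" using mesh tetra_hexa_polyhedral_cell by (simp add: mesh_def)
lemma cells_disjoint: "K \<in> T ==> K' \<in> T ==> K \<noteq> K' ==> interior K \<inter> interior K' = {}"
 using mesh by (simp add: mesh_def)
lemma T_cover: "\<Union>T = closure \<Omega>" using mesh by (simp add: mesh_def)

lemma interior_union_subset: "\<T> \<subseteq> T ==> interior (\<Union>\<T>) \<subseteq> \<Omega>"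
 using interior_mono[of "\<Union>\<T>" "closure \<Omega>"] T_cover lipschitz_domain_interior_closure[OF dom] by blast

lemma interior_cell_subset: "K \<in> T ==> interior K \<subseteq> \<Omega>"
 using interior_union_subset[of "{K}"] by simp

abbreviation "plane K a \<equiv> {x. a \<bullet> x = support K a}"
abbreviation "facet_measure K a \<equiv> restrict_space (plane_measure (plane K a)) K"

text \<open>At a good point the mesh looks like a plane or a half space: every other cell through the point
 lies opposite \<open>K\<close> along a facet with normal \<open>- a\<close>. The last clause
 discards points where a null part of the facet meets the boundary of the domain; such parts are
 not boundary faces. Hanging nodes are allowed, so a facet of \<open>K\<close> may meet several
 cells, and the faces of the mesh are in general only pieces of facets.\<close>

definition good :: "(real^3) set => real^3 => real^3 => bool" where
 "good K a x \<longleftrightarrow> generic K a x \<and>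
   (\<forall>K'\<in>T - {K}. x \<in> K' --> aff_dim (K \<inter> K') = 2 \<and> K \<inter> K' \<subseteq> plane K a \<and> - a \<in> normals K' \<and>
    support K' (- a) = - support K a \<and> generic K' (- a) x) \<and>
   (emeasure (plane_measure (plane K a)) (K \<inter> plane K a \<inter> frontier \<Omega>) = 0 --> x \<notin> frontier \<Omega>)"

lemma facet_opposite:
 assumes K: "K \<in> T" "K' \<in> T" "K \<noteq> K'" and a: "a \<in> normals K" and f: "f \<subseteq> K \<inter> K'" "f \<subseteq> plane K a" "aff_dim f = 2"
 shows "- a \<in> normals K'" "support K' (- a) = - support K a" "K \<inter> K' \<subseteq> plane K a" "aff_dim (K \<inter> K') = 2"
proof -
 have fK: "f \<subseteq> K" "f \<subseteq> K'" using f by auto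
 obtain n s where n: "n \<in> normals K" "support K n = s" "- n \<in> normals K'" "support K' (- n) = - s" "K \<inter> K' \<subseteq> {x. n \<bullet> x = s}"
  by (rule cells_opposite[OF cell[OF K(1)] cell[OF K(2)] cells_disjoint[OF K] fK f(3)])
 have "a = n"
 proof (rule normal_on_face_unique[OF cell[OF K(1)] fK(1) f(3) n(1)])
  show "f \<subseteq> {x. n \<bullet> x = support K n}" using n f by blast
  show "norm a = 1" by (rule normals_facet(1)[OF cell[OF K(1)] a])
  show "a \<bullet> y \<le> a \<bullet> x" if "x \<in> f" "y \<in> K" for x y
   using support_ge[OF cell[OF K(1)] that(2), of a] that(1) f(2) by auto
 qed
 then show "- a \<in> normals K'" "support K' (- a) = - support K a" "K \<inter> K' \<subseteq> plane K a" using n by auto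
 have "aff_dim (K \<inter> K') \<le> aff_dim (plane K a)" by (rule aff_dim_subset) fact
 moreover have "a \<noteq> 0" using normals_facet(1)[OF cell[OF K(1)] a] by auto
 moreover have "aff_dim f \<le> aff_dim (K \<inter> K')" by (rule aff_dim_subset[OF f(1)])
 ultimately show "aff_dim (K \<inter> K') = 2" using f(3) aff_dim_hyperplane[of a "support K a"] by simp
qed

text \<open>A cell that meets the facet in a set of lower dimension does so on a null set; otherwise it lies
 opposite and almost all points are generic for it.\<close>

lemma AE_good:
 assumes K: "K \<in> T" and a: "a \<in> normals K"
 shows "AE x in plane_measure (plane K a). x \<in> K --> good K a x"
proof -
 let ?M = "plane_measure (plane K a)"
 have na: "norm a = 1" by (rule normals_facet(1)[OF cell[OF K] a])
 have on: "AE x in ?M. a \<bullet> x = support K a" by (rule AE_plane_on[OF na])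
 have "AE x in ?M. x \<in> K --> x \<in> K' --> aff_dim (K \<inter> K') = 2 \<and> K \<inter> K' \<subseteq> plane K a \<and> - a \<in> normals K' \<and>
    support K' (- a) = - support K a \<and> generic K' (- a) x" if K': "K' \<in> T - {K}" for K'
 proof -
  let ?f = "K \<inter> K' \<inter> plane K a"
  have cl: "closed ?f" using cell_closed[OF cell] K K' by (intro closed_Int closed_hyperplane) auto
  have "aff_dim ?f \<le> aff_dim (plane K a)" by (intro aff_dim_subset) blast
  moreover have "a \<noteq> 0" using na by auto
  ultimately have le: "aff_dim ?f \<le> 2" using aff_dim_hyperplane[of a "support K a"] by simp
  show ?thesis
  proof (cases "aff_dim ?f < 2")
   case True
   have "AE x in ?M. x \<notin> ?f" by (rule AE_plane_lowdim[OF na _ _ True]) (use cl in auto)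
   then show ?thesis using on by eventually_elim blast
  next
   case False
   then have d: "aff_dim ?f = 2" using le by simp
   have KK: "K' \<in> T" "K \<noteq> K'" using K' by auto
   have fs: "?f \<subseteq> K \<inter> K'" "?f \<subseteq> plane K a" by auto
   note o = facet_opposite[OF K KK a fs d]
   have eq: "plane K' (- a) = plane K a" using o(2) by auto
   have "AE x in ?M. generic K' (- a) x" using AE_generic[OF cell[OF KK(1)] o(1)] unfolding eq .
   then show ?thesis by eventually_elim (use o in blast)
  qed
 qed
 then have "AE x in ?M. \<forall>K'\<in>T - {K}. x \<in> K --> x \<in> K' --> aff_dim (K \<inter> K') = 2 \<and> K \<inter> K' \<subseteq> plane K a \<and> - a \<in> normals K' \<and>
    support K' (- a) = - support K a \<and> generic K' (- a) x"
  using T_finite by (subst AE_ball_countable) (auto simp: countable_finite)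
 moreover have "AE x in ?M. generic K a x" by (rule AE_generic[OF cell[OF K] a])
 moreover have "AE x in ?M. x \<in> K --> emeasure ?M (K \<inter> plane K a \<inter> frontier \<Omega>) = 0 --> x \<notin> frontier \<Omega>"
 proof (cases "emeasure ?M (K \<inter> plane K a \<inter> frontier \<Omega>) = 0")
  case True
  have "closed (K \<inter> plane K a \<inter> frontier \<Omega>)"
   using cell_closed[OF cell[OF K]] by (intro closed_Int closed_hyperplane frontier_closed)
  then have "K \<inter> plane K a \<inter> frontier \<Omega> \<in> null_sets ?M" using True by (simp add: null_sets_def)
  then have "AE x in ?M. x \<notin> K \<inter> plane K a \<inter> frontier \<Omega>" by (rule AE_not_in)
  then show ?thesis using on by eventually_elim blast
 qed simp
 ultimately show ?thesis by eventually_elim (unfold good_def, blast)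
qed

lemma good_plane: "good K a x ==> a \<bullet> x = support K a"
 by (simp add: good_def generic_def)

text \<open>The two half balls fill a ball.\<close>

lemma good_two_cells:
 assumes K: "K \<in> T" "K' \<in> T" "K \<noteq> K'" and x: "x \<in> K" "x \<in> K'" and g: "good K a x"
 shows "x \<in> interior (K \<union> K')"
proof -
 have gen: "generic K a x" "- a \<in> normals K'" "support K' (- a) = - support K a" "generic K' (- a) x"
  using g K x unfolding good_def by auto
 obtain e1 where e1: "e1 > 0" "!!y. dist x y < e1 ==> a \<bullet> y \<le> support K a ==> y \<in> K"
  by (rule generic_half_ball[OF cell[OF K(1)] x(1) gen(1)]) blast
 obtain e2 where e2: "e2 > 0" "!!y. dist x y < e2 ==> (- a) \<bullet> y \<le> support K' (- a) ==> y \<in> K'"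
  by (rule generic_half_ball[OF cell[OF K(2)] x(2) gen(4)]) blast
 have "ball x (min e1 e2) \<subseteq> K \<union> K'"
 proof
  fix y assume y: "y \<in> ball x (min e1 e2)"
  show "y \<in> K \<union> K'"
  proof (cases "a \<bullet> y \<le> support K a")
   case True then show ?thesis using e1(2)[of y] y by simp
  next
   case False then show ?thesis using e2(2)[of y] y gen(3) by simp
  qed
 qed
 then show ?thesis unfolding mem_interior using e1(1) e2(1) by (intro exI[of _ "min e1 e2"]) simp
qed

lemma good_in_domain:
 assumes K: "K \<in> T" "K' \<in> T" "K \<noteq> K'" and x: "x \<in> K" "x \<in> K'" and g: "good K a x"
 shows "x \<in> \<Omega>"
 using good_two_cells[OF assms] interior_union_subset[of "{K, K'}"] K by auto

text \<open>A third cell would overlap the half ball of the second one.\<close>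

lemma good_third_cell:
 assumes K: "K \<in> T" "K' \<in> T" "K'' \<in> T" "K \<noteq> K'" "K \<noteq> K''" and x: "x \<in> K" "x \<in> K'" "x \<in> K''" and g: "good K a x" and a: "a \<in> normals K"
 shows "K' = K''"
proof (rule ccontr)
 assume ne: "K' \<noteq> K''"
 have s1: "support K' (- a) = - support K a" "generic K' (- a) x" using g K x unfolding good_def by auto
 have s2: "support K'' (- a) = - support K a" "generic K'' (- a) x" using g K x unfolding good_def by auto
 obtain e1 where e1: "e1 > 0" "!!y. dist x y < e1 ==> (- a) \<bullet> y < support K' (- a) ==> y \<in> interior K'"
  by (rule generic_half_ball[OF cell[OF K(2)] x(2) s1(2)]) blast
 obtain e2 where e2: "e2 > 0" "!!y. dist x y < e2 ==> (- a) \<bullet> y < support K'' (- a) ==> y \<in> interior K''"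
  by (rule generic_half_ball[OF cell[OF K(3)] x(3) s2(2)]) blast
 have na: "norm a = 1" by (rule normals_facet(1)[OF cell[OF K(1)] a])
 let ?t = "min e1 e2 / 2"
 have t: "?t > 0" "?t < e1" "?t < e2" using e1(1) e2(1) by (auto simp: min_def)
 let ?y = "x + ?t *\<^sub>R a"
 have dy: "dist x ?y = ?t" using t(1) na by (simp add: dist_norm)
 have "a \<bullet> a = 1" using na by (simp add: norm_eq_1)
 then have ay: "(- a) \<bullet> ?y < - support K a" using good_plane[OF g] t(1) by (simp add: inner_add_right)
 have "?y \<in> interior K'" "?y \<in> interior K''"
  using e1(2)[of ?y] e2(2)[of ?y] dy t ay s1(1) s2(1) by simp_all
 then show False using cells_disjoint[OF K(2,3) ne] by blast
qed

text \<open>The points just outside \<open>K\<close> belong to finitely many other closed cells.\<close>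

lemma good_has_neighbour:
 assumes K: "K \<in> T" and x: "x \<in> K" "x \<in> \<Omega>" and g: "good K a x" and a: "a \<in> normals K"
 obtains K' where "K' \<in> T" "K' \<noteq> K" "x \<in> K'"
proof -
 let ?C = "\<Union>(T - {K})"
 have cl: "closed ?C" using T_finite cell_closed[OF cell] by (intro closed_Union) auto
 have na: "norm a = 1" "a \<bullet> a = 1" using normals_facet(1)[OF cell[OF K] a] by (auto simp: norm_eq_1)
 obtain e where e: "e > 0" "ball x e \<subseteq> \<Omega>" using \<Omega>_open x(2) open_contains_ball by blast
 have "x \<in> closure ?C" unfolding closure_approachable
 proof (intro allI impI)
  fix d :: real assume d: "d > 0"
  let ?t = "min d e / 2"
  have t: "?t > 0" "?t < d" "?t < e" using d e(1) by (auto simp: min_def)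
  let ?y = "x + ?t *\<^sub>R a"
  have dy: "dist ?y x = ?t" using t(1) na by (simp add: dist_norm)
  have "?y \<in> ball x e" using dy t(3) by (simp add: dist_commute)
  then have "?y \<in> \<Union>T" using e(2) T_cover closure_subset by blast
  moreover have "?y \<notin> K"
  proof
   assume "?y \<in> K"
   then have "a \<bullet> ?y \<le> support K a" by (rule support_ge[OF cell[OF K]])
   then show False using good_plane[OF g] t(1) na by (simp add: inner_add_right)
  qed
  ultimately have "?y \<in> ?C" by blast
  then show "\<exists>y\<in>?C. dist y x < d" by (rule bexI[rotated]) (use dy t(2) in linarith)
 qed
 then have "x \<in> ?C" using cl by simp
 then show ?thesis using that by blast
qed

lemma faces_finite: "finite (faces \<Omega> T)"
proof -
 have "interior_faces T \<subseteq> (\<lambda>(K, K'). K \<inter> K') ` (T \<times> T)" by (auto simp: interior_faces_def)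
 then have "finite (interior_faces T)" using T_finite finite_subset by blast
 moreover have "boundary_faces \<Omega> T \<subseteq> (\<Union>K\<in>T. (\<lambda>a. K \<inter> plane K a \<inter> frontier \<Omega>) ` normals K)"
 proof
  fix f assume "f \<in> boundary_faces \<Omega> T"
  then obtain F K where FK: "f = F \<inter> frontier \<Omega>" "K \<in> T" "F facet_of K" by (auto simp: boundary_faces_def)
  obtain a where "a \<in> normals K" "F = K \<inter> plane K a" using facet_rep(3)[OF cell[OF FK(2)] FK(3)] by blast
  then show "f \<in> (\<Union>K\<in>T. (\<lambda>a. K \<inter> plane K a \<inter> frontier \<Omega>) ` normals K)" using FK by blast
 qed
 moreover have "finite (\<Union>K\<in>T. (\<lambda>a. K \<inter> plane K a \<inter> frontier \<Omega>) ` normals K)"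
  using T_finite facet_rep(1)[OF cell] by auto
 ultimately show ?thesis unfolding faces_def using finite_subset by blast
qed

lemma surface_measure_facet:
 assumes K: "K \<in> T" and a: "a \<in> normals K" and f: "affine hull f = plane K a"
 shows "surface_measure f = restrict_space (plane_measure (plane K a)) f"
 unfolding surface_measure_def f ..

lemma boundary_face_cases:
 assumes "f \<in> boundary_faces \<Omega> T"
 obtains K a where "K \<in> T" "a \<in> normals K" "f = K \<inter> plane K a \<inter> frontier \<Omega>"
  "emeasure (plane_measure (plane K a)) f > 0"
proof -
 obtain F K where FK: "f = F \<inter> frontier \<Omega>" "K \<in> T" "F facet_of K" "emeasure (surface_measure F) (F \<inter> frontier \<Omega>) > 0"
  using assms by (auto simp: boundary_faces_def)
 obtain a where a: "a \<in> normals K" "F = K \<inter> plane K a" using facet_rep(3)[OF cell[OF FK(2)] FK(3)] by blast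
 have hull: "affine hull F = plane K a" using normals_facet(3)[OF cell[OF FK(2)] a(1)] a(2) by simp
 have "closed F" using a(2) cell_closed[OF cell[OF FK(2)]] by (auto intro: closed_Int closed_hyperplane)
 then have "emeasure (surface_measure F) (F \<inter> frontier \<Omega>) = emeasure (plane_measure (plane K a)) (F \<inter> frontier \<Omega>)"
  unfolding surface_measure_facet[OF FK(2) a(1) hull] by (intro emeasure_restrict_space) auto
 then show ?thesis using that[OF FK(2) a(1)] FK a by simp
qed

lemma interior_face_cases:
 assumes "f \<in> interior_faces T"
 obtains K K' where "K \<in> T" "K' \<in> T" "K \<noteq> K'" "f = K \<inter> K'" "aff_dim f = 2"
 using assms that by (auto simp: interior_faces_def)

text \<open>A good point inside the domain lies in exactly one other cell, and the intersection of the two is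
 the face; a good point on the boundary lies in no other cell and belongs to a boundary face of
 positive measure.\<close>

lemma face_partition:
 assumes K: "K \<in> T" and a: "a \<in> normals K" and x: "x \<in> K" and g: "good K a x"
 shows "\<exists>!f. f \<in> faces \<Omega> T \<and> f \<subseteq> K \<inter> plane K a \<and> x \<in> f"
proof (cases "x \<in> \<Omega>")
 case True
 obtain K' where K': "K' \<in> T" "K' \<noteq> K" "x \<in> K'" by (rule good_has_neighbour[OF K x True g a])
 have d: "aff_dim (K \<inter> K') = 2" "K \<inter> K' \<subseteq> plane K a" using g K' unfolding good_def by auto
 show ?thesis
 proof (rule ex1I[of _ "K \<inter> K'"])
  have "K \<inter> K' \<in> interior_faces T" using K K' d(1) by (auto simp: interior_faces_def)
  then show "K \<inter> K' \<in> faces \<Omega> T \<and> K \<inter> K' \<subseteq> K \<inter> plane K a \<and> x \<in> K \<inter> K'"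
   using d x K' by (auto simp: faces_def)
  fix f assume f: "f \<in> faces \<Omega> T \<and> f \<subseteq> K \<inter> plane K a \<and> x \<in> f"
  have "f \<notin> boundary_faces \<Omega> T"
  proof
   assume "f \<in> boundary_faces \<Omega> T"
   then have "f \<subseteq> frontier \<Omega>" by (auto simp: boundary_faces_def)
   then show False using f True \<Omega>_open by (auto simp: frontier_def interior_open)
  qed
  then have "f \<in> interior_faces T" using f by (simp add: faces_def)
  then obtain K1 K2 where K12: "K1 \<in> T" "K2 \<in> T" "K1 \<noteq> K2" "f = K1 \<inter> K2" by (rule interior_face_cases)
  have only: "L = K \<or> L = K'" if "L \<in> T" "x \<in> L" for L
   using good_third_cell[OF K K'(1) that(1) _ _ x K'(3) that(2) g a] K'(2) by blast
  have "K1 = K \<or> K1 = K'" "K2 = K \<or> K2 = K'" using only K12 f by auto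
  then show "f = K \<inter> K'" using K12 by auto
 qed
next
 case False
 have "x \<in> closure \<Omega>" using K x T_cover by blast
 then have fr: "x \<in> frontier \<Omega>" using False \<Omega>_open by (simp add: frontier_def interior_open)
 let ?f = "K \<inter> plane K a \<inter> frontier \<Omega>"
 have pos: "emeasure (plane_measure (plane K a)) ?f > 0" using g fr unfolding good_def by (auto simp: zero_less_iff_neq_zero)
 have only: "L = K" if "L \<in> T" "x \<in> L" for L
  using good_in_domain[OF K that(1) _ x that(2) g] False by blast
 show ?thesis
 proof (rule ex1I[of _ ?f])
  let ?F = "K \<inter> plane K a"
  have "?F facet_of K" using a by (simp add: normals_def)
  moreover have "emeasure (surface_measure ?F) (?F \<inter> frontier \<Omega>) > 0"
  proof -
   have "closed ?F" using cell_closed[OF cell[OF K]] by (intro closed_Int closed_hyperplane)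
   then have "emeasure (surface_measure ?F) (?F \<inter> frontier \<Omega>) = emeasure (plane_measure (plane K a)) (?F \<inter> frontier \<Omega>)"
    unfolding surface_measure_facet[OF K a normals_facet(3)[OF cell[OF K] a]] by (intro emeasure_restrict_space) auto
   then show ?thesis using pos by simp
  qed
  ultimately have "?f \<in> boundary_faces \<Omega> T" using K unfolding boundary_faces_def by blast
  then show "?f \<in> faces \<Omega> T \<and> ?f \<subseteq> K \<inter> plane K a \<and> x \<in> ?f"
   using x fr good_plane[OF g] by (auto simp: faces_def)
  fix f assume f: "f \<in> faces \<Omega> T \<and> f \<subseteq> K \<inter> plane K a \<and> x \<in> f"
  have "f \<notin> interior_faces T"
  proof
   assume "f \<in> interior_faces T"
   then obtain K1 K2 where "K1 \<in> T" "K2 \<in> T" "K1 \<noteq> K2" "f = K1 \<inter> K2" by (rule interior_face_cases)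
   then show False using only[of K1] only[of K2] f by auto
  qed
  then have "f \<in> boundary_faces \<Omega> T" using f by (simp add: faces_def)
  then obtain K1 a1 where K1: "K1 \<in> T" "a1 \<in> normals K1" "f = K1 \<inter> plane K1 a1 \<inter> frontier \<Omega>"
   by (rule boundary_face_cases) blast
  have "K1 = K" using only[OF K1(1)] K1(3) f by blast
  moreover have "a1 = a"
  proof (rule ccontr)
   assume "a1 \<noteq> a"
   then have "a1 \<bullet> x \<noteq> support K a1" using g K1(2) \<open>K1 = K\<close> unfolding good_def generic_def by blast
   then show False using K1(3) \<open>K1 = K\<close> f by auto
  qed
  ultimately show "f = ?f" using K1 by simp
 qed
qed

lemma face_closed:
 assumes "f \<in> faces \<Omega> T" shows "closed f"
proof (cases "f \<in> interior_faces T")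
 case True
 then obtain K K' where "K \<in> T" "K' \<in> T" "f = K \<inter> K'" by (rule interior_face_cases) blast
 then show ?thesis using cell_closed[OF cell] by (simp add: closed_Int)
next
 case False
 then have "f \<in> boundary_faces \<Omega> T" using assms by (simp add: faces_def)
 then obtain K a where "K \<in> T" "f = K \<inter> plane K a \<inter> frontier \<Omega>" by (rule boundary_face_cases) blast
 then show ?thesis using cell_closed[OF cell] by (auto intro!: closed_Int closed_hyperplane)
qed

lemma facet_integral_split:
 fixes g :: "real^3 => real"
 assumes K: "K \<in> T" and a: "a \<in> normals K" and g: "integrable (facet_measure K a) g"
 shows "(LINT x|facet_measure K a. g x)
  = (\<Sum>f\<in>{f \<in> faces \<Omega> T. f \<subseteq> K \<inter> plane K a}. LINT x|restrict_space (plane_measure (plane K a)) f. g x)"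
proof -
 let ?M = "plane_measure (plane K a)" and ?S = "{f \<in> faces \<Omega> T. f \<subseteq> K \<inter> plane K a}"
 have fin: "finite ?S" using faces_finite by simp
 have Kb: "K \<in> sets borel" using cell_closed[OF cell[OF K]] by simp
 have fb: "f \<in> sets borel" if "f \<in> ?S" for f using face_closed that by simp
 have gi: "integrable ?M (\<lambda>x. indicator K x * g x)"
  using g Kb by (subst (asm) integrable_restrict_space) auto
 have fi: "integrable ?M (\<lambda>x. indicator f x * g x)" if f: "f \<in> ?S" for f
 proof -
  have "integrable ?M (\<lambda>x. indicator f x *\<^sub>R (indicator K x * g x))"
   by (rule integrable_mult_indicator[OF _ gi]) (use fb[OF f] in simp)
  moreover have "(\<lambda>x. indicator f x *\<^sub>R (indicator K x * g x)) = (\<lambda>x. indicator f x * g x)"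
   by (rule ext) (use f in \<open>auto simp: indicator_def\<close>)
  ultimately show ?thesis by (simp only:)
 qed
 have "(LINT x|restrict_space ?M K. g x) = (LINT x|?M. indicator K x * g x)"
  using Kb by (subst integral_restrict_space) auto
 also have "... = (LINT x|?M. (\<Sum>f\<in>?S. indicator f x * g x))"
 proof (rule integral_cong_AE)
  show "(\<lambda>x. indicator K x * g x) \<in> borel_measurable ?M" using gi by (rule borel_measurable_integrable)
  show "(\<lambda>x. \<Sum>f\<in>?S. indicator f x * g x) \<in> borel_measurable ?M"
   by (intro borel_measurable_sum borel_measurable_integrable fi)
  show "AE x in ?M. indicator K x * g x = (\<Sum>f\<in>?S. indicator f x * g x)"
   using AE_good[OF K a]
  proof eventually_elim
   case (elim x)
   show ?case
   proof (cases "x \<in> K")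
    case True
    then have "\<exists>!f. f \<in> faces \<Omega> T \<and> f \<subseteq> K \<inter> plane K a \<and> x \<in> f" using face_partition[OF K a True] elim by blast
    then obtain f0 where f0: "f0 \<in> ?S" "x \<in> f0" and u: "!!f. f \<in> ?S ==> x \<in> f ==> f = f0" by blast
    have "(\<Sum>f\<in>?S. indicator f x * g x) = (\<Sum>f\<in>?S. if f = f0 then g x else 0)"
    proof (rule sum.cong[OF refl])
     fix f assume f: "f \<in> ?S"
     show "indicator f x * g x = (if f = f0 then g x else 0)"
     proof (cases "x \<in> f")
      case True
      then have "f = f0" by (rule u[OF f])
      then show ?thesis using f0(2) by simp
     next
      case False
      then have "f \<noteq> f0" using f0(2) by blast
      then show ?thesis using False by simp
     qed
    qed
    also have "... = g x" using fin f0(1) by simp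
    finally show ?thesis using True by simp
   next
    case False
    then have "(\<Sum>f\<in>?S. indicator f x * g x) = 0" by (intro sum.neutral) (auto simp: indicator_def)
    then show ?thesis using False by simp
   qed
  qed
 qed
 also have "... = (\<Sum>f\<in>?S. LINT x|?M. indicator f x * g x)" by (intro Bochner_Integration.integral_sum fi)
 also have "... = (\<Sum>f\<in>?S. LINT x|restrict_space ?M f. g x)"
  by (intro sum.cong refl) (use fb in \<open>simp add: integral_restrict_space\<close>)
 finally show ?thesis .
qed

lemma outward_normal_eq:
 assumes K: "K \<in> T" and a: "a \<in> normals K" and f: "f \<subseteq> K" "f \<subseteq> plane K a" "aff_dim f = 2"
 shows "outward_normal K f = a"
 unfolding outward_normal_def
proof (rule the_equality)
 show "norm a = 1 \<and> (\<forall>x\<in>f. \<forall>y\<in>K. a \<bullet> (y - x) \<le> 0)"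
  using normals_facet(1)[OF cell[OF K] a] support_ge[OF cell[OF K], of _ a] f(2) by (auto simp: inner_diff_right)
 fix n assume n: "norm n = 1 \<and> (\<forall>x\<in>f. \<forall>y\<in>K. n \<bullet> (y - x) \<le> 0)"
 show "n = a"
  by (rule normal_on_face_unique[OF cell[OF K] f(1,3) a f(2)]) (use n in \<open>auto simp: inner_diff_right\<close>)
qed

lemma interior_face_adjacent:
 assumes K: "K \<in> T" "K' \<in> T" "K \<noteq> K'" and d: "aff_dim (K \<inter> K') = 2"
 shows "adjacent T (K \<inter> K') = {K, K'}"
proof
 show "{K, K'} \<subseteq> adjacent T (K \<inter> K')" using K by (auto simp: adjacent_def)
 show "adjacent T (K \<inter> K') \<subseteq> {K, K'}"
 proof (rule subsetI, rule ccontr)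
  fix L assume L: "L \<in> adjacent T (K \<inter> K')" "L \<notin> {K, K'}"
  then have LT: "L \<in> T" "K \<inter> K' \<subseteq> L" by (auto simp: adjacent_def)
  have ne: "K \<noteq> L" "K' \<noteq> L" using L by auto
  show False
   by (rule no_three_cells[OF cell[OF K(1)] cell[OF K(2)] cell[OF LT(1)] cells_disjoint[OF K] cells_disjoint[OF K(1) LT(1) ne(1)]
      cells_disjoint[OF K(2) LT(1) ne(2)] _ _ LT(2) d]) auto
 qed
qed

lemma boundary_face_geometry:
 assumes K: "K \<in> T" and a: "a \<in> normals K" and f: "f = K \<inter> plane K a \<inter> frontier \<Omega>" and pos: "emeasure (plane_measure (plane K a)) f > 0"
 shows "aff_dim f = 2" "adjacent T f = {K}"
proof -
 let ?M = "plane_measure (plane K a)"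
 have na: "norm a = 1" by (rule normals_facet(1)[OF cell[OF K] a])
 have fb: "f \<in> sets borel"
  unfolding f using cell_closed[OF cell[OF K]] by (intro borel_closed closed_Int closed_hyperplane frontier_closed)
 have ex: "\<exists>x\<in>f. P x" if "AE x in ?M. x \<in> f --> P x" for P
 proof (rule ccontr)
  assume no: "\<not> (\<exists>x\<in>f. P x)"
  from that have "AE x in ?M. x \<notin> f" by eventually_elim (use no in blast)
  then have "f \<in> null_sets ?M" using fb by (subst AE_iff_null_sets) auto
  then show False using pos by (simp add: null_sets_def)
 qed
 show "aff_dim f = 2"
 proof (rule ccontr)
  assume ne: "aff_dim f \<noteq> 2"
  have "aff_dim f \<le> aff_dim (plane K a)" unfolding f by (intro aff_dim_subset) blast
  moreover have "a \<noteq> 0" using na by auto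
  ultimately have lt: "aff_dim f < 2" using ne aff_dim_hyperplane[of a "support K a"] by simp
  have "AE x in ?M. x \<notin> f" by (rule AE_plane_lowdim[OF na fb _ lt]) (auto simp: f)
  then have "\<exists>x\<in>f. False" by (intro ex) simp
  then show False by blast
 qed
 show "adjacent T f = {K}"
 proof
  show "{K} \<subseteq> adjacent T f" using K f by (auto simp: adjacent_def)
  show "adjacent T f \<subseteq> {K}"
  proof
   fix L assume "L \<in> adjacent T f"
   then have L: "L \<in> T" "f \<subseteq> L" by (auto simp: adjacent_def)
   have "AE x in ?M. x \<in> f --> good K a x" using AE_good[OF K a] by eventually_elim (simp add: f)
   then obtain x where x: "x \<in> f" "good K a x" using ex by blast
   have "x \<notin> \<Omega>" using x(1) \<Omega>_open by (simp add: f frontier_def interior_open)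
   then have "L = K" using good_in_domain[OF K L(1) _ _ _ x(2)] x(1) L(2) f by blast
   then show "L \<in> {K}" by simp
  qed
 qed
qed

lemma interior_face_normals:
 assumes K: "K \<in> T" "K' \<in> T" "K \<noteq> K'" and d: "aff_dim (K \<inter> K') = 2"
 obtains a where "a \<in> normals K" "- a \<in> normals K'" "support K' (- a) = - support K a" "K \<inter> K' \<subseteq> plane K a"
  "outward_normal K (K \<inter> K') = a" "outward_normal K' (K \<inter> K') = - a"
proof -
 obtain n s where n: "n \<in> normals K" "support K n = s" "- n \<in> normals K'" "support K' (- n) = - s" "K \<inter> K' \<subseteq> {x. n \<bullet> x = s}"
  by (rule cells_opposite[OF cell[OF K(1)] cell[OF K(2)] cells_disjoint[OF K] Int_lower1 Int_lower2 d])
 have p: "K \<inter> K' \<subseteq> plane K n" "K \<inter> K' \<subseteq> plane K' (- n)" using n by auto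
 show ?thesis
  by (rule that[OF n(1,3) _ p(1) outward_normal_eq[OF K(1) n(1) Int_lower1 p(1) d] outward_normal_eq[OF K(2) n(3) Int_lower2 p(2) d]])
   (use n in simp)
qed

lemma adjacent_face_normal:
 assumes f: "f \<in> faces \<Omega> T" and K: "K \<in> adjacent T f"
 shows "outward_normal K f \<in> normals K" "f \<subseteq> K \<inter> plane K (outward_normal K f)" "aff_dim f = 2"
proof -
 have *: "outward_normal K f \<in> normals K \<and> f \<subseteq> K \<inter> plane K (outward_normal K f) \<and> aff_dim f = 2"
 proof (cases "f \<in> interior_faces T")
  case True
  then obtain K1 K2 where K12: "K1 \<in> T" "K2 \<in> T" "K1 \<noteq> K2" "f = K1 \<inter> K2" "aff_dim f = 2" by (rule interior_face_cases)
  have d: "aff_dim (K1 \<inter> K2) = 2" using K12 by simp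
  obtain a where a: "a \<in> normals K1" "- a \<in> normals K2" "support K2 (- a) = - support K1 a" "K1 \<inter> K2 \<subseteq> plane K1 a"
   "outward_normal K1 (K1 \<inter> K2) = a" "outward_normal K2 (K1 \<inter> K2) = - a"
   by (rule interior_face_normals[OF K12(1-3) d])
  have "K = K1 \<or> K = K2" using K interior_face_adjacent[OF K12(1-3) d] K12(4) by auto
  then show ?thesis
  proof
   assume "K = K1" then show ?thesis using a K12 by auto
  next
   assume "K = K2" then show ?thesis using a K12 by auto
  qed
 next
  case False
  then have "f \<in> boundary_faces \<Omega> T" using f by (simp add: faces_def)
  then obtain K1 a where K1: "K1 \<in> T" "a \<in> normals K1" "f = K1 \<inter> plane K1 a \<inter> frontier \<Omega>" "emeasure (plane_measure (plane K1 a)) f > 0"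
   by (rule boundary_face_cases)
  note geo = boundary_face_geometry[OF K1]
  have "K = K1" using K geo(2) by simp
  moreover have "outward_normal K1 f = a" by (rule outward_normal_eq[OF K1(1,2) _ _ geo(1)]) (use K1(3) in auto)
  ultimately show ?thesis using K1 geo(1) by auto
 qed
 then show "outward_normal K f \<in> normals K" "f \<subseteq> K \<inter> plane K (outward_normal K f)" "aff_dim f = 2" by auto
qed

lemma adjacent_surface_measure:
 assumes f: "f \<in> faces \<Omega> T" and K: "K \<in> adjacent T f"
 shows "surface_measure f = restrict_space (plane_measure (plane K (outward_normal K f))) f"
proof -
 have KT: "K \<in> T" using K by (simp add: adjacent_def)
 note n = adjacent_face_normal[OF f K]
 have "affine hull f = plane K (outward_normal K f)"
  by (rule affine_hyperplane_eq[OF n(3)]) (use n(2) normals_facet(1)[OF cell[OF KT] n(1)] in auto)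
 then show ?thesis by (rule surface_measure_facet[OF KT n(1)])
qed

text \<open>From sums over cells and facets to sums over faces and adjacent cells: a face lies in exactly one
 facet of each adjacent cell, the one with the outward normal of the face.\<close>

lemma sum_facets_eq_sum_faces:
 fixes I :: "(real^3) set => (real^3) set => real^3 => real"
 shows "(\<Sum>K\<in>T. \<Sum>a\<in>normals K. \<Sum>f\<in>{f \<in> faces \<Omega> T. f \<subseteq> K \<inter> plane K a}. I f K a)
  = (\<Sum>f\<in>faces \<Omega> T. \<Sum>K\<in>adjacent T f. I f K (outward_normal K f))"
proof -
 have "(\<Sum>K\<in>T. \<Sum>a\<in>normals K. \<Sum>f\<in>{f \<in> faces \<Omega> T. f \<subseteq> K \<inter> plane K a}. I f K a)
   = (\<Sum>K\<in>T. \<Sum>a\<in>normals K. \<Sum>f\<in>faces \<Omega> T. if f \<subseteq> K \<inter> plane K a then I f K a else 0)"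
  by (intro sum.cong refl sum.inter_filter[OF faces_finite])
 also have "... = (\<Sum>K\<in>T. \<Sum>f\<in>faces \<Omega> T. \<Sum>a\<in>normals K. if f \<subseteq> K \<inter> plane K a then I f K a else 0)"
  by (intro sum.cong refl sum.swap)
 also have "... = (\<Sum>f\<in>faces \<Omega> T. \<Sum>K\<in>T. \<Sum>a\<in>normals K. if f \<subseteq> K \<inter> plane K a then I f K a else 0)"
  by (rule sum.swap)
 also have "... = (\<Sum>f\<in>faces \<Omega> T. \<Sum>K\<in>adjacent T f. I f K (outward_normal K f))"
 proof (rule sum.cong[OF refl])
  fix f assume f: "f \<in> faces \<Omega> T"
  have "(\<Sum>K\<in>T. \<Sum>a\<in>normals K. if f \<subseteq> K \<inter> plane K a then I f K a else 0) = (\<Sum>K\<in>T. if f \<subseteq> K then I f K (outward_normal K f) else 0)"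
  proof (rule sum.cong[OF refl])
   fix K assume K: "K \<in> T"
   show "(\<Sum>a\<in>normals K. if f \<subseteq> K \<inter> plane K a then I f K a else 0) = (if f \<subseteq> K then I f K (outward_normal K f) else 0)"
   proof (cases "f \<subseteq> K")
    case True
    then have "K \<in> adjacent T f" using K by (simp add: adjacent_def)
    note n = adjacent_face_normal[OF f this]
    have "(\<Sum>a\<in>normals K. if f \<subseteq> K \<inter> plane K a then I f K a else 0) = (\<Sum>a\<in>normals K. if a = outward_normal K f then I f K a else 0)"
    proof (rule sum.cong[OF refl])
     fix a assume a: "a \<in> normals K"
     have "outward_normal K f = a" if "f \<subseteq> K \<inter> plane K a" using outward_normal_eq[OF K a _ _ n(3)] that by blast
     then have "f \<subseteq> K \<inter> plane K a \<longleftrightarrow> a = outward_normal K f" using n(2) by blast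
     then show "(if f \<subseteq> K \<inter> plane K a then I f K a else 0) = (if a = outward_normal K f then I f K a else 0)"
      by (simp only:)
    qed
    also have "... = I f K (outward_normal K f)" using n(1) facet_rep(1)[OF cell[OF K]] by simp
    finally show ?thesis using True by simp
   next
    case False then show ?thesis by (auto intro!: sum.neutral)
   qed
  qed
  also have "... = (\<Sum>K\<in>adjacent T f. I f K (outward_normal K f))"
   unfolding adjacent_def by (rule sum.inter_filter[OF T_finite, symmetric])
  finally show "(\<Sum>K\<in>T. \<Sum>a\<in>normals K. if f \<subseteq> K \<inter> plane K a then I f K a else 0) = (\<Sum>K\<in>adjacent T f. I f K (outward_normal K f))" .
 qed
 finally show ?thesis .
qed

lemma AE_one_cell: "AE x in lebesgue_on \<Omega>. \<exists>!K. K \<in> T \<and> x \<in> interior K"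
proof -
 have "negligible (\<Union>K\<in>T. frontier K)"
  using T_finite negligible_convex_frontier[OF cell_convex[OF cell]] by (intro negligible_Union finite_imageI) auto
 then have "AE x in lebesgue. x \<notin> (\<Union>K\<in>T. frontier K)" by (simp only: negligible_iff_null_sets AE_not_in)
 then have "AE x in lebesgue. x \<in> \<Omega> --> (\<exists>!K. K \<in> T \<and> x \<in> interior K)"
 proof eventually_elim
  case (elim x)
  show ?case
  proof
   assume "x \<in> \<Omega>"
   then have "x \<in> \<Union>T" using T_cover closure_subset by blast
   then obtain K where K: "K \<in> T" "x \<in> K" by blast
   then have "x \<in> interior K" using elim cell_closed[OF cell[OF K(1)]] by (auto simp: frontier_def)
   then show "\<exists>!K. K \<in> T \<and> x \<in> interior K" using K(1) cells_disjoint by blast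
  qed
 qed
 then show ?thesis using \<Omega>_lebesgue by (simp add: AE_restrict_space_iff)
qed

lemma integral_cells:
 fixes g :: "real^3 => real"
 assumes g: "integrable (lebesgue_on \<Omega>) g"
 shows "(LINT x|lebesgue_on \<Omega>. g x) = (\<Sum>K\<in>T. LINT x|lebesgue_on (interior K). g x)"
proof -
 have gl: "integrable lebesgue (\<lambda>x. indicator \<Omega> x *\<^sub>R g x)" using g lebesgue_on_integral_eq(2)[OF \<Omega>_lebesgue, of g] by simp
 have ik: "integrable lebesgue (\<lambda>x. indicator (interior K) x *\<^sub>R g x)" if K: "K \<in> T" for K
 proof -
  have "integrable lebesgue (\<lambda>x. indicator (interior K) x *\<^sub>R (indicator \<Omega> x *\<^sub>R g x))"
   by (rule integrable_mult_indicator[OF _ gl]) simp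
  moreover have "(\<lambda>x. indicator (interior K) x *\<^sub>R (indicator \<Omega> x *\<^sub>R g x)) = (\<lambda>x. indicator (interior K) x *\<^sub>R g x)"
   by (rule ext) (use interior_cell_subset[OF K] in \<open>auto simp: indicator_def\<close>)
  ultimately show ?thesis by (simp only:)
 qed
 have "(LINT x|lebesgue_on \<Omega>. g x) = (LINT x|lebesgue. indicator \<Omega> x *\<^sub>R g x)" by (rule lebesgue_on_integral_eq(1)[OF \<Omega>_lebesgue])
 also have "... = (LINT x|lebesgue. (\<Sum>K\<in>T. indicator (interior K) x *\<^sub>R g x))"
 proof (rule integral_cong_AE)
  show "(\<lambda>x. indicator \<Omega> x *\<^sub>R g x) \<in> borel_measurable lebesgue" using gl by (rule borel_measurable_integrable)
  show "(\<lambda>x. \<Sum>K\<in>T. indicator (interior K) x *\<^sub>R g x) \<in> borel_measurable lebesgue"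
   by (intro borel_measurable_sum borel_measurable_integrable ik)
  have "AE x in lebesgue. x \<in> \<Omega> --> (\<exists>!K. K \<in> T \<and> x \<in> interior K)"
   using AE_one_cell \<Omega>_lebesgue by (simp add: AE_restrict_space_iff)
  then show "AE x in lebesgue. indicator \<Omega> x *\<^sub>R g x = (\<Sum>K\<in>T. indicator (interior K) x *\<^sub>R g x)"
  proof eventually_elim
   case (elim x)
   show ?case
   proof (cases "x \<in> \<Omega>")
    case True
    then obtain K0 where K0: "K0 \<in> T" "x \<in> interior K0" and u: "!!K. K \<in> T ==> x \<in> interior K ==> K = K0" using elim by blast
    have "(\<Sum>K\<in>T. indicator (interior K) x *\<^sub>R g x) = (\<Sum>K\<in>T. if K = K0 then g x else 0)"
    proof (rule sum.cong[OF refl])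
     fix K assume K: "K \<in> T"
     show "indicator (interior K) x *\<^sub>R g x = (if K = K0 then g x else 0)"
     proof (cases "x \<in> interior K")
      case True
      then have "K = K0" by (rule u[OF K])
      then show ?thesis using K0(2) by simp
     next
      case False
      then have "K \<noteq> K0" using K0(2) by blast
      then show ?thesis using False by simp
     qed
    qed
    then show ?thesis using True K0(1) T_finite by simp
   next
    case False
    then have "(\<Sum>K\<in>T. indicator (interior K) x *\<^sub>R g x) = 0"
     using interior_cell_subset by (intro sum.neutral) (auto simp: indicator_def)
    then show ?thesis using False by simp
   qed
  qed
 qed
 also have "... = (\<Sum>K\<in>T. LINT x|lebesgue. indicator (interior K) x *\<^sub>R g x)" by (intro Bochner_Integration.integral_sum ik)
 also have "... = (\<Sum>K\<in>T. LINT x|lebesgue_on (interior K). g x)"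
  by (intro sum.cong refl lebesgue_on_integral_eq(1)[symmetric]) simp
 finally show ?thesis .
qed

lemma AE_subset_cell:
 assumes K: "K \<in> T" and ae: "AE x in lebesgue_on \<Omega>. P x" shows "AE x in lebesgue_on (interior K). P x"
proof -
 have "AE x in lebesgue. x \<in> \<Omega> --> P x" using ae \<Omega>_lebesgue by (simp add: AE_restrict_space_iff)
 then have "AE x in lebesgue. x \<in> interior K --> P x"
  by eventually_elim (use interior_cell_subset[OF K] in blast)
 then show ?thesis by (simp add: AE_restrict_space_iff)
qed

end

section \<open>Weak derivatives and traces on the cells\<close>

lemma measurable_lebesgue_on_subset:
 assumes "f \<in> borel_measurable (lebesgue_on S)" "V \<subseteq> S" shows "f \<in> borel_measurable (lebesgue_on V)"
 using measurable_restrict_mono[OF assms] .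

lemma integrable_lebesgue_on_subset:
 fixes f :: "real^3 => 'b::euclidean_space"
 assumes f: "integrable (lebesgue_on S) f" and S: "S \<in> sets lebesgue" "V \<subseteq> S" "V \<in> sets lebesgue"
 shows "integrable (lebesgue_on V) f"
proof -
 have "integrable lebesgue (\<lambda>x. indicator V x *\<^sub>R (indicator S x *\<^sub>R f x))"
  by (rule integrable_mult_indicator[OF S(3)]) (use f lebesgue_on_integral_eq(2)[OF S(1), of f] in simp)
 moreover have "(\<lambda>x. indicator V x *\<^sub>R (indicator S x *\<^sub>R f x)) = (\<lambda>x. indicator V x *\<^sub>R f x)"
  by (rule ext) (use S(2) in \<open>auto simp: indicator_def\<close>)
 ultimately show ?thesis using lebesgue_on_integral_eq(2)[OF S(3), of f] by (simp only:)
qed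

lemma integral_lebesgue_on_subset:
 fixes f :: "real^3 => 'b::euclidean_space"
 assumes S: "S \<in> sets lebesgue" "V \<subseteq> S" "V \<in> sets lebesgue" and z: "!!x. x \<notin> V ==> f x = 0"
 shows "(LINT x|lebesgue_on S. f x) = (LINT x|lebesgue_on V. f x)"
proof -
 have "(\<lambda>x. indicator S x *\<^sub>R f x) = (\<lambda>x. indicator V x *\<^sub>R f x)"
  by (rule ext) (use S(2) z in \<open>auto simp: indicator_def\<close>)
 then show ?thesis using lebesgue_on_integral_eq(1)[OF S(1), of f] lebesgue_on_integral_eq(1)[OF S(3), of f] by (simp only:)
qed

lemma L2_subset:
 assumes "L2 S v" and S: "S \<in> sets lebesgue" "V \<subseteq> S" "V \<in> sets lebesgue"
 shows "L2 V v"
 using assms(1) unfolding L2_def by (auto intro: measurable_lebesgue_on_subset[OF _ S(2)] integrable_lebesgue_on_subset[OF _ S])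

lemma has_weak_curl_subset:
 assumes h: "has_weak_curl S v u" and S: "S \<in> sets lebesgue" "V \<subseteq> S" "V \<in> sets lebesgue"
 shows "has_weak_curl V v u"
 unfolding has_weak_curl_def
proof (intro conjI allI impI)
 show "L2 V u" by (rule L2_subset[OF _ S]) (use h in \<open>simp add: has_weak_curl_def\<close>)
 fix \<phi> :: "real^3 => real^3" assume t: "test_fun V \<phi>"
 have "(LINT x|lebesgue_on V. v x \<bullet> curl \<phi> x) = (LINT x|lebesgue_on S. v x \<bullet> curl \<phi> x)"
  by (rule integral_lebesgue_on_subset[OF S, symmetric]) (simp add: test_fun_outside[OF test_fun_curl[OF t]])
 also have "... = (LINT x|lebesgue_on S. u x \<bullet> \<phi> x)"
  using h test_fun_mono[OF t S(2)] by (simp add: has_weak_curl_def)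
 also have "... = (LINT x|lebesgue_on V. u x \<bullet> \<phi> x)"
  by (rule integral_lebesgue_on_subset[OF S]) (simp add: test_fun_outside[OF t])
 finally show "(LINT x|lebesgue_on V. v x \<bullet> curl \<phi> x) = (LINT x|lebesgue_on V. u x \<bullet> \<phi> x)" .
qed

lemma smooth_borel_lebesgue_on: "smooth (f :: real^3 => 'b::euclidean_space) ==> f \<in> borel_measurable (lebesgue_on S)"
 by (intro borel_lebesgue_on smooth_measurable)

lemma has_weak_curl_cong_AE:
 assumes v: "v \<in> borel_measurable (lebesgue_on U)" "v' \<in> borel_measurable (lebesgue_on U)"
  and eq: "AE x in lebesgue_on U. v x = v' x" and h: "has_weak_curl U v u"
 shows "has_weak_curl U v' u"
 unfolding has_weak_curl_def
proof (intro conjI allI impI)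
 show "L2 U u" using h by (simp add: has_weak_curl_def)
 fix \<phi> :: "real^3 => real^3" assume t: "test_fun U \<phi>"
 have [measurable]: "curl \<phi> \<in> borel_measurable (lebesgue_on U)"
  using t by (intro smooth_borel_lebesgue_on curl_smooth) (simp add: test_fun_def)
 note v[measurable]
 have "(LINT x|lebesgue_on U. v' x \<bullet> curl \<phi> x) = (LINT x|lebesgue_on U. v x \<bullet> curl \<phi> x)"
  by (rule integral_cong_AE) (use eq in auto)
 then show "(LINT x|lebesgue_on U. v' x \<bullet> curl \<phi> x) = (LINT x|lebesgue_on U. u x \<bullet> \<phi> x)"
  using h t by (simp add: has_weak_curl_def)
qed

lemma smooth_has_weak_curl:
 assumes U: "bounded U" "U \<in> sets borel" and p: "smooth p"
 shows "has_weak_curl U p (curl p)"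
 unfolding has_weak_curl_def
proof (intro conjI allI impI)
 have Ul: "U \<in> sets lebesgue" using U(2) by (rule sets_completionI_sets[of _ lborel, simplified])
 show "L2 U (curl p)" using U(1) Ul curl_smooth[OF p] by (rule smooth_L2)
 fix \<phi> :: "real^3 => real^3" assume t: "test_fun U \<phi>"
 then have sm: "smooth \<phi>" and bd: "bounded {x. \<phi> x \<noteq> 0}" by (auto simp: test_fun_alt)
 have "(LINT x|lebesgue_on U. p x \<bullet> curl \<phi> x) = (LINT x|lborel. p x \<bullet> curl \<phi> x)"
  by (rule integral_lebesgue_on_lborel[OF Ul])
   (simp_all add: test_fun_outside[OF test_fun_curl[OF t]] smooth_measurable[OF smooth_inner[OF p curl_smooth[OF sm]]])
 also have "... = (LINT x|lborel. curl p x \<bullet> \<phi> x)" using integral_curl_by_parts[OF p sm] bd by simp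
 also have "... = (LINT x|lebesgue_on U. curl p x \<bullet> \<phi> x)"
  by (rule integral_lebesgue_on_lborel[OF Ul, symmetric])
   (simp_all add: test_fun_outside[OF t] smooth_measurable[OF smooth_inner[OF curl_smooth[OF p] sm]])
 finally show "(LINT x|lebesgue_on U. p x \<bullet> curl \<phi> x) = (LINT x|lebesgue_on U. curl p x \<bullet> \<phi> x)" .
qed

lemma weak_curl_AE:
 assumes "open U" "bounded U" "has_weak_curl U v u"
 shows "has_weak_curl U v (weak_curl U v)" "AE x in lebesgue_on U. weak_curl U v x = u x"
proof -
 show *: "has_weak_curl U v (weak_curl U v)" unfolding weak_curl_def by (rule someI[of "has_weak_curl U v", OF assms(3)])
 show "AE x in lebesgue_on U. weak_curl U v x = u x" by (rule weak_curl_unique[OF assms(1,2) * assms(3)])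
qed

lemma has_weak_partial_cong_AE:
 assumes v: "v \<in> borel_measurable (lebesgue_on U)" "v' \<in> borel_measurable (lebesgue_on U)"
  and eq: "AE x in lebesgue_on U. v x = v' x" and h: "has_weak_partial U i v g"
 shows "has_weak_partial U i v' g"
 unfolding has_weak_partial_def
proof (intro conjI allI impI)
 show "L2 U g" using h by (simp add: has_weak_partial_def)
 fix \<phi> :: "real^3 => real" assume t: "test_fun U \<phi>"
 have [measurable]: "partial i \<phi> \<in> borel_measurable (lebesgue_on U)"
  using t by (intro smooth_borel_lebesgue_on smooth_partial) (simp add: test_fun_def)
 note v[measurable]
 have "(LINT x|lebesgue_on U. partial i \<phi> x *\<^sub>R v' x) = (LINT x|lebesgue_on U. partial i \<phi> x *\<^sub>R v x)"
  by (rule integral_cong_AE) (use eq in auto)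
 then show "(LINT x|lebesgue_on U. partial i \<phi> x *\<^sub>R v' x) = - (LINT x|lebesgue_on U. \<phi> x *\<^sub>R g x)"
  using h t by (simp add: has_weak_partial_def)
qed

lemma smooth_has_weak_partial:
 assumes U: "bounded U" "U \<in> sets borel" and p: "smooth p"
 shows "has_weak_partial U i p (partial i p)"
 unfolding has_weak_partial_def
proof (intro conjI allI impI)
 have Ul: "U \<in> sets lebesgue" using U(2) by (rule sets_completionI_sets[of _ lborel, simplified])
 show "L2 U (partial i p)" using U(1) Ul smooth_partial[OF p] by (rule smooth_L2)
 fix \<phi> :: "real^3 => real" assume t: "test_fun U \<phi>"
 then have sm: "smooth \<phi>" and bd: "bounded {x. \<phi> x \<noteq> 0}" by (auto simp: test_fun_alt)
 note sp = smooth_scaleR[OF sm p] smooth_scaleR[OF smooth_partial[OF sm] p] smooth_scaleR[OF sm smooth_partial[OF p]]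
 have b: "bounded {x. \<phi> x *\<^sub>R p x \<noteq> 0}" "bounded {x. partial i \<phi> x *\<^sub>R p x \<noteq> 0}" "bounded {x. \<phi> x *\<^sub>R partial i p x \<noteq> 0}"
  by (rule bounded_subset[OF bd], force, rule bounded_subset[OF partial_bounded_support[OF bd]], force, rule bounded_subset[OF bd], force)
 have pe: "partial i (\<lambda>x. \<phi> x *\<^sub>R p x) x = partial i \<phi> x *\<^sub>R p x + \<phi> x *\<^sub>R partial i p x" for x
  by (rule partial_bilinear[OF bounded_bilinear_scaleR smooth_differentiable[OF sm] smooth_differentiable[OF p]])
 have "(LINT x|lborel. partial i \<phi> x *\<^sub>R p x) + (LINT x|lborel. \<phi> x *\<^sub>R partial i p x) = (LINT x|lborel. partial i (\<lambda>x. \<phi> x *\<^sub>R p x) x)"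
  unfolding pe by (rule Bochner_Integration.integral_add[symmetric]) (intro smooth_integrable sp b)+
 also have "... = 0" by (rule integral_partial_eq_0[OF sp(1) b(1)])
 finally have e: "(LINT x|lborel. partial i \<phi> x *\<^sub>R p x) = - (LINT x|lborel. \<phi> x *\<^sub>R partial i p x)" by (simp add: eq_neg_iff_add_eq_0)
 have "(LINT x|lebesgue_on U. partial i \<phi> x *\<^sub>R p x) = (LINT x|lborel. partial i \<phi> x *\<^sub>R p x)"
  by (rule integral_lebesgue_on_lborel[OF Ul smooth_measurable[OF sp(2)]]) (simp add: test_fun_outside[OF test_fun_partial[OF t]])
 moreover have "(LINT x|lebesgue_on U. \<phi> x *\<^sub>R partial i p x) = (LINT x|lborel. \<phi> x *\<^sub>R partial i p x)"
  by (rule integral_lebesgue_on_lborel[OF Ul smooth_measurable[OF sp(3)]]) (simp add: test_fun_outside[OF t])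
 ultimately show "(LINT x|lebesgue_on U. partial i \<phi> x *\<^sub>R p x) = - (LINT x|lebesgue_on U. \<phi> x *\<^sub>R partial i p x)"
  using e by simp
qed

text \<open>The trace of a field involves a choice of weak derivatives; uniqueness makes it depend on the
 field only.\<close>

lemma has_weak_partial_unique:
 assumes U: "open U" "bounded U" and g: "has_weak_partial U i v g" "has_weak_partial U i v g'"
 shows "AE x in lebesgue_on U. g x = g' x"
proof -
 have Ul: "U \<in> sets lebesgue" using U(1) by simp
 interpret finite_measure "lebesgue_on U" by (rule finite_measure_lebesgue_on[OF U(2) Ul])
 have gs: "L2_on (lebesgue_on U) g" "L2_on (lebesgue_on U) g'"
  using g by (simp_all add: has_weak_partial_def L2_iff)
 have c: "AE x in lebesgue_on U. g x $ j - g' x $ j = 0" for j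
 proof (rule fundamental_lemma_lebesgue_on[OF U(1)])
  have gi: "integrable (lebesgue_on U) g" "integrable (lebesgue_on U) g'"
   using gs L2_on_imp_integrable by blast+
  show "integrable (lebesgue_on U) (\<lambda>x. g x $ j - g' x $ j)"
   by (intro Bochner_Integration.integrable_diff integrable_bounded_linear[OF bounded_linear_vec_nth] gi)
  fix \<phi> :: "real^3 => real" assume t: "test_fun U \<phi>"
  then have "smooth \<phi>" "bounded {x. \<phi> x \<noteq> 0}" by (auto simp: test_fun_alt)
  then obtain B where B: "!!x. norm (\<phi> x) \<le> B" using smooth_bounded_range by metis
  have pm: "\<phi> \<in> borel_measurable (lebesgue_on U)" using t by (intro smooth_borel_lebesgue_on) (simp add: test_fun_def)
  have B': "AE x in lebesgue_on U. \<bar>\<phi> x\<bar> \<le> B" using B by simp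
  have pi: "integrable (lebesgue_on U) (\<lambda>x. \<phi> x *\<^sub>R g x)" "integrable (lebesgue_on U) (\<lambda>x. \<phi> x *\<^sub>R g' x)"
   using L2_on_bounded_mult[OF gs(1) pm B'] L2_on_bounded_mult[OF gs(2) pm B'] L2_on_imp_integrable by blast+
  have "(LINT x|lebesgue_on U. \<phi> x *\<^sub>R g x - \<phi> x *\<^sub>R g' x) = 0"
   using g t pi by (simp add: has_weak_partial_def)
  then have "(LINT x|lebesgue_on U. (\<phi> x *\<^sub>R g x - \<phi> x *\<^sub>R g' x) $ j) = 0"
   by (subst integral_bounded_linear[OF bounded_linear_vec_nth]) (simp_all add: pi)
  then show "(LINT x|lebesgue_on U. \<phi> x * (g x $ j - g' x $ j)) = 0" by (simp add: right_diff_distrib)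
 qed
 have "AE x in lebesgue_on U. \<forall>j. g x $ j - g' x $ j = 0" using c by (subst AE_all_countable) blast
 then show ?thesis by eventually_elim (simp add: vec_eq_iff)
qed

lemma L2_tendsto_restrict_subset:
 assumes t: "L2_tendsto (restrict_space M S) F g" and S: "f \<subseteq> S" "f \<inter> space M \<in> sets M" "S \<inter> space M \<in> sets M"
 shows "L2_tendsto (restrict_space M f) F g"
proof -
 let ?h = "\<lambda>n x. ennreal ((norm (F n x - g x))\<^sup>2)"
 have le: "(\<integral>\<^sup>+x. ?h n x \<partial>restrict_space M f) \<le> (\<integral>\<^sup>+x. ?h n x \<partial>restrict_space M S)" for n
 proof -
  have "(\<integral>\<^sup>+x. ?h n x \<partial>restrict_space M f) = (\<integral>\<^sup>+x. ?h n x * indicator f x \<partial>M)"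
   using S(2) by (intro nn_integral_restrict_space) (simp add: Int_commute)
  also have "... \<le> (\<integral>\<^sup>+x. ?h n x * indicator S x \<partial>M)"
   by (intro nn_integral_mono mult_left_mono) (use S(1) in \<open>auto simp: indicator_def\<close>)
  also have "... = (\<integral>\<^sup>+x. ?h n x \<partial>restrict_space M S)"
   using S(3) by (intro nn_integral_restrict_space[symmetric]) (simp add: Int_commute)
  finally show ?thesis .
 qed
 show ?thesis unfolding L2_tendsto_def
  by (rule tendsto_sandwich[OF _ _ tendsto_const t[unfolded L2_tendsto_def]]) (simp_all add: le)
qed

lemma has_trace_alt:
 "has_trace K f v \<tau> \<longleftrightarrow> \<tau> \<in> borel_measurable (surface_measure f) \<and>
   (\<exists>\<phi> g. (\<forall>n. smooth (\<phi> n)) \<and> L2_tendsto (lebesgue_on (interior K)) \<phi> v \<and>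
    (\<forall>i. has_weak_partial (interior K) i v (g i) \<and> L2_tendsto (lebesgue_on (interior K)) (\<lambda>n. partial i (\<phi> n)) (g i)) \<and>
    L2_tendsto (surface_measure f) \<phi> \<tau>)"
 by (simp add: has_trace_def L2_tendsto_def)

lemma has_trace_cong_AE:
 assumes v: "v \<in> borel_measurable (lebesgue_on (interior K))" "v' \<in> borel_measurable (lebesgue_on (interior K))"
  and eq: "AE x in lebesgue_on (interior K). v x = v' x" and h: "has_trace K f v \<tau>"
 shows "has_trace K f v' \<tau>"
proof -
 obtain \<phi> g where pg: "\<forall>n. smooth (\<phi> n)" "L2_tendsto (lebesgue_on (interior K)) \<phi> v"
  "\<forall>i. has_weak_partial (interior K) i v (g i) \<and> L2_tendsto (lebesgue_on (interior K)) (\<lambda>n. partial i (\<phi> n)) (g i)"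
  "L2_tendsto (surface_measure f) \<phi> \<tau>"
  using h unfolding has_trace_alt by blast
 have "L2_tendsto (lebesgue_on (interior K)) \<phi> v'" using pg(2) L2_tendsto_cong_AE[OF eq] by simp
 moreover have "has_weak_partial (interior K) i v' (g i)" for i using has_weak_partial_cong_AE[OF v eq] pg(3) by blast
 ultimately show ?thesis using h pg unfolding has_trace_alt by blast
qed

context meshed_domain
begin

lemma adjacent_T: "K \<in> adjacent T f ==> K \<in> T" by (simp add: adjacent_def)

lemma interior_cell: "K \<in> T ==> open (interior K) \<and> bounded (interior K) \<and> interior K \<in> sets borel \<and> interior K \<in> sets lebesgue"
 using bounded_subset[OF cell_bounded[OF cell] interior_subset, of K] by simp

lemma L2_cell: "L2 \<Omega> v ==> K \<in> T ==> L2 (interior K) v"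
 using L2_subset[OF _ \<Omega>_lebesgue interior_cell_subset] interior_cell by blast

lemma face_restrict:
 assumes f: "f \<in> faces \<Omega> T" and K: "K \<in> adjacent T f"
  and t: "L2_tendsto (restrict_space (plane_measure (plane K (outward_normal K f))) K) F g"
 shows "L2_tendsto (surface_measure f) F g"
 unfolding adjacent_surface_measure[OF f K]
 by (rule L2_tendsto_restrict_subset[OF t])
  (use K face_closed[OF f] cell_closed[OF cell[OF adjacent_T[OF K]]] in \<open>auto simp: adjacent_def\<close>)

lemma smooth_surface_measurable:
 assumes "smooth (p :: real^3 => 'b::euclidean_space)" shows "p \<in> borel_measurable (surface_measure f)"
 unfolding surface_measure_def
 using smooth_measurable[OF assms] by (intro measurable_restrict_space1) (simp cong: measurable_cong_sets)

lemma has_trace_unique: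
 assumes f: "f \<in> faces \<Omega> T" and K: "K \<in> adjacent T f" and v: "v \<in> borel_measurable (lebesgue_on (interior K))"
  and h: "has_trace K f v \<tau>" "has_trace K f v \<tau>'"
 shows "AE x in surface_measure f. \<tau> x = \<tau>' x"
proof -
 have KT: "K \<in> T" by (rule adjacent_T[OF K])
 note cK = cell[OF KT]
 interpret C: convex_cell "normals K" "support K" by (rule cell_convex_cell[OF cK])
 have CU: "open_halfspaces (normals K) (support K) = interior K" by (rule cell_interior[OF cK, symmetric])
 have CK: "halfspaces (normals K) (support K) = K" by (rule facet_rep(2)[OF cK, symmetric])
 note iK = interior_cell[OF KT]
 obtain \<phi> g where pg: "\<forall>n. smooth (\<phi> n)" "L2_tendsto (lebesgue_on (interior K)) \<phi> v"
  "\<forall>i. has_weak_partial (interior K) i v (g i) \<and> L2_tendsto (lebesgue_on (interior K)) (\<lambda>n. partial i (\<phi> n)) (g i)"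
  "L2_tendsto (surface_measure f) \<phi> \<tau>"
  using h(1) unfolding has_trace_alt by blast
 obtain \<phi>' g' where pg': "\<forall>n. smooth (\<phi>' n)" "L2_tendsto (lebesgue_on (interior K)) \<phi>' v"
  "\<forall>i. has_weak_partial (interior K) i v (g' i) \<and> L2_tendsto (lebesgue_on (interior K)) (\<lambda>n. partial i (\<phi>' n)) (g' i)"
  "L2_tendsto (surface_measure f) \<phi>' \<tau>'"
  using h(2) unfolding has_trace_alt by blast
 have gm: "g i \<in> borel_measurable (lebesgue_on (interior K))" for i
  using pg(3) by (simp add: has_weak_partial_def L2_def)
 have eq: "AE x in lebesgue_on (interior K). g' i x = g i x" for i
  by (rule has_weak_partial_unique) (use iK pg(3) pg'(3) in blast)+
 have t': "L2_tendsto (lebesgue_on (interior K)) (\<lambda>n. partial i (\<phi>' n)) (g i)" for i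
  using pg'(3) L2_tendsto_cong_AE[OF eq] by simp
 have "L2_tendsto (C.face (outward_normal K f)) (\<lambda>n x. \<phi> n x - \<phi>' n x) (\<lambda>x. 0)"
  by (rule C.traces_close[of \<phi> \<phi>' v g, unfolded CU])
   (use pg pg' v gm t' adjacent_face_normal(1)[OF f K] in auto)
 then have c: "L2_tendsto (surface_measure f) (\<lambda>n x. \<phi> n x - \<phi>' n x) (\<lambda>x. 0)"
  unfolding CK by (rule face_restrict[OF f K])
 have m: "\<tau> \<in> borel_measurable (surface_measure f)" "\<tau>' \<in> borel_measurable (surface_measure f)"
  using h by (simp_all add: has_trace_def)
 show ?thesis
  by (rule L2_tendsto_unique_AE[OF _ _ m pg(4) pg'(4) c]) (use pg(1) pg'(1) smooth_surface_measurable in blast)+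
qed

text \<open>The trace, chosen among all functions that satisfy its definition, may be replaced by any of them.\<close>

lemma trace_on_AE:
 assumes f: "f \<in> faces \<Omega> T" and K: "K \<in> adjacent T f" and v: "v \<in> borel_measurable (lebesgue_on (interior K))"
  and h: "has_trace K f v \<tau>"
 shows "AE x in surface_measure f. trace_on K f v x = \<tau> x"
 using has_trace_unique[OF f K v someI[of "has_trace K f v", OF h] h] by (simp add: trace_on_def)

lemma smooth_has_trace:
 assumes f: "f \<in> faces \<Omega> T" and K: "K \<in> adjacent T f" and v: "v \<in> borel_measurable (lebesgue_on (interior K))"
  and p: "smooth p" and eq: "AE x in lebesgue_on (interior K). v x = p x"
 shows "has_trace K f v p"
proof (rule has_trace_cong_AE)
 show "has_trace K f p p" unfolding has_trace_alt
 proof (intro conjI exI[of _ "\<lambda>n::nat. p"] exI[of _ "\<lambda>i. partial i p"] allI)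
  show "has_weak_partial (interior K) i p (partial i p)" for i
   using interior_cell[OF adjacent_T[OF K]] by (intro smooth_has_weak_partial p) auto
 qed (simp_all add: p smooth_surface_measurable L2_tendsto_def)
qed (use v eq smooth_borel_lebesgue_on[OF p] in auto)

text \<open>A family of one-sided traces, one for each facet of the cell, for which Green's formula holds.\<close>

definition green_traces :: "(real^3) set => (real^3 => real^3) => (real^3 => real^3) => (real^3 => real^3 => real^3) => bool" where
 "green_traces K v c \<tau> \<longleftrightarrow>
  (\<forall>a\<in>normals K. L2_on (facet_measure K a) (\<tau> a)) \<and>
  (\<forall>f\<in>faces \<Omega> T. K \<in> adjacent T f --> has_trace K f v (\<tau> (outward_normal K f))) \<and>
  (\<forall>p. smooth p --> (LINT x|lebesgue_on (interior K). c x \<bullet> p x) - (LINT x|lebesgue_on (interior K). v x \<bullet> curl p x)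
    = (\<Sum>a\<in>normals K. LINT x|facet_measure K a. cross3 a (\<tau> a x) \<bullet> p x))"

lemma cell_green:
 assumes K: "K \<in> T" and v: "v \<in> H1 (interior K)" and c: "has_weak_curl (interior K) v c"
 shows "\<exists>\<tau>. green_traces K v c \<tau>"
proof -
 note cK = cell[OF K]
 interpret C: convex_cell "normals K" "support K" by (rule cell_convex_cell[OF cK])
 have CU: "open_halfspaces (normals K) (support K) = interior K" by (rule cell_interior[OF cK, symmetric])
 have CK: "halfspaces (normals K) (support K) = K" by (rule facet_rep(2)[OF cK, symmetric])
 have vL: "L2 (interior K) v" using v by (simp add: H1_def)
 have "\<forall>i. \<exists>w. has_weak_partial (interior K) i v w" using v by (simp add: H1_def)
 then obtain g where g: "!!i. has_weak_partial (interior K) i v (g i)" by metis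
 have gL: "L2_on (lebesgue_on (interior K)) (g i)" for i using g[of i] by (simp add: has_weak_partial_def L2_iff)
 obtain \<phi> where phi: "!!n. smooth (\<phi> n)" "L2_tendsto (lebesgue_on (interior K)) \<phi> v"
  "!!i. L2_tendsto (lebesgue_on (interior K)) (\<lambda>n. partial i (\<phi> n)) (g i)"
  by (rule C.H1_density[of v g, unfolded CU]) (use vL g in auto)
 have ex: "\<exists>\<tau>. \<tau> \<in> borel_measurable borel \<and> L2_on (C.face a) \<tau> \<and> L2_tendsto (C.face a) \<phi> \<tau>" if a: "a \<in> normals K" for a
  by (rule C.trace_exists[of \<phi> v g a, unfolded CU]) (use phi vL gL a in \<open>auto simp: L2_iff\<close>)
 define \<tau> where "\<tau> a = (SOME \<tau>. \<tau> \<in> borel_measurable borel \<and> L2_on (C.face a) \<tau> \<and> L2_tendsto (C.face a) \<phi> \<tau>)" for a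
 have \<tau>: "\<tau> a \<in> borel_measurable borel" "L2_on (C.face a) (\<tau> a)" "L2_tendsto (C.face a) \<phi> (\<tau> a)" if a: "a \<in> normals K" for a
  using someI_ex[OF ex[OF a]] unfolding \<tau>_def by blast+
 have "green_traces K v c \<tau>" unfolding green_traces_def
 proof (intro conjI)
  show "\<forall>a\<in>normals K. L2_on (facet_measure K a) (\<tau> a)"
   using \<tau>(2) unfolding CK by blast
  show "\<forall>f\<in>faces \<Omega> T. K \<in> adjacent T f --> has_trace K f v (\<tau> (outward_normal K f))"
  proof (intro ballI impI)
   fix f assume f: "f \<in> faces \<Omega> T" and Kf: "K \<in> adjacent T f"
   note n = adjacent_face_normal(1)[OF f Kf]
   have lim: "L2_tendsto (surface_measure f) \<phi> (\<tau> (outward_normal K f))"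
    by (rule face_restrict[OF f Kf]) (use \<tau>(3)[OF n] in \<open>simp only: CK\<close>)
   have m: "\<tau> (outward_normal K f) \<in> borel_measurable (surface_measure f)"
    unfolding surface_measure_def using \<tau>(1)[OF n]
    by (intro measurable_restrict_space1) (simp cong: measurable_cong_sets)
   show "has_trace K f v (\<tau> (outward_normal K f))" unfolding has_trace_alt
    using m lim phi g by blast
  qed
  show "\<forall>p. smooth p --> (LINT x|lebesgue_on (interior K). c x \<bullet> p x) - (LINT x|lebesgue_on (interior K). v x \<bullet> curl p x)
    = (\<Sum>a\<in>normals K. LINT x|facet_measure K a. cross3 a (\<tau> a x) \<bullet> p x)"
  proof (intro allI impI)
   fix p :: "real^3 => real^3" assume p: "smooth p"
   show "(LINT x|lebesgue_on (interior K). c x \<bullet> p x) - (LINT x|lebesgue_on (interior K). v x \<bullet> curl p x)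
    = (\<Sum>a\<in>normals K. LINT x|facet_measure K a. cross3 a (\<tau> a x) \<bullet> p x)"
    by (rule C.green_curl_trace[of \<phi> v g \<tau> c p, unfolded CU CK])
     (use phi vL gL \<tau> c p in \<open>auto simp: L2_iff CK\<close>)
  qed
 qed
 then show ?thesis by blast
qed

end

lemma cross3_inner_swap: "cross3 a p \<bullet> t = - (cross3 a t \<bullet> p)"
 by (simp add: cross3_def inner_vec_def sum_3 algebra_simps)

lemma integrable_restrict_space_subset:
 fixes g :: "_ => real"
 assumes g: "integrable (restrict_space M S) g" and S: "f \<subseteq> S" "f \<inter> space M \<in> sets M" "S \<inter> space M \<in> sets M"
 shows "integrable (restrict_space M f) g"
proof -
 have "integrable M (\<lambda>x. indicator S x *\<^sub>R g x)" using g integrable_restrict_space[OF S(3), of g] by simp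
 then have "integrable M (\<lambda>x. indicator (f \<inter> space M) x *\<^sub>R (indicator S x *\<^sub>R g x))"
  by (rule integrable_mult_indicator[OF S(2)])
 then have "integrable M (\<lambda>x. indicator f x *\<^sub>R g x)"
  by (rule Bochner_Integration.integrable_cong[OF refl, THEN iffD1, rotated]) (use S(1) in \<open>auto simp: indicator_def\<close>)
 then show ?thesis using integrable_restrict_space[OF S(2), of g] by simp
qed

section \<open>Green's formula on the mesh\<close>

locale meshed_field = meshed_domain +
 fixes w c :: "real^3 => real^3" and \<tau> :: "(real^3) set => real^3 => real^3 => real^3"
 assumes w_L2: "L2 \<Omega> w" and w_curl: "has_weak_curl \<Omega> w c" and traces: "!!K. K \<in> T ==> green_traces K w c (\<tau> K)"
begin

abbreviation "face_trace f K \<equiv> \<tau> K (outward_normal K f)"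

text \<open>The tangential trace \<open>n \<times> v\<close> seen from \<open>K\<close>.\<close>

definition flux :: "(real^3) set => (real^3) set => real^3 => real^3" where
 "flux f K x = cross3 (outward_normal K f) (face_trace f K x)"

lemma c_L2: "L2 \<Omega> c" using w_curl by (simp add: has_weak_curl_def)

lemma facet_flux_integrable:
 assumes K: "K \<in> T" and a: "a \<in> normals K" and p: "smooth p"
 shows "integrable (facet_measure K a) (\<lambda>x. cross3 a (\<tau> K a x) \<bullet> p x)"
proof (rule L2_on_inner)
 show "L2_on (facet_measure K a) (\<lambda>x. cross3 a (\<tau> K a x))"
  by (rule L2_on_bounded_linear[OF traces[OF K, unfolded green_traces_def, THEN conjunct1, rule_format, OF a]]) (rule bounded_bilinear.bounded_linear_right[OF bounded_bilinear_cross3])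
 interpret C: convex_cell "normals K" "support K" by (rule cell_convex_cell[OF cell[OF K]])
 show "L2_on (facet_measure K a) p"
  using C.smooth_L2_on_face[OF p a] facet_rep(2)[OF cell[OF K]] by simp
qed

lemma flux_integrable:
 assumes f: "f \<in> faces \<Omega> T" and K: "K \<in> adjacent T f" and p: "smooth p"
 shows "integrable (surface_measure f) (\<lambda>x. flux f K x \<bullet> p x)"
 unfolding adjacent_surface_measure[OF f K] flux_def
 by (rule integrable_restrict_space_subset[OF facet_flux_integrable[OF adjacent_T[OF K] adjacent_face_normal(1)[OF f K] p]])
  (use K face_closed[OF f] cell_closed[OF cell[OF adjacent_T[OF K]]] in \<open>auto simp: adjacent_def\<close>)

text \<open>Green's formulas of all cells, added up; the tests may jump from cell to cell.\<close>

lemma mesh_green: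
 assumes p: "!!K. K \<in> T ==> smooth (p K)"
 shows "(\<Sum>K\<in>T. (LINT x|lebesgue_on (interior K). c x \<bullet> p K x) - (LINT x|lebesgue_on (interior K). w x \<bullet> curl (p K) x))
  = (\<Sum>f\<in>faces \<Omega> T. \<Sum>K\<in>adjacent T f. LINT x|surface_measure f. flux f K x \<bullet> p K x)"
proof -
 have "(\<Sum>K\<in>T. (LINT x|lebesgue_on (interior K). c x \<bullet> p K x) - (LINT x|lebesgue_on (interior K). w x \<bullet> curl (p K) x))
  = (\<Sum>K\<in>T. \<Sum>a\<in>normals K. \<Sum>f\<in>{f \<in> faces \<Omega> T. f \<subseteq> K \<inter> plane K a}.
    LINT x|restrict_space (plane_measure (plane K a)) f. cross3 a (\<tau> K a x) \<bullet> p K x)"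
 proof (rule sum.cong[OF refl])
  fix K assume K: "K \<in> T"
  have "(\<Sum>a\<in>normals K. LINT x|facet_measure K a. cross3 a (\<tau> K a x) \<bullet> p K x)
   = (\<Sum>a\<in>normals K. \<Sum>f\<in>{f \<in> faces \<Omega> T. f \<subseteq> K \<inter> plane K a}.
    LINT x|restrict_space (plane_measure (plane K a)) f. cross3 a (\<tau> K a x) \<bullet> p K x)"
   by (intro sum.cong[OF refl] facet_integral_split[OF K] facet_flux_integrable[OF K _ p[OF K]])
  then show "(LINT x|lebesgue_on (interior K). c x \<bullet> p K x) - (LINT x|lebesgue_on (interior K). w x \<bullet> curl (p K) x)
   = (\<Sum>a\<in>normals K. \<Sum>f\<in>{f \<in> faces \<Omega> T. f \<subseteq> K \<inter> plane K a}.
    LINT x|restrict_space (plane_measure (plane K a)) f. cross3 a (\<tau> K a x) \<bullet> p K x)"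
   using traces[OF K] p[OF K] unfolding green_traces_def by simp
 qed
 also have "... = (\<Sum>f\<in>faces \<Omega> T. \<Sum>K\<in>adjacent T f.
   LINT x|restrict_space (plane_measure (plane K (outward_normal K f))) f. cross3 (outward_normal K f) (\<tau> K (outward_normal K f) x) \<bullet> p K x)"
  by (rule sum_facets_eq_sum_faces)
 also have "... = (\<Sum>f\<in>faces \<Omega> T. \<Sum>K\<in>adjacent T f. LINT x|surface_measure f. flux f K x \<bullet> p K x)"
  by (intro sum.cong refl) (simp only: adjacent_surface_measure flux_def)
 finally show ?thesis .
qed

lemma L2_cell_inner_integrable:
 assumes "L2 \<Omega> u" "L2 \<Omega> v" shows "integrable (lebesgue_on \<Omega>) (\<lambda>x. u x \<bullet> v x)"
 using assms by (simp add: L2_iff L2_on_inner)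

text \<open>Almost every point of an interior face has a neighbourhood inside the domain that meets no other
 face. Test functions supported in such neighbourhoods isolate a single face.\<close>

lemma AE_off_other_faces:
 assumes K: "K \<in> T" "K' \<in> T" "K \<noteq> K'" and d: "aff_dim (K \<inter> K') = 2"
 shows "AE x in surface_measure (K \<inter> K'). x \<in> \<Omega> - \<Union>(faces \<Omega> T - {K \<inter> K'})"
proof -
 let ?f = "K \<inter> K'"
 have f: "?f \<in> faces \<Omega> T" using K d by (auto simp: faces_def interior_faces_def)
 have Kf: "K \<in> adjacent T ?f" using K by (simp add: adjacent_def)
 let ?a = "outward_normal K ?f"
 note n = adjacent_face_normal[OF f Kf]
 have fb: "?f \<in> sets borel" using face_closed[OF f] by simp
 have "AE x in plane_measure (plane K ?a). x \<in> ?f --> x \<in> \<Omega> - \<Union>(faces \<Omega> T - {?f})"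
  using AE_good[OF K(1) n(1)]
 proof eventually_elim
  case (elim x)
  show ?case
  proof
   assume xf: "x \<in> ?f"
   then have x: "x \<in> K" "x \<in> K'" by auto
   then have g: "good K ?a x" using elim by blast
   have x\<Omega>: "x \<in> \<Omega>" by (rule good_in_domain[OF K x g])
   have "g = ?f" if g': "g \<in> faces \<Omega> T" "x \<in> g" for g
   proof (cases "g \<in> interior_faces T")
    case True
    then obtain K1 K2 where K12: "K1 \<in> T" "K2 \<in> T" "K1 \<noteq> K2" "g = K1 \<inter> K2" by (rule interior_face_cases)
    have only: "L = K \<or> L = K'" if "L \<in> T" "x \<in> L" for L
     using good_third_cell[OF K(1,2) that(1) K(3) _ x that(2) g n(1)] by blast
    have "K1 = K \<or> K1 = K'" "K2 = K \<or> K2 = K'" using only K12 g'(2) by auto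
    then show ?thesis using K12 by auto
   next
    case False
    then have "g \<subseteq> frontier \<Omega>" using g'(1) by (auto simp: faces_def boundary_faces_def)
    then show ?thesis using g'(2) x\<Omega> \<Omega>_open by (auto simp: frontier_def interior_open)
   qed
   then show "x \<in> \<Omega> - \<Union>(faces \<Omega> T - {?f})" using x\<Omega> by blast
  qed
 qed
 then show ?thesis unfolding adjacent_surface_measure[OF f Kf] using fb by (subst AE_restrict_space_iff) auto
qed

text \<open>Tested with one smooth field on all cells, the left-hand side of Green's formula on the mesh
 vanishes because the weak curl of \<open>w\<close> exists across the faces. With tests supported
 off the other faces only the sum of the two fluxes on \<open>f\<close> remains, which vanishes by
 the fundamental lemma for the measure of the plane.\<close>

lemma tangential_continuity:
 assumes fi: "f \<in> interior_faces T"
 shows "AE x in surface_measure f. (\<Sum>K\<in>adjacent T f. flux f K x) = 0"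
proof -
 obtain K K' where K: "K \<in> T" "K' \<in> T" "K \<noteq> K'" "f = K \<inter> K'" "aff_dim f = 2" by (rule interior_face_cases[OF fi])
 have f: "f \<in> faces \<Omega> T" using fi by (simp add: faces_def)
 have Kf: "K \<in> adjacent T f" using K by (simp add: adjacent_def)
 let ?V = "\<Omega> - \<Union>(faces \<Omega> T - {f})" and ?P = "plane K (outward_normal K f)"
 have Vop: "open ?V" using faces_finite face_closed by (intro open_Diff \<Omega>_open closed_Union) auto
 define D where "D x = (\<Sum>L\<in>adjacent T f. flux f L x)" for x
 have z: "(LINT x|surface_measure f. D x \<bullet> \<phi> x) = 0" if t: "test_fun ?V \<phi>" for \<phi>
 proof -
  have t\<Omega>: "test_fun \<Omega> \<phi>" by (rule test_fun_mono[OF t]) blast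
  have sm: "smooth \<phi>" using t by (simp add: test_fun_def)
  have L: "L2 \<Omega> \<phi>" "L2 \<Omega> (curl \<phi>)" by (intro smooth_L2 \<Omega>_bounded \<Omega>_lebesgue curl_smooth sm)+
  have "(\<Sum>K\<in>T. (LINT x|lebesgue_on (interior K). c x \<bullet> \<phi> x) - (LINT x|lebesgue_on (interior K). w x \<bullet> curl \<phi> x))
    = (LINT x|lebesgue_on \<Omega>. c x \<bullet> \<phi> x) - (LINT x|lebesgue_on \<Omega>. w x \<bullet> curl \<phi> x)"
   by (simp only: sum_subtractf integral_cells[OF L2_cell_inner_integrable[OF c_L2 L(1)]] integral_cells[OF L2_cell_inner_integrable[OF w_L2 L(2)]])
  also have "... = 0" using w_curl t\<Omega> by (simp add: has_weak_curl_def)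
  finally have "(\<Sum>g\<in>faces \<Omega> T. \<Sum>K\<in>adjacent T g. LINT x|surface_measure g. flux g K x \<bullet> \<phi> x) = 0"
   using mesh_green[of "\<lambda>K. \<phi>"] sm by simp
  moreover have "(\<Sum>g\<in>faces \<Omega> T. \<Sum>K\<in>adjacent T g. LINT x|surface_measure g. flux g K x \<bullet> \<phi> x)
   = (\<Sum>g\<in>{f}. \<Sum>K\<in>adjacent T g. LINT x|surface_measure g. flux g K x \<bullet> \<phi> x)"
  proof (rule sum.mono_neutral_right[OF faces_finite], use f in simp, intro ballI sum.neutral)
   fix g K assume g: "g \<in> faces \<Omega> T - {f}"
   have "(LINT x|surface_measure g. flux g K x \<bullet> \<phi> x) = (LINT x|surface_measure g. 0)"
   proof (rule lint_cong[OF refl])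
    fix x assume "x \<in> space (surface_measure g)"
    then have "x \<in> g" by (simp add: surface_measure_def space_restrict_space)
    then have "x \<notin> ?V" using g by blast
    then show "flux g K x \<bullet> \<phi> x = 0" using test_fun_outside[OF t] by simp
   qed
   then show "(LINT x|surface_measure g. flux g K x \<bullet> \<phi> x) = 0" by simp
  qed
  ultimately have "(\<Sum>K\<in>adjacent T f. LINT x|surface_measure f. flux f K x \<bullet> \<phi> x) = 0" by simp
  moreover have "(LINT x|surface_measure f. D x \<bullet> \<phi> x) = (\<Sum>K\<in>adjacent T f. LINT x|surface_measure f. flux f K x \<bullet> \<phi> x)"
   unfolding D_def inner_sum_left by (intro Bochner_Integration.integral_sum flux_integrable[OF f _ sm])
  ultimately show ?thesis by simp
 qed
 have fb: "f \<in> sets borel" using face_closed[OF f] by simp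
 note sf = adjacent_surface_measure[OF f Kf]
 have comp: "AE x in plane_measure ?P. x \<in> ?V --> indicator f x * (D x $ j) = 0" for j
 proof (rule fundamental_lemma[OF _ Vop])
  show "sets (plane_measure ?P) = sets borel" by simp
  have "integrable (surface_measure f) (\<lambda>x. D x \<bullet> axis j 1)"
   unfolding D_def inner_sum_left by (intro Bochner_Integration.integrable_sum flux_integrable[OF f _ smooth_const])
  then have "integrable (restrict_space (plane_measure ?P) f) (\<lambda>x. D x $ j)"
   by (simp add: sf inner_axis)
  then show "integrable (plane_measure ?P) (\<lambda>x. indicator f x * (D x $ j))"
   using fb by (subst (asm) integrable_restrict_space) auto
  fix \<phi> :: "real^3 => real" assume t: "test_fun ?V \<phi>"
  have "test_fun ?V (\<lambda>x. \<phi> x *\<^sub>R axis j (1::real))" by (rule test_fun_scaleR[OF t smooth_const])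
  then have "(LINT x|surface_measure f. D x \<bullet> (\<phi> x *\<^sub>R axis j 1)) = 0" by (rule z)
  then have "(LINT x|restrict_space (plane_measure ?P) f. \<phi> x * (D x $ j)) = 0" by (simp add: sf inner_axis)
  then have "(LINT x|plane_measure ?P. indicator f x * (\<phi> x * (D x $ j))) = 0"
   using fb by (subst (asm) integral_restrict_space) auto
  then show "(LINT x|plane_measure ?P. \<phi> x * (indicator f x * (D x $ j))) = 0" by (simp add: mult.left_commute)
 qed
 have "AE x in plane_measure ?P. \<forall>j. x \<in> ?V --> indicator f x * (D x $ j) = 0" using comp by (subst AE_all_countable) blast
 then have "AE x in plane_measure ?P. x \<in> f --> x \<in> ?V --> D x = 0" by eventually_elim (auto simp: vec_eq_iff indicator_def)
 then have "AE x in surface_measure f. x \<in> ?V --> D x = 0"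
  unfolding sf using fb by (subst AE_restrict_space_iff) auto
 moreover have "AE x in surface_measure f. x \<in> ?V" by (rule AE_off_other_faces[OF K(1-3), folded K(4), OF K(5)])
 ultimately have "AE x in surface_measure f. D x = 0" by eventually_elim blast
 then show ?thesis by (simp only: D_def)
qed

lemma has_trace_measurable:
 assumes "has_trace K f v \<theta>" shows "trace_on K f v \<in> borel_measurable (surface_measure f)"
proof -
 have "has_trace K f v (trace_on K f v)" unfolding trace_on_def by (rule someI[of "has_trace K f v", OF assms])
 then show ?thesis unfolding has_trace_alt by (rule conjunct1)
qed

text \<open>Let \<open>t, t'\<close> be the traces of \<open>w\<close> and \<open>p, p'\<close> those of
 \<open>v\<close> on the two sides of a face with normal \<open>a\<close>. As \<open>a \<times> t =
 a \<times> t'\<close>, the product \<open>(a \<times> (p - p')) \<bullet> (t + t')/2\<close>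
 equals \<open>- (a \<times> t) \<bullet> (p - p')\<close>, which is minus the sum of the two flux
 terms. On a boundary face there is one side only and the identity is algebraic.\<close>

lemma jump_average_integral:
 assumes f: "f \<in> faces \<Omega> T" and v: "v \<notin> H0curl \<Omega>" "v \<in> borel_measurable (lebesgue_on \<Omega>)"
  and p: "!!K. K \<in> T ==> smooth (p K)" "!!K. K \<in> T ==> AE x in lebesgue_on (interior K). v x = p K x"
  and w': "!!K. K \<in> T ==> w' \<in> borel_measurable (lebesgue_on (interior K))"
   "!!K. K \<in> T ==> AE x in lebesgue_on (interior K). w x = w' x"
 shows "(LINT x|surface_measure f. tangential_jump \<Omega> T f v x \<bullet> average T f w' x)
  = - (\<Sum>K\<in>adjacent T f. LINT x|surface_measure f. flux f K x \<bullet> p K x)"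
proof -
 let ?S = "surface_measure f"
 have vm: "v \<in> borel_measurable (lebesgue_on (interior K))" if "K \<in> T" for K
  by (rule measurable_lebesgue_on_subset[OF v(2) interior_cell_subset[OF that]])
 have wm: "w \<in> borel_measurable (lebesgue_on (interior K))" if "K \<in> T" for K
  using L2_cell[OF w_L2 that] by (simp add: L2_def)
 have tv: "has_trace K f v (p K)" if K: "K \<in> adjacent T f" for K
  using smooth_has_trace[OF f K vm[OF adjacent_T[OF K]] p(1)[OF adjacent_T[OF K]] p(2)[OF adjacent_T[OF K]]] .
 have tr: "has_trace K f w (face_trace f K)" if K: "K \<in> adjacent T f" for K
  using traces[OF adjacent_T[OF K]] f K unfolding green_traces_def by blast
 have tw: "has_trace K f w' (face_trace f K)" if K: "K \<in> adjacent T f" for K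
  by (rule has_trace_cong_AE[OF wm[OF adjacent_T[OF K]] w'[OF adjacent_T[OF K]] tr[OF K]])
 have fin: "finite (adjacent T f)" using T_finite by (simp add: adjacent_def)
 have jm: "tangential_jump \<Omega> T f v \<in> borel_measurable ?S"
 proof -
  have "(\<lambda>x. \<Sum>K\<in>adjacent T f. cross3 (outward_normal K f) (trace_on K f v x)) \<in> borel_measurable ?S"
   by (intro borel_measurable_sum measurable_compose[OF has_trace_measurable[OF tv] borel_measurable_continuous_onI]
     linear_continuous_on bounded_bilinear.bounded_linear_right[OF bounded_bilinear_cross3])
  then show ?thesis using v(1) unfolding tangential_jump_def by simp
 qed
 have am: "average T f w' \<in> borel_measurable ?S"
  unfolding average_def by (intro borel_measurable_scaleR borel_measurable_const borel_measurable_sum has_trace_measurable[OF tw])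
 have aev: "AE x in ?S. \<forall>K\<in>adjacent T f. trace_on K f v x = p K x"
  using fin trace_on_AE[OF f _ vm tv] adjacent_T by (subst AE_ball_countable) (auto simp: countable_finite)
 have aew: "AE x in ?S. \<forall>K\<in>adjacent T f. trace_on K f w' x = face_trace f K x"
  using fin trace_on_AE[OF f _ w'(1) tw] adjacent_T by (subst AE_ball_countable) (auto simp: countable_finite)
 have "AE x in ?S. tangential_jump \<Omega> T f v x \<bullet> average T f w' x = - (\<Sum>K\<in>adjacent T f. flux f K x \<bullet> p K x)"
 proof (cases "f \<in> interior_faces T")
  case True
  obtain K K' where K: "K \<in> T" "K' \<in> T" "K \<noteq> K'" "f = K \<inter> K'" "aff_dim f = 2" by (rule interior_face_cases[OF True])
  have d: "aff_dim (K \<inter> K') = 2" using K by simp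
  have adj: "adjacent T f = {K, K'}" using interior_face_adjacent[OF K(1-3) d] K(4) by simp
  obtain a where a: "outward_normal K f = a" "outward_normal K' f = - a"
   by (rule interior_face_normals[OF K(1-3) d]) (use K(4) in blast)
  show ?thesis using aev aew tangential_continuity[OF True]
  proof eventually_elim
   case (elim x)
   let ?t = "face_trace f K x" and ?t' = "face_trace f K' x"
   have s: "cross3 a ?t' = cross3 a ?t" using elim(3) K(3) by (simp add: adj flux_def a cross_minus_left)
   have j: "tangential_jump \<Omega> T f v x = cross3 a (p K x) - cross3 a (p K' x)"
    using elim(1) K(3) v(1) by (simp add: tangential_jump_def adj a cross_minus_left)
   have av: "average T f w' x = (?t + ?t') /\<^sub>R 2"
    using elim(2) K(3) by (simp add: average_def adj)
   have "tangential_jump \<Omega> T f v x \<bullet> average T f w' x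
    = - ((cross3 a ?t + cross3 a ?t') \<bullet> p K x - (cross3 a ?t + cross3 a ?t') \<bullet> p K' x) / 2"
    unfolding j av
    by (simp add: inner_diff_left inner_add_left inner_add_right cross3_inner_swap[of a "p K x"] cross3_inner_swap[of a "p K' x"])
   also have "... = - (cross3 a ?t \<bullet> p K x - cross3 a ?t \<bullet> p K' x)" unfolding s inner_add_left by simp
   also have "... = - (\<Sum>K\<in>adjacent T f. flux f K x \<bullet> p K x)"
    using K(3) s by (simp add: adj flux_def a cross_minus_left)
   finally show ?case .
  qed
 next
  case False
  then have "f \<in> boundary_faces \<Omega> T" using f by (simp add: faces_def)
  then obtain K a where K: "K \<in> T" "a \<in> normals K" "f = K \<inter> plane K a \<inter> frontier \<Omega>" "emeasure (plane_measure (plane K a)) f > 0"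
   by (rule boundary_face_cases)
  have adj: "adjacent T f = {K}" by (rule boundary_face_geometry(2)[OF K])
  show ?thesis using aev aew
  proof eventually_elim
   case (elim x)
   then show ?case using v(1)
    by (simp add: tangential_jump_def average_def adj flux_def cross3_inner_swap[of _ "p K x"])
  qed
 qed
 then have "(LINT x|?S. tangential_jump \<Omega> T f v x \<bullet> average T f w' x) = (LINT x|?S. - (\<Sum>K\<in>adjacent T f. flux f K x \<bullet> p K x))"
 proof (rule integral_cong_AE[rotated 2])
  show "(\<lambda>x. tangential_jump \<Omega> T f v x \<bullet> average T f w' x) \<in> borel_measurable ?S"
   by (rule borel_measurable_inner[OF jm am])
  show "(\<lambda>x. - (\<Sum>K\<in>adjacent T f. flux f K x \<bullet> p K x)) \<in> borel_measurable ?S"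
   by (intro borel_measurable_uminus borel_measurable_sum borel_measurable_integrable flux_integrable[OF f _ p(1)[OF adjacent_T]])
 qed
 also have "... = - (\<Sum>K\<in>adjacent T f. LINT x|?S. flux f K x \<bullet> p K x)"
  by (simp add: Bochner_Integration.integral_sum flux_integrable[OF f _ p(1)[OF adjacent_T]])
 finally show ?thesis .
qed

end

section \<open>Testing with cut-off piecewise polynomials\<close>

lemma test_fun_sum:
 fixes F :: "'j => real^3 => real^3"
 assumes J: "finite J" and t: "!!j. j \<in> J ==> test_fun U (F j)"
 shows "test_fun U (\<lambda>x. \<Sum>j\<in>J. F j x)"
proof -
 have sub: "{x. (\<Sum>j\<in>J. F j x) \<noteq> 0} \<subseteq> (\<Union>j\<in>J. {x. F j x \<noteq> 0})" by (auto dest: sum.not_neutral_contains_not_neutral)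
 have "bounded (\<Union>j\<in>J. {x. F j x \<noteq> 0})" using J t by (auto simp: test_fun_alt)
 moreover have "closure (\<Union>j\<in>J. {x. F j x \<noteq> 0}) \<subseteq> U"
  using t by (intro order_trans[OF closure_minimal[of _ "\<Union>j\<in>J. closure {x. F j x \<noteq> 0}"]] UN_mono order_refl closed_UN J)
   (auto simp: test_fun_alt intro: subsetD[OF closure_subset])
 moreover have "smooth (\<lambda>x. \<Sum>j\<in>J. F j x)" using t by (intro smooth_sum) (simp add: test_fun_def)
 ultimately show ?thesis unfolding test_fun_alt using bounded_subset[OF _ sub] closure_mono[OF sub] by blast
qed

text \<open>Test fields are admissible in the variational inequality; both their weak curl and their
 tangential trace are computed by integration by parts on the whole space.\<close>

lemma test_fun_H0curl:
 assumes U: "open U" "bounded U" and t: "test_fun U \<phi>"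
 shows "\<phi> \<in> H0curl U" "AE x in lebesgue_on U. weak_curl U \<phi> x = curl \<phi> x"
proof -
 have sm: "smooth \<phi>" and bd: "bounded {x. \<phi> x \<noteq> 0}" using t by (auto simp: test_fun_alt)
 have Ul: "U \<in> sets lebesgue" "U \<in> sets borel" using U by auto
 have h: "has_weak_curl U \<phi> (curl \<phi>)" by (rule smooth_has_weak_curl[OF U(2) Ul(2) sm])
 note wc = weak_curl_AE[OF U h]
 show "AE x in lebesgue_on U. weak_curl U \<phi> x = curl \<phi> x" by (rule wc(2))
 have L2p: "L2 U \<phi>" by (rule smooth_L2[OF U(2) Ul(1) sm])
 have "tangential_trace U \<phi> q = 0" if q: "smooth q" for q
 proof -
  have [measurable]: "q \<in> borel_measurable (lebesgue_on U)" "\<phi> \<in> borel_measurable (lebesgue_on U)"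
   "curl q \<in> borel_measurable (lebesgue_on U)" "curl \<phi> \<in> borel_measurable (lebesgue_on U)"
   by (intro smooth_borel_lebesgue_on curl_smooth q sm)+
  have [measurable]: "weak_curl U \<phi> \<in> borel_measurable (lebesgue_on U)" using wc(1) by (simp add: has_weak_curl_def L2_def)
  have "tangential_trace U \<phi> q = (LINT x|lebesgue_on U. curl \<phi> x \<bullet> q x - \<phi> x \<bullet> curl q x)"
   unfolding tangential_trace_def by (rule integral_cong_AE) (use wc(2) in auto)
  also have "... = (LINT x|lborel. curl \<phi> x \<bullet> q x - \<phi> x \<bullet> curl q x)"
   by (rule integral_lebesgue_on_lborel[OF Ul(1)])
    (simp_all add: test_fun_outside[OF t] test_fun_outside[OF test_fun_curl[OF t]]
     smooth_measurable[OF smooth_diff[OF smooth_inner[OF curl_smooth[OF sm] q] smooth_inner[OF sm curl_smooth[OF q]]]])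
  also have "... = (LINT x|lborel. curl \<phi> x \<bullet> q x) - (LINT x|lborel. \<phi> x \<bullet> curl q x)"
  proof (rule Bochner_Integration.integral_diff)
   show "integrable lborel (\<lambda>x. curl \<phi> x \<bullet> q x)"
   proof (rule smooth_integrable)
    show "bounded {x. curl \<phi> x \<bullet> q x \<noteq> 0}"
     by (rule bounded_subset[OF bounded_closure[OF bd]]) (use curl_support[of \<phi>] in auto)
   qed (intro smooth_inner curl_smooth sm q)
   show "integrable lborel (\<lambda>x. \<phi> x \<bullet> curl q x)"
    by (rule smooth_integrable[OF smooth_inner[OF sm curl_smooth[OF q]]]) (rule bounded_subset[OF bd], auto)
  qed
  also have "... = 0" using integral_curl_by_parts[OF sm q] bd by simp
  finally show ?thesis .
 qed
 then show "\<phi> \<in> H0curl U" unfolding H0curl_def Hcurl_def using L2p h by blast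
qed

lemma L2_on_norm: "L2_on M f ==> L2_on M (\<lambda>x. norm (f x))"
 by (auto simp: L2_on_def intro: borel_measurable_norm)

lemma integral_inner_dominated_limit:
 fixes g v :: "'a => real^3"
 assumes g: "L2_on M g" and v: "L2_on M v" and m: "!!n. vn n \<in> borel_measurable M"
  and ae: "AE x in M. (\<forall>n. norm (vn n x) \<le> norm (v x)) \<and> (\<lambda>n. vn n x) \<longlonglongrightarrow> v x"
 shows "(\<lambda>n. LINT x|M. g x \<bullet> vn n x) \<longlonglongrightarrow> (LINT x|M. g x \<bullet> v x)"
proof (rule integral_dominated_convergence[where w = "\<lambda>x. norm (g x) * norm (v x)"])
 have gm: "g \<in> borel_measurable M" "v \<in> borel_measurable M" using g v by (simp_all add: L2_on_def)
 show "(\<lambda>x. g x \<bullet> v x) \<in> borel_measurable M" using gm by (rule borel_measurable_inner)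
 show "(\<lambda>x. g x \<bullet> vn n x) \<in> borel_measurable M" for n using gm(1) m by (rule borel_measurable_inner)
 show "integrable M (\<lambda>x. norm (g x) * norm (v x))"
  using L2_on_inner[OF L2_on_norm[OF g] L2_on_norm[OF v]] by simp
 show "AE x in M. (\<lambda>n. g x \<bullet> vn n x) \<longlonglongrightarrow> g x \<bullet> v x"
  using ae by eventually_elim (intro tendsto_inner tendsto_const, simp)
 show "AE x in M. norm (g x \<bullet> vn n x) \<le> norm (g x) * norm (v x)" for n
  using ae
 proof eventually_elim
  case (elim x)
  have "norm (g x \<bullet> vn n x) \<le> norm (g x) * norm (vn n x)" by (simp add: Cauchy_Schwarz_ineq2)
  also have "... \<le> norm (g x) * norm (v x)" using elim by (intro mult_left_mono) auto
  finally show ?case .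
 qed
qed

text \<open>The inequality for the test fields \<open>vn\<close>, in which the curl is moved to
 \<open>\<mu>\<inverse> curl E\<close>, contains no derivative of \<open>vn\<close> any more. It
 passes to the limit by dominated convergence, the nonlinear term because \<open>\<psi>\<^sup>0(E;
 \<cdot>)\<close> is Lipschitz with constant \<open>c0 + c1 \<bar>E\<bar>\<close>.\<close>

lemma hvi_limit:
 fixes \<Omega> :: "(real^3) set" and \<psi> :: "real^3 => real^3 => real" and vn :: "nat => real^3 => real^3"
 assumes U: "open \<Omega>" "bounded \<Omega>"
  and \<epsilon>: "\<epsilon> \<in> borel_measurable (lebesgue_on \<Omega>)" "AE x in lebesgue_on \<Omega>. \<bar>\<epsilon> x\<bar> \<le> \<epsilon>1"
  and load: "L2 \<Omega> load" and EL: "L2 \<Omega> E"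
  and \<psi>m: "!!\<xi>. (\<lambda>x. \<psi> x \<xi>) \<in> borel_measurable (lebesgue_on \<Omega>)"
  and \<psi>l: "AE x in lebesgue_on \<Omega>. locally_lipschitz (\<psi> x)"
  and \<psi>g: "AE x in lebesgue_on \<Omega>. \<forall>\<xi>. \<forall>\<zeta>\<in>clarke_subdiff (\<psi> x) \<xi>. norm \<zeta> \<le> c0 + c1 * norm \<xi>"
  and wm: "(\<lambda>x. inverse (\<mu> x) *\<^sub>R weak_curl \<Omega> E x) \<in> borel_measurable (lebesgue_on \<Omega>)"
  and c: "has_weak_curl \<Omega> (\<lambda>x. inverse (\<mu> x) *\<^sub>R weak_curl \<Omega> E x) c"
  and hvi: "\<forall>v\<in>H0curl \<Omega>.
      maxwell_form \<Omega> \<epsilon> \<mu> E v + (LINT x|lebesgue_on \<Omega>. clarke_dd (\<psi> x) (E x) (v x))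
       \<ge> (LINT x|lebesgue_on \<Omega>. load x \<bullet> v x)"
  and v: "L2 \<Omega> v" and vn: "!!n. test_fun \<Omega> (vn n)"
  and ae: "AE x in lebesgue_on \<Omega>. (\<forall>n. norm (vn n x) \<le> norm (v x)) \<and> (\<lambda>n. vn n x) \<longlonglongrightarrow> v x"
 shows "(LINT x|lebesgue_on \<Omega>. load x \<bullet> v x) \<le> (LINT x|lebesgue_on \<Omega>. \<epsilon> x * (E x \<bullet> v x)) + (LINT x|lebesgue_on \<Omega>. c x \<bullet> v x)
   + (LINT x|lebesgue_on \<Omega>. clarke_dd (\<psi> x) (E x) (v x))"
proof -
 let ?M = "lebesgue_on \<Omega>" and ?w = "\<lambda>x. inverse (\<mu> x) *\<^sub>R weak_curl \<Omega> E x"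
 have Ul: "\<Omega> \<in> sets lebesgue" using U(1) by simp
 interpret finite_measure ?M by (rule finite_measure_lebesgue_on[OF U(2) Ul])
 have vnm: "vn n \<in> borel_measurable ?M" for n
  using vn[of n] by (intro smooth_borel_lebesgue_on) (simp add: test_fun_def)
 have s: "L2_on ?M load" "L2_on ?M E" "L2_on ?M v" "L2_on ?M c"
  using load EL v c by (simp_all add: L2_iff has_weak_curl_def)
 have sE: "L2_on ?M (\<lambda>x. \<epsilon> x *\<^sub>R E x)" by (rule L2_on_bounded_mult[OF s(2) \<epsilon>])
 have m: "E \<in> borel_measurable ?M" "v \<in> borel_measurable ?M" using s by (simp_all add: L2_on_def)
 have form: "maxwell_form \<Omega> \<epsilon> \<mu> E (vn n) = (LINT x|?M. (\<epsilon> x *\<^sub>R E x) \<bullet> vn n x) + (LINT x|?M. c x \<bullet> vn n x)" for n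
 proof -
  note tc = test_fun_H0curl[OF U vn[of n]]
  have "has_weak_curl \<Omega> (vn n) (weak_curl \<Omega> (vn n))"
   using tc(1) someI_ex[of "has_weak_curl \<Omega> (vn n)"] by (simp add: H0curl_def Hcurl_def weak_curl_def)
  then have wcm: "weak_curl \<Omega> (vn n) \<in> borel_measurable ?M" by (simp add: has_weak_curl_def L2_def)
  have cm: "curl (vn n) \<in> borel_measurable ?M"
   using vn[of n] by (intro smooth_borel_lebesgue_on curl_smooth) (simp add: test_fun_def)
  have "(LINT x|?M. inverse (\<mu> x) * (weak_curl \<Omega> E x \<bullet> weak_curl \<Omega> (vn n) x)) = (LINT x|?M. ?w x \<bullet> weak_curl \<Omega> (vn n) x)" by simp
  also have "... = (LINT x|?M. ?w x \<bullet> curl (vn n) x)"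
   by (rule integral_cong_AE[OF borel_measurable_inner[OF wm wcm] borel_measurable_inner[OF wm cm]]) (use tc(2) in \<open>eventually_elim, simp\<close>)
  also have "... = (LINT x|?M. c x \<bullet> vn n x)" using c vn by (simp add: has_weak_curl_def)
  finally show ?thesis by (simp add: maxwell_form_def)
 qed
 have psi_lim: "(\<lambda>n. LINT x|?M. clarke_dd (\<psi> x) (E x) (vn n x)) \<longlonglongrightarrow> (LINT x|?M. clarke_dd (\<psi> x) (E x) (v x))"
 proof (rule integral_dominated_convergence[where w = "\<lambda>x. (c0 + c1 * norm (E x)) * norm (v x)"])
  show "(\<lambda>x. clarke_dd (\<psi> x) (E x) (v x)) \<in> borel_measurable ?M"
   by (rule clarke_integrand_measurable[OF Ul \<psi>m \<psi>l m])
  show "(\<lambda>x. clarke_dd (\<psi> x) (E x) (vn n x)) \<in> borel_measurable ?M" for n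
   by (rule clarke_integrand_measurable[OF Ul \<psi>m \<psi>l m(1) vnm])
  have "L2_on ?M (\<lambda>x. c0 + c1 * norm (E x))"
  proof (rule L2_on_add)
   show "L2_on ?M (\<lambda>x. c0)" by (rule bounded_L2_on[where B = "\<bar>c0\<bar>"]) auto
   show "L2_on ?M (\<lambda>x. c1 * norm (E x))"
    by (rule L2_on_bounded_linear[OF L2_on_norm[OF s(2)] bounded_linear_mult_right])
  qed
  from L2_on_inner[OF this L2_on_norm[OF s(3)]]
  show "integrable ?M (\<lambda>x. (c0 + c1 * norm (E x)) * norm (v x))" by simp
  show "AE x in ?M. (\<lambda>n. clarke_dd (\<psi> x) (E x) (vn n x)) \<longlonglongrightarrow> clarke_dd (\<psi> x) (E x) (v x)"
   using ae \<psi>l \<psi>g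
  proof eventually_elim
   case (elim x)
   let ?k = "c0 + c1 * norm (E x)"
   have le: "\<bar>clarke_dd (\<psi> x) (E x) (vn n x) - clarke_dd (\<psi> x) (E x) (v x)\<bar> \<le> ?k * norm (vn n x - v x)" for n
    by (rule clarke_dd_lipschitz[OF elim(2)]) (use elim(3) in blast)
   have "(\<lambda>n. ?k * norm (vn n x - v x)) \<longlonglongrightarrow> ?k * norm (v x - v x)"
    using elim(1) by (intro tendsto_intros) blast
   then have "(\<lambda>n. ?k * norm (vn n x - v x)) \<longlonglongrightarrow> 0" by simp
   then have "(\<lambda>n. clarke_dd (\<psi> x) (E x) (vn n x) - clarke_dd (\<psi> x) (E x) (v x)) \<longlonglongrightarrow> 0"
    by (rule Lim_null_comparison[rotated]) (use le in simp)
   then show ?case by (rule LIM_zero_cancel)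
  qed
  show "AE x in ?M. norm (clarke_dd (\<psi> x) (E x) (vn n x)) \<le> (c0 + c1 * norm (E x)) * norm (v x)" for n
   using ae \<psi>l \<psi>g
  proof eventually_elim
   case (elim x)
   let ?k = "c0 + c1 * norm (E x)"
   have b: "\<bar>clarke_dd (\<psi> x) (E x) \<zeta>\<bar> \<le> ?k * norm \<zeta>" for \<zeta>
    by (rule clarke_dd_bound[OF elim(2)]) (use elim(3) in blast)
   have "0 \<le> ?k * norm (axis 1 1 :: real^3)" using b[of "axis 1 1"] by linarith
   then have k: "0 \<le> ?k" by simp
   show ?case using b[of "vn n x"] mult_left_mono[OF _ k, of "norm (vn n x)" "norm (v x)"] elim(1) by force
  qed
 qed
 have lim: "(\<lambda>n. LINT x|?M. g x \<bullet> vn n x) \<longlonglongrightarrow> (LINT x|?M. g x \<bullet> v x)" if "L2_on ?M g" for g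
  by (rule integral_inner_dominated_limit[OF that s(3) vnm ae])
 have "(LINT x|?M. load x \<bullet> v x) \<le> (LINT x|?M. (\<epsilon> x *\<^sub>R E x) \<bullet> v x) + (LINT x|?M. c x \<bullet> v x) + (LINT x|?M. clarke_dd (\<psi> x) (E x) (v x))"
 proof (rule LIMSEQ_le[OF lim[OF s(1)]])
  show "(\<lambda>n. (LINT x|?M. (\<epsilon> x *\<^sub>R E x) \<bullet> vn n x) + (LINT x|?M. c x \<bullet> vn n x) + (LINT x|?M. clarke_dd (\<psi> x) (E x) (vn n x)))
   \<longlonglongrightarrow> (LINT x|?M. (\<epsilon> x *\<^sub>R E x) \<bullet> v x) + (LINT x|?M. c x \<bullet> v x) + (LINT x|?M. clarke_dd (\<psi> x) (E x) (v x))"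
   by (intro tendsto_add lim sE s psi_lim)
  show "\<exists>N. \<forall>n\<ge>N. (LINT x|?M. load x \<bullet> vn n x) \<le> (LINT x|?M. (\<epsilon> x *\<^sub>R E x) \<bullet> vn n x) + (LINT x|?M. c x \<bullet> vn n x)
    + (LINT x|?M. clarke_dd (\<psi> x) (E x) (vn n x))"
   using hvi[rule_format, OF test_fun_H0curl(1)[OF U vn]] unfolding form by blast
 qed
 then show ?thesis by simp
qed

context meshed_domain
begin

lemma AE_cells:
 assumes P: "!!K. K \<in> T ==> AE x in lebesgue_on (interior K). P x" shows "AE x in lebesgue_on \<Omega>. P x"
proof -
 have "AE x in lebesgue. \<forall>K\<in>T. x \<in> interior K --> P x"
  using P T_finite by (subst AE_ball_countable) (auto simp: countable_finite AE_restrict_space_iff)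
 moreover have "AE x in lebesgue. x \<in> \<Omega> --> (\<exists>!K. K \<in> T \<and> x \<in> interior K)"
  using AE_one_cell \<Omega>_lebesgue by (simp add: AE_restrict_space_iff)
 ultimately have "AE x in lebesgue. x \<in> \<Omega> --> P x" by eventually_elim blast
 then show ?thesis using \<Omega>_lebesgue by (simp add: AE_restrict_space_iff)
qed

text \<open>Cut off each smooth piece inside its cell. The curls of these fields blow up near the faces; only
 their values are controlled.\<close>

lemma piecewise_smooth_approx:
 fixes v :: "real^3 => real^3"
 assumes p: "!!K. K \<in> T ==> smooth (p K)" "!!K. K \<in> T ==> AE x in lebesgue_on (interior K). v x = p K x"
 obtains vn where "!!n. test_fun \<Omega> (vn n)"
  "AE x in lebesgue_on \<Omega>. (\<forall>n. norm (vn n x) \<le> norm (v x)) \<and> (\<lambda>n. vn n x) \<longlonglongrightarrow> v x"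
proof
 define vn where "vn n x = (\<Sum>K\<in>T. cutoff (normals K) (support K) n x *\<^sub>R p K x)" for n x
 have vn_eq: "vn = (\<lambda>n x. \<Sum>K\<in>T. cutoff (normals K) (support K) n x *\<^sub>R p K x)" by (intro ext) (simp add: vn_def)
 note fin = facet_rep(1)[OF cell] and int = cell_interior[OF cell]
 show "test_fun \<Omega> (vn n)" for n
  unfolding vn_eq
 proof (rule test_fun_sum[OF T_finite])
  fix K assume K: "K \<in> T"
  have "bounded (halfspaces (normals K) (support K))"
   using facet_rep(2)[OF cell[OF K]] cell_bounded[OF cell[OF K]] by simp
  moreover have "open_halfspaces (normals K) (support K) \<subseteq> \<Omega>" using interior_cell_subset[OF K] int[OF K] by simp
  ultimately show "test_fun \<Omega> (\<lambda>x. cutoff (normals K) (support K) n x *\<^sub>R p K x)"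
   by (intro test_fun_scaleR cutoff_test_fun fin[OF K] p(1)[OF K])
 qed
 show "AE x in lebesgue_on \<Omega>. (\<forall>n. norm (vn n x) \<le> norm (v x)) \<and> (\<lambda>n. vn n x) \<longlonglongrightarrow> v x"
 proof (rule AE_cells)
  fix K assume K: "K \<in> T"
  have "AE x in lebesgue_on (interior K). x \<in> interior K" by (rule AE_I2) (simp add: space_restrict_space)
  then show "AE x in lebesgue_on (interior K). (\<forall>n. norm (vn n x) \<le> norm (v x)) \<and> (\<lambda>n. vn n x) \<longlonglongrightarrow> v x"
   using p(2)[OF K]
  proof eventually_elim
   case (elim x)
   have eq: "vn n x = cutoff (normals K) (support K) n x *\<^sub>R v x" for n
   proof -
    have "vn n x = (\<Sum>L\<in>T. if L = K then cutoff (normals K) (support K) n x *\<^sub>R v x else 0)"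
     unfolding vn_def
    proof (rule sum.cong[OF refl])
     fix L assume L: "L \<in> T"
     show "cutoff (normals L) (support L) n x *\<^sub>R p L x = (if L = K then cutoff (normals K) (support K) n x *\<^sub>R v x else 0)"
     proof (cases "L = K")
      case False
      then have "x \<notin> interior L" using cells_disjoint[OF K L] elim(1) by blast
      then show ?thesis using False cutoff_outside[OF fin[OF L]] int[OF L] by simp
     qed (simp add: elim(2))
    qed
    then show ?thesis using K T_finite by simp
   qed
   have "(\<lambda>n. cutoff (normals K) (support K) n x) \<longlonglongrightarrow> 1"
    using cutoff_tendsto[OF fin[OF K], of "support K" x] elim(1) int[OF K] by simp
   then have "(\<lambda>n. vn n x) \<longlonglongrightarrow> 1 *\<^sub>R v x" unfolding eq by (intro tendsto_scaleR tendsto_const)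
   moreover have "norm (vn n x) \<le> norm (v x)" for n
    using cutoff_bounds[of "normals K" "support K" n x] mult_right_mono[of "cutoff (normals K) (support K) n x" 1 "norm (v x)"]
    by (simp add: eq)
   ultimately show ?case by simp
  qed
 qed
qed

lemma broken_curl_cell:
 assumes K: "K \<in> T" and u: "has_weak_curl (interior K) v u"
 shows "AE x in lebesgue_on (interior K). broken_curl T v x = u x"
proof -
 note iK = interior_cell[OF K]
 have "AE x in lebesgue_on (interior K). x \<in> interior K" by (rule AE_I2) (simp add: space_restrict_space)
 moreover have "AE x in lebesgue_on (interior K). weak_curl (interior K) v x = u x"
  by (rule weak_curl_AE(2)) (use iK u in auto)
 ultimately show ?thesis
 proof eventually_elim
  case (elim x)
  have "broken_curl T v x = (\<Sum>L\<in>T. if L = K then weak_curl (interior K) v x else 0)"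
   unfolding broken_curl_def
  proof (rule sum.cong[OF refl])
   fix L assume L: "L \<in> T"
   show "indicator (interior L) x *\<^sub>R weak_curl (interior L) v x = (if L = K then weak_curl (interior K) v x else 0)"
   proof (cases "L = K")
    case True then show ?thesis using elim(1) by simp
   next
    case False
    then have "x \<notin> interior L" using cells_disjoint[OF K L] elim(1) by blast
    then show ?thesis using False by simp
   qed
  qed
  then show ?case using K T_finite elim(2) by simp
 qed
qed

lemma broken_curl_L2:
 assumes u: "!!K. K \<in> T ==> has_weak_curl (interior K) v (u K)"
 shows "L2 \<Omega> (broken_curl T v)"
proof -
 have "L2_on (lebesgue_on \<Omega>) (\<lambda>x. indicator (interior K) x *\<^sub>R weak_curl (interior K) v x)" if K: "K \<in> T" for K
 proof -
  note iK = interior_cell[OF K]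
  have "has_weak_curl (interior K) v (weak_curl (interior K) v)" by (rule weak_curl_AE(1)) (use iK u[OF K] in auto)
  then have L: "weak_curl (interior K) v \<in> borel_measurable (lebesgue_on (interior K))"
   "integrable (lebesgue_on (interior K)) (\<lambda>x. (norm (weak_curl (interior K) v x))\<^sup>2)"
   by (simp_all add: has_weak_curl_def L2_def)
  have m: "(\<lambda>x. indicator (interior K) x *\<^sub>R weak_curl (interior K) v x) \<in> borel_measurable lebesgue"
   using L(1) by (subst (asm) borel_measurable_restrict_space_iff) auto
  have "integrable lebesgue (\<lambda>x. indicator (interior K) x *\<^sub>R (norm (weak_curl (interior K) v x))\<^sup>2)"
   using L(2) lebesgue_on_integral_eq(2)[of "interior K" "\<lambda>x. (norm (weak_curl (interior K) v x))\<^sup>2"] by simp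
  moreover have "(\<lambda>x. indicator (interior K) x *\<^sub>R (norm (weak_curl (interior K) v x))\<^sup>2)
    = (\<lambda>x. (norm (indicator (interior K) x *\<^sub>R weak_curl (interior K) v x))\<^sup>2)"
   by (auto simp: indicator_def)
  ultimately have "integrable lebesgue (\<lambda>x. (norm (indicator (interior K) x *\<^sub>R weak_curl (interior K) v x))\<^sup>2)" by (simp only:)
  then have "integrable (lebesgue_on \<Omega>) (\<lambda>x. (norm (indicator (interior K) x *\<^sub>R weak_curl (interior K) v x))\<^sup>2)"
   unfolding lebesgue_on_integral_eq(2)[OF \<Omega>_lebesgue] by (rule integrable_mult_indicator[OF \<Omega>_lebesgue])
  then show ?thesis using measurable_restrict_space1[OF m] by (simp add: L2_on_def)
 qed
 note si = this
 have "L2_on (lebesgue_on \<Omega>) (\<lambda>x. \<Sum>K\<in>S. indicator (interior K) x *\<^sub>R weak_curl (interior K) v x)" if "finite S" "S \<subseteq> T" for S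
  using that
 proof (induction S rule: finite_induct)
  case empty then show ?case by (simp add: L2_on_def)
 next
  case (insert K S)
  have K: "K \<in> T" and S: "S \<subseteq> T" using insert.prems by auto
  show ?case unfolding sum.insert[OF insert.hyps] by (rule L2_on_add[OF si[OF K] insert.IH[OF S]])
 qed
 from this[OF T_finite order_refl] show ?thesis unfolding L2_iff broken_curl_def .
qed

end

lemma (in meshed_domain) meshed_field_exists:
 assumes w: "L2 \<Omega> w" "has_weak_curl \<Omega> w c" "!!K. K \<in> T ==> w \<in> H1 (interior K)"
 obtains \<tau> where "meshed_field \<Omega> T w c \<tau>"
proof -
 have "\<exists>\<tau>. green_traces K w c \<tau>" if K: "K \<in> T" for K
  by (rule cell_green[OF K w(3)[OF K] has_weak_curl_subset[OF w(2) \<Omega>_lebesgue interior_cell_subset[OF K]]])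
   (use interior_cell[OF K] in blast)
 then obtain \<tau> where "!!K. K \<in> T ==> green_traces K w c (\<tau> K)" by metis
 then have "meshed_field \<Omega> T w c \<tau>" using w by unfold_locales
 then show ?thesis by (rule that)
qed

lemma H0curl_weak_curl:
 assumes "v \<in> H0curl U" shows "L2 U v" "has_weak_curl U v (weak_curl U v)"
 using assms someI_ex[of "has_weak_curl U v"] by (auto simp: H0curl_def Hcurl_def weak_curl_def)

context meshed_domain
begin

text \<open>The weak curl on the domain restricts to the weak curl on each cell.\<close>

lemma broken_curl_H0curl:
 assumes "v \<in> H0curl \<Omega>" shows "AE x in lebesgue_on \<Omega>. broken_curl T v x = weak_curl \<Omega> v x"
proof (rule AE_cells)
 fix K assume K: "K \<in> T"
 show "AE x in lebesgue_on (interior K). broken_curl T v x = weak_curl \<Omega> v x"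
  by (rule broken_curl_cell[OF K has_weak_curl_subset[OF H0curl_weak_curl(2)[OF assms] \<Omega>_lebesgue interior_cell_subset[OF K]]])
   (use interior_cell[OF K] in blast)
qed

lemma broken_curl_H0curl_measurable:
 assumes "v \<in> H0curl \<Omega>" shows "broken_curl T v \<in> borel_measurable (lebesgue_on \<Omega>)"
proof -
 have "L2 \<Omega> (broken_curl T v)"
  by (rule broken_curl_L2[of v "\<lambda>K. weak_curl \<Omega> v"], rule has_weak_curl_subset[OF H0curl_weak_curl(2)[OF assms] \<Omega>_lebesgue interior_cell_subset])
   (use interior_cell in blast)+
 then show ?thesis by (simp add: L2_def)
qed

text \<open>Both jumps vanish by definition and the broken curls are the weak curls.\<close>

lemma ipdg_form_H0curl:
 assumes E: "E \<in> H0curl \<Omega>" and v: "v \<in> H0curl \<Omega>" and \<mu>: "\<mu> \<in> borel_measurable (lebesgue_on \<Omega>)"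
 shows "ipdg_form \<Omega> T \<eta> \<epsilon> \<mu> E v = maxwell_form \<Omega> \<epsilon> \<mu> E v"
proof -
 have m: "weak_curl \<Omega> E \<in> borel_measurable (lebesgue_on \<Omega>)" "weak_curl \<Omega> v \<in> borel_measurable (lebesgue_on \<Omega>)"
  using H0curl_weak_curl(2)[OF E] H0curl_weak_curl(2)[OF v] by (simp_all add: has_weak_curl_def L2_def)
 have "(LINT x|lebesgue_on \<Omega>. inverse (\<mu> x) * (broken_curl T E x \<bullet> broken_curl T v x))
   = (LINT x|lebesgue_on \<Omega>. inverse (\<mu> x) * (weak_curl \<Omega> E x \<bullet> weak_curl \<Omega> v x))"
 proof (rule integral_cong_AE)
  show "AE x in lebesgue_on \<Omega>. inverse (\<mu> x) * (broken_curl T E x \<bullet> broken_curl T v x) = inverse (\<mu> x) * (weak_curl \<Omega> E x \<bullet> weak_curl \<Omega> v x)"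
   using broken_curl_H0curl[OF E] broken_curl_H0curl[OF v] by eventually_elim simp
 qed (intro borel_measurable_times borel_measurable_inverse borel_measurable_inner \<mu> m broken_curl_H0curl_measurable E v)+
 then show ?thesis using E v by (simp add: ipdg_form_def maxwell_form_def tangential_jump_def)
qed

text \<open>The jump of \<open>E\<close> vanishes, so one face sum remains. By the jump-average identity and
 Green's formula on the mesh it exactly compensates the difference between the volume integrals of
 \<open>w \<bullet> curl v\<close> and \<open>curl w \<bullet> v\<close>.\<close>

lemma ipdg_form_dg:
 assumes E: "E \<in> H0curl \<Omega>" and v: "v \<notin> H0curl \<Omega>" "L2 \<Omega> v" and \<mu>: "\<mu> \<in> borel_measurable (lebesgue_on \<Omega>)"
  and w: "L2 \<Omega> (\<lambda>x. inverse (\<mu> x) *\<^sub>R weak_curl \<Omega> E x)" "has_weak_curl \<Omega> (\<lambda>x. inverse (\<mu> x) *\<^sub>R weak_curl \<Omega> E x) c"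
   "!!K. K \<in> T ==> (\<lambda>x. inverse (\<mu> x) *\<^sub>R weak_curl \<Omega> E x) \<in> H1 (interior K)"
  and p: "!!K. K \<in> T ==> smooth (p K)" "!!K. K \<in> T ==> AE x in lebesgue_on (interior K). v x = p K x"
 shows "ipdg_form \<Omega> T \<eta> \<epsilon> \<mu> E v = (LINT x|lebesgue_on \<Omega>. \<epsilon> x * (E x \<bullet> v x)) + (LINT x|lebesgue_on \<Omega>. c x \<bullet> v x)"
proof -
 let ?w = "\<lambda>x. inverse (\<mu> x) *\<^sub>R weak_curl \<Omega> E x" and ?w' = "\<lambda>x. inverse (\<mu> x) *\<^sub>R broken_curl T E x"
 obtain \<tau> where \<tau>: "meshed_field \<Omega> T ?w c \<tau>" using meshed_field_exists[OF w] by blast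
 interpret F: meshed_field \<Omega> T ?w c \<tau> by (rule \<tau>)
 have vm: "v \<in> borel_measurable (lebesgue_on \<Omega>)" using v(2) by (simp add: L2_def)
 have cL: "L2 \<Omega> c" using w(2) by (simp add: has_weak_curl_def)
 have wm: "?w \<in> borel_measurable (lebesgue_on \<Omega>)" using w(1) by (simp add: L2_def)
 have w'm: "?w' \<in> borel_measurable (lebesgue_on \<Omega>)"
  by (intro borel_measurable_scaleR borel_measurable_inverse \<mu> broken_curl_H0curl_measurable[OF E])
 have ww': "AE x in lebesgue_on \<Omega>. ?w x = ?w' x" using broken_curl_H0curl[OF E] by eventually_elim simp
 have curl_v: "has_weak_curl (interior K) v (curl (p K))" if K: "K \<in> T" for K
 proof -
  note iK = interior_cell[OF K]
  have ae: "AE x in lebesgue_on (interior K). p K x = v x" using p(2)[OF K] by eventually_elim simp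
  show ?thesis
   by (rule has_weak_curl_cong_AE[OF smooth_borel_lebesgue_on[OF p(1)[OF K]] measurable_lebesgue_on_subset[OF vm interior_cell_subset[OF K]] ae])
    (use iK p(1)[OF K] in \<open>intro smooth_has_weak_curl, auto\<close>)
 qed
 have bcv: "L2 \<Omega> (broken_curl T v)" by (rule broken_curl_L2[OF curl_v])
 have bcvm: "broken_curl T v \<in> borel_measurable (lebesgue_on \<Omega>)" using bcv by (simp add: L2_def)
 have jump: "(\<Sum>f\<in>faces \<Omega> T. LINT x|surface_measure f. tangential_jump \<Omega> T f v x \<bullet> average T f ?w' x)
  = (\<Sum>f\<in>faces \<Omega> T. - (\<Sum>K\<in>adjacent T f. LINT x|surface_measure f. F.flux f K x \<bullet> p K x))"
 proof (rule sum.cong[OF refl])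
  fix f assume f: "f \<in> faces \<Omega> T"
  show "(LINT x|surface_measure f. tangential_jump \<Omega> T f v x \<bullet> average T f ?w' x)
   = - (\<Sum>K\<in>adjacent T f. LINT x|surface_measure f. F.flux f K x \<bullet> p K x)"
   by (rule F.jump_average_integral[OF f v(1) vm p])
    (use measurable_lebesgue_on_subset[OF w'm interior_cell_subset] AE_subset_cell[OF _ ww'] in auto)
 qed
 have vol: "(LINT x|lebesgue_on \<Omega>. inverse (\<mu> x) * (broken_curl T E x \<bullet> broken_curl T v x))
  = (\<Sum>K\<in>T. LINT x|lebesgue_on (interior K). ?w x \<bullet> curl (p K) x)"
 proof -
  have "(LINT x|lebesgue_on \<Omega>. inverse (\<mu> x) * (broken_curl T E x \<bullet> broken_curl T v x)) = (LINT x|lebesgue_on \<Omega>. ?w' x \<bullet> broken_curl T v x)" by simp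
  also have "... = (LINT x|lebesgue_on \<Omega>. ?w x \<bullet> broken_curl T v x)"
   by (rule integral_cong_AE[OF borel_measurable_inner[OF w'm bcvm] borel_measurable_inner[OF wm bcvm]]) (use ww' in \<open>eventually_elim, simp only:\<close>)
  also have "... = (\<Sum>K\<in>T. LINT x|lebesgue_on (interior K). ?w x \<bullet> broken_curl T v x)"
   by (rule integral_cells[OF F.L2_cell_inner_integrable[OF w(1) bcv]])
  also have "... = (\<Sum>K\<in>T. LINT x|lebesgue_on (interior K). ?w x \<bullet> curl (p K) x)"
  proof (rule sum.cong[OF refl])
   fix K assume K: "K \<in> T"
   note sub = measurable_lebesgue_on_subset[OF _ interior_cell_subset[OF K]]
   have ae: "AE x in lebesgue_on (interior K). ?w x \<bullet> broken_curl T v x = ?w x \<bullet> curl (p K) x"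
    using broken_curl_cell[OF K curl_v[OF K]] by eventually_elim simp
   show "(LINT x|lebesgue_on (interior K). ?w x \<bullet> broken_curl T v x) = (LINT x|lebesgue_on (interior K). ?w x \<bullet> curl (p K) x)"
    by (rule integral_cong_AE[OF borel_measurable_inner[OF sub[OF wm] sub[OF bcvm]] borel_measurable_inner[OF sub[OF wm] smooth_borel_lebesgue_on[OF curl_smooth[OF p(1)[OF K]]]] ae])
  qed
  finally show ?thesis .
 qed
 have cv: "(LINT x|lebesgue_on \<Omega>. c x \<bullet> v x) = (\<Sum>K\<in>T. LINT x|lebesgue_on (interior K). c x \<bullet> p K x)"
 proof -
  have "(LINT x|lebesgue_on \<Omega>. c x \<bullet> v x) = (\<Sum>K\<in>T. LINT x|lebesgue_on (interior K). c x \<bullet> v x)"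
   by (rule integral_cells[OF F.L2_cell_inner_integrable[OF cL v(2)]])
  also have "... = (\<Sum>K\<in>T. LINT x|lebesgue_on (interior K). c x \<bullet> p K x)"
  proof (rule sum.cong[OF refl])
   fix K assume K: "K \<in> T"
   note sub = measurable_lebesgue_on_subset[OF _ interior_cell_subset[OF K]]
   have cm: "c \<in> borel_measurable (lebesgue_on \<Omega>)" using cL by (simp add: L2_def)
   have ae: "AE x in lebesgue_on (interior K). c x \<bullet> v x = c x \<bullet> p K x"
    using p(2)[OF K] by eventually_elim simp
   show "(LINT x|lebesgue_on (interior K). c x \<bullet> v x) = (LINT x|lebesgue_on (interior K). c x \<bullet> p K x)"
    by (rule integral_cong_AE[OF borel_measurable_inner[OF sub[OF cm] sub[OF vm]] borel_measurable_inner[OF sub[OF cm] smooth_borel_lebesgue_on[OF p(1)[OF K]]] ae])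
  qed
  finally show ?thesis .
 qed
 have "ipdg_form \<Omega> T \<eta> \<epsilon> \<mu> E v = (LINT x|lebesgue_on \<Omega>. \<epsilon> x * (E x \<bullet> v x))
   + (LINT x|lebesgue_on \<Omega>. inverse (\<mu> x) * (broken_curl T E x \<bullet> broken_curl T v x))
   - (\<Sum>f\<in>faces \<Omega> T. LINT x|surface_measure f. tangential_jump \<Omega> T f v x \<bullet> average T f ?w' x)"
 proof -
  have "tangential_jump \<Omega> T f E = (\<lambda>x. 0)" for f using E by (simp add: tangential_jump_def fun_eq_iff)
  then show ?thesis by (simp add: ipdg_form_def)
 qed
 then show ?thesis using jump vol cv F.mesh_green[of p, OF p(1)] by (simp add: sum_subtractf sum_negf)
qed

end

theorem theorem1:
  fixes \<Omega> :: "(real^3) set"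
    and \<epsilon> \<mu> :: "real^3 \<Rightarrow> real"
    and \<epsilon>0 \<epsilon>1 \<mu>0 \<mu>1 c0 c1 m \<eta> \<kappa> :: real
    and l :: nat
    and \<psi> :: "real^3 \<Rightarrow> real^3 \<Rightarrow> real"
    and load E :: "real^3 \<Rightarrow> real^3"
    and T :: "(real^3) set set"
  assumes "lipschitz_domain \<Omega>"
    and "\<epsilon> \<in> borel_measurable (lebesgue_on \<Omega>)" and "0 < \<epsilon>0"
    and "AE x in lebesgue_on \<Omega>. \<epsilon>0 \<le> \<epsilon> x \<and> \<epsilon> x \<le> \<epsilon>1"
    and "\<mu> \<in> borel_measurable (lebesgue_on \<Omega>)" and "0 < \<mu>0"
    and "AE x in lebesgue_on \<Omega>. \<mu>0 \<le> \<mu> x \<and> \<mu> x \<le> \<mu>1"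
    and "L2 \<Omega> load"
    and "\<And>\<xi>. (\<lambda>x. \<psi> x \<xi>) \<in> borel_measurable (lebesgue_on \<Omega>)"
    and "integrable (lebesgue_on \<Omega>) (\<lambda>x. \<psi> x 0)"
    and "AE x in lebesgue_on \<Omega>. locally_lipschitz (\<psi> x)"
    and "0 \<le> c0" and "0 \<le> c1"
    and "AE x in lebesgue_on \<Omega>. \<forall>\<xi>. \<forall>\<zeta>\<in>clarke_subdiff (\<psi> x) \<xi>. norm \<zeta> \<le> c0 + c1 * norm \<xi>"
    and "0 \<le> m"
    and "AE x in lebesgue_on \<Omega>. \<forall>\<xi>1 \<xi>2.
           clarke_dd (\<psi> x) \<xi>1 (\<xi>2 - \<xi>1) + clarke_dd (\<psi> x) \<xi>2 (\<xi>1 - \<xi>2) \<le> m * (norm (\<xi>1 - \<xi>2))\<^sup>2"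
    and "mesh \<Omega> T" and "shape_regular \<kappa> T" and "1 \<le> l" and "0 < \<eta>"
    and "E \<in> H0curl \<Omega>"
    and "\<forall>v\<in>H0curl \<Omega>.
           maxwell_form \<Omega> \<epsilon> \<mu> E v + (LINT x|lebesgue_on \<Omega>. clarke_dd (\<psi> x) (E x) (v x))
             \<ge> (LINT x|lebesgue_on \<Omega>. load x \<bullet> v x)"
    and "(\<lambda>x. inverse (\<mu> x) *\<^sub>R weak_curl \<Omega> E x) \<in> Hcurl \<Omega>"
    and "\<forall>K\<in>T. (\<lambda>x. inverse (\<mu> x) *\<^sub>R weak_curl \<Omega> E x) \<in> H1 (interior K)"
  shows "\<forall>v\<in>dg_space \<Omega> T l.
           ipdg_form \<Omega> T \<eta> \<epsilon> \<mu> E v + (LINT x|lebesgue_on \<Omega>. clarke_dd (\<psi> x) (E x) (v x))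
             \<ge> (LINT x|lebesgue_on \<Omega>. load x \<bullet> v x)"
proof
 fix v assume v: "v \<in> dg_space \<Omega> T l"
 let ?w = "\<lambda>x. inverse (\<mu> x) *\<^sub>R weak_curl \<Omega> E x"
 interpret meshed_domain \<Omega> T by (unfold_locales) (fact assms(1) assms(17))+
 have vL: "L2 \<Omega> v" using v by (simp add: dg_space_def)
 have "\<forall>K\<in>T. \<exists>p. smooth p \<and> (AE x in lebesgue_on (interior K). v x = p x)"
 proof
  fix K assume K: "K \<in> T"
  obtain q where q: "q \<in> poly_fields l" "AE x in lebesgue_on K. v x = q x" using v K by (auto simp: dg_space_def)
  have Kl: "K \<in> sets lebesgue" using cell_closed[OF cell[OF K]] by simp
  have "AE x in lebesgue. x \<in> K --> v x = q x" using q(2) Kl by (simp add: AE_restrict_space_iff)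
  then have "AE x in lebesgue. x \<in> interior K --> v x = q x" by eventually_elim (use interior_subset in blast)
  then have "AE x in lebesgue_on (interior K). v x = q x" by (simp add: AE_restrict_space_iff)
  then show "\<exists>p. smooth p \<and> (AE x in lebesgue_on (interior K). v x = p x)" using poly_fields_smooth[OF q(1)] by blast
 qed
 then obtain p where p: "!!K. K \<in> T ==> smooth (p K)" "!!K. K \<in> T ==> AE x in lebesgue_on (interior K). v x = p K x"
  by metis
 have w: "L2 \<Omega> ?w" "\<exists>c. has_weak_curl \<Omega> ?w c" using assms(23) by (simp_all add: Hcurl_def)
 obtain c where c: "has_weak_curl \<Omega> ?w c" using w(2) by blast
 show "ipdg_form \<Omega> T \<eta> \<epsilon> \<mu> E v + (LINT x|lebesgue_on \<Omega>. clarke_dd (\<psi> x) (E x) (v x)) \<ge> (LINT x|lebesgue_on \<Omega>. load x \<bullet> v x)"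
 proof (cases "v \<in> H0curl \<Omega>")
  case True
  then show ?thesis using assms(22) ipdg_form_H0curl[OF assms(21) True assms(5)] by simp
 next
  case False
  obtain vn where vn: "!!n. test_fun \<Omega> (vn n)"
   "AE x in lebesgue_on \<Omega>. (\<forall>n. norm (vn n x) \<le> norm (v x)) \<and> (\<lambda>n. vn n x) \<longlonglongrightarrow> v x"
   by (rule piecewise_smooth_approx[OF p]) blast+
  have \<epsilon>: "AE x in lebesgue_on \<Omega>. \<bar>\<epsilon> x\<bar> \<le> \<epsilon>1" using assms(4) by eventually_elim (use assms(3) in linarith)
  have "(LINT x|lebesgue_on \<Omega>. load x \<bullet> v x) \<le> (LINT x|lebesgue_on \<Omega>. \<epsilon> x * (E x \<bullet> v x)) + (LINT x|lebesgue_on \<Omega>. c x \<bullet> v x)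
    + (LINT x|lebesgue_on \<Omega>. clarke_dd (\<psi> x) (E x) (v x))"
   by (rule hvi_limit[OF \<Omega>_open \<Omega>_bounded assms(2) \<epsilon> assms(8) H0curl_weak_curl(1)[OF assms(21)] assms(9) assms(11) assms(14) _ c assms(22) vL vn])
    (use w(1) in \<open>simp add: L2_def\<close>)
  also have "(LINT x|lebesgue_on \<Omega>. \<epsilon> x * (E x \<bullet> v x)) + (LINT x|lebesgue_on \<Omega>. c x \<bullet> v x) = ipdg_form \<Omega> T \<eta> \<epsilon> \<mu> E v"
   by (rule ipdg_form_dg[OF assms(21) False vL assms(5) w(1) c _ p, symmetric]) (use assms(24) in blast)
  finally show ?thesis .
 qed
qed

end
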